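(* Let $k$ be a commutative ring, let $S=k[x_1,\dots,x_n]$ be graded by an abelian group $A$ via a positive grading $\deg\colon\mathbb{N}^n\to A$, and let $h\colon A\to\mathbb{N}$ be a function supported on $A_+$. If $D\subseteq A$ is supportive for $h$, and $E\supseteq D$ is a very supportive superset of $D$, then the Hilbert scheme $H_S^h$ is defined (as a closed subscheme of the Grassmann scheme $G^h_{S_D}$, via restriction of degrees $I\mapsto\bigoplus_{a\in D}I_a$) by the natural quadratic equations for $D$ together with the natural determinantal equations $I_{r_e-h(e)+1}(\Gamma_e)$, where $e$ runs over $E\setminus D$.
   Context: A grading of $S$ is a semigroup homomorphism $\deg\colon\mathbb{N}^n\to A$, with $A$ generated by the degrees of the variables; $S_a$ is the $k$-span of monomials of degree $a$; $A_+=\deg(\mathbb{N}^n)$. The grading is positive if $1$ is the only monomial of degree $0$; then every $S_a$ is free of finite rank, and $a\le b\iff b-a\in A_+$ is a partial order on degrees. $H_S^h$ is the $k$-scheme representing the functor sending a commutative $k$-algebra $R$ to the set of homogeneous ideals $I\subseteq R\otimes_k S$ with $(R\otimes_k S_a)/I_a$ locally free of rank $h(a)$ for all $a\in A$. For a finite set $D$ of degrees, $G^h_{S_D}=\prod_{a\in D}G^{h(a)}_{S_a}$ is the graded Grassmann scheme, whose $R$-points are families $(L_a)_{a\in D}$ of submodules $L_a\subseteq R\otimes_k S_a$ with $(R\otimes_k S_a)/L_a$ locally free of rank $h(a)$. The natural quadratic equations for $D$ are the quadratic equations in Plücker coordinates on $G^{h(a)}_{S_a}\times G^{h(b)}_{S_b}$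 expressing: for all $a<b$ in $D$ and all monomials $x^u$ with $\deg(u)=b-a$, $x^uL_a\subseteq L_b$. For a degree $e$, the matrix $\Gamma_e$ has columns indexed by the monomials of degree $e$. For each $d\in D$ with $d<e$, each set $B=\{b_0,\dots,b_{h(d)}\}$ of $h(d)+1$ monomials of degree $d$, and each monomial $x^u$ of degree $e-d$, $\Gamma_e$ has a row consisting of the coefficients of the polynomial $x^u\sum_{i}(-1)^i\gamma_{B\setminus\{b_i\}}\,b_i$, where $\gamma_{B\setminus\{b_i\}}$ is the Plücker coordinate on $G^{h(d)}_{S_d}$ indexed by the $h(d)$ monomials $b_0,\dots,\widehat{b_i},\dots,b_{h(d)}$ in this order (so that $\sum_i(-1)^i\gamma_{B\setminus\{b_i\}}b_i\in L_d$). With $r_e=\operatorname{rank}_kS_e$, $I_m(\Gamma_e)$ denotes the ideal generated by the $m\times m$ minors (the unit ideal if $m\le0$); the natural determinantal equations contributed by $e$ are the vanishing of the minors in $I_{r_e-h(e)+1}(\Gamma_e)$. For a monomial ideal $I\subseteq S$, $h_I(a)$ is the number of monomials of degree $a$ not in $I$. Consider the conditions on $D\subseteq A$: (g) every monomial ideal with Hilbert function $h$ is generated by monomials of degree in $D$; (h) every monomial ideal $I$ generated in degrees $D$ satisfies: if $h_I(a)=h(a)$ for all $a\in D$ then $h_I(a)=h(a)$ for all $a\in A$; (h$'$) every monomial ideal $I$ generated in degrees $D$ satisfies: if $h_I(a)=h(a)$ for all $a\in D$ then $h_I(a)\le h(a)$ for all $a\in A$; (s) for every monomial ideal $I$ with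 $h_I=h$, the syzygy module of $I$ is generated by the syzygies $x^ux^{v'}=x^vx^{u'}=\operatorname{lcm}(x^u,x^v)$ among generators $x^u,x^v$ of $I$ with $\deg\operatorname{lcm}(x^u,x^v)\in D$. $D$ is supportive for $h$ if it is finite and satisfies (g) and (h$'$); very supportive if it is finite and satisfies (g), (h) and (s). *)

theory Defs
  imports
    "HOL-Algebra.Module"
    "HOL-Algebra.QuotRing"
    "HOL-Combinatorics.Permutations"
    "HOL-Library.Function_Algebras"
begin

text \<open>
  Schemes over \<open>k\<close> are described by their functors of points. A closed subscheme of the graded
  Grassmann scheme cut out by multihomogeneous equations in Pluecker coordinates is the subfunctor
  of those \<open>R\<close>-points at which the equations hold, for all commutative \<open>k\<close>-algebras \<open>R\<close>. Rings are
  given by the locale \<^locale>\<open>cring\<close>, so the zero ring is included.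
\<close>

section \<open>Modules and localization\<close>

text \<open>The ring fields \<^const>\<open>monoid.mult\<close> and \<^const>\<open>one\<close> are part of the module record but play no role
  in a module. Elements of the free module on \<open>X\<close> are extended by zero outside \<open>X\<close>.\<close>

definition free_module :: "('r, 'm) ring_scheme \<Rightarrow> 'x set \<Rightarrow> ('r, 'x \<Rightarrow> 'r) module" where
  "free_module R X =
    \<lparr>carrier = {p. range p \<subseteq> carrier R \<and> finite {x. p x \<noteq> \<zero>\<^bsub>R\<^esub>} \<and> {x. p x \<noteq> \<zero>\<^bsub>R\<^esub>} \<subseteq> X},
     monoid.mult = undefined, one = undefined,
     zero = (\<lambda>x. \<zero>\<^bsub>R\<^esub>),
     add = (\<lambda>p q x. p x \<oplus>\<^bsub>R\<^esub> q x),
     smult = (\<lambda>c p x. c \<otimes>\<^bsub>R\<^esub> p x)\<rparr>"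

definition quotient_module :: "('r, 'm, 'z) module_scheme \<Rightarrow> 'm set \<Rightarrow> ('r, 'm set) module" where
  "quotient_module M N =
    \<lparr>carrier = a_rcosets\<^bsub>M\<^esub> N,
     monoid.mult = undefined, one = undefined,
     zero = N,
     add = (<+>\<^bsub>M\<^esub>),
     smult = (\<lambda>c X. \<Union>m\<in>X. N +>\<^bsub>M\<^esub> (c \<odot>\<^bsub>M\<^esub> m))\<rparr>"

definition module_span ::
  "('r, 'a) ring_scheme \<Rightarrow> ('r, 'm, 'z) module_scheme \<Rightarrow> 'm set \<Rightarrow> 'm set" where
  "module_span R M X = \<Inter>{N. submodule N R M \<and> X \<subseteq> N}"

text \<open>The fraction \<open>m / f\<^sup>i\<close> in the localization at the powers of \<open>f\<close> of an \<open>R\<close>-module with carrier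
  \<open>C\<close> and scalar multiplication \<open>act\<close>, as an equivalence class of pairs.\<close>

definition fraction ::
  "('r, 'a) ring_scheme \<Rightarrow> 'r \<Rightarrow> ('r \<Rightarrow> 'm \<Rightarrow> 'm) \<Rightarrow> 'm set \<Rightarrow> 'm \<Rightarrow> nat \<Rightarrow> ('m \<times> nat) set" where
  "fraction R f act C m i =
    {(m', j). m' \<in> C \<and>
       (\<exists>l::nat. act (f [^]\<^bsub>R\<^esub> (l + j)) m = act (f [^]\<^bsub>R\<^esub> (l + i)) m')}"

abbreviation ring_fraction ::
  "('r, 'a) ring_scheme \<Rightarrow> 'r \<Rightarrow> 'r \<Rightarrow> nat \<Rightarrow> ('r \<times> nat) set" where
  "ring_fraction R f \<equiv> fraction R f (monoid.mult R) (carrier R)"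

abbreviation module_fraction ::
  "('r, 'a) ring_scheme \<Rightarrow> 'r \<Rightarrow> ('r, 'm, 'z) module_scheme \<Rightarrow> 'm \<Rightarrow> nat \<Rightarrow> ('m \<times> nat) set" where
  "module_fraction R f M \<equiv> fraction R f (smult M) (carrier M)"

definition loc_ring :: "('r, 'a) ring_scheme \<Rightarrow> 'r \<Rightarrow> ('r \<times> nat) set ring" where
  "loc_ring R f =
    \<lparr>carrier = {ring_fraction R f a i | a i. a \<in> carrier R},
     monoid.mult = (\<lambda>X Y. \<Union>(a, i)\<in>X. \<Union>(b, j)\<in>Y. ring_fraction R f (a \<otimes>\<^bsub>R\<^esub> b) (i + j)),
     one = ring_fraction R f \<one>\<^bsub>R\<^esub> 0,
     zero = ring_fraction R f \<zero>\<^bsub>R\<^esub> 0,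
     add = (\<lambda>X Y. \<Union>(a, i)\<in>X. \<Union>(b, j)\<in>Y.
       ring_fraction R f ((f [^]\<^bsub>R\<^esub> j \<otimes>\<^bsub>R\<^esub> a) \<oplus>\<^bsub>R\<^esub> (f [^]\<^bsub>R\<^esub> i \<otimes>\<^bsub>R\<^esub> b)) (i + j))\<rparr>"

definition loc_module ::
  "('r, 'a) ring_scheme \<Rightarrow> 'r \<Rightarrow> ('r, 'm, 'z) module_scheme
    \<Rightarrow> (('r \<times> nat) set, ('m \<times> nat) set) module" where
  "loc_module R f M =
    \<lparr>carrier = {module_fraction R f M m i | m i. m \<in> carrier M},
     monoid.mult = undefined, one = undefined,
     zero = module_fraction R f M \<zero>\<^bsub>M\<^esub> 0,
     add = (\<lambda>X Y. \<Union>(m, i)\<in>X. \<Union>(m', j)\<in>Y.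
       module_fraction R f M
         ((f [^]\<^bsub>R\<^esub> j \<odot>\<^bsub>M\<^esub> m) \<oplus>\<^bsub>M\<^esub> (f [^]\<^bsub>R\<^esub> i \<odot>\<^bsub>M\<^esub> m')) (i + j)),
     smult = (\<lambda>X Y. \<Union>(a, i)\<in>X. \<Union>(m, j)\<in>Y. module_fraction R f M (a \<odot>\<^bsub>M\<^esub> m) (i + j))\<rparr>"

definition module_isos ::
  "('r, 'a) ring_scheme \<Rightarrow> ('r, 'm, 'y) module_scheme \<Rightarrow> ('r, 'n, 'z) module_scheme
    \<Rightarrow> ('m \<Rightarrow> 'n) set" where
  "module_isos R M N =
    {\<phi>. bij_betw \<phi> (carrier M) (carrier N) \<and>
        (\<forall>x\<in>carrier M. \<forall>y\<in>carrier M. \<phi> (x \<oplus>\<^bsub>M\<^esub> y) = \<phi> x \<oplus>\<^bsub>N\<^esub> \<phi> y) \<and>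
        (\<forall>c\<in>carrier R. \<forall>x\<in>carrier M. \<phi> (c \<odot>\<^bsub>M\<^esub> x) = c \<odot>\<^bsub>N\<^esub> \<phi> x)}"

text \<open>Trivializations of \<open>W\<close> over the basic open set \<open>D(f)\<close>: isomorphisms of \<open>W\<^sub>f\<close> with the free
  \<open>R\<^sub>f\<close>-module of rank \<open>r\<close>.\<close>

definition trivializations ::
  "('r, 'a) ring_scheme \<Rightarrow> 'r \<Rightarrow> ('r, 'm, 'z) module_scheme \<Rightarrow> nat
    \<Rightarrow> (('m \<times> nat) set \<Rightarrow> nat \<Rightarrow> ('r \<times> nat) set) set" where
  "trivializations R f W r =
    module_isos (loc_ring R f) (loc_module R f W) (free_module (loc_ring R f) {..<r})"

definition locally_free ::
  "('r, 'a) ring_scheme \<Rightarrow> ('r, 'm, 'z) module_scheme \<Rightarrow> nat \<Rightarrow> bool" where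
  "locally_free R W r \<longleftrightarrow>
    (\<exists>F. finite F \<and> F \<subseteq> carrier R \<and> genideal R F = carrier R \<and>
         (\<forall>f\<in>F. trivializations R f W r \<noteq> {}))"

definition ring_det :: "('r, 'a) ring_scheme \<Rightarrow> nat \<Rightarrow> (nat \<Rightarrow> nat \<Rightarrow> 'r) \<Rightarrow> 'r" where
  "ring_det R m M =
    (\<Oplus>\<^bsub>R\<^esub>\<pi>\<in>{\<pi>. \<pi> permutes {..<m}}.
       (if evenperm \<pi> then \<one>\<^bsub>R\<^esub> else \<ominus>\<^bsub>R\<^esub> \<one>\<^bsub>R\<^esub>) \<otimes>\<^bsub>R\<^esub> (\<Otimes>\<^bsub>R\<^esub>i\<in>{..<m}. M i (\<pi> i)))"


section \<open>Polynomials and gradings\<close>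

text \<open>The monomial \<open>x\<^sup>u\<close> is given by its exponent vector \<open>u :: 'n \<Rightarrow> nat\<close>, where \<open>'n\<close> indexes the
  variables. The \<open>R\<close>-algebra \<open>R \<otimes>\<^sub>k k[x]\<close> is identified with \<open>R[x]\<close>, whose underlying module is free
  on all monomials, and \<open>R \<otimes>\<^sub>k S\<^sub>a\<close> with the submodule of \<open>R[x]\<close> spanned by the monomials of
  degree \<open>a\<close>.\<close>

definition poly_ring :: "('r, 'm) ring_scheme \<Rightarrow> (('n::finite \<Rightarrow> nat) \<Rightarrow> 'r) ring" where
  "poly_ring R =
    \<lparr>carrier = carrier (free_module R UNIV),
     monoid.mult = (\<lambda>p q w. \<Oplus>\<^bsub>R\<^esub>u\<in>{u. u \<le> w}. p u \<otimes>\<^bsub>R\<^esub> q (w - u)),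
     one = (\<lambda>w. if w = 0 then \<one>\<^bsub>R\<^esub> else \<zero>\<^bsub>R\<^esub>),
     zero = (\<lambda>w. \<zero>\<^bsub>R\<^esub>),
     add = (\<lambda>p q w. p w \<oplus>\<^bsub>R\<^esub> q w)\<rparr>"

definition xpow :: "('r, 'm) ring_scheme \<Rightarrow> ('n \<Rightarrow> nat) \<Rightarrow> ('n \<Rightarrow> nat) \<Rightarrow> 'r" where
  "xpow R u = (\<lambda>w. if w = u then \<one>\<^bsub>R\<^esub> else \<zero>\<^bsub>R\<^esub>)"

definition unit_exp :: "'n \<Rightarrow> 'n \<Rightarrow> nat" where
  "unit_exp i = (\<lambda>j. if j = i then 1 else 0)"

definition grading :: "(('n \<Rightarrow> nat) \<Rightarrow> 'a::ab_group_add) \<Rightarrow> bool" where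
  "grading deg \<longleftrightarrow>
    (\<forall>u v. deg (u + v) = deg u + deg v) \<and>
    (\<forall>H. 0 \<in> H \<and> (\<forall>a\<in>H. \<forall>b\<in>H. a - b \<in> H) \<and> (\<forall>i. deg (unit_exp i) \<in> H) \<longrightarrow> H = UNIV)"

definition positive_grading :: "(('n \<Rightarrow> nat) \<Rightarrow> 'a::ab_group_add) \<Rightarrow> bool" where
  "positive_grading deg \<longleftrightarrow> grading deg \<and> (\<forall>u. deg u = 0 \<longleftrightarrow> u = 0)"

definition deg_less :: "(('n \<Rightarrow> nat) \<Rightarrow> 'a::ab_group_add) \<Rightarrow> 'a \<Rightarrow> 'a \<Rightarrow> bool" where
  "deg_less deg a b \<longleftrightarrow> a \<noteq> b \<and> b - a \<in> range deg"

definition monomials :: "(('n \<Rightarrow> nat) \<Rightarrow> 'a) \<Rightarrow> 'a \<Rightarrow> ('n \<Rightarrow> nat) set" where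
  "monomials deg a = {u. deg u = a}"

definition graded_piece ::
  "('r, 'm) ring_scheme \<Rightarrow> (('n \<Rightarrow> nat) \<Rightarrow> 'a) \<Rightarrow> 'a \<Rightarrow> ('r, ('n \<Rightarrow> nat) \<Rightarrow> 'r) module" where
  "graded_piece R deg a = free_module R (monomials deg a)"

definition homogeneous_ideal ::
  "('r, 'm) ring_scheme \<Rightarrow> (('n::finite \<Rightarrow> nat) \<Rightarrow> 'a) \<Rightarrow> (('n \<Rightarrow> nat) \<Rightarrow> 'r) set \<Rightarrow> bool" where
  "homogeneous_ideal R deg I \<longleftrightarrow>
    ideal I (poly_ring R) \<and>
    (\<forall>p\<in>I. \<forall>a. (\<lambda>u. if deg u = a then p u else \<zero>\<^bsub>R\<^esub>) \<in> I)"

definition ideal_piece ::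
  "('r, 'm) ring_scheme \<Rightarrow> (('n \<Rightarrow> nat) \<Rightarrow> 'a) \<Rightarrow> (('n \<Rightarrow> nat) \<Rightarrow> 'r) set \<Rightarrow> 'a
    \<Rightarrow> (('n \<Rightarrow> nat) \<Rightarrow> 'r) set" where
  "ideal_piece R deg I a = I \<inter> carrier (graded_piece R deg a)"


section \<open>The Hilbert and Grassmann functors\<close>

text \<open>The \<open>R\<close>-points of \<open>H\<^sub>S\<^sup>h\<close> and of the graded Grassmann scheme, and their functoriality along
  \<open>\<psi> : R \<rightarrow> R'\<close>, which takes the image of \<open>R' \<otimes>\<^sub>R L\<close> in \<open>R' \<otimes>\<^sub>k S\<close>. Families indexed by \<open>D\<close> are
  extensional functions.\<close>

definition hilbert_points ::
  "('r, 'm) ring_scheme \<Rightarrow> (('n::finite \<Rightarrow> nat) \<Rightarrow> 'a) \<Rightarrow> ('a \<Rightarrow> nat)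
    \<Rightarrow> (('n \<Rightarrow> nat) \<Rightarrow> 'r) set set" where
  "hilbert_points R deg h =
    {I. homogeneous_ideal R deg I \<and>
        (\<forall>a. locally_free R (quotient_module (graded_piece R deg a) (ideal_piece R deg I a)) (h a))}"

definition grassmann_points ::
  "('r, 'm) ring_scheme \<Rightarrow> (('n \<Rightarrow> nat) \<Rightarrow> 'a) \<Rightarrow> ('a \<Rightarrow> nat) \<Rightarrow> 'a set
    \<Rightarrow> ('a \<Rightarrow> (('n \<Rightarrow> nat) \<Rightarrow> 'r) set) set" where
  "grassmann_points R deg h D =
    {L \<in> extensional D. \<forall>a\<in>D.
        submodule (L a) R (graded_piece R deg a) \<and>
        locally_free R (quotient_module (graded_piece R deg a) (L a)) (h a)}"

definition restrict_degrees ::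
  "('r, 'm) ring_scheme \<Rightarrow> (('n \<Rightarrow> nat) \<Rightarrow> 'a) \<Rightarrow> 'a set \<Rightarrow> (('n \<Rightarrow> nat) \<Rightarrow> 'r) set
    \<Rightarrow> 'a \<Rightarrow> (('n \<Rightarrow> nat) \<Rightarrow> 'r) set" where
  "restrict_degrees R deg D I = (\<lambda>a\<in>D. ideal_piece R deg I a)"

definition hilbert_map ::
  "('s, 'm) ring_scheme \<Rightarrow> ('r \<Rightarrow> 's) \<Rightarrow> (('n::finite \<Rightarrow> nat) \<Rightarrow> 'r) set
    \<Rightarrow> (('n \<Rightarrow> nat) \<Rightarrow> 's) set" where
  "hilbert_map R' \<psi> I = genideal (poly_ring R') ((\<lambda>p. \<psi> \<circ> p) ` I)"

definition grassmann_map ::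
  "('s, 'm) ring_scheme \<Rightarrow> ('r \<Rightarrow> 's) \<Rightarrow> (('n \<Rightarrow> nat) \<Rightarrow> 'a) \<Rightarrow> 'a set
    \<Rightarrow> ('a \<Rightarrow> (('n \<Rightarrow> nat) \<Rightarrow> 'r) set) \<Rightarrow> 'a \<Rightarrow> (('n \<Rightarrow> nat) \<Rightarrow> 's) set" where
  "grassmann_map R' \<psi> deg D L =
    (\<lambda>a\<in>D. module_span R' (graded_piece R' deg a) ((\<lambda>p. \<psi> \<circ> p) ` L a))"


section \<open>Pluecker coordinates and the natural equations\<close>

text \<open>
  The Pluecker coordinates of degree \<open>a\<close> are sections of a line bundle. Over \<open>D(f)\<close>, after choosing
  trivializations \<open>\<Phi> a\<close> of the quotients \<open>(R \<otimes> S\<^sub>a) / L\<^sub>a\<close>, they become elements of \<open>R\<^sub>f\<close>, namely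
  determinants of the coordinates of the images of the chosen monomials. Changing \<open>\<Phi> a\<close> multiplies
  all coordinates of degree \<open>a\<close> by one unit, and multihomogeneous equations hold at \<open>L\<close> iff they hold
  in \<open>R\<^sub>f\<close> for all \<open>f\<close> and all trivializations over \<open>D(f)\<close>.
\<close>

definition local_trivializations ::
  "('r, 'm) ring_scheme \<Rightarrow> (('n \<Rightarrow> nat) \<Rightarrow> 'a) \<Rightarrow> ('a \<Rightarrow> nat) \<Rightarrow> 'a set
    \<Rightarrow> ('a \<Rightarrow> (('n \<Rightarrow> nat) \<Rightarrow> 'r) set) \<Rightarrow> 'r
    \<Rightarrow> ('a \<Rightarrow> ((('n \<Rightarrow> nat) \<Rightarrow> 'r) set \<times> nat) set \<Rightarrow> nat \<Rightarrow> ('r \<times> nat) set) set" where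
  "local_trivializations R deg h D L f =
    {\<Phi>. \<forall>a\<in>D. \<Phi> a \<in> trivializations R f (quotient_module (graded_piece R deg a) (L a)) (h a)}"

definition pluecker ::
  "('r, 'm) ring_scheme \<Rightarrow> (('n \<Rightarrow> nat) \<Rightarrow> 'a) \<Rightarrow> ('a \<Rightarrow> (('n \<Rightarrow> nat) \<Rightarrow> 'r) set) \<Rightarrow> 'r
    \<Rightarrow> ('a \<Rightarrow> ((('n \<Rightarrow> nat) \<Rightarrow> 'r) set \<times> nat) set \<Rightarrow> nat \<Rightarrow> ('r \<times> nat) set)
    \<Rightarrow> 'a \<Rightarrow> ('n \<Rightarrow> nat) list \<Rightarrow> ('r \<times> nat) set" where
  "pluecker R deg L f \<Phi> a bs =
    (let P = graded_piece R deg a; W = quotient_module P (L a)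
     in ring_det (loc_ring R f) (length bs)
          (\<lambda>i j. \<Phi> a (module_fraction R f W (L a +>\<^bsub>P\<^esub> xpow R (bs ! i)) 0) j))"

definition omit :: "nat \<Rightarrow> 'x list \<Rightarrow> 'x list" where
  "omit i bs = take i bs @ drop (Suc i) bs"

text \<open>\<open>x\<^sup>u L\<^sub>a \<subseteq> L\<^sub>b\<close> says that each generator \<open>\<Sum>\<^sub>i (-1)\<^sup>i \<gamma>\<^bsub>B - b\<^sub>i\<^esub> b\<^sub>i\<close> of \<open>L\<^sub>a\<close>, multiplied by
  \<open>x\<^sup>u\<close>, becomes zero in the quotient \<open>W\<close> of degree \<open>b\<close>, equivalently its wedge product with any
  \<open>h(b) - 1\<close> monomials is zero in the top exterior power of \<open>W\<close>. Expanding that wedge product gives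
  the following bilinear equations. For \<open>h(b) = 0\<close> there is no condition, and no equation.\<close>

definition quadratic_equations ::
  "('r, 'm) ring_scheme \<Rightarrow> (('n \<Rightarrow> nat) \<Rightarrow> 'a::ab_group_add) \<Rightarrow> ('a \<Rightarrow> nat) \<Rightarrow> 'a set
    \<Rightarrow> ('a \<Rightarrow> (('n \<Rightarrow> nat) \<Rightarrow> 'r) set) \<Rightarrow> bool" where
  "quadratic_equations R deg h D L \<longleftrightarrow>
    (\<forall>f\<in>carrier R. \<forall>\<Phi>\<in>local_trivializations R deg h D L f.
     \<forall>a\<in>D. \<forall>b\<in>D. deg_less deg a b \<longrightarrow>
       (\<forall>u\<in>monomials deg (b - a). \<forall>bs cs.
          distinct bs \<and> set bs \<subseteq> monomials deg a \<and> length bs = h a + 1 \<and>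
          set cs \<subseteq> monomials deg b \<and> length cs + 1 = h b \<longrightarrow>
          (let K = loc_ring R f; \<gamma> = pluecker R deg L f \<Phi>
           in (\<Oplus>\<^bsub>K\<^esub>i\<in>{..h a}. (\<ominus>\<^bsub>K\<^esub> \<one>\<^bsub>K\<^esub>) [^]\<^bsub>K\<^esub> i \<otimes>\<^bsub>K\<^esub>
                 (\<gamma> a (omit i bs) \<otimes>\<^bsub>K\<^esub> \<gamma> b ((u + bs ! i) # cs))) = \<zero>\<^bsub>K\<^esub>)))"

text \<open>Rows of \<open>\<Gamma>\<^sub>e\<close> are indexed by triples \<open>(d, B, u)\<close>, with \<open>B\<close> given by any ordering of its
  elements. Reordering \<open>B\<close> changes the row only by a sign, hence does not affect ideals of minors.\<close>

definition gamma_rows ::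
  "(('n \<Rightarrow> nat) \<Rightarrow> 'a::ab_group_add) \<Rightarrow> ('a \<Rightarrow> nat) \<Rightarrow> 'a set \<Rightarrow> 'a
    \<Rightarrow> ('a \<times> ('n \<Rightarrow> nat) list \<times> ('n \<Rightarrow> nat)) set" where
  "gamma_rows deg h D e =
    {(d, bs, u). d \<in> D \<and> deg_less deg d e \<and>
       distinct bs \<and> set bs \<subseteq> monomials deg d \<and> length bs = h d + 1 \<and> u \<in> monomials deg (e - d)}"

definition gamma_entry ::
  "('r, 'm) ring_scheme \<Rightarrow> (('n \<Rightarrow> nat) \<Rightarrow> 'a) \<Rightarrow> ('a \<Rightarrow> nat) \<Rightarrow> ('a \<Rightarrow> (('n \<Rightarrow> nat) \<Rightarrow> 'r) set) \<Rightarrow> 'r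
    \<Rightarrow> ('a \<Rightarrow> ((('n \<Rightarrow> nat) \<Rightarrow> 'r) set \<times> nat) set \<Rightarrow> nat \<Rightarrow> ('r \<times> nat) set)
    \<Rightarrow> 'a \<times> ('n \<Rightarrow> nat) list \<times> ('n \<Rightarrow> nat) \<Rightarrow> ('n \<Rightarrow> nat) \<Rightarrow> ('r \<times> nat) set" where
  "gamma_entry R deg h L f \<Phi> = (\<lambda>(d, bs, u) w.
    (let K = loc_ring R f; \<gamma> = pluecker R deg L f \<Phi>
     in (\<Oplus>\<^bsub>K\<^esub>i\<in>{..h d}. if u + bs ! i = w
           then (\<ominus>\<^bsub>K\<^esub> \<one>\<^bsub>K\<^esub>) [^]\<^bsub>K\<^esub> i \<otimes>\<^bsub>K\<^esub> \<gamma> d (omit i bs) else \<zero>\<^bsub>K\<^esub>)))"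

definition minors_ideal ::
  "('r, 'm) ring_scheme \<Rightarrow> int \<Rightarrow> 'i set \<Rightarrow> 'j set \<Rightarrow> ('i \<Rightarrow> 'j \<Rightarrow> 'r) \<Rightarrow> 'r set" where
  "minors_ideal K m X Y M =
    (if m \<le> 0 then carrier K
     else genideal K
       {ring_det K (nat m) (\<lambda>i j. M (xs ! i) (ys ! j)) | xs ys.
          distinct xs \<and> set xs \<subseteq> X \<and> length xs = nat m \<and>
          distinct ys \<and> set ys \<subseteq> Y \<and> length ys = nat m})"

definition determinantal_equations ::
  "('r, 'm) ring_scheme \<Rightarrow> (('n \<Rightarrow> nat) \<Rightarrow> 'a::ab_group_add) \<Rightarrow> ('a \<Rightarrow> nat) \<Rightarrow> 'a set \<Rightarrow> 'a
    \<Rightarrow> ('a \<Rightarrow> (('n \<Rightarrow> nat) \<Rightarrow> 'r) set) \<Rightarrow> bool" where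
  "determinantal_equations R deg h D e L \<longleftrightarrow>
    (\<forall>f\<in>carrier R. \<forall>\<Phi>\<in>local_trivializations R deg h D L f.
       minors_ideal (loc_ring R f) (int (card (monomials deg e)) - int (h e) + 1)
         (gamma_rows deg h D e) (monomials deg e) (gamma_entry R deg h L f \<Phi>)
       = {\<zero>\<^bsub>loc_ring R f\<^esub>})"


section \<open>Supportive and very supportive sets of degrees\<close>

definition monomial_ideal ::
  "('k, 'm) ring_scheme \<Rightarrow> (('n::finite \<Rightarrow> nat) \<Rightarrow> 'k) set \<Rightarrow> bool" where
  "monomial_ideal k I \<longleftrightarrow> (\<exists>U. I = genideal (poly_ring k) (xpow k ` U))"

definition mono_hilbert ::
  "('k, 'm) ring_scheme \<Rightarrow> (('n \<Rightarrow> nat) \<Rightarrow> 'a) \<Rightarrow> (('n \<Rightarrow> nat) \<Rightarrow> 'k) set \<Rightarrow> 'a \<Rightarrow> nat" where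
  "mono_hilbert k deg I a = card {u \<in> monomials deg a. xpow k u \<notin> I}"

definition generated_in_degrees ::
  "('k, 'm) ring_scheme \<Rightarrow> (('n::finite \<Rightarrow> nat) \<Rightarrow> 'a) \<Rightarrow> 'a set \<Rightarrow> (('n \<Rightarrow> nat) \<Rightarrow> 'k) set \<Rightarrow> bool"
  where
  "generated_in_degrees k deg D I \<longleftrightarrow>
    I = genideal (poly_ring k) {xpow k u | u. xpow k u \<in> I \<and> deg u \<in> D}"

definition minimal_generators ::
  "('k, 'm) ring_scheme \<Rightarrow> (('n \<Rightarrow> nat) \<Rightarrow> 'k) set \<Rightarrow> ('n \<Rightarrow> nat) set" where
  "minimal_generators k I = {u. xpow k u \<in> I \<and> (\<forall>v. v < u \<longrightarrow> xpow k v \<notin> I)}"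

text \<open>The syzygy module sits inside the free \<open>S\<close>-module on the minimal monomial generators. The
  least common multiple of \<open>x\<^sup>u\<close> and \<open>x\<^sup>v\<close> has the pointwise maximum \<^term>\<open>sup u v\<close> as exponent.\<close>

definition syzygy_module ::
  "('k, 'm) ring_scheme \<Rightarrow> (('n::finite \<Rightarrow> nat) \<Rightarrow> 'k) set
    \<Rightarrow> (('n \<Rightarrow> nat) \<Rightarrow> ('n \<Rightarrow> nat) \<Rightarrow> 'k) set" where
  "syzygy_module k I =
    (let S = poly_ring k; G = minimal_generators k I
     in {s \<in> carrier (free_module S G). (\<Oplus>\<^bsub>S\<^esub>u\<in>G. s u \<otimes>\<^bsub>S\<^esub> xpow k u) = \<zero>\<^bsub>S\<^esub>})"

definition pair_syzygy ::
  "('k, 'm) ring_scheme \<Rightarrow> ('n::finite \<Rightarrow> nat) \<Rightarrow> ('n \<Rightarrow> nat)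
    \<Rightarrow> ('n \<Rightarrow> nat) \<Rightarrow> ('n \<Rightarrow> nat) \<Rightarrow> 'k" where
  "pair_syzygy k u v =
    (let S = poly_ring k
     in (\<lambda>g. (if g = u then xpow k (sup u v - u) else \<zero>\<^bsub>S\<^esub>)
             \<ominus>\<^bsub>S\<^esub> (if g = v then xpow k (sup u v - v) else \<zero>\<^bsub>S\<^esub>)))"

definition cond_g ::
  "('k, 'm) ring_scheme \<Rightarrow> (('n::finite \<Rightarrow> nat) \<Rightarrow> 'a) \<Rightarrow> ('a \<Rightarrow> nat) \<Rightarrow> 'a set \<Rightarrow> bool" where
  "cond_g k deg h D \<longleftrightarrow>
    (\<forall>I. monomial_ideal k I \<and> mono_hilbert k deg I = h \<longrightarrow> generated_in_degrees k deg D I)"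

definition cond_h ::
  "('k, 'm) ring_scheme \<Rightarrow> (('n::finite \<Rightarrow> nat) \<Rightarrow> 'a) \<Rightarrow> ('a \<Rightarrow> nat) \<Rightarrow> 'a set \<Rightarrow> bool" where
  "cond_h k deg h D \<longleftrightarrow>
    (\<forall>I. monomial_ideal k I \<and> generated_in_degrees k deg D I \<and>
         (\<forall>a\<in>D. mono_hilbert k deg I a = h a)
       \<longrightarrow> (\<forall>a. mono_hilbert k deg I a = h a))"

definition cond_h' ::
  "('k, 'm) ring_scheme \<Rightarrow> (('n::finite \<Rightarrow> nat) \<Rightarrow> 'a) \<Rightarrow> ('a \<Rightarrow> nat) \<Rightarrow> 'a set \<Rightarrow> bool" where
  "cond_h' k deg h D \<longleftrightarrow>
    (\<forall>I. monomial_ideal k I \<and> generated_in_degrees k deg D I \<and>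
         (\<forall>a\<in>D. mono_hilbert k deg I a = h a)
       \<longrightarrow> (\<forall>a. mono_hilbert k deg I a \<le> h a))"

definition cond_s ::
  "('k, 'm) ring_scheme \<Rightarrow> (('n::finite \<Rightarrow> nat) \<Rightarrow> 'a) \<Rightarrow> ('a \<Rightarrow> nat) \<Rightarrow> 'a set \<Rightarrow> bool" where
  "cond_s k deg h D \<longleftrightarrow>
    (\<forall>I. monomial_ideal k I \<and> mono_hilbert k deg I = h \<longrightarrow>
       (let G = minimal_generators k I
        in syzygy_module k I =
             module_span (poly_ring k) (free_module (poly_ring k) G)
               {pair_syzygy k u v | u v. u \<in> G \<and> v \<in> G \<and> deg (sup u v) \<in> D}))"

definition supportive ::
  "('k, 'm) ring_scheme \<Rightarrow> (('n::finite \<Rightarrow> nat) \<Rightarrow> 'a) \<Rightarrow> ('a \<Rightarrow> nat) \<Rightarrow> 'a set \<Rightarrow> bool" where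
  "supportive k deg h D \<longleftrightarrow> finite D \<and> cond_g k deg h D \<and> cond_h' k deg h D"

definition very_supportive ::
  "('k, 'm) ring_scheme \<Rightarrow> (('n::finite \<Rightarrow> nat) \<Rightarrow> 'a) \<Rightarrow> ('a \<Rightarrow> nat) \<Rightarrow> 'a set \<Rightarrow> bool" where
  "very_supportive k deg h D \<longleftrightarrow>
    finite D \<and> cond_g k deg h D \<and> cond_h k deg h D \<and> cond_s k deg h D"

end

theory Submission
  imports
    "Jordan_Normal_Form.Determinant"
    "HOL-Computational_Algebra.Polynomial"
    "HOL-Library.Poly_Mapping"
    Defs
begin

text \<open>
  Locally at a maximal ideal, a family of pieces of degrees in \<open>D\<close> with locally free quotients has
  well-defined leading monomials for a term order, and these generate a monomial ideal with the
  prescribed number of standard monomials in the degrees of \<open>D\<close>. By (h\<open>'\<close>) the standard monomials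
  still span in every degree with at most \<open>h\<close> elements; the vanishing minors exclude fewer than \<open>h\<close>
  in the degrees of \<open>E\<close>, so (h) gives Hilbert function \<open>h\<close>. By (s), every S-pair can be replaced by
  a chain of S-pairs of degrees in \<open>E\<close>, where the minors force the remainders to vanish, so a form of
  Buchberger's criterion, with Nakayama's lemma in place of division, shows that all quotients are
  locally free of rank \<open>h\<close>. Condition (g) shows in the same way that the pieces of degrees in \<open>D\<close>
  generate, which gives uniqueness. The equations are read off in local coordinates.
\<close>

section \<open>Linear algebra modulo and away from maximal ideals\<close>

text \<open>The coefficient ring \<open>R\<close> need not be local, Noetherian or a domain, and it
  is given by a carrier. It is written as \<open>T / Z\<close> for a type-class ring
  \<open>T\<close>, and submodules over \<open>R\<close> are replaced by their preimages over
  \<open>T\<close>, so that spans and determinants of the libraries apply. Local freeness of rank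
  \<open>r\<close> is used as a pair of conditions on Fitting ideals: local generation by
  \<open>r\<close> elements, and vanishing of all minors of size \<open>card X - r + 1\<close> of
  the relations. The size r_e - h(e) + 1 in the determinantal equations is exactly this number, so
  in degree e the equations supply the second half, while (h') supplies the first. Conditions (g),
  (h), (h') and (s) speak of ideals over \<open>k\<close>, whereas leading monomials belong to
  residue fields of \<open>R\<close>. Both are expressed by up-closed sets of exponents, in which
  the coefficients are forgotten. This transfer requires 1 \<noteq> 0 in \<open>k\<close>, which
  holds as soon as \<open>R\<close> is not the zero ring; over the zero ring there is no maximal
  ideal to examine.\<close>

definition scl :: "'t::comm_ring_1 \<Rightarrow> ('x \<Rightarrow> 't) \<Rightarrow> 'x \<Rightarrow> 't" where
  "scl c p = (\<lambda>x. c * p x)"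

lemma scl_apply [simp]: "scl c p x = c * p x"
  by (simp add: scl_def)

global_interpretation fv: Modules.module "scl :: 't::comm_ring_1 \<Rightarrow> ('x \<Rightarrow> 't) \<Rightarrow> 'x \<Rightarrow> 't"
  defines lspan = fv.span and lsub = fv.subspace
  by standard (auto simp: fun_eq_iff algebra_simps)

definition Fn :: "'x set \<Rightarrow> ('x \<Rightarrow> 't::comm_ring_1) set" where
  "Fn X = {p. \<forall>x. x \<notin> X \<longrightarrow> p x = 0}"

definition ev :: "'x \<Rightarrow> 'x \<Rightarrow> 't::comm_ring_1" where
  "ev x = (\<lambda>y. if y = x then 1 else 0)"

section \<open>Ideals, maximal ideals and membership tested locally\<close>

definition ideal_set :: "'t::comm_ring_1 set \<Rightarrow> bool" where
  "ideal_set Q \<longleftrightarrow> 0 \<in> Q \<and> (\<forall>a\<in>Q. \<forall>b\<in>Q. a + b \<in> Q) \<and> (\<forall>c. \<forall>a\<in>Q. c * a \<in> Q)"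

text \<open>Invertibility modulo \<open>P\<close> of every element outside \<open>P\<close> is the
  form of maximality that the arguments use; primality is derived from it.\<close>

definition max_ideal :: "'t::comm_ring_1 set \<Rightarrow> bool" where
  "max_ideal P \<longleftrightarrow> ideal_set P \<and> 1 \<notin> P \<and> (\<forall>a. a \<notin> P \<longrightarrow> (\<exists>b. a * b - 1 \<in> P))"

lemma sum_apply: "(\<Sum>i\<in>A. f i) x = (\<Sum>i\<in>A. f i x)" for f :: "'i \<Rightarrow> 'x \<Rightarrow> 't::comm_ring_1"
  by (induction A rule: infinite_finite_induct) auto

lemma FnI: "(\<And>x. x \<notin> X \<Longrightarrow> p x = 0) \<Longrightarrow> p \<in> Fn X"
  by (simp add: Fn_def)

lemma FnD: "p \<in> Fn X \<Longrightarrow> x \<notin> X \<Longrightarrow> p x = 0"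
  by (simp add: Fn_def)

lemma Fn_mono: "X \<subseteq> Y \<Longrightarrow> Fn X \<subseteq> Fn Y"
  by (auto simp: Fn_def)

lemma subspace_Fn: "lsub (Fn X)"
  by (rule fv.subspaceI) (auto simp: Fn_def)

lemma ev_in_Fn: "x \<in> X \<Longrightarrow> ev x \<in> Fn X"
  by (auto simp: Fn_def ev_def)

lemma Fn_expand:
  assumes "finite X" "p \<in> Fn X"
  shows "p = (\<Sum>x\<in>X. scl (p x) (ev x))"
proof
  fix y
  have "(\<Sum>x\<in>X. scl (p x) (ev x)) y = (\<Sum>x\<in>X. if x = y then p x else 0)"
    unfolding sum_apply by (rule sum.cong) (auto simp: ev_def)
  also have "\<dots> = p y" using assms by (auto simp: Fn_def)
  finally show "p y = (\<Sum>x\<in>X. scl (p x) (ev x)) y" by simp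
qed

lemma idealD0: "ideal_set Q \<Longrightarrow> 0 \<in> Q"
  and idealD_add: "ideal_set Q \<Longrightarrow> a \<in> Q \<Longrightarrow> b \<in> Q \<Longrightarrow> a + b \<in> Q"
  and idealD_mult: "ideal_set Q \<Longrightarrow> a \<in> Q \<Longrightarrow> c * a \<in> Q"
  by (auto simp: ideal_set_def)

lemma idealD_mult2: "ideal_set Q \<Longrightarrow> a \<in> Q \<Longrightarrow> a * c \<in> Q"
  using idealD_mult[of Q a c] by (simp add: mult.commute)

lemma idealD_minus: "ideal_set Q \<Longrightarrow> a \<in> Q \<Longrightarrow> - a \<in> Q"
  using idealD_mult[of Q a "- 1"] by simp

lemma idealD_diff: "ideal_set Q \<Longrightarrow> a \<in> Q \<Longrightarrow> b \<in> Q \<Longrightarrow> a - b \<in> Q"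
  using idealD_add[of Q a "- b"] idealD_minus[of Q b] by simp

lemma idealD_sum: "ideal_set Q \<Longrightarrow> (\<And>i. i \<in> A \<Longrightarrow> f i \<in> Q) \<Longrightarrow> sum f A \<in> Q"
  by (induction A rule: infinite_finite_induct) (auto intro: idealD0 idealD_add)

lemma idealD_prod:
  assumes "ideal_set Q" "finite A" "i \<in> A" "f i \<in> Q" shows "prod f A \<in> Q"
  using assms by (simp add: prod.remove[of A i] idealD_mult2)

lemmas idealD = idealD0 idealD_add idealD_mult idealD_mult2 idealD_minus idealD_diff

lemma ideal_add_cancel: "ideal_set Q \<Longrightarrow> b \<in> Q \<Longrightarrow> a + b \<in> Q \<longleftrightarrow> a \<in> Q"
  using idealD_diff[of Q "a + b" b] idealD_add[of Q a b] by auto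

lemma max_idealD: "max_ideal P \<Longrightarrow> ideal_set P" "max_ideal P \<Longrightarrow> 1 \<notin> P"
  by (auto simp: max_ideal_def)

lemma max_ideal_inverse: "max_ideal P \<Longrightarrow> a \<notin> P \<Longrightarrow> \<exists>b. a * b - 1 \<in> P"
  by (auto simp: max_ideal_def)

lemma max_ideal_prime: 
  assumes P: "max_ideal P" and ab: "a \<notin> P" "b \<notin> P" shows "a * b \<notin> P"
proof
  assume H: "a * b \<in> P"
  obtain a' where a': "a * a' - 1 \<in> P" using max_ideal_inverse[OF P ab(1)] by auto
  have "a' * (a * b) - b * (a * a' - 1) \<in> P"
    by (intro idealD_diff idealD_mult max_idealD(1)[OF P] H a')
  then show False using ab(2) by (simp add: algebra_simps)
qed

lemma max_ideal_prod:
  assumes P: "max_ideal P" and "\<And>i. i \<in> A \<Longrightarrow> f i \<notin> P" shows "prod f A \<notin> P"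
  using assms(2)
proof (induction A rule: infinite_finite_induct)
  case (insert x F)
  then show ?case using max_ideal_prime[OF P] by simp
qed (simp_all add: max_idealD(2)[OF P])

lemma max_ideal_power: "max_ideal P \<Longrightarrow> s \<notin> P \<Longrightarrow> s ^ n \<notin> P"
  using max_ideal_prod[of P "{..<n}" "\<lambda>_. s"] by simp

lemma max_ideal_diff: "max_ideal P \<Longrightarrow> s \<notin> P \<Longrightarrow> p \<in> P \<Longrightarrow> s - p \<notin> P"
  using idealD_add[of P "s - p" p] max_idealD(1) by auto

text \<open>Zorn's lemma for the ideals that contain \<open>Q\<close> and avoid 1; the union of a
  nonempty chain of them is again one.\<close>

lemma max_ideal_exists:
  assumes Q: "ideal_set (Q::'t::comm_ring_1 set)" "1 \<notin> Q"
  shows "\<exists>P. max_ideal P \<and> Q \<subseteq> P"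
proof -
  define S where "S = {I. ideal_set I \<and> 1 \<notin> I \<and> Q \<subseteq> I}"
  have "\<exists>M\<in>S. \<forall>I\<in>S. M \<subseteq> I \<longrightarrow> I = M"
  proof (rule subset_Zorn_nonempty)
    show "S \<noteq> {}" using Q by (auto simp: S_def)
    fix C assume C: "C \<noteq> {}" "subset.chain S C"
    have sub: "C \<subseteq> S" using C(2) by (simp add: subset.chain_def)
    have "ideal_set (\<Union>C)"
      unfolding ideal_set_def
    proof (intro conjI ballI allI)
      show "0 \<in> \<Union>C" using C(1) sub by (auto simp: S_def ideal_set_def)
      fix a b assume "a \<in> \<Union>C" "b \<in> \<Union>C"
      then obtain I1 I2 where I: "I1 \<in> C" "a \<in> I1" "I2 \<in> C" "b \<in> I2" by auto
      have "I1 \<subseteq> I2 \<or> I2 \<subseteq> I1" using C(2) I by (auto simp: subset.chain_def)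
      then obtain I where "I \<in> C" "a \<in> I" "b \<in> I" using I by blast
      moreover from this have "ideal_set I" using sub by (auto simp: S_def)
      ultimately show "a + b \<in> \<Union>C" using idealD_add by blast
    next
      fix c a assume "a \<in> \<Union>C"
      then obtain I where "I \<in> C" "a \<in> I" by auto
      moreover from this have "ideal_set I" using sub by (auto simp: S_def)
      ultimately show "c * a \<in> \<Union>C" using idealD_mult by blast
    qed
    moreover have "1 \<notin> \<Union>C" using sub by (auto simp: S_def)
    moreover have "Q \<subseteq> \<Union>C" using C(1) sub by (auto simp: S_def)
    ultimately show "\<Union>C \<in> S" by (simp add: S_def)
  qed
  then obtain M where M: "M \<in> S" "\<And>I. I \<in> S \<Longrightarrow> M \<subseteq> I \<Longrightarrow> I = M" by auto
  have iM: "ideal_set M" using M(1) by (simp add: S_def)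
  have "max_ideal M"
    unfolding max_ideal_def
  proof (intro conjI allI impI)
    show "ideal_set M" "1 \<notin> M" using M(1) by (auto simp: S_def)
    fix a assume a: "a \<notin> M"
    \<comment> \<open>The ideal generated by \<open>M\<close> and \<open>a\<close> is strictly
      larger than \<open>M\<close>, so it contains 1, and this yields an inverse of \<open>a\<close>
      modulo \<open>M\<close>.\<close>
    define I where "I = {m + c * a | m c. m \<in> M}"
    have I: "ideal_set I"
      unfolding ideal_set_def
    proof (intro conjI ballI allI)
      show "0 \<in> I" using idealD0[OF iM] by (auto simp: I_def intro!: exI[of _ 0])
      fix x y assume "x \<in> I" "y \<in> I"
      then obtain m c m' c' where "x = m + c * a" "y = m' + c' * a" "m \<in> M" "m' \<in> M"
        by (auto simp: I_def)
      then show "x + y \<in> I" using idealD_add[OF iM]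
        unfolding I_def by (intro CollectI exI[of _ "m + m'"] exI[of _ "c + c'"]) (auto simp: algebra_simps)
    next
      fix d x assume "x \<in> I"
      then obtain m c where "x = m + c * a" "m \<in> M" by (auto simp: I_def)
      moreover from this have "d * m \<in> M" by (intro idealD_mult[OF iM])
      ultimately show "d * x \<in> I"
        unfolding I_def by (intro CollectI exI[of _ "d * m"] exI[of _ "d * c"]) (auto simp: algebra_simps)
    qed
    have "M \<subseteq> I" by (force simp: I_def intro: exI[of _ 0])
    moreover have "a = 0 + 1 * a" by simp
    then have "a \<in> I" using idealD0[OF iM] unfolding I_def by blast
    ultimately have "1 \<in> I" using M I a by (auto simp: S_def)
    then obtain m c where mc: "1 = m + c * a" "m \<in> M" by (auto simp: I_def)
    have "a * c - 1 = - m" using mc(1) by (simp add: algebra_simps)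
    then have "a * c - 1 \<in> M" using mc(2) idealD_minus[OF iM] by metis
    then show "\<exists>b. a * b - 1 \<in> M" by blast
  qed
  then show ?thesis using M(1) by (auto simp: S_def)
qed

text \<open>Ideals containing \<open>Z\<close> are the ideals of \<open>T / Z\<close>, so only the
  maximal ideals over \<open>Z\<close> have to be avoided. The passages from local to global rest on
  this.\<close>

lemma one_in_ideal_locally:
  assumes "ideal_set Q" "Z \<subseteq> Q" "\<And>P. max_ideal P \<Longrightarrow> Z \<subseteq> P \<Longrightarrow> \<exists>s\<in>Q. s \<notin> P"
  shows "1 \<in> Q"
  using max_ideal_exists[of Q] assms by (meson subset_iff)

text \<open>The ideal of all \<open>s\<close> with \<open>s * c \<in> Z\<close> lies in no maximal
  ideal over \<open>Z\<close>, hence contains 1.\<close>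

lemma in_ideal_locally:
  assumes Z: "ideal_set Z" and loc: "\<And>P. max_ideal P \<Longrightarrow> Z \<subseteq> P \<Longrightarrow> \<exists>s. s \<notin> P \<and> s * c \<in> Z"
  shows "c \<in> Z"
proof -
  have "1 \<in> {s. s * c \<in> Z}"
  proof (rule one_in_ideal_locally)
    show "ideal_set {s. s * c \<in> Z}"
      using Z by (auto simp: ideal_set_def algebra_simps)
    show "Z \<subseteq> {s. s * c \<in> Z}" using idealD_mult2[OF Z] by auto
  qed (use loc in auto)
  then show ?thesis by simp
qed

text \<open>The same argument for the conductor of \<open>y\<close> into \<open>M\<close>; the
  assumption on \<open>Z\<close> places \<open>Z\<close> inside this conductor.\<close>

lemma in_subspace_locally:
  assumes Z: "ideal_set Z" and M: "lsub M" and ZM: "\<And>s. s \<in> Z \<Longrightarrow> scl s y \<in> M"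
    and loc: "\<And>P. max_ideal P \<Longrightarrow> Z \<subseteq> P \<Longrightarrow> \<exists>s. s \<notin> P \<and> scl s y \<in> M"
  shows "y \<in> M"
proof -
  have "1 \<in> {s. scl s y \<in> M}"
  proof (rule one_in_ideal_locally)
    show "ideal_set {s. scl s y \<in> M}"
      unfolding ideal_set_def
      using fv.subspace_0[OF M] fv.subspace_add[OF M] fv.subspace_scale[OF M]
      by (auto simp: fv.scale_left_distrib simp flip: fv.scale_scale)
    show "Z \<subseteq> {s. scl s y \<in> M}" using ZM by auto
  qed (use loc in auto)
  then show ?thesis by simp
qed

subsection \<open>Saturation and Nakayama's lemma\<close>

text \<open>For a submodule \<open>M\<close> these are the vectors whose image in the localization
  at \<open>P\<close> lies in the localization of \<open>M\<close>. No localized module at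
  \<open>P\<close> has to be constructed.\<close>

definition sat :: "'t::comm_ring_1 set \<Rightarrow> ('x \<Rightarrow> 't) set \<Rightarrow> ('x \<Rightarrow> 't) set" where
  "sat P M = {y. \<exists>s. s \<notin> P \<and> scl s y \<in> M}"

lemma satI: "s \<notin> P \<Longrightarrow> scl s y \<in> M \<Longrightarrow> y \<in> sat P M"
  by (auto simp: sat_def)

lemma sat_superset: "max_ideal P \<Longrightarrow> M \<subseteq> sat P M"
  using max_idealD(2) by (force intro!: satI[of 1])

lemma subspace_sat:
  assumes P: "max_ideal P" and M: "lsub M"
  shows "lsub (sat P M)"
proof (rule fv.subspaceI)
  show "0 \<in> sat P M" using sat_superset[OF P, of M] fv.subspace_0[OF M] by auto
next
  fix x y assume "x \<in> sat P M" "y \<in> sat P M"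
  then obtain s t where st: "s \<notin> P" "t \<notin> P" "scl s x \<in> M" "scl t y \<in> M" by (auto simp: sat_def)
  have "scl (s * t) (x + y) = scl t (scl s x) + scl s (scl t y)"
    by (auto simp: fun_eq_iff algebra_simps)
  then have "scl (s * t) (x + y) \<in> M"
    using fv.subspace_add[OF M fv.subspace_scale[OF M st(3), of t] fv.subspace_scale[OF M st(4), of s]]
    by simp
  then show "x + y \<in> sat P M" using max_ideal_prime[OF P st(1,2)] by (rule satI[rotated])
next
  fix c x assume "x \<in> sat P M"
  then obtain s where s: "s \<notin> P" "scl s x \<in> M" by (auto simp: sat_def)
  have "scl s (scl c x) = scl c (scl s x)" by (auto simp: fun_eq_iff algebra_simps)
  then have "scl s (scl c x) \<in> M" using fv.subspace_scale[OF M s(2), of c] by metis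
  then show "scl c x \<in> sat P M" by (rule satI[OF s(1)])
qed

lemma sat_sat:
  assumes "max_ideal P" shows "sat P (sat P M) = sat P M"
proof
  show "sat P (sat P M) \<subseteq> sat P M"
    unfolding sat_def using max_ideal_prime[OF assms] by fastforce
qed (rule sat_superset[OF assms])

lemma sat_cancel:
  assumes "max_ideal P" "s \<notin> P" "scl s y \<in> sat P M" shows "y \<in> sat P M"
  using satI[OF assms(2,3)] sat_sat[OF assms(1)] by auto

definition pmul :: "'t::comm_ring_1 set \<Rightarrow> ('x \<Rightarrow> 't) set \<Rightarrow> ('x \<Rightarrow> 't) set" where
  "pmul P F = {scl p y | p y. p \<in> P \<and> y \<in> F}"

lemma span_pmul_insert:
  assumes P: "ideal_set P" and z: "z \<in> lspan (Q \<union> pmul P (insert m F))"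
  shows "\<exists>x p. x \<in> lspan (Q \<union> pmul P F) \<and> p \<in> P \<and> z = x + scl p m"
  using z
proof (induction rule: fv.span_induct_alt)
  case base
  have "0 = 0 + scl 0 m" by simp
  then show ?case using fv.span_zero idealD0[OF P] by blast
next
  case (step c u z)
  then obtain x p where xp: "x \<in> lspan (Q \<union> pmul P F)" "p \<in> P" "z = x + scl p m" by blast
  consider "u \<in> Q \<union> pmul P F" | q where "q \<in> P" "u = scl q m"
    using step(1) by (auto simp: pmul_def)
  then show ?case
  proof cases
    case 1
    then have "scl c u + x \<in> lspan (Q \<union> pmul P F)"
      by (intro fv.span_add fv.span_scale xp fv.span_base)
    moreover have "scl c u + z = (scl c u + x) + scl p m" using xp(3) by (simp only: add.assoc)
    ultimately show ?thesis using xp(2) by blast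
  next
    case 2
    have "c * q + p \<in> P" using 2(1) xp(2) by (intro idealD_add idealD_mult P)
    moreover have "scl c u + z = x + scl (c * q + p) m"
      using 2(2) xp(3) by (simp add: fun_eq_iff algebra_simps)
    ultimately show ?thesis using xp(1) by blast
  qed
qed

text \<open>Generators are eliminated one at a time. A relation \<open>s m = x + p m\<close> with
  \<open>p \<in> P\<close> gives \<open>(s - p) m = x\<close>, and \<open>s - p\<close> is outside
  \<open>P\<close>; after multiplication by \<open>s - p\<close>, the element \<open>m\<close> can
  be replaced in the relations of all the other generators.\<close>

lemma nakayama:
  assumes P: "max_ideal P"
  shows "finite F \<Longrightarrow> F \<subseteq> sat P (lspan (Q \<union> pmul P F)) \<Longrightarrow> F \<subseteq> sat P (lspan Q)"
proof (induction F rule: finite_induct)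
  case (insert m F)
  let ?A = "lspan (Q \<union> pmul P F)"
  have iP: "ideal_set P" using P by (rule max_idealD)
  obtain s where s: "s \<notin> P" "scl s m \<in> lspan (Q \<union> pmul P (insert m F))"
    using insert.prems by (auto simp: sat_def)
  then obtain x p where xp: "x \<in> ?A" "p \<in> P" "scl s m = x + scl p m"
    using span_pmul_insert[OF iP] by blast
  have m: "scl (s - p) m = x" using xp(3) by (auto simp: fun_eq_iff algebra_simps)
  have sp: "s - p \<notin> P" using max_ideal_diff[OF P s(1) xp(2)] .
  have "F \<subseteq> sat P ?A"
  proof
    fix m' assume "m' \<in> F"
    then obtain s' where s': "s' \<notin> P" "scl s' m' \<in> lspan (Q \<union> pmul P (insert m F))"
      using insert.prems by (auto simp: sat_def)
    then obtain x' p' where xp': "x' \<in> ?A" "p' \<in> P" "scl s' m' = x' + scl p' m"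
      using span_pmul_insert[OF iP] by blast
    have "scl ((s - p) * s') m' = scl (s - p) (scl s' m')" by simp
    also have "\<dots> = scl (s - p) x' + scl p' (scl (s - p) m)"
      unfolding xp'(3) by (simp add: fun_eq_iff algebra_simps)
    also have "\<dots> = scl (s - p) x' + scl p' x" unfolding m ..
    finally have "scl ((s - p) * s') m' \<in> ?A"
      using xp(1) xp'(1) by (simp add: fv.span_add fv.span_scale)
    then show "m' \<in> sat P ?A" using max_ideal_prime[OF P sp s'(1)] by (rule satI[rotated])
  qed
  then have F: "F \<subseteq> sat P (lspan Q)" by (rule insert.IH)
  have sub: "lsub (sat P (lspan Q))" by (rule subspace_sat[OF P]) simp
  have "?A \<subseteq> sat P (lspan Q)"
  proof (rule fv.span_minimal[OF _ sub])
    have "Q \<subseteq> sat P (lspan Q)" using sat_superset[OF P] fv.span_superset by blast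
    then show "Q \<union> pmul P F \<subseteq> sat P (lspan Q)"
      using F fv.subspace_scale[OF sub] by (auto simp: pmul_def)
  qed
  then have "scl (s - p) m \<in> sat P (lspan Q)" using m xp(1) by auto
  then have "m \<in> sat P (lspan Q)" by (rule sat_cancel[OF P sp])
  then show ?case using F by simp
qed simp

subsection \<open>Leading positions\<close>

text \<open>The reduction of \<open>p\<close> modulo \<open>P\<close> has leading position
  \<open>w\<close> with coefficient 1 there. Coefficients at lower positions are arbitrary.\<close>

definition lead :: "'t::comm_ring_1 set \<Rightarrow> ('x \<Rightarrow> 'o::linorder) \<Rightarrow> ('x \<Rightarrow> 't) \<Rightarrow> 'x \<Rightarrow> bool" where
  "lead P rk p w \<longleftrightarrow> p w - 1 \<in> P \<and> (\<forall>x. rk w < rk x \<longrightarrow> p x \<in> P)"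

definition leads :: "'t::comm_ring_1 set \<Rightarrow> ('x \<Rightarrow> 'o::linorder) \<Rightarrow> ('x \<Rightarrow> 't) set \<Rightarrow> 'x set" where
  "leads P rk M = {w. \<exists>p\<in>M. lead P rk p w}"

lemma lead_notin: "max_ideal P \<Longrightarrow> lead P rk p w \<Longrightarrow> p w \<notin> P"
  using idealD_diff[of P "p w" "p w - 1"] by (auto simp: lead_def max_ideal_def)

lemma leads_subset:
  assumes "max_ideal P" "M \<subseteq> Fn X" shows "leads P rk M \<subseteq> X"
  using assms lead_notin[OF assms(1)] idealD0[OF max_idealD(1)[OF assms(1)]]
  by (fastforce simp: leads_def Fn_def)

lemma exists_max_rank:
  assumes "finite B" "B \<noteq> {}"
  shows "\<exists>b\<in>B. \<forall>x\<in>B. rk x \<le> (rk b :: 'o::linorder)"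
proof -
  have "Max (rk ` B) \<in> rk ` B" using assms by (intro Max_in) auto
  then obtain b where "b \<in> B" "rk b = Max (rk ` B)" by auto
  then show ?thesis using assms(1) by (intro bexI[of _ b]) auto
qed

text \<open>The highest position at which \<open>p\<close> is nonzero modulo \<open>P\<close>
  becomes a leading position after scaling by an inverse modulo \<open>P\<close>.\<close>

lemma in_leadsI:
  assumes P: "max_ideal P" and M: "lsub M" and X: "finite X" and rk: "inj_on rk X"
    and p: "p \<in> M" "p \<in> Fn X" "p x \<notin> P"
  shows "\<exists>w \<in> leads P rk M. p w \<notin> P \<and> rk x \<le> rk w"
proof -
  have iP: "ideal_set P" using P by (rule max_idealD)
  define B where "B = {x \<in> X. p x \<notin> P}"
  have PB: "x \<in> B \<longleftrightarrow> p x \<notin> P" for x using p(2) idealD0[OF iP] by (auto simp: B_def Fn_def)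
  have "finite B" unfolding B_def using X by simp
  moreover have "B \<noteq> {}" using p(3) PB by blast
  ultimately obtain w where w: "w \<in> B" "\<And>y. y \<in> B \<Longrightarrow> rk y \<le> rk w" using exists_max_rank by metis
  obtain b where b: "p w * b - 1 \<in> P" using max_ideal_inverse[OF P] w(1) PB by auto
  have "lead P rk (scl b p) w"
    unfolding lead_def
  proof (intro conjI allI impI)
    show "scl b p w - 1 \<in> P" using b by (simp add: mult.commute)
    fix y assume "rk w < rk y"
    then have "p y \<in> P" using w(2) PB leD by blast
    then show "scl b p y \<in> P" using idealD_mult[OF iP] by simp
  qed
  then have "w \<in> leads P rk M" using fv.subspace_scale[OF M p(1)] by (auto simp: leads_def)
  then show ?thesis using w PB p(3) by blast
qed

text \<open>Modulo \<open>P\<close> the vectors \<open>t w\<close> together with the unit vectors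
  off \<open>J\<close> form a unitriangular system. Hence every \<open>ev w\<close> lies in the span
  up to \<open>P\<close> times unit vectors, and Nakayama's lemma removes this error.\<close>

lemma span_triangular:
  fixes P :: "'t::comm_ring_1 set" and X :: "'x set" and rk :: "'x \<Rightarrow> 'o::linorder"
  assumes P: "max_ideal P" and X: "finite X" and rk: "inj_on rk X" and J: "J \<subseteq> X"
    and t: "\<And>w. w \<in> J \<Longrightarrow> t w \<in> Fn X" "\<And>w. w \<in> J \<Longrightarrow> lead P rk (t w) w"
  shows "Fn X \<subseteq> sat P (lspan (t ` J \<union> Fn (X - J)))"
proof -
  have iP: "ideal_set P" using P by (rule max_idealD)
  let ?Q = "t ` J \<union> Fn (X - J)" and ?F = "(ev ` J :: ('x \<Rightarrow> 't) set)"
  let ?S = "sat P (lspan (?Q \<union> pmul P ?F))"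
  have subS: "lsub ?S" by (rule subspace_sat[OF P]) simp
  have inS: "y \<in> ?Q \<union> pmul P ?F \<Longrightarrow> y \<in> ?S" for y
    by (rule subsetD[OF sat_superset[OF P]]) (rule fv.span_base)
  have ev: "ev w \<in> ?S" if "w \<in> J" for w
    using that
  proof (induction "card {x\<in>J. rk x < rk w}" arbitrary: w rule: less_induct)
    case less
    have w: "w \<in> J" by fact
    have IH: "ev x \<in> ?S" if x: "x \<in> J" "rk x < rk w" for x
    proof (rule less.hyps)
      show "card {y \<in> J. rk y < rk x} < card {x \<in> J. rk x < rk w}"
        using x finite_subset[OF J X] by (intro psubset_card_mono) (auto intro: less_trans)
    qed fact
    \<comment> \<open>Each coefficient of \<open>t w - ev w\<close> is absorbed: off
      \<open>J\<close> by \<open>Fn (X - J)\<close>, at or above \<open>w\<close> because it lies in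
      \<open>P\<close>, and below \<open>w\<close> by the induction on the rank.\<close>
    have c: "scl (t w x - (if x = w then 1 else 0)) (ev x) \<in> ?S" if x: "x \<in> X" for x
    proof (cases "x \<in> J")
      case False
      then have "x \<noteq> w" using w by auto
      then show ?thesis using False x by (auto intro!: inS fv.subspace_scale[OF subspace_Fn] ev_in_Fn)
    next
      case True
      consider "x = w" | "rk x < rk w" | "rk w < rk x" "x \<noteq> w"
        using inj_onD[OF rk, of x w] x w J by (cases "rk x" "rk w" rule: linorder_cases) auto
      then show ?thesis
      proof cases
        case 1
        then show ?thesis using t(2)[OF w] True
          by (intro inS UnI2) (auto simp: pmul_def lead_def)
      next
        case 2
        then show ?thesis by (intro fv.subspace_scale[OF subS] IH True)
      next
        case 3
        then show ?thesis using t(2)[OF w] True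
          by (intro inS UnI2) (auto simp: pmul_def lead_def)
      qed
    qed
    have "ev w = t w - (\<Sum>x\<in>X. scl (t w x - (if x = w then 1 else 0)) (ev x))"
    proof -
      have "t w = (\<Sum>x\<in>X. scl (t w x) (ev x))" by (rule Fn_expand[OF X t(1)[OF w]])
      moreover have "ev w = (\<Sum>x\<in>X. scl (if x = w then 1 else 0) (ev x :: 'x \<Rightarrow> 't))"
        using X J w by (subst sum.mono_neutral_right[of X "{w}"]) auto
      ultimately show ?thesis by (simp add: fv.scale_left_diff_distrib sum_subtractf)
    qed
    moreover have "t w \<in> ?S" using w by (intro inS) auto
    moreover have "(\<Sum>x\<in>X. scl (t w x - (if x = w then 1 else 0)) (ev x)) \<in> ?S"
      by (rule fv.subspace_sum[OF subS]) (rule c)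
    ultimately show ?case using fv.subspace_diff[OF subS] by simp
  qed
  have "?F \<subseteq> sat P (lspan ?Q)"
    by (rule nakayama[OF P]) (use ev finite_subset[OF J X] in auto)
  moreover have sub: "lsub (sat P (lspan ?Q))" by (rule subspace_sat[OF P]) simp
  moreover have "ev x \<in> sat P (lspan ?Q)" if "x \<in> X - J" for x
    using that by (intro subsetD[OF sat_superset[OF P]] fv.span_base UnI2 ev_in_Fn)
  ultimately have "ev x \<in> sat P (lspan ?Q)" if "x \<in> X" for x
    using that by (cases "x \<in> J") auto
  then have "(\<Sum>x\<in>X. scl (p x) (ev x)) \<in> sat P (lspan ?Q)" for p
    by (intro fv.subspace_sum[OF sub] fv.subspace_scale[OF sub])
  then show ?thesis by (subst subset_eq) (metis Fn_expand[OF X])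
qed

lemma span_image_plus_Fn:
  assumes J: "finite J" and B: "lsub B" and z: "z \<in> lspan (t ` J \<union> B)"
  shows "\<exists>\<alpha> n. n \<in> B \<and> z = (\<Sum>w\<in>J. scl (\<alpha> w) (t w)) + n"
  using z
proof (induction rule: fv.span_induct_alt)
  case base
  show ?case
  proof (intro exI conjI)
    show "0 \<in> B" by (rule fv.subspace_0[OF B])
    show "0 = (\<Sum>w\<in>J. scl ((\<lambda>_. 0) w) (t w)) + 0" by simp
  qed
next
  case (step c u z)
  then obtain \<alpha> n where a: "n \<in> B" "z = (\<Sum>w\<in>J. scl (\<alpha> w) (t w)) + n" by blast
  show ?case
  proof (cases "u \<in> B")
    case True
    then have "scl c u + n \<in> B" using a fv.subspace_add[OF B] fv.subspace_scale[OF B] by blast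
    moreover have "scl c u + z = (\<Sum>w\<in>J. scl (\<alpha> w) (t w)) + (scl c u + n)"
      using a(2) by (simp only: ac_simps)
    ultimately show ?thesis by blast
  next
    case False
    then obtain w where w: "w \<in> J" "u = t w" using step by auto
    have "(\<Sum>v\<in>J. scl ((\<alpha>(w := \<alpha> w + c)) v) (t v)) = scl c (t w) + (\<Sum>v\<in>J. scl (\<alpha> v) (t v))"
      using J w(1) by (simp add: sum.remove[of J w] fun_eq_iff algebra_simps)
    then have "scl c u + z = (\<Sum>v\<in>J. scl ((\<alpha>(w := \<alpha> w + c)) v) (t v)) + n"
      using a(2) w(2) by (simp only: add.assoc)
    then show ?thesis using a(1) by blast
  qed
qed

text \<open>Division of \<open>z\<close> by the \<open>t w\<close>, with a remainder
  \<open>n\<close> that has no coefficient at a position of \<open>J\<close>. The factor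
  \<open>s\<close> is the denominator that a division over the localization at \<open>P\<close>
  would have.\<close>

lemma decompose_triangular:
  assumes P: "max_ideal P" and X: "finite X" and rk: "inj_on rk X" and J: "J \<subseteq> X"
    and t: "\<And>w. w \<in> J \<Longrightarrow> t w \<in> Fn X" "\<And>w. w \<in> J \<Longrightarrow> lead P rk (t w) w"
    and z: "z \<in> Fn X"
  obtains s \<alpha> n where "s \<notin> P" "n \<in> Fn (X - J)" "scl s z = (\<Sum>w\<in>J. scl (\<alpha> w) (t w)) + n"
proof -
  obtain s where s: "s \<notin> P" "scl s z \<in> lspan (t ` J \<union> Fn (X - J))"
    using span_triangular[OF assms(1-6)] z by (auto simp: sat_def)
  then show thesis
    using span_image_plus_Fn[OF finite_subset[OF J X] subspace_Fn s(2)] that by blast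
qed

text \<open>Read off the coefficient at the highest position \<open>b\<close> with
  \<open>\<alpha> b \<notin> P\<close>. Vectors with lower leading position contribute elements of
  \<open>P\<close> there, those with higher leading position have their coefficient in
  \<open>P\<close>, and \<open>n\<close> vanishes there; so \<open>\<alpha> b * t b b\<close> would
  lie in \<open>P\<close>. For an S-pair this bounds the leading terms that can occur outside
  \<open>P\<close> in its division.\<close>

lemma triangular_coefficients:
  assumes P: "max_ideal P" and X: "finite X" and rk: "inj_on rk X" and J: "J \<subseteq> X"
    and t: "\<And>w. w \<in> J \<Longrightarrow> lead P rk (t w) w"
    and n: "n \<in> Fn (X - J)" and z: "z = (\<Sum>w\<in>J. scl (\<alpha> w) (t w)) + n"
    and small: "\<And>x. x \<in> X \<Longrightarrow> rk m \<le> rk x \<Longrightarrow> z x \<in> P"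
    and w: "w \<in> J" "rk m \<le> rk w"
  shows "\<alpha> w \<in> P"
proof (rule ccontr)
  assume aw: "\<alpha> w \<notin> P"
  have iP: "ideal_set P" using P by (rule max_idealD)
  have fJ: "finite J" using J X by (rule finite_subset)
  define B where "B = {w\<in>J. \<alpha> w \<notin> P \<and> rk m \<le> rk w}"
  have "finite B" "B \<noteq> {}" using fJ aw w by (auto simp: B_def)
  then obtain b where b: "b \<in> B" "\<And>y. y \<in> B \<Longrightarrow> rk y \<le> rk b" using exists_max_rank by metis
  have bJ: "b \<in> J" "\<alpha> b \<notin> P" "rk m \<le> rk b" using b(1) by (auto simp: B_def)
  have "n b = 0" using n bJ(1) by (auto simp: Fn_def)
  then have zb: "z b = \<alpha> b * t b b + (\<Sum>w\<in>J - {b}. \<alpha> w * t w b)"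
    using z fJ bJ(1) by (simp add: sum_apply sum.remove)
  have "\<alpha> w * t w b \<in> P" if "w \<in> J - {b}" for w
  proof (cases "rk w < rk b")
    case True
    then show ?thesis using t[of w] that iP by (auto simp: lead_def intro: idealD_mult)
  next
    case False
    then have "rk b < rk w" using inj_onD[OF rk, of w b] that J bJ
      by (cases "rk w" "rk b" rule: linorder_cases) auto
    then have "w \<notin> B" "rk m \<le> rk w" using b(2) bJ by force+
    then show ?thesis using that iP by (auto simp: B_def intro: idealD_mult2)
  qed
  then have "(\<Sum>w\<in>J - {b}. \<alpha> w * t w b) \<in> P" by (intro idealD_sum[OF iP])
  moreover have "z b \<in> P" using small bJ J by auto
  ultimately have "\<alpha> b * t b b \<in> P" using zb ideal_add_cancel[OF iP] by metis
  then show False using max_ideal_prime[OF P bJ(2)] lead_notin[OF P t[OF bJ(1)]] by blast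
qed

subsection \<open>Determinants and minors\<close>

definition dt :: "nat \<Rightarrow> (nat \<Rightarrow> nat \<Rightarrow> 't::comm_ring_1) \<Rightarrow> 't" where
  "dt m M = det (mat m m (\<lambda>(i, j). M i j))"

lemma dt_leibniz: "dt m M = (\<Sum>\<pi>\<in>{\<pi>. \<pi> permutes {..<m}}. signof \<pi> * (\<Prod>i<m. M i (\<pi> i)))"
proof -
  have "dt m M = (\<Sum>\<pi>\<in>{\<pi>. \<pi> permutes {0..<m}}.
      signof \<pi> * (\<Prod>i = 0..<m. mat m m (\<lambda>(i, j). M i j) $$ (i, \<pi> i)))"
    unfolding dt_def by (rule det_def') simp
  also have "\<dots> = (\<Sum>\<pi>\<in>{\<pi>. \<pi> permutes {..<m}}. signof \<pi> * (\<Prod>i<m. M i (\<pi> i)))"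
    unfolding lessThan_atLeast0
    by (intro sum.cong refl arg_cong2[of _ _ _ _ "(*)"] prod.cong) (auto simp: permutes_def permutes_in_image)
  finally show ?thesis .
qed

lemma dt_cong: "(\<And>i j. i < m \<Longrightarrow> j < m \<Longrightarrow> M i j = M' i j) \<Longrightarrow> dt m M = dt m M'"
  unfolding dt_def by (rule arg_cong[of _ _ det]) (auto intro!: eq_matI)

lemma dt_row_linear:
  assumes k: "k < m"
  shows "dt m (M(k := \<lambda>j. a * x j + y j)) = a * dt m (M(k := x)) + dt m (M(k := y))"
proof -
  have pr: "(\<Prod>i<m. (M(k := z)) i (\<pi> i)) = z (\<pi> k) * (\<Prod>i\<in>{..<m} - {k}. M i (\<pi> i))" for z \<pi>
    using k by (subst prod.remove[of _ k]) (auto intro!: prod.cong)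
  show ?thesis
    unfolding dt_leibniz pr sum_distrib_left sum.distrib[symmetric]
    by (rule sum.cong) (auto simp: algebra_simps)
qed

lemma dt_row_zero: "k < m \<Longrightarrow> dt m (M(k := \<lambda>j. 0)) = 0"
  using dt_row_linear[of k m M 1 "\<lambda>_. 0" "\<lambda>_. 0"] by simp

lemma dt_scale_rows: "dt m (\<lambda>i j. c i * M i j) = (\<Prod>i<m. c i) * dt m M"
  unfolding dt_leibniz sum_distrib_left
  by (rule sum.cong) (auto simp: prod.distrib algebra_simps)

lemma dt_identical_rows:
  assumes "i < m" "i' < m" "i \<noteq> i'" "\<And>j. j < m \<Longrightarrow> M i j = M i' j"
  shows "dt m M = 0"
  unfolding dt_def using assms by (intro det_identical_rows[of _ m i i']) auto

lemma dt_identical_cols: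
  assumes "j < m" "j' < m" "j \<noteq> j'" "\<And>i. i < m \<Longrightarrow> M i j = M i j'"
  shows "dt m M = 0"
  unfolding dt_def using assms by (intro det_identical_columns[of _ m j j']) auto

lemma dt_row_in_ideal:
  assumes Q: "ideal_set Q" and k: "k < m" and "\<And>j. M k j \<in> Q"
  shows "dt m M \<in> Q"
  unfolding dt_leibniz
  by (intro idealD_sum[OF Q] idealD_mult[OF Q] idealD_prod[OF Q, where i = k]) (use assms in auto)

lemma dt_upper_triangular:
  assumes "\<And>i j. i < m \<Longrightarrow> j < i \<Longrightarrow> M i j = 0"
  shows "dt m M = (\<Prod>i<m. M i i)"
proof -
  have "dt m M = prod_list (diag_mat (mat m m (\<lambda>(i, j). M i j)))"
    unfolding dt_def
    by (rule det_upper_triangular[of _ m]) (use assms in \<open>auto simp: upper_triangular_def\<close>)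
  also have "\<dots> = (\<Prod>i<m. M i i)"
    by (subst prod_list_diag_prod) (auto simp: lessThan_atLeast0)
  finally show ?thesis .
qed

text \<open>Rows and columns may repeat. Such minors are 0, so this is the condition on the ideal of
  \<open>m\<close>-minors of the matrix whose rows are the elements of \<open>S\<close>.\<close>

definition minors_in :: "nat \<Rightarrow> 'x set \<Rightarrow> ('x \<Rightarrow> 't::comm_ring_1) set \<Rightarrow> 't set \<Rightarrow> bool" where
  "minors_in m X S Q \<longleftrightarrow> (\<forall>y xs. (\<forall>i<m. y i \<in> S) \<and> set xs \<subseteq> X \<and> length xs = m \<longrightarrow>
     dt m (\<lambda>i j. y i (xs ! j)) \<in> Q)"

lemma minors_inD:
  "minors_in m X S Q \<Longrightarrow> (\<And>i. i < m \<Longrightarrow> y i \<in> S) \<Longrightarrow> set xs \<subseteq> X \<Longrightarrow> length xs = m \<Longrightarrow>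
     dt m (\<lambda>i j. y i (xs ! j)) \<in> Q"
  by (auto simp: minors_in_def)

lemma minors_in_mono: "minors_in m X S Q \<Longrightarrow> S' \<subseteq> S \<Longrightarrow> minors_in m X S' Q"
  by (auto simp: minors_in_def)

text \<open>Rows of a minor are moved from \<open>S\<close> to its span one at a time.\<close>

lemma minors_in_span:
  assumes Q: "ideal_set Q" and S: "minors_in m X S Q"
  shows "minors_in m X (lspan S) Q"
proof -
  have "dt m (\<lambda>i j. y i (xs ! j)) \<in> Q"
    if "k \<le> m" "\<And>i. i < k \<Longrightarrow> y i \<in> lspan S" "\<And>i. k \<le> i \<Longrightarrow> i < m \<Longrightarrow> y i \<in> S"
      "set xs \<subseteq> X" "length xs = m" for k y xs
    using that
  proof (induction k arbitrary: y)
    case 0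
    then show ?case using minors_inD[OF S] by auto
  next
    case (Suc k)
    let ?d = "\<lambda>v. dt m (\<lambda>i j. (y(k := v)) i (xs ! j))"
    have row: "(\<lambda>i j. (y(k := v)) i (xs ! j)) = (\<lambda>i j. y i (xs ! j))(k := \<lambda>j. v (xs ! j))" for v
      by (auto simp: fun_eq_iff)
    have "?d v \<in> Q" if "v \<in> lspan S" for v
      using that
    proof (induction rule: fv.span_induct_alt)
      case base
      have "?d 0 = 0" unfolding row using dt_row_zero[of k m] Suc.prems(1) by (simp add: Suc_le_eq)
      then show "?d 0 \<in> Q" using idealD0[OF Q] by simp
    next
      case (step c u v)
      have "?d (scl c u + v) = c * ?d u + ?d v"
        unfolding row using Suc.prems(1) dt_row_linear[of k m] by (simp add: Suc_le_eq)
      moreover have "?d u \<in> Q"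
        by (rule Suc.IH) (use Suc.prems step(1) in auto)
      ultimately show "?d (scl c u + v) \<in> Q" using step idealD_add[OF Q] idealD_mult[OF Q] by simp
    qed
    from this[OF Suc.prems(2)[of k, OF lessI]] show ?case by simp
  qed
  from this[of m] show ?thesis by (auto simp: minors_in_def)
qed

text \<open>A row with all entries in \<open>Q\<close> puts the whole minor into \<open>Q\<close>,
  so generators need to be known only modulo \<open>Q\<close>.\<close>

lemma minors_in_add_ideal:
  assumes Q: "ideal_set Q" and S: "minors_in m X S Q"
  shows "minors_in m X (lspan (S \<union> {q. \<forall>x. q x \<in> Q})) Q"
proof (rule minors_in_span[OF Q])
  show "minors_in m X (S \<union> {q. \<forall>x. q x \<in> Q}) Q"
    unfolding minors_in_def
  proof (intro allI impI)
    fix y xs assume A: "(\<forall>i<m. y i \<in> S \<union> {q. \<forall>x. q x \<in> Q}) \<and> set xs \<subseteq> X \<and> length xs = m"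
    show "dt m (\<lambda>i j. y i (xs ! j)) \<in> Q"
    proof (cases "\<exists>k<m. \<forall>x. y k x \<in> Q")
      case True
      then show ?thesis using dt_row_in_ideal[OF Q, of _ m "\<lambda>i j. y i (xs ! j)"] by auto
    next
      case False
      then show ?thesis using A by (intro minors_inD[OF S]) auto
    qed
  qed
qed

text \<open>By the pigeonhole principle two of the \<open>m\<close> rows coincide, and the minor is
  0.\<close>

lemma minors_in_few_rows:
  assumes Q: "ideal_set Q" and T: "finite T" "card T < m"
  shows "minors_in m X T Q"
  unfolding minors_in_def
proof (intro allI impI)
  fix y xs assume A: "(\<forall>i<m. y i \<in> T) \<and> set xs \<subseteq> X \<and> length xs = m"
  have "\<not> inj_on y {..<m}"
    using T A card_inj_on_le[of y "{..<m}" T] by auto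
  then obtain i i' where "i < m" "i' < m" "i \<noteq> i'" "y i = y i'" by (auto simp: inj_on_def)
  then have "dt m (\<lambda>i j. y i (xs ! j)) = 0" by (intro dt_identical_rows[of i m i']) auto
  then show "dt m (\<lambda>i j. y i (xs ! j)) \<in> Q" using idealD0[OF Q] by simp
qed

text \<open>Multiplying row \<open>i\<close> by \<open>s i\<close> multiplies the minor by the
  product of the \<open>s i\<close>, which stays outside \<open>P\<close>; denominators can thus be
  cleared row by row.\<close>

lemma minors_in_locally:
  assumes Z: "ideal_set Z"
    and loc: "\<And>P. max_ideal P \<Longrightarrow> Z \<subseteq> P \<Longrightarrow> \<exists>S. minors_in m X S Z \<and> M \<subseteq> sat P S"
  shows "minors_in m X M Z"
  unfolding minors_in_def
proof (intro allI impI)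
  fix y xs assume A: "(\<forall>i<m. y i \<in> M) \<and> set xs \<subseteq> X \<and> length xs = m"
  show "dt m (\<lambda>i j. y i (xs ! j)) \<in> Z"
  proof (rule in_ideal_locally[OF Z])
    fix P assume P: "max_ideal P" "Z \<subseteq> P"
    obtain S where S: "minors_in m X S Z" "M \<subseteq> sat P S" using loc[OF P] by auto
    have "\<forall>i\<in>{..<m}. \<exists>s. s \<notin> P \<and> scl s (y i) \<in> S" using A S(2) by (auto simp: sat_def)
    then obtain s where s: "\<And>i. i < m \<Longrightarrow> s i \<notin> P \<and> scl (s i) (y i) \<in> S" by (metis lessThan_iff)
    have "dt m (\<lambda>i j. scl (s i) (y i) (xs ! j)) \<in> Z"
      by (rule minors_inD[OF S(1), of "\<lambda>i. scl (s i) (y i)"]) (use s A in blast)+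
    then have "(\<Prod>i<m. s i) * dt m (\<lambda>i j. y i (xs ! j)) \<in> Z" by (simp add: dt_scale_rows)
    moreover have "(\<Prod>i<m. s i) \<notin> P" using s by (intro max_ideal_prod[OF P(1)]) auto
    ultimately show "\<exists>s. s \<notin> P \<and> s * dt m (\<lambda>i j. y i (xs ! j)) \<in> Z" by blast
  qed
qed

text \<open>The minor of the relations \<open>f x - n\<^sub>x\<close> for \<open>x \<in> X - N\<close> together with one more relation \<open>c\<close>
  supported on \<open>N\<close> is triangular, with diagonal \<open>f, \<dots>, f, c v\<close>.\<close>

lemma minors_relation:
  fixes M :: "('x \<Rightarrow> 't::comm_ring_1) set"
  assumes X: "finite X" and N: "N \<subseteq> X" "card N = r"
    and f: "\<And>x. x \<in> X - N \<Longrightarrow> \<exists>n\<in>Fn N. scl f (ev x) - n \<in> M"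
    and mi: "minors_in (card X - r + 1) X M Z"
    and c: "c \<in> M" "c \<in> Fn N" and v: "v \<in> N"
  shows "f ^ (card X - r) * c v \<in> Z"
proof -
  let ?m = "card X - r"
  have fN: "finite N" using N X finite_subset by blast
  have cardXN: "card (X - N) = ?m" using N fN by (simp add: card_Diff_subset)
  obtain ws where ws: "set ws = X - N" "distinct ws" "length ws = ?m"
    using finite_distinct_list[of "X - N"] X cardXN distinct_card by (metis finite_Diff)
  obtain n where n: "\<And>x. x \<in> X - N \<Longrightarrow> n x \<in> Fn N \<and> scl f (ev x) - n x \<in> M"
    using f by metis
  define y where "y = (\<lambda>i. if i < ?m then scl f (ev (ws ! i)) - n (ws ! i) else c)"
  define xs where "xs = ws @ [v]"
  have wsi: "ws ! i \<in> X - N" if "i < ?m" for i using that ws by (metis nth_mem)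
  have "dt (?m + 1) (\<lambda>i j. y i (xs ! j)) \<in> Z"
  proof (rule minors_inD[OF mi])
    show "y i \<in> M" for i using wsi[of i] n c(1) by (auto simp: y_def)
    show "set xs \<subseteq> X" using ws(1) v N by (auto simp: xs_def)
    show "length xs = ?m + 1" using ws by (simp add: xs_def)
  qed
  moreover have "dt (?m + 1) (\<lambda>i j. y i (xs ! j)) = (\<Prod>i<?m + 1. y i (xs ! i))"
  proof (rule dt_upper_triangular)
    fix i j assume ij: "i < ?m + 1" "j < i"
    then have j: "j < ?m" by simp
    then have xj: "xs ! j = ws ! j" "ws ! j \<in> X - N" using ws wsi by (auto simp: xs_def nth_append)
    show "y i (xs ! j) = 0"
    proof (cases "i < ?m")
      case True
      then have "ws ! j \<noteq> ws ! i" using ws ij nth_eq_iff_index_eq[of ws j i] by auto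
      then show ?thesis using True xj n[OF wsi[OF True]] by (auto simp: y_def ev_def Fn_def)
    next
      case False
      then show ?thesis using xj c(2) by (auto simp: y_def Fn_def)
    qed
  qed
  moreover have "(\<Prod>i<?m. y i (xs ! i)) = f ^ ?m"
  proof -
    have "y i (xs ! i) = f" if i: "i < ?m" for i
      using i n[OF wsi[OF i]] wsi[OF i] ws by (auto simp: y_def xs_def nth_append ev_def Fn_def)
    then show ?thesis by simp
  qed
  moreover have "y ?m (xs ! ?m) = c v" using ws by (simp add: y_def xs_def nth_append)
  ultimately show ?thesis by simp
qed

subsection \<open>Locally free quotients\<close>

text \<open>An ideal \<open>Z\<close> and submodules containing \<open>Z\<^sup>X\<close> encode the ring \<open>'t / Z\<close> and its submodules of
  \<open>('t / Z)\<^sup>X\<close>.\<close>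

definition piece_module :: "'t::comm_ring_1 set \<Rightarrow> 'x set \<Rightarrow> ('x \<Rightarrow> 't) set \<Rightarrow> bool" where
  "piece_module Z X M \<longleftrightarrow> lsub M \<and> M \<subseteq> Fn X \<and> (\<forall>p\<in>Fn X. (\<forall>x. p x \<in> Z) \<longrightarrow> p \<in> M)"

text \<open>After inverting \<open>f\<close>, the classes of the positions in \<open>N\<close>
  generate \<open>Fn X\<close> modulo \<open>M\<close>.\<close>

definition spans_by :: "'t::comm_ring_1 \<Rightarrow> 'x set \<Rightarrow> ('x \<Rightarrow> 't) set \<Rightarrow> 'x set \<Rightarrow> bool" where
  "spans_by f X M N \<longleftrightarrow> (\<forall>x\<in>X. \<exists>n\<in>Fn N. scl f (ev x) - n \<in> M)"

text \<open>Freeness of \<open>T\<^sup>X / M\<close> of rank \<open>r\<close> near each maximal ideal, in terms of Fitting ideals: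
  the \<open>r\<close>-th one is the unit ideal, and the one before vanishes.\<close>

definition loc_free :: "'t::comm_ring_1 set \<Rightarrow> 'x set \<Rightarrow> ('x \<Rightarrow> 't) set \<Rightarrow> nat \<Rightarrow> bool" where
  "loc_free Z X M r \<longleftrightarrow>
    (\<forall>P. max_ideal P \<and> Z \<subseteq> P \<longrightarrow>
       (\<exists>N f. N \<subseteq> X \<and> card N = r \<and> f \<notin> P \<and> spans_by f X M N)) \<and>
    minors_in (card X - r + 1) X M Z"

lemma piece_moduleD:
  assumes "piece_module Z X M"
  shows "lsub M" "M \<subseteq> Fn X" "\<And>p. p \<in> Fn X \<Longrightarrow> (\<And>x. p x \<in> Z) \<Longrightarrow> p \<in> M"
  using assms by (auto simp: piece_module_def)

lemma spans_by_mono: "spans_by f X M N \<Longrightarrow> M \<subseteq> M' \<Longrightarrow> N \<subseteq> N' \<Longrightarrow> spans_by f X M' N'"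
  unfolding spans_by_def using Fn_mono by blast

lemma spans_by_mult:
  assumes "lsub M" "spans_by f X M N" shows "spans_by (g * f) X M N"
  unfolding spans_by_def
proof
  fix x assume "x \<in> X"
  then obtain n where n: "n \<in> Fn N" "scl f (ev x) - n \<in> M" using assms(2) by (auto simp: spans_by_def)
  have "scl (g * f) (ev x) - scl g n = scl g (scl f (ev x) - n)"
    by (simp add: fun_eq_iff algebra_simps)
  then have "scl (g * f) (ev x) - scl g n \<in> M"
    using fv.subspace_scale[OF assms(1) n(2)] by metis
  then show "\<exists>n\<in>Fn N. scl (g * f) (ev x) - n \<in> M"
    using fv.subspace_scale[OF subspace_Fn n(1)] by blast
qed

text \<open>The product of the finitely many denominators \<open>s x\<close> serves all
  \<open>x\<close> at once.\<close>

lemma spans_by_sat: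
  assumes P: "max_ideal P" and X: "finite X" and M: "lsub M"
    and "\<And>x. x \<in> X \<Longrightarrow> \<exists>s n. s \<notin> P \<and> n \<in> Fn N \<and> scl s (ev x) - n \<in> M"
  shows "\<exists>f. f \<notin> P \<and> spans_by f X M N"
proof -
  obtain s n where s: "\<And>x. x \<in> X \<Longrightarrow> s x \<notin> P \<and> n x \<in> Fn N \<and> scl (s x) (ev x) - n x \<in> M"
    using assms(4) by metis
  have "spans_by (\<Prod>x\<in>X. s x) X M N"
    unfolding spans_by_def
  proof
    fix x assume x: "x \<in> X"
    have "spans_by (s x) {x} M N" using s[OF x] by (auto simp: spans_by_def)
    then have "spans_by ((\<Prod>y\<in>X - {x}. s y) * s x) {x} M N" by (rule spans_by_mult[OF M])
    then show "\<exists>n\<in>Fn N. scl (\<Prod>x\<in>X. s x) (ev x) - n \<in> M"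
      using prod.remove[OF X x, of s] by (auto simp: spans_by_def mult.commute)
  qed
  moreover have "(\<Prod>x\<in>X. s x) \<notin> P" using s by (intro max_ideal_prod[OF P]) auto
  ultimately show ?thesis by blast
qed

text \<open>Macaulay's argument: dividing \<open>ev x\<close> by elements of \<open>M\<close> with
  leading positions in \<open>J\<close> leaves a remainder supported off \<open>J\<close>, so the
  standard positions generate the quotient near \<open>P\<close>.\<close>

lemma spans_by_leads:
  assumes P: "max_ideal P" and X: "finite X" and rk: "inj_on rk X"
    and M: "lsub M" "M \<subseteq> Fn X" and J: "J \<subseteq> leads P rk M"
  shows "\<exists>f. f \<notin> P \<and> spans_by f X M (X - J)"
proof (rule spans_by_sat[OF P X M(1)])
  have JX: "J \<subseteq> X" using J leads_subset[OF P M(2)] by blast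
  have "\<forall>w\<in>J. \<exists>p. p \<in> M \<and> lead P rk p w" using J by (auto simp: leads_def)
  then obtain t where t: "\<And>w. w \<in> J \<Longrightarrow> t w \<in> M \<and> lead P rk (t w) w" by metis
  fix x assume x: "x \<in> X"
  obtain s \<alpha> n where *: "s \<notin> P" "n \<in> Fn (X - J)" "scl s (ev x) = (\<Sum>w\<in>J. scl (\<alpha> w) (t w)) + n"
    by (rule decompose_triangular[OF P X rk JX, of t "ev x"]) (use t M(2) ev_in_Fn[OF x] in blast)+
  have "(\<Sum>w\<in>J. scl (\<alpha> w) (t w)) \<in> M"
    using t by (intro fv.subspace_sum[OF M(1)] fv.subspace_scale[OF M(1)]) auto
  then have "scl s (ev x) - n \<in> M" using *(3) by simp
  then show "\<exists>s n. s \<notin> P \<and> n \<in> Fn (X - J) \<and> scl s (ev x) - n \<in> M" using * by blast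
qed

text \<open>A coefficient outside \<open>P\<close> would produce a leading position of
  \<open>M\<close> in the support of \<open>c\<close>.\<close>

lemma notin_leads_coefficient:
  assumes P: "max_ideal P" and X: "finite X" and rk: "inj_on rk X"
    and M: "lsub M" "M \<subseteq> Fn X" and c: "c \<in> M" "c \<in> Fn (X - leads P rk M)"
  shows "c x \<in> P"
proof (rule ccontr)
  assume "c x \<notin> P"
  then obtain w where "w \<in> leads P rk M" "c w \<notin> P"
    using in_leadsI[OF P M(1) X rk c(1), of x] M(2) c(1) by blast
  then show False using c(2) idealD0[OF max_idealD(1)[OF P]] by (auto simp: Fn_def)
qed

text \<open>With fewer leading positions, \<open>M\<close> modulo \<open>P\<close> would be spanned
  by fewer than \<open>card X - card N\<close> vectors and all its minors of that size would lie in
  \<open>P\<close>. The relations that express the positions outside \<open>N\<close> through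
  \<open>N\<close> have a minor that is a power of \<open>f\<close>.\<close>

lemma card_leads_ge:
  assumes P: "max_ideal P" and X: "finite X" and rk: "inj_on rk X"
    and M: "lsub M" "M \<subseteq> Fn X" and N: "N \<subseteq> X" "f \<notin> P" "spans_by f X M N"
  shows "card X - card N \<le> card (leads P rk M)"
proof (rule ccontr)
  assume less: "\<not> ?thesis"
  have iP: "ideal_set P" using P by (rule max_idealD)
  define J where "J = leads P rk M"
  have JX: "J \<subseteq> X" unfolding J_def by (rule leads_subset[OF P M(2)])
  have "\<forall>w\<in>J. \<exists>p. p \<in> M \<and> lead P rk p w" by (auto simp: J_def leads_def)
  then obtain t where t: "\<And>w. w \<in> J \<Longrightarrow> t w \<in> M \<and> lead P rk (t w) w" by metis
  let ?m = "card X - card N"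
  let ?T = "lspan (t ` J \<union> {q. \<forall>x. q x \<in> P})"
  \<comment> \<open>Modulo \<open>P\<close> the lifts \<open>t w\<close> already span
    \<open>M\<close>: the remainder of a division lies in \<open>M\<close>, has no coefficient at a
    leading position, and therefore has all its coefficients in \<open>P\<close>.\<close>
  have "M \<subseteq> ?T"
  proof
    fix y assume y: "y \<in> M"
    obtain s \<alpha> n where *: "s \<notin> P" "n \<in> Fn (X - J)" "scl s y = (\<Sum>w\<in>J. scl (\<alpha> w) (t w)) + n"
      by (rule decompose_triangular[OF P X rk JX, of t y]) (use t M(2) y in blast)+
    have sum: "(\<Sum>w\<in>J. scl (\<alpha> w) (t w)) \<in> M" "(\<Sum>w\<in>J. scl (\<alpha> w) (t w)) \<in> ?T"
      using t by (intro fv.subspace_sum[OF M(1)] fv.subspace_scale[OF M(1)] fv.span_sum fv.span_scale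
        fv.span_base; auto)+
    have "scl s y - (\<Sum>w\<in>J. scl (\<alpha> w) (t w)) \<in> M"
      by (intro fv.subspace_diff[OF M(1)] fv.subspace_scale[OF M(1)] y sum)
    then have "n \<in> M" using *(3) by simp
    then have "n x \<in> P" for x
      using notin_leads_coefficient[OF P X rk M] *(2) by (auto simp: J_def)
    then have "n \<in> ?T" by (intro fv.span_base) auto
    then have sy: "scl s y \<in> ?T" unfolding *(3) by (rule fv.span_add[OF sum(2)])
    obtain b where b: "s * b - 1 \<in> P" using max_ideal_inverse[OF P *(1)] by auto
    have "scl (s * b - 1) y \<in> ?T" using idealD_mult2[OF iP b] by (intro fv.span_base) auto
    then have "scl b (scl s y) - scl (s * b - 1) y \<in> ?T"
      by (rule fv.span_diff[OF fv.span_scale[OF sy]])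
    moreover have "scl b (scl s y) - scl (s * b - 1) y = y" by (simp add: fun_eq_iff algebra_simps)
    ultimately show "y \<in> ?T" by (simp only:)
  qed
  moreover have "minors_in ?m X ?T P"
    using less finite_subset[OF JX X] card_image_le[of J t]
    by (intro minors_in_add_ideal[OF iP] minors_in_few_rows[OF iP]) (auto simp: J_def)
  ultimately have mi: "minors_in ?m X M P" by (rule minors_in_mono[rotated])
  obtain ws where ws: "set ws = X - N" "distinct ws"
    using finite_distinct_list[of "X - N"] X by auto
  have lws: "length ws = ?m"
    using distinct_card[OF ws(2)] ws(1) card_Diff_subset[OF finite_subset[OF N(1) X] N(1)] by simp
  have wsi: "ws ! i \<in> X - N" if "i < ?m" for i using nth_mem[of i ws] that ws(1) lws by simp
  have "\<forall>x\<in>X - N. \<exists>n. n \<in> Fn N \<and> scl f (ev x) - n \<in> M" using N(3) by (auto simp: spans_by_def)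
  then obtain n where n: "\<And>x. x \<in> X - N \<Longrightarrow> n x \<in> Fn N \<and> scl f (ev x) - n x \<in> M" by metis
  define y where "y = (\<lambda>i. scl f (ev (ws ! i)) - n (ws ! i))"
  \<comment> \<open>On the columns outside \<open>N\<close> these relations form \<open>f\<close>
    times the identity matrix.\<close>
  have yij: "y i (ws ! j) = (if j = i then f else 0)" if "i < ?m" "j < ?m" for i j
    using n[OF wsi[OF that(1)]] wsi[OF that(2)] nth_eq_iff_index_eq[OF ws(2), of j i] that lws
    by (auto simp: y_def ev_def Fn_def)
  have "dt ?m (\<lambda>i j. y i (ws ! j)) \<in> P"
  proof (rule minors_inD[OF mi])
    show "y i \<in> M" if "i < ?m" for i using n[OF wsi[OF that]] unfolding y_def by simp
  qed (use ws lws in auto)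
  moreover have "dt ?m (\<lambda>i j. y i (ws ! j)) = (\<Prod>i<?m. y i (ws ! i))"
    by (rule dt_upper_triangular) (simp add: yij)
  moreover have "\<dots> = f ^ ?m" by (simp add: yij)
  ultimately show False using max_ideal_power[OF P N(2)] by simp
qed

text \<open>The two Fitting conditions play opposite roles: local generation by \<open>r\<close>
  elements bounds the number of standard positions from above, the vanishing minors bound it from
  below. The minors also show that a relation among standard positions is trivial near
  \<open>P\<close>, so remainders of divisions vanish locally.\<close>

lemma loc_free_leads:
  assumes Z: "ideal_set Z" and P: "max_ideal P" "Z \<subseteq> P" and X: "finite X" and rk: "inj_on rk X"
    and M: "piece_module Z X M" and lf: "loc_free Z X M r"
  shows "card (X - leads P rk M) = r"
    and "c \<in> M \<Longrightarrow> c \<in> Fn (X - leads P rk M) \<Longrightarrow> \<exists>s. s \<notin> P \<and> (\<forall>x. s * c x \<in> Z)"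
proof -
  note M' = piece_moduleD(1,2)[OF M]
  define J where "J = leads P rk M"
  have JX: "J \<subseteq> X" unfolding J_def by (rule leads_subset[OF P(1) M'(2)])
  have iP: "ideal_set P" using P(1) by (rule max_idealD)
  obtain N0 f0 where N0: "N0 \<subseteq> X" "card N0 = r" "f0 \<notin> P" "spans_by f0 X M N0"
    using lf P by (auto simp: loc_free_def)
  have rX: "r \<le> card X" using N0 X card_mono by metis
  have mi: "minors_in (card X - r + 1) X M Z" using lf by (simp add: loc_free_def)
  obtain f where f: "f \<notin> P" "spans_by f X M (X - J)"
    using spans_by_leads[OF P(1) X rk M'] by (auto simp: J_def)
  have "card (X - J) \<le> r"
    using card_leads_ge[OF P(1) X rk M' N0(1,3,4)] N0(2) JX X rX
    by (simp add: card_Diff_subset finite_subset J_def)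
  \<comment> \<open>If fewer than \<open>r\<close> positions were standard, they could be padded to
    a set \<open>N'\<close> of size \<open>r\<close>. The relation expressing an added position
    \<open>x\<close> has coefficient \<open>f\<close> at \<open>x\<close>, and
    \<open>minors_relation\<close> would put a power of \<open>f\<close> into
    \<open>P\<close>.\<close>
  moreover have "r \<le> card (X - J)"
  proof (rule ccontr)
    assume less: "\<not> r \<le> card (X - J)"
    then obtain N' where N': "X - J \<subseteq> N'" "N' \<subseteq> X" "card N' = r"
      using exists_subset_between[of "X - J" r X] rX X by auto
    have "N' \<noteq> X - J" using less N'(3) by auto
    then obtain x where x: "x \<in> N'" "x \<notin> X - J" using N'(1) by auto
    then obtain n where n: "n \<in> Fn (X - J)" "scl f (ev x) - n \<in> M"
      using f(2) N'(2) by (auto simp: spans_by_def)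
    have "f ^ (card X - r) * (scl f (ev x) - n) x \<in> Z"
    proof (rule minors_relation[OF X N'(2,3) _ mi n(2) _ x(1)])
      show "\<exists>n\<in>Fn N'. scl f (ev x) - n \<in> M" if "x \<in> X - N'" for x
        using f(2) that Fn_mono[OF N'(1)] unfolding spans_by_def by blast
      show "scl f (ev x) - n \<in> Fn N'"
        using Fn_mono[OF N'(1)] n(1) ev_in_Fn[OF x(1)]
        by (blast intro: fv.subspace_diff[OF subspace_Fn] fv.subspace_scale[OF subspace_Fn])
    qed
    moreover have "(scl f (ev x) - n) x = f" using n(1) x(2) by (simp add: ev_def Fn_def)
    ultimately have "f ^ (card X - r) * f \<in> P" using P(2) by auto
    then show False using max_ideal_power[OF P(1) f(1), of "Suc (card X - r)"] by (simp add: mult.commute)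
  qed
  ultimately show eq: "card (X - leads P rk M) = r" by (simp add: J_def)
  assume c: "c \<in> M" "c \<in> Fn (X - leads P rk M)"
  have "f ^ (card X - r) * c x \<in> Z" for x
  proof (cases "x \<in> X - J")
    case True
    show ?thesis
    proof (rule minors_relation[OF X _ _ _ mi c(1) _ True])
      show "card (X - J) = r" using eq by (simp add: J_def)
      show "\<exists>n\<in>Fn (X - J). scl f (ev y) - n \<in> M" if "y \<in> X - (X - J)" for y
        using f(2) that unfolding spans_by_def by blast
      show "c \<in> Fn (X - J)" using c(2) by (simp add: J_def)
    qed auto
  next
    case False
    then show ?thesis using c(2) idealD0[OF Z] by (auto simp: J_def Fn_def)
  qed
  then show "\<exists>s. s \<notin> P \<and> (\<forall>x. s * c x \<in> Z)" using max_ideal_power[OF P(1) f(1), of "card X - r"] by blast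
qed

section \<open>Exponent vectors\<close>

text \<open>Some subsequence is monotone, and a decreasing sequence of natural numbers is constant
  from the place of its minimum on.\<close>

lemma nondecreasing_subsequence:
  fixes s :: "nat \<Rightarrow> nat"
  shows "\<exists>g :: nat \<Rightarrow> nat. strict_mono g \<and> mono (s \<circ> g)"
proof -
  obtain h where h: "strict_mono h" "monoseq (s \<circ> h)"
    using seq_monosub[of s] by (auto simp: o_def)
  from h(2) consider "mono (s \<circ> h)" | "decseq (s \<circ> h)" by (auto simp: monoseq_iff)
  then show ?thesis
  proof cases
    case 2
    define N where "N = (ARG_MIN (s \<circ> h) n. True)"
    have N: "(s \<circ> h) N \<le> (s \<circ> h) n" for n
      unfolding N_def by (rule arg_min_nat_le) simp
    have "(s \<circ> h) (n + N) = (s \<circ> h) N" for n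
      using N[of "n + N"] decseqD[OF 2, of N "n + N"] by simp
    then have "mono (s \<circ> (\<lambda>n. h (n + N)))" by (auto simp: mono_def)
    moreover have "strict_mono (\<lambda>n. h (n + N))"
      using h(1) by (auto simp: strict_mono_def)
    ultimately show ?thesis by blast
  next
    case 1
    then show ?thesis using h(1) by blast
  qed
qed

text \<open>Dickson's lemma: an injective sequence in \<open>A\<close> is thinned out once for each
  variable, until every coordinate is nondecreasing.\<close>

lemma infinite_exponents_comparable:
  assumes "infinite (A :: ('n::finite \<Rightarrow> nat) set)"
  shows "\<exists>u\<in>A. \<exists>v\<in>A. u \<noteq> v \<and> u \<le> v"
proof -
  obtain f :: "nat \<Rightarrow> 'n \<Rightarrow> nat" where f: "inj f" "range f \<subseteq> A"
    using infinite_countable_subset[OF assms] by auto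
  have "finite I \<Longrightarrow> \<exists>g :: nat \<Rightarrow> nat. strict_mono g \<and> (\<forall>i\<in>I. mono (\<lambda>n. f (g n) i))" for I :: "'n set"
  proof (induction I rule: finite_induct)
    case empty
    show ?case by (auto intro: exI[of _ id] simp: strict_mono_def)
  next
    case (insert i I)
    then obtain g :: "nat \<Rightarrow> nat" where g: "strict_mono g" "\<And>j. j \<in> I \<Longrightarrow> mono (\<lambda>n. f (g n) j)" by auto
    obtain h :: "nat \<Rightarrow> nat" where h: "strict_mono h" "mono ((\<lambda>n. f (g n) i) \<circ> h)"
      using nondecreasing_subsequence by metis
    have "mono (\<lambda>n. f (g (h n)) j)" if "j \<in> insert i I" for j
    proof (cases "j = i")
      case True
      then show ?thesis using h(2) by (simp add: o_def)
    next
      case False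
      then have "mono (\<lambda>n. f (g n) j)" using that g(2) by simp
      then show ?thesis using strict_mono_mono[OF h(1)] unfolding mono_def by blast
    qed
    moreover have "strict_mono (\<lambda>n. g (h n))" using g(1) h(1) by (auto simp: strict_mono_def)
    ultimately show ?case by blast
  qed
  from this[of UNIV] obtain g :: "nat \<Rightarrow> nat" where g: "strict_mono g" "\<And>i. mono (\<lambda>n. f (g n) i)" by auto
  have "f (g 0) \<le> f (g 1)" using g(2) by (auto simp: le_fun_def mono_def)
  moreover have "g 0 \<noteq> g 1" using strict_monoD[OF g(1), of 0 1] by simp
  then have "f (g 0) \<noteq> f (g 1)" using f(1) by (auto dest: injD)
  ultimately show ?thesis using subsetD[OF f(2)] by (meson rangeI)
qed

lemma le_add_diff_exponent: "u \<le> v \<Longrightarrow> u + (v - u) = (v :: 'n \<Rightarrow> nat)"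
  by (auto simp: le_fun_def fun_eq_iff)

lemma exponent_le_iff: "u \<le> v \<longleftrightarrow> (\<exists>w. v = u + (w :: 'n \<Rightarrow> nat))"
  using le_add_diff_exponent[of u v] by (auto simp: le_fun_def intro: exI[of _ "v - u"] dest: sym)

lemma finite_exponents_le: "finite {u. u \<le> (w :: 'n::finite \<Rightarrow> nat)}"
proof -
  have "{u. u \<le> w} = (\<Pi>\<^sub>E i\<in>UNIV. {..w i})" by (simp add: set_eq_iff PiE_iff le_fun_def)
  then show ?thesis using finite_PiE[of UNIV "\<lambda>i. {..w i}"] by simp
qed

lemma positive_grading_add: "positive_grading deg \<Longrightarrow> deg (u + v) = deg u + deg v"
  by (simp add: positive_grading_def grading_def)

text \<open>By Dickson's lemma infinitely many monomials of one degree would include distinct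
  \<open>u \<le> v\<close>; then \<open>v - u\<close> is nonzero of degree 0, against
  positivity.\<close>

lemma finite_monomials:
  fixes deg :: "('n::finite \<Rightarrow> nat) \<Rightarrow> 'a::ab_group_add"
  assumes "positive_grading deg"
  shows "finite (monomials deg a)"
proof (rule ccontr)
  assume "infinite (monomials deg a)"
  from infinite_exponents_comparable[OF this]
  obtain u v where uv: "deg u = a" "deg v = a" "u \<noteq> v" "u \<le> v"
    unfolding monomials_def by blast
  have "deg v = deg u + deg (v - u)"
    using positive_grading_add[OF assms, of u "v - u"] le_add_diff_exponent[OF uv(4)] by simp
  then have "deg (v - u) = 0" using uv by simp
  then have "v - u = 0" using assms unfolding positive_grading_def by blast
  then show False using le_add_diff_exponent[OF uv(4)] uv(3) by simp
qed

text \<open>A monomial order: the polynomial with coefficients \<open>u i\<close> is compared by leading coefficients.\<close>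

lemma exists_term_order:
  "\<exists>rk :: ('n::finite \<Rightarrow> nat) \<Rightarrow> int poly. inj rk \<and> (\<forall>u v. rk (u + v) = rk u + rk v)"
proof -
  obtain idx :: "'n \<Rightarrow> nat" where idx: "inj idx"
    using finite_imp_inj_to_nat_seg[of "UNIV :: 'n set"] by auto
  define rk :: "('n \<Rightarrow> nat) \<Rightarrow> int poly" where "rk u = (\<Sum>i\<in>UNIV. monom (int (u i)) (idx i))" for u
  have "coeff (rk u) (idx i) = int (u i)" for u i
  proof -
    have "coeff (rk u) (idx i) = (\<Sum>j\<in>UNIV. if j = i then int (u j) else 0)"
      unfolding rk_def coeff_sum by (rule sum.cong) (use idx in \<open>auto dest: injD\<close>)
    then show ?thesis by simp
  qed
  then have c: "u i = nat (coeff (rk u) (idx i))" for u i by simp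
  have "inj rk"
  proof (rule injI, rule ext)
    show "u i = v i" if "rk u = rk v" for u v i
      using c[of u i] c[of v i] that by simp
  qed
  moreover have "rk (u + v) = rk u + rk v" for u v
    by (simp add: rk_def sum.distrib flip: add_monom)
  ultimately show ?thesis by blast
qed

text \<open>Multiplication by the monomial with exponent \<open>u\<close>, on coefficient
  functions.\<close>

definition shift :: "('n \<Rightarrow> nat) \<Rightarrow> (('n \<Rightarrow> nat) \<Rightarrow> 't::comm_ring_1) \<Rightarrow> ('n \<Rightarrow> nat) \<Rightarrow> 't" where
  "shift u p = (\<lambda>w. if u \<le> w then p (w - u) else 0)"

lemma shift_apply_add [simp]: "shift u p (u + w) = p w"
  by (auto simp: shift_def le_fun_def)

lemma shift_zero_exponent [simp]: "shift 0 p = p"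
  by (auto simp: shift_def le_fun_def fun_eq_iff)

lemma shift_shift: "shift u (shift v p) = shift (u + v) p"
proof
  fix w
  have "u \<le> w \<and> v \<le> w - u \<longleftrightarrow> u + v \<le> w"
    by (auto simp: le_fun_def) (metis add.commute add_leD1 le_diff_conv2 le_add_diff_inverse)+
  then show "shift u (shift v p) w = shift (u + v) p w"
    by (auto simp: shift_def fun_eq_iff diff_diff_eq)
qed

lemma shift_add: "shift u (p + q) = shift u p + shift u q"
  and shift_diff: "shift u (p - q) = shift u p - shift u q"
  and shift_scl: "shift u (scl c p) = scl c (shift u p)"
  and shift_0: "shift u 0 = 0"
  by (auto simp: shift_def fun_eq_iff)

lemma shift_sum: "shift u (\<Sum>i\<in>A. f i) = (\<Sum>i\<in>A. shift u (f i))"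
  by (simp add: shift_def fun_eq_iff sum_apply)

lemma shift_ev: "shift u (ev x) = ev (u + x)"
  unfolding shift_def ev_def
  by (auto simp: fun_eq_iff exponent_le_iff)

lemma shift_coeff_in: "ideal_set Q \<Longrightarrow> (\<And>x. p x \<in> Q) \<Longrightarrow> shift u p x \<in> Q"
  using idealD0 by (auto simp: shift_def)

lemma shift_in_Fn:
  assumes "\<And>u v. deg (u + v) = deg u + deg v" and "p \<in> Fn (monomials deg a)"
  shows "shift u p \<in> Fn (monomials deg (deg u + a))"
proof (rule FnI)
  fix w assume "w \<notin> monomials deg (deg u + a)"
  then have "u \<le> w \<Longrightarrow> w - u \<notin> monomials deg a"
    using assms(1)[of u "w - u"] le_add_diff_exponent[of u w] by (auto simp: monomials_def)
  then show "shift u p w = 0" using assms(2) by (auto simp: shift_def Fn_def)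
qed

text \<open>A coefficient of \<open>shift u p\<close> above \<open>u + w\<close> is either 0 or a
  coefficient of \<open>p\<close> above \<open>w\<close>, because \<open>rk\<close> is
  additive.\<close>

lemma lead_shift:
  fixes rk :: "('n \<Rightarrow> nat) \<Rightarrow> 'o::linordered_ab_group_add"
  assumes P: "ideal_set P" and rk: "\<And>u v. rk (u + v) = rk u + rk v" and p: "lead P rk p w"
  shows "lead P rk (shift u p) (u + w)"
  unfolding lead_def
proof (intro conjI allI impI)
  show "shift u p (u + w) - 1 \<in> P" using p by (simp only: lead_def shift_apply_add)
  fix x assume x: "rk (u + w) < rk x"
  show "shift u p x \<in> P"
  proof (cases "u \<le> x")
    case True
    have "rk x = rk u + rk (x - u)"
      using rk[of u "x - u"] by (simp only: le_add_diff_exponent[OF True])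
    from ord_eq_less_trans[OF rk[of u w, symmetric] ord_less_eq_trans[OF x this]]
    have "rk w < rk (x - u)" by (rule add_less_imp_less_left)
    then have "p (x - u) \<in> P" using p unfolding lead_def by blast
    then show ?thesis using True unfolding shift_def by simp
  next
    case False
    then show ?thesis using idealD0[OF P] unfolding shift_def by simp
  qed
qed

section \<open>Monomial ideals as up-closed sets of exponents\<close>

text \<open>These are the exponent sets of monomial ideals. In this form the four conditions on
  \<open>D\<close> mention no coefficient ring, so they can be applied to leading monomials modulo
  any maximal ideal.\<close>

definition up_closed :: "('n \<Rightarrow> nat) set \<Rightarrow> bool" where
  "up_closed J \<longleftrightarrow> (\<forall>u\<in>J. \<forall>v. u \<le> v \<longrightarrow> v \<in> J)"

definition standard_count :: "(('n \<Rightarrow> nat) \<Rightarrow> 'a) \<Rightarrow> ('n \<Rightarrow> nat) set \<Rightarrow> 'a \<Rightarrow> nat" where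
  "standard_count deg J a = card (monomials deg a - J)"

definition minimal_exponents :: "('n \<Rightarrow> nat) set \<Rightarrow> ('n \<Rightarrow> nat) set" where
  "minimal_exponents J = {u \<in> J. \<forall>v. v < u \<longrightarrow> v \<notin> J}"

definition exponents_generated :: "(('n \<Rightarrow> nat) \<Rightarrow> 'a) \<Rightarrow> 'a set \<Rightarrow> ('n \<Rightarrow> nat) set \<Rightarrow> bool" where
  "exponents_generated deg D J \<longleftrightarrow> (\<forall>w\<in>J. \<exists>v\<in>J. v \<le> w \<and> deg v \<in> D)"

definition exponents_g :: "(('n \<Rightarrow> nat) \<Rightarrow> 'a) \<Rightarrow> ('a \<Rightarrow> nat) \<Rightarrow> 'a set \<Rightarrow> bool" where
  "exponents_g deg h D \<longleftrightarrow>
    (\<forall>J. up_closed J \<and> standard_count deg J = h \<longrightarrow> exponents_generated deg D J)"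

definition exponents_h :: "(('n \<Rightarrow> nat) \<Rightarrow> 'a) \<Rightarrow> ('a \<Rightarrow> nat) \<Rightarrow> 'a set \<Rightarrow> bool" where
  "exponents_h deg h D \<longleftrightarrow>
    (\<forall>J. up_closed J \<and> exponents_generated deg D J \<and> (\<forall>a\<in>D. standard_count deg J a = h a)
       \<longrightarrow> (\<forall>a. standard_count deg J a = h a))"

definition exponents_h' :: "(('n \<Rightarrow> nat) \<Rightarrow> 'a) \<Rightarrow> ('a \<Rightarrow> nat) \<Rightarrow> 'a set \<Rightarrow> bool" where
  "exponents_h' deg h D \<longleftrightarrow>
    (\<forall>J. up_closed J \<and> exponents_generated deg D J \<and> (\<forall>a\<in>D. standard_count deg J a = h a)
       \<longrightarrow> (\<forall>a. standard_count deg J a \<le> h a))"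

definition lcm_relation ::
  "(('n \<Rightarrow> nat) \<Rightarrow> 'a) \<Rightarrow> 'a set \<Rightarrow> ('n \<Rightarrow> nat) set \<Rightarrow> ('n \<Rightarrow> nat) \<Rightarrow> (('n \<Rightarrow> nat) \<times> ('n \<Rightarrow> nat)) set" where
  "lcm_relation deg D G w = {(x, y). x \<in> G \<and> y \<in> G \<and> x \<le> w \<and> y \<le> w \<and> deg (sup x y) \<in> D}"

text \<open>In multidegree \<open>w\<close>, the syzygies are generated by those of lcm-degree in \<open>D\<close> iff the graph of
  \<^const>\<open>lcm_relation\<close> on the generators dividing \<open>x\<^sup>w\<close> is connected.\<close>

definition exponents_s :: "(('n \<Rightarrow> nat) \<Rightarrow> 'a) \<Rightarrow> ('a \<Rightarrow> nat) \<Rightarrow> 'a set \<Rightarrow> bool" where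
  "exponents_s deg h D \<longleftrightarrow>
    (\<forall>J. up_closed J \<and> finite (minimal_exponents J) \<and> standard_count deg J = h \<longrightarrow>
      (\<forall>w. \<forall>u\<in>minimal_exponents J. \<forall>v\<in>minimal_exponents J. u \<le> w \<and> v \<le> w \<longrightarrow>
         (u, v) \<in> (lcm_relation deg D (minimal_exponents J) w)\<^sup>*))"

lemma minimal_exponent_below:
  assumes "w \<in> (J :: ('n::finite \<Rightarrow> nat) set)"
  shows "\<exists>u\<in>minimal_exponents J. u \<le> w"
proof -
  have "finite {v \<in> J. v \<le> w}" using finite_exponents_le[of w] by (rule rev_finite_subset) auto
  moreover have "w \<in> {v \<in> J. v \<le> w}" using assms by simp
  ultimately obtain u where u: "u \<in> {v \<in> J. v \<le> w}" "\<And>v. v \<in> {v \<in> J. v \<le> w} \<Longrightarrow> v \<le> u \<Longrightarrow> u = v"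
    using finite_has_minimal2[of "{v \<in> J. v \<le> w}" w] by blast
  have "v \<notin> J" if "v < u" for v
  proof
    assume "v \<in> J"
    moreover have "v \<le> w" using that u(1) by (auto intro: order.trans[OF less_imp_le])
    ultimately show False using u(2)[of v] less_imp_le[OF that] that by blast
  qed
  then show ?thesis using u(1) unfolding minimal_exponents_def by blast
qed

section \<open>Families of submodules generated in finitely many degrees\<close>

locale graded =
  fixes deg :: "('n::finite \<Rightarrow> nat) \<Rightarrow> 'a::ab_group_add"
    and Z :: "'t::comm_ring_1 set"
    and h :: "'a \<Rightarrow> nat"
  assumes pos: "positive_grading deg"
    and Z: "ideal_set Z"
begin

abbreviation X :: "'a \<Rightarrow> ('n \<Rightarrow> nat) set" where "X \<equiv> monomials deg"

lemma finX: "finite (X a)" by (rule finite_monomials[OF pos])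

lemma deg_add: "deg (u + v) = deg u + deg v" by (rule positive_grading_add[OF pos])

lemma inX [simp]: "u \<in> X a \<longleftrightarrow> deg u = a" by (simp add: monomials_def)

lemma deg_diff: "u \<le> w \<Longrightarrow> deg (w - u) + deg u = deg w"
  using deg_add[of "w - u" u] le_add_diff_exponent[of u w] by (simp add: add.commute)

definition Zpart :: "'a \<Rightarrow> (('n \<Rightarrow> nat) \<Rightarrow> 't) set" where
  "Zpart a = {p \<in> Fn (X a). \<forall>x. p x \<in> Z}"

definition shifts :: "'a set \<Rightarrow> ('a \<Rightarrow> (('n \<Rightarrow> nat) \<Rightarrow> 't) set) \<Rightarrow> 'a \<Rightarrow> (('n \<Rightarrow> nat) \<Rightarrow> 't) set" where
  "shifts D M a = {shift u p | u d p. d \<in> D \<and> p \<in> M d \<and> deg u + d = a}"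

text \<open>The part of degree \<open>a\<close> of the ideal generated by the pieces
  \<open>M d\<close> with \<open>d \<in> D\<close>; \<open>Zpart a\<close> consists of the vectors
  that vanish over \<open>T / Z\<close>.\<close>

definition gpiece :: "'a set \<Rightarrow> ('a \<Rightarrow> (('n \<Rightarrow> nat) \<Rightarrow> 't) set) \<Rightarrow> 'a \<Rightarrow> (('n \<Rightarrow> nat) \<Rightarrow> 't) set" where
  "gpiece D M a = lspan (shifts D M a \<union> Zpart a)"

lemma shift_Fn: "p \<in> Fn (X a) \<Longrightarrow> deg u + a = b \<Longrightarrow> shift u p \<in> Fn (X b)"
  using shift_in_Fn[of deg p a u] deg_add by auto

lemma shift_Zpart: "p \<in> Zpart a \<Longrightarrow> deg u + a = b \<Longrightarrow> shift u p \<in> Zpart b"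
  unfolding Zpart_def using shift_Fn shift_coeff_in[OF Z] by blast

lemma subspace_gpiece: "lsub (gpiece D M a)" by (simp add: gpiece_def)

lemma shifts_gpiece: "d \<in> D \<Longrightarrow> p \<in> M d \<Longrightarrow> deg u + d = a \<Longrightarrow> shift u p \<in> gpiece D M a"
  unfolding gpiece_def shifts_def by (rule fv.span_base) blast

lemma Zpart_gpiece: "Zpart a \<subseteq> gpiece D M a"
  unfolding gpiece_def using fv.span_superset by blast

lemma deg_zero: "deg 0 = 0"
  using deg_add[of 0 0] by simp

lemma gpiece_base: "d \<in> D \<Longrightarrow> M d \<subseteq> gpiece D M d"
  using shifts_gpiece[of d D _ M 0 d] deg_zero by auto

lemma piece_module_gpiece:
  assumes "\<And>d. d \<in> D \<Longrightarrow> M d \<subseteq> Fn (X d)"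
  shows "piece_module Z (X a) (gpiece D M a)"
proof -
  have "shifts D M a \<union> Zpart a \<subseteq> Fn (X a)"
    using shift_Fn assms unfolding shifts_def Zpart_def by blast
  then have "gpiece D M a \<subseteq> Fn (X a)"
    unfolding gpiece_def by (rule fv.span_minimal[OF _ subspace_Fn])
  moreover have "p \<in> gpiece D M a" if "p \<in> Fn (X a)" "\<forall>x. p x \<in> Z" for p
    using subsetD[OF Zpart_gpiece, of p a D M] that unfolding Zpart_def by blast
  ultimately show ?thesis using subspace_gpiece unfolding piece_module_def by blast
qed

lemma subspace_shift_vimage: "lsub S \<Longrightarrow> lsub {p. shift u p \<in> S}"
  using fv.subspace_0 fv.subspace_add fv.subspace_scale
  by (intro fv.subspaceI) (simp_all add: shift_add shift_scl shift_0)

lemma gpiece_shift: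
  assumes "p \<in> gpiece D M a" "deg u + a = b"
  shows "shift u p \<in> gpiece D M b"
proof -
  have "shifts D M a \<union> Zpart a \<subseteq> {p. shift u p \<in> gpiece D M b}"
  proof
    fix q assume "q \<in> shifts D M a \<union> Zpart a"
    then show "q \<in> {p. shift u p \<in> gpiece D M b}"
    proof
      assume "q \<in> shifts D M a"
      then obtain v d r where q: "q = shift v r" "d \<in> D" "r \<in> M d" "deg v + d = a"
        unfolding shifts_def by blast
      have "deg (u + v) + d = b" using q(4) assms(2) by (simp add: deg_add add.assoc)
      then show ?thesis using shifts_gpiece[of d D r M "u + v" b] q by (simp add: shift_shift)
    next
      assume "q \<in> Zpart a"
      then show ?thesis using shift_Zpart[of q a u b] assms(2) Zpart_gpiece by blast
    qed
  qed
  then have "gpiece D M a \<subseteq> {p. shift u p \<in> gpiece D M b}"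
    unfolding gpiece_def[of D M a]
    by (rule fv.span_minimal[OF _ subspace_shift_vimage[OF subspace_gpiece]])
  then show ?thesis using assms(1) by blast
qed

text \<open>If the family is stable under multiplication between degrees of \<open>D\<close>,
  generating an ideal adds nothing in those degrees. This makes the ideal restrict to the given
  Grassmann point.\<close>

lemma gpiece_closed:
  assumes "d \<in> D" "piece_module Z (X d) (M d)"
    and "\<And>a u p. a \<in> D \<Longrightarrow> p \<in> M a \<Longrightarrow> deg u + a = d \<Longrightarrow> shift u p \<in> M d"
  shows "gpiece D M d = M d"
proof
  have "shifts D M d \<union> Zpart d \<subseteq> M d"
    using assms(3) piece_moduleD(3)[OF assms(2)] unfolding shifts_def Zpart_def by blast
  then show "gpiece D M d \<subseteq> M d"
    unfolding gpiece_def by (rule fv.span_minimal[OF _ piece_moduleD(1)[OF assms(2)]])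
qed (rule gpiece_base[where M = M, OF assms(1)])

lemma killed_Zpart: "n \<in> Fn (X a) \<Longrightarrow> \<forall>x. s * n x \<in> Z \<Longrightarrow> scl s n \<in> Zpart a"
  unfolding Zpart_def using fv.subspace_scale[OF subspace_Fn] by auto

end

subsection \<open>Uniqueness\<close>

locale graded_at = graded deg Z h
  for deg :: "('n::finite \<Rightarrow> nat) \<Rightarrow> 'a::ab_group_add" and Z :: "'t::comm_ring_1 set" and h +
  fixes P :: "'t set" and rk :: "('n \<Rightarrow> nat) \<Rightarrow> int poly"
  assumes P: "max_ideal P" and ZP: "Z \<subseteq> P"
    and rk_inj: "inj rk" and rk_add: "\<And>u v. rk (u + v) = rk u + rk v"
begin

lemma rkX: "inj_on rk (X a)" using rk_inj by (rule inj_on_subset) simp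

lemma iP: "ideal_set P" by (rule max_idealD[OF P])

lemmas lead_shift' = lead_shift[OF iP, of rk, OF rk_add]

lemma leads_shift:
  assumes "w \<in> leads P rk (M a)" "\<And>p. p \<in> M a \<Longrightarrow> shift u p \<in> M b"
  shows "u + w \<in> leads P rk (M b)"
  using assms lead_shift' unfolding leads_def by blast

text \<open>The element \<open>z\<close> of \<open>M\<close> is divided by leading terms \<open>t w\<close>; the remainder is \<open>0\<close> locally.\<close>

lemma divide_locally:
  assumes M: "piece_module Z (X a) M" and lf: "loc_free Z (X a) M (h a)"
    and t: "\<And>w. w \<in> leads P rk M \<Longrightarrow> t w \<in> M \<and> lead P rk (t w) w"
    and z: "z \<in> M"
  shows "\<exists>s \<alpha> n. s \<notin> P \<and> n \<in> Zpart a \<and>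
    scl s z = (\<Sum>w\<in>leads P rk M. scl (\<alpha> w) (t w)) + n \<and>
    (\<forall>m. (\<forall>x\<in>X a. rk m \<le> rk x \<longrightarrow> z x \<in> P) \<longrightarrow> (\<forall>w\<in>leads P rk M. rk m \<le> rk w \<longrightarrow> \<alpha> w \<in> P))"
proof -
  note M' = piece_moduleD(1,2)[OF M]
  let ?L = "leads P rk M"
  have LX: "?L \<subseteq> X a" by (rule leads_subset[OF P M'(2)])
  have tF: "t w \<in> Fn (X a)" "lead P rk (t w) w" if "w \<in> ?L" for w
    using t[OF that] M'(2) by auto
  obtain s \<alpha> n where d: "s \<notin> P" "n \<in> Fn (X a - ?L)" "scl s z = (\<Sum>w\<in>?L. scl (\<alpha> w) (t w)) + n"
    by (rule decompose_triangular[OF P finX rkX LX tF]) (use z M'(2) in blast)+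
  have "scl s z - (\<Sum>w\<in>?L. scl (\<alpha> w) (t w)) \<in> M"
    by (intro fv.subspace_diff[OF M'(1)] fv.subspace_sum[OF M'(1)] fv.subspace_scale[OF M'(1)] z)
      (use t in blast)
  then have nM: "n \<in> M" using d(3) by simp
  obtain s' where s': "s' \<notin> P" "\<forall>x. s' * n x \<in> Z"
    using loc_free_leads(2)[OF Z P ZP finX rkX M lf nM d(2)] by blast
  show ?thesis
  proof (rule exI[of _ "s' * s"], rule exI[of _ "\<lambda>w. s' * \<alpha> w"], rule exI[of _ "scl s' n"],
      intro conjI allI impI ballI)
    show "s' * s \<notin> P" by (rule max_ideal_prime[OF P s'(1) d(1)])
    show "scl s' n \<in> Zpart a"
      using killed_Zpart[OF _ s'(2)] M'(2) nM by blast
    show "scl (s' * s) z = (\<Sum>w\<in>?L. scl (s' * \<alpha> w) (t w)) + scl s' n"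
    proof -
      have "scl (s' * s) z = scl s' (scl s z)" by simp
      also have "\<dots> = (\<Sum>w\<in>?L. scl s' (scl (\<alpha> w) (t w))) + scl s' n"
        unfolding d(3) by (simp only: fv.scale_right_distrib fv.scale_sum_right)
      finally show ?thesis by simp
    qed
    show "s' * \<alpha> w \<in> P" if small: "\<forall>x\<in>X a. rk m \<le> rk x \<longrightarrow> z x \<in> P"
      and w: "w \<in> ?L" "rk m \<le> rk w" for m w
    proof -
      have "(scl s z) x \<in> P" if "x \<in> X a" "rk m \<le> rk x" for x
        using idealD_mult[OF iP, of "z x" s] small that by simp
      then have "\<alpha> w \<in> P"
        by (intro triangular_coefficients[where rk = rk and t = t and \<alpha> = \<alpha> and m = m,
              OF P finX rkX LX _ d(2,3) _ w]) (use tF(2) in blast)+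
      then show ?thesis by (rule idealD_mult[OF iP])
    qed
  qed
qed

text \<open>The leading monomials of all pieces form a monomial ideal with Hilbert function
  \<open>h\<close>. By (g) each of them is a multiple of one whose degree is in \<open>D\<close>,
  hence is also the leading monomial of an element of \<open>gpiece D I a\<close>. Dividing
  \<open>y\<close> by such elements leaves a remainder in \<open>Zpart a\<close>.\<close>

lemma piece_locally_generated:
  assumes I: "\<And>a. piece_module Z (X a) (I a)" "\<And>a. loc_free Z (X a) (I a) (h a)"
    and sh: "\<And>u p a. p \<in> I a \<Longrightarrow> shift u p \<in> I (deg u + a)"
    and g: "exponents_g deg h D" and y: "y \<in> I a"
  shows "\<exists>s. s \<notin> P \<and> scl s y \<in> gpiece D I a"
proof -
  define J where "J = {w. w \<in> leads P rk (I (deg w))}"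
  have leads_deg: "deg w = b" if "w \<in> leads P rk (I b)" for w b
    using subsetD[OF leads_subset[OF P piece_moduleD(2)[OF I(1)[of b]], of rk] that] by simp
  have JX: "X b - J = X b - leads P rk (I b)" for b by (auto simp: J_def)
  have "up_closed J"
    unfolding up_closed_def
  proof (intro ballI allI impI)
    fix u v assume u: "u \<in> J" "u \<le> v"
    have "(v - u) + u \<in> leads P rk (I (deg (v - u) + deg u))"
      by (rule leads_shift[of u I]) (use u sh in \<open>auto simp: J_def\<close>)
    moreover have "(v - u) + u = v" using le_add_diff_exponent[OF u(2)] by (simp add: add.commute)
    ultimately show "v \<in> J" using deg_diff[OF u(2)] by (simp add: J_def)
  qed
  moreover have "standard_count deg J = h"
    using loc_free_leads(1)[OF Z P ZP finX rkX I] by (auto simp: standard_count_def JX)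
  ultimately have gen: "exponents_generated deg D J" using g unfolding exponents_g_def by blast
  have "\<forall>w\<in>leads P rk (I a). \<exists>q. q \<in> I a \<and> q \<in> gpiece D I a \<and> lead P rk q w"
  proof
    fix w assume w: "w \<in> leads P rk (I a)"
    have dw: "deg w = a" by (rule leads_deg[OF w])
    then have "w \<in> J" using w by (simp add: J_def)
    then obtain v where v: "v \<in> J" "v \<le> w" "deg v \<in> D" using gen unfolding exponents_generated_def by blast
    then obtain p where p: "p \<in> I (deg v)" "lead P rk p v" by (auto simp: J_def leads_def)
    have d: "deg (w - v) + deg v = a" using deg_diff[OF v(2)] dw by simp
    have "(w - v) + v = w" using le_add_diff_exponent[OF v(2)] by (simp add: add.commute)
    then have "lead P rk (shift (w - v) p) w" using lead_shift'[OF p(2), of "w - v"] by simp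
    moreover have "shift (w - v) p \<in> gpiece D I a" by (rule shifts_gpiece[where M = I, OF v(3) p(1) d])
    moreover have "shift (w - v) p \<in> I a" using sh[OF p(1), of "w - v"] d by simp
    ultimately show "\<exists>q. q \<in> I a \<and> q \<in> gpiece D I a \<and> lead P rk q w" by blast
  qed
  then obtain t where t: "\<And>w. w \<in> leads P rk (I a) \<Longrightarrow> t w \<in> I a \<and> t w \<in> gpiece D I a \<and> lead P rk (t w) w"
    by metis
  have t': "t w \<in> I a \<and> lead P rk (t w) w" if "w \<in> leads P rk (I a)" for w using t[OF that] by simp
  obtain s \<alpha> n where s: "s \<notin> P" "n \<in> Zpart a" "scl s y = (\<Sum>w\<in>leads P rk (I a). scl (\<alpha> w) (t w)) + n"
    using divide_locally[where t = t, OF I(1) I(2) t' y] by blast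
  have "(\<Sum>w\<in>leads P rk (I a). scl (\<alpha> w) (t w)) \<in> gpiece D I a"
    by (intro fv.subspace_sum[OF subspace_gpiece] fv.subspace_scale[OF subspace_gpiece]) (use t in blast)
  then have "scl s y \<in> gpiece D I a"
    unfolding s(3) by (rule fv.subspace_add[OF subspace_gpiece _ subsetD[OF Zpart_gpiece s(2)]])
  then show ?thesis using s(1) by blast
qed

end

text \<open>Condition (g) is assumed only for \<open>Z \<noteq> UNIV\<close>, which is implied by
  the existence of a maximal ideal over \<open>Z\<close>; for the zero ring the local statement is
  vacuous.\<close>

lemma (in graded) generated_by_pieces:
  assumes I: "\<And>a. piece_module Z (X a) (I a)" "\<And>a. loc_free Z (X a) (I a) (h a)"
    and sh: "\<And>u p a. p \<in> I a \<Longrightarrow> shift u p \<in> I (deg u + a)"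
    and g: "Z \<noteq> UNIV \<Longrightarrow> exponents_g deg h D"
  shows "I a \<subseteq> gpiece D I a"
proof
  fix y assume y: "y \<in> I a"
  obtain rk :: "('n \<Rightarrow> nat) \<Rightarrow> int poly" where rk: "inj rk" "\<And>u v. rk (u + v) = rk u + rk v"
    using exists_term_order by blast
  have yF: "y \<in> Fn (X a)" using y piece_moduleD(2)[OF I(1)] by blast
  show "y \<in> gpiece D I a"
  proof (rule in_subspace_locally[OF Z subspace_gpiece])
    show "scl s y \<in> gpiece D I a" if "s \<in> Z" for s
      using killed_Zpart[OF yF, of s] idealD_mult2[OF Z that] Zpart_gpiece by blast
    fix P assume PZ: "max_ideal P" "Z \<subseteq> P"
    interpret graded_at deg Z h P rk
      by unfold_locales (use PZ rk in auto)
    have "Z \<noteq> UNIV" using max_idealD(2)[OF PZ(1)] PZ(2) by blast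
    then show "\<exists>s. s \<notin> P \<and> scl s y \<in> gpiece D I a"
      using piece_locally_generated[OF I sh g y] by blast
  qed
qed

subsection \<open>Existence\<close>

text \<open>The assumption \<open>closed\<close> is the content of the quadratic equations, and
  \<open>minors\<close> with \<open>rank_bound\<close> that of the determinantal ones. The case r_e
  < h(e), in which the unit ideal is required to vanish, is separate because the truncated
  subtraction in \<open>card (X e) - h e + 1\<close> would give minors of size 1.\<close>

locale graded_data = graded deg Z h
  for deg :: "('n::finite \<Rightarrow> nat) \<Rightarrow> 'a::ab_group_add" and Z :: "'t::comm_ring_1 set" and h +
  fixes D E :: "'a set" and M :: "'a \<Rightarrow> (('n \<Rightarrow> nat) \<Rightarrow> 't) set"
  assumes finD: "finite D" and DE: "D \<subseteq> E"
    and M: "\<And>d. d \<in> D \<Longrightarrow> piece_module Z (X d) (M d)"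
    and Mfree: "\<And>d. d \<in> D \<Longrightarrow> loc_free Z (X d) (M d) (h d)"
    and closed: "\<And>a b u p. a \<in> D \<Longrightarrow> b \<in> D \<Longrightarrow> p \<in> M a \<Longrightarrow> deg u + a = b \<Longrightarrow> shift u p \<in> M b"
    and minors: "\<And>e. e \<in> E - D \<Longrightarrow> minors_in (card (X e) - h e + 1) (X e) (shifts D M e) Z"
    and rank_bound: "\<And>e. e \<in> E - D \<Longrightarrow> card (X e) < h e \<Longrightarrow> Z = UNIV"
    and comb: "Z \<noteq> UNIV \<Longrightarrow> exponents_h' deg h D" "Z \<noteq> UNIV \<Longrightarrow> exponents_h deg h E"
      "Z \<noteq> UNIV \<Longrightarrow> exponents_s deg h E"
begin

abbreviation I :: "'a \<Rightarrow> (('n \<Rightarrow> nat) \<Rightarrow> 't) set" where "I \<equiv> gpiece D M"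

lemma I_piece: "piece_module Z (X a) (I a)"
  by (rule piece_module_gpiece[OF piece_moduleD(2)[OF M]])

lemma I_D: "d \<in> D \<Longrightarrow> I d = M d"
  by (rule gpiece_closed[OF _ M]) (auto intro: closed)

end

locale graded_data_at = graded_data deg Z h D E M + graded_at deg Z h P rk
  for deg :: "('n::finite \<Rightarrow> nat) \<Rightarrow> 'a::ab_group_add" and Z :: "'t::comm_ring_1 set" and h D E M P rk
begin

section \<open>The monomial ideal of leading terms and its Hilbert function\<close>

lemma Z_proper: "Z \<noteq> UNIV" using max_idealD(2)[OF P] ZP by blast

text \<open>Only leading monomials in the degrees of \<open>D\<close> are taken as generators, so
  that (h') applies to \<open>J\<close>. In other degrees \<open>J\<close> might a priori miss
  leading monomials of \<open>I\<close>.\<close>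

definition J :: "('n \<Rightarrow> nat) set" where
  "J = {w. \<exists>d\<in>D. \<exists>m\<in>leads P rk (M d). m \<le> w}"

lemma up_closed_J: "up_closed J"
  unfolding up_closed_def J_def by (blast intro: order_trans)

lemma leads_M: "d \<in> D \<Longrightarrow> w \<in> leads P rk (M d) \<Longrightarrow> deg w = d \<and> w \<in> J"
  using subsetD[OF leads_subset[OF P piece_moduleD(2)[OF M]], of d w rk] unfolding J_def by auto

lemma J_lead:
  assumes "w \<in> J"
  obtains d m p where "d \<in> D" "m \<le> w" "p \<in> M d" "lead P rk p m" "deg m = d" "m \<in> J"
    "lead P rk (shift (w - m) p) w" "deg (w - m) + d = deg w"
proof -
  obtain d m where dm: "d \<in> D" "m \<in> leads P rk (M d)" "m \<le> w" using assms unfolding J_def by blast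
  then obtain p where p: "p \<in> M d" "lead P rk p m" unfolding leads_def by blast
  have "(w - m) + m = w" using le_add_diff_exponent[OF dm(3)] by (simp add: add.commute)
  then have "lead P rk (shift (w - m) p) w" using lead_shift'[OF p(2), of "w - m"] by simp
  then show thesis using that dm p leads_M[OF dm(1,2)] deg_diff[OF dm(3)] by blast
qed

text \<open>A multiple of a lead whose degree is again in \<open>D\<close> is a lead there, by the
  closure of \<open>M\<close> under multiplication within \<open>D\<close>.\<close>

lemma J_D: assumes d: "d \<in> D" shows "J \<inter> X d = leads P rk (M d)"
proof
  show "J \<inter> X d \<subseteq> leads P rk (M d)"
  proof
    fix w assume "w \<in> J \<inter> X d"
    then have w: "w \<in> J" "deg w = d" by auto
    from w(1) obtain d' m p where *: "d' \<in> D" "m \<le> w" "p \<in> M d'" "lead P rk (shift (w - m) p) w"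
      "deg (w - m) + d' = deg w" by (rule J_lead)
    have "shift (w - m) p \<in> M d" by (rule closed[OF *(1) d *(3)]) (use *(5) w(2) in simp)
    then show "w \<in> leads P rk (M d)" using *(4) unfolding leads_def by blast
  qed
qed (use leads_M[OF d] in auto)

lemma generated_J: "exponents_generated deg D J"
  unfolding exponents_generated_def
proof
  fix w assume "w \<in> J"
  then obtain d m p where "d \<in> D" "m \<le> w" "deg m = d" "m \<in> J" by (rule J_lead)
  then show "\<exists>v\<in>J. v \<le> w \<and> deg v \<in> D" by blast
qed

lemma J_leads_I: "J \<inter> X a \<subseteq> leads P rk (I a)"
proof
  fix w assume "w \<in> J \<inter> X a"
  then have w: "w \<in> J" "deg w = a" by auto
  from w(1) obtain d m p where *: "d \<in> D" "m \<le> w" "p \<in> M d" "lead P rk (shift (w - m) p) w"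
    "deg (w - m) + d = deg w" by (rule J_lead)
  have "shift (w - m) p \<in> I a" by (rule shifts_gpiece[where M = M, OF *(1,3)]) (use * w in simp)
  then show "w \<in> leads P rk (I a)" using *(4) unfolding leads_def by blast
qed

lemma X_minus_J: "X a - J = X a - J \<inter> X a" by blast

lemma count_J_D: "d \<in> D \<Longrightarrow> standard_count deg J d = h d"
  using loc_free_leads(1)[OF Z P ZP finX rkX M Mfree]
  by (simp add: standard_count_def X_minus_J J_D)

text \<open>In the degrees of \<open>D\<close> the count is exact by local freeness, and
  \<open>J\<close> is generated in these degrees; (h') extends the upper bound to all
  degrees.\<close>

lemma count_J_le: "standard_count deg J a \<le> h a"
  using comb(1)[OF Z_proper] up_closed_J generated_J count_J_D unfolding exponents_h'_def by blast

lemma spans_I: "\<exists>f. f \<notin> P \<and> spans_by f (X a) (I a) (X a - J)"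
  using spans_by_leads[OF P finX rkX piece_moduleD(1,2)[OF I_piece] J_leads_I, of a]
  by (simp add: X_minus_J[symmetric])

text \<open>At most \<open>h e\<close> monomials are standard for \<open>J\<close>, and they
  generate near \<open>P\<close>. Local freeness asks for a generating set of exactly
  \<open>h e\<close> monomials, so the set is padded; \<open>rank_bound\<close> ensures that there
  are enough monomials.\<close>

lemma rank_spans_E:
  assumes e: "e \<in> E - D"
  shows "\<exists>N f. N \<subseteq> X e \<and> card N = h e \<and> f \<notin> P \<and> spans_by f (X e) (I e) N"
proof -
  obtain f where f: "f \<notin> P" "spans_by f (X e) (I e) (X e - J)" using spans_I by blast
  have "h e \<le> card (X e)" using rank_bound[OF e] Z_proper by (meson not_le)
  then obtain N where N: "X e - J \<subseteq> N" "N \<subseteq> X e" "card N = h e"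
    using exists_subset_between[of "X e - J" "h e" "X e"] count_J_le[of e] finX
    by (auto simp: standard_count_def)
  then have "spans_by f (X e) (I e) N" using spans_by_mono[OF f(2) order_refl] by blast
  then show ?thesis using f N by blast
qed

end

context graded_data
begin

lemma local_data:
  assumes "max_ideal P" "Z \<subseteq> P"
  obtains rk where "graded_data_at deg Z h D E M P rk"
proof -
  obtain rk :: "('n \<Rightarrow> nat) \<Rightarrow> int poly" where rk: "inj rk" "\<And>u v. rk (u + v) = rk u + rk v"
    using exists_term_order by blast
  have "graded_data_at deg Z h D E M P rk"
    by unfold_locales (use assms rk in auto)
  then show thesis by (rule that)
qed

lemma minors_gpiece:
  assumes "minors_in m (X a) (shifts D M a) Z" shows "minors_in m (X a) (I a) Z"
proof (rule minors_in_mono[OF minors_in_add_ideal[OF Z assms]])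
  show "I a \<subseteq> lspan (shifts D M a \<union> {q. \<forall>x. q x \<in> Z})"
    unfolding gpiece_def by (rule fv.span_mono) (auto simp: Zpart_def)
qed

text \<open>In a degree of \<open>E - D\<close>, local generation by \<open>h e\<close> monomials
  comes from (h'), and the other Fitting condition is the vanishing of the minors of
  \<open>\<Gamma>\<close>.\<close>

lemma loc_free_E:
  assumes e: "e \<in> E" shows "loc_free Z (X e) (I e) (h e)"
proof (cases "e \<in> D")
  case True
  then show ?thesis using Mfree I_D by simp
next
  case False
  then have e': "e \<in> E - D" using e by blast
  show ?thesis
    unfolding loc_free_def
  proof (intro conjI allI impI)
    fix P assume "max_ideal P \<and> Z \<subseteq> P"
    then obtain rk where "graded_data_at deg Z h D E M P rk" using local_data by blast
    then show "\<exists>N f. N \<subseteq> X e \<and> card N = h e \<and> f \<notin> P \<and> spans_by f (X e) (I e) N"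
      by (rule graded_data_at.rank_spans_E[OF _ e'])
  next
    show "minors_in (card (X e) - h e + 1) (X e) (I e) Z"
      by (rule minors_gpiece[OF minors[OF e']])
  qed
qed

end

context graded_data_at
begin

text \<open>Every element of \<open>J\<close> is a lead of \<open>I\<close>. Exactly
  \<open>h e\<close> monomials are not leads, by local freeness, and at most \<open>h e\<close> are
  outside \<open>J\<close>; counting turns the inclusion into an equality.\<close>

lemma J_E: assumes e: "e \<in> E" shows "J \<inter> X e = leads P rk (I e)"
proof -
  have L: "leads P rk (I e) \<subseteq> X e" by (rule leads_subset[OF P piece_moduleD(2)[OF I_piece]])
  have "card (X e - leads P rk (I e)) = h e"
    by (rule loc_free_leads(1)[OF Z P ZP finX rkX I_piece loc_free_E[OF e]])
  then have "card (X e - J) \<le> card (X e - leads P rk (I e))"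
    using count_J_le[of e] by (simp add: standard_count_def)
  moreover have "X e - leads P rk (I e) \<subseteq> X e - J" using J_leads_I[of e] by blast
  ultimately have "X e - leads P rk (I e) = X e - J"
    using card_seteq[of "X e - J" "X e - leads P rk (I e)"] finX by blast
  then show ?thesis using L by blast
qed

text \<open>The counts in the degrees of \<open>E\<close> are now exact, and \<open>J\<close> is
  generated in degrees of \<open>D\<close>, hence of \<open>E\<close>, so (h) determines the whole
  Hilbert function.\<close>

lemma count_J: "standard_count deg J = h"
proof
  fix a
  have "standard_count deg J e = h e" if "e \<in> E" for e
    using loc_free_leads(1)[OF Z P ZP finX rkX I_piece loc_free_E[OF that]]
    by (simp add: standard_count_def X_minus_J J_E[OF that])
  moreover have "exponents_generated deg E J"
    using generated_J DE unfolding exponents_generated_def by blast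
  ultimately show "standard_count deg J a = h a"
    using comb(2)[OF Z_proper] up_closed_J unfolding exponents_h_def by blast
qed

section \<open>Lifts of the minimal generators and Buchberger's criterion near a maximal
  ideal\<close>

definition G :: "('n \<Rightarrow> nat) set" where "G = minimal_exponents J"

text \<open>Since \<open>J\<close> consists of the multiples of leads in degrees of
  \<open>D\<close>, its minimal elements are themselves such leads.\<close>

lemma G_lead: assumes "u \<in> G" shows "deg u \<in> D" "\<exists>p. p \<in> M (deg u) \<and> lead P rk p u"
proof -
  have u: "u \<in> J" "\<And>v. v < u \<Longrightarrow> v \<notin> J" using assms unfolding G_def minimal_exponents_def by blast+
  from u(1) obtain d m p where *: "d \<in> D" "m \<le> u" "p \<in> M d" "lead P rk p m" "deg m = d" "m \<in> J"
    by (rule J_lead)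
  have "m = u" using u(2)[of m] *(2,6) by (auto simp: less_le)
  then show "deg u \<in> D" "\<exists>p. p \<in> M (deg u) \<and> lead P rk p u" using * by auto
qed

lemma finite_G: "finite G"
  by (rule finite_subset[of _ "\<Union>d\<in>D. X d"]) (use G_lead(1) finD finX in auto)

text \<open>A lift to \<open>M\<close> of the minimal generator with exponent \<open>u\<close>;
  these lifts take the place of a Groebner basis.\<close>

definition g :: "('n \<Rightarrow> nat) \<Rightarrow> ('n \<Rightarrow> nat) \<Rightarrow> 't" where
  "g u = (SOME p. p \<in> M (deg u) \<and> lead P rk p u)"

lemma g: "u \<in> G \<Longrightarrow> g u \<in> M (deg u)" "u \<in> G \<Longrightarrow> lead P rk (g u) u"
  using someI_ex[OF G_lead(2)] unfolding g_def by blast+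

definition gen :: "('n \<Rightarrow> nat) \<Rightarrow> 'n \<Rightarrow> nat" where
  "gen w = (SOME u. u \<in> G \<and> u \<le> w)"

lemma gen: "w \<in> J \<Longrightarrow> gen w \<in> G" "w \<in> J \<Longrightarrow> gen w \<le> w"
  using someI_ex[of "\<lambda>u. u \<in> G \<and> u \<le> w"] minimal_exponent_below[of w J] unfolding gen_def G_def by blast+

text \<open>The multiple of the lift \<open>g u\<close> whose leading exponent is \<open>w\<close>,
  meant for \<open>u \<le> w\<close>.\<close>

definition T :: "('n \<Rightarrow> nat) \<Rightarrow> ('n \<Rightarrow> nat) \<Rightarrow> ('n \<Rightarrow> nat) \<Rightarrow> 't" where
  "T w u = shift (w - u) (g u)"

lemma T_in:
  assumes "u \<in> G" "u \<le> w" shows "T w u \<in> I (deg w)" "lead P rk (T w u) w"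
proof -
  show "T w u \<in> I (deg w)"
    unfolding T_def by (rule shifts_gpiece[where M = M, OF G_lead(1) g(1) deg_diff]) (rule assms)+
  have "(w - u) + u = w" using le_add_diff_exponent[OF assms(2)] by (simp add: add.commute)
  then show "lead P rk (T w u) w"
    unfolding T_def using lead_shift'[OF g(2)[OF assms(1)], of "w - u"] by simp
qed

lemma shift_T: "u \<le> w \<Longrightarrow> shift v (T w u) = T (v + w) u"
proof -
  assume "u \<le> w"
  then have "v + (w - u) = (v + w) - u" by (auto simp: le_fun_def fun_eq_iff)
  then show ?thesis unfolding T_def by (simp only: shift_shift)
qed

lemma divide:
  assumes e: "e \<in> E" and z: "z \<in> I e"
  shows "\<exists>s \<alpha> n. s \<notin> P \<and> n \<in> Zpart e \<and> scl s z = (\<Sum>w\<in>J \<inter> X e. scl (\<alpha> w) (T w (gen w))) + n \<and>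
    (\<forall>m. (\<forall>x\<in>X e. rk m \<le> rk x \<longrightarrow> z x \<in> P) \<longrightarrow> (\<forall>w\<in>J \<inter> X e. rk m \<le> rk w \<longrightarrow> \<alpha> w \<in> P))"
proof -
  have "T w (gen w) \<in> I e \<and> lead P rk (T w (gen w)) w" if "w \<in> leads P rk (I e)" for w
  proof -
    have w: "w \<in> J" "deg w = e" using that J_E[OF e] by auto
    then show ?thesis using T_in[OF gen[OF w(1)]] by simp
  qed
  from divide_locally[where t = "\<lambda>w. T w (gen w)", OF I_piece loc_free_E[OF e] this z]
  show ?thesis unfolding J_E[OF e] .
qed

definition family :: "'a \<Rightarrow> (('n \<Rightarrow> nat) \<Rightarrow> 't) set" where
  "family a = {T w u | w u. w \<in> J \<inter> X a \<and> u \<in> G \<and> u \<le> w}"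

text \<open>Here one multiple is kept for each leading monomial of degree \<open>a\<close>, whereas
  \<open>family a\<close> contains one for every generator dividing it. The aim is to show that the
  kept ones span the rest near \<open>P\<close>.\<close>

definition basis :: "'a \<Rightarrow> (('n \<Rightarrow> nat) \<Rightarrow> 't) set" where
  "basis a = (\<lambda>w. T w (gen w)) ` (J \<inter> X a) \<union> Zpart a"

lemma finite_family: "finite (family a)"
proof -
  have "family a \<subseteq> (\<lambda>(w, u). T w u) ` (X a \<times> G)" unfolding family_def by auto
  then show ?thesis using finite_subset finX finite_G by blast
qed

lemma T_family: "w \<in> J \<Longrightarrow> deg w = a \<Longrightarrow> u \<in> G \<Longrightarrow> u \<le> w \<Longrightarrow> T w u \<in> family a"
  unfolding family_def by auto

text \<open>The shape required by Nakayama's lemma: the span of the basis, up to \<open>P\<close>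
  times the finite family.\<close>

abbreviation target :: "'a \<Rightarrow> (('n \<Rightarrow> nat) \<Rightarrow> 't) set" where
  "target a \<equiv> sat P (lspan (basis a \<union> pmul P (family a)))"

lemma subspace_target: "lsub (target a)"
  by (rule subspace_sat[OF P]) simp

lemma in_target: "y \<in> basis a \<union> pmul P (family a) \<Longrightarrow> y \<in> target a"
  by (rule subsetD[OF sat_superset[OF P]]) (rule fv.span_base)

text \<open>If \<open>lcm(x\<^sup>u, x\<^sup>v)\<close> has degree in \<open>E\<close>, dividing the S-pair of \<open>g u\<close> and \<open>g v\<close> leaves no
  remainder, because the quotient is already free in that degree. Coefficients of terms above the
  lcm lie in \<open>P\<close> and are absorbed by Nakayama's lemma.\<close>

lemma S_pair:
  assumes w: "deg w = a" and uv: "(u, v) \<in> lcm_relation deg E G w"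
    and IH: "\<And>w' u. w' \<in> J \<Longrightarrow> deg w' = a \<Longrightarrow> rk w' < rk w \<Longrightarrow> u \<in> G \<Longrightarrow> u \<le> w' \<Longrightarrow> T w' u \<in> target a"
  shows "T w u - T w v \<in> target a"
proof -
  define l where "l = sup u v"
  have uv': "u \<in> G" "v \<in> G" "u \<le> l" "v \<le> l" "l \<le> w" "deg l \<in> E"
    using uv unfolding lcm_relation_def l_def by auto
  \<comment> \<open>The difference in degree \<open>a\<close> is the multiple by the monomial
    \<open>y\<close> of the S-pair at the lcm \<open>l\<close>. Division is carried out in degree
    \<open>deg l \<in> E\<close>, where freeness is known, and its result is multiplied by
    \<open>y\<close>.\<close>
  define y where "y = w - l"
  have yl: "y + l = w" using le_add_diff_exponent[OF uv'(5)] by (simp add: y_def add.commute)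
  have dyl: "deg y + deg l = a" using deg_diff[OF uv'(5)] w by (simp add: y_def)
  let ?z = "T l u - T l v"
  have zI: "?z \<in> I (deg l)"
    by (intro fv.subspace_diff[OF subspace_gpiece] T_in(1) uv')
  have small: "?z x \<in> P" if "x \<in> X (deg l)" "rk l \<le> rk x" for x
  proof (cases "x = l")
    case True
    have "T l u l - 1 \<in> P" "T l v l - 1 \<in> P"
      using T_in(2)[OF uv'(1,3)] T_in(2)[OF uv'(2,4)] unfolding lead_def by blast+
    from idealD_diff[OF iP this] show ?thesis using True by simp
  next
    case False
    then have "rk l < rk x" using that(2) rk_inj by (metis injD order_le_less)
    then have "T l u x \<in> P" "T l v x \<in> P"
      using T_in(2)[OF uv'(1,3)] T_in(2)[OF uv'(2,4)] unfolding lead_def by blast+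
    from idealD_diff[OF iP this] show ?thesis by simp
  qed
  obtain s \<alpha> n where d: "s \<notin> P" "n \<in> Zpart (deg l)"
      "scl s ?z = (\<Sum>m\<in>J \<inter> X (deg l). scl (\<alpha> m) (T m (gen m))) + n"
    and \<alpha>: "\<forall>m. (\<forall>x\<in>X (deg l). rk m \<le> rk x \<longrightarrow> ?z x \<in> P) \<longrightarrow>
      (\<forall>w\<in>J \<inter> X (deg l). rk m \<le> rk w \<longrightarrow> \<alpha> w \<in> P)"
    using divide[OF uv'(6) zI] by blast
  have "shift y (scl s ?z) \<in> target a"
    unfolding d(3) shift_add shift_sum
  proof (intro fv.subspace_add[OF subspace_target] fv.subspace_sum[OF subspace_target])
    show "shift y n \<in> target a"
      using shift_Zpart[OF d(2) dyl] by (intro in_target) (simp add: basis_def)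
    fix m assume m: "m \<in> J \<inter> X (deg l)"
    then have mJ: "m \<in> J" "deg m = deg l" by auto
    have ymJ: "y + m \<in> J" using up_closed_J mJ(1) unfolding up_closed_def by (metis exponent_le_iff add.commute)
    have dym: "deg (y + m) = a" using dyl mJ(2) by (simp add: deg_add)
    have gm: "gen m \<le> y + m" using gen(2)[OF mJ(1)] by (auto simp: le_fun_def intro: trans_le_add2)
    have eq: "shift y (scl (\<alpha> m) (T m (gen m))) = scl (\<alpha> m) (T (y + m) (gen m))"
      by (simp only: shift_scl shift_T[OF gen(2)[OF mJ(1)]])
    show "shift y (scl (\<alpha> m) (T m (gen m))) \<in> target a"
    proof (cases "rk l \<le> rk m")
      case True
      have "\<alpha> m \<in> P" using \<alpha> small m True by blast
      then have "scl (\<alpha> m) (T (y + m) (gen m)) \<in> pmul P (family a)"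
        using T_family[OF ymJ dym gen(1)[OF mJ(1)] gm] unfolding pmul_def by blast
      then show ?thesis unfolding eq by (intro in_target) simp
    next
      case False
      have "rk y + rk m < rk y + rk l" using False by (intro add_strict_left_mono) simp
      then have "rk (y + m) < rk w" unfolding rk_add[of y m] rk_add[of y l, unfolded yl] .
      then have "T (y + m) (gen m) \<in> target a"
        by (rule IH[OF ymJ dym _ gen(1)[OF mJ(1)] gm])
      then show ?thesis unfolding eq by (rule fv.subspace_scale[OF subspace_target])
    qed
  qed
  moreover have "shift y (scl s ?z) = scl s (T w u - T w v)"
    by (simp only: shift_scl shift_diff shift_T[OF uv'(3)] shift_T[OF uv'(4)] yl)
  ultimately show ?thesis using sat_cancel[OF P d(1)] by metis
qed

text \<open>By (s), the generators \<open>u\<close> and \<open>gen w\<close> are joined by a chain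
  of generators dividing the monomial \<open>w\<close> in which neighbours have an lcm of degree in
  \<open>E\<close>. The differences along the chain telescope, and \<open>T w (gen w)\<close>
  belongs to the basis. The induction is over the rank of \<open>w\<close> within its
  degree.\<close>

lemma T_target:
  assumes "w \<in> J" "deg w = a" "u \<in> G" "u \<le> w" shows "T w u \<in> target a"
  using assms
proof (induction "card {x \<in> X a. rk x < rk w}" arbitrary: w u rule: less_induct)
  case less
  note w = less.prems(1,2)
  have IH: "T w' v \<in> target a" if "w' \<in> J" "deg w' = a" "rk w' < rk w" "v \<in> G" "v \<le> w'" for w' v
  proof (rule less.hyps[OF _ that(1,2,4,5)])
    show "card {x \<in> X a. rk x < rk w'} < card {x \<in> X a. rk x < rk w}"
    proof (rule psubset_card_mono)
      show "finite {x \<in> X a. rk x < rk w}" by (rule finite_subset[OF _ finX[of a]]) blast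
      have "w' \<in> {x \<in> X a. rk x < rk w}" "w' \<notin> {x \<in> X a. rk x < rk w'}" using that by simp_all
      moreover have "{x \<in> X a. rk x < rk w'} \<subseteq> {x \<in> X a. rk x < rk w}"
        using less_trans[OF _ that(3)] by blast
      ultimately show "{x \<in> X a. rk x < rk w'} \<subset> {x \<in> X a. rk x < rk w}" by blast
    qed
  qed
  have "(u, v) \<in> (lcm_relation deg E G w)\<^sup>* \<Longrightarrow> T w u - T w v \<in> target a" for v
  proof (induction rule: rtrancl_induct)
    case base
    show "T w u - T w u \<in> target a" by (simp only: diff_self fv.subspace_0[OF subspace_target])
  next
    case (step x y)
    have "T w x - T w y \<in> target a" by (rule S_pair[OF w(2) step.hyps(2) IH])
    with step.IH have "(T w u - T w x) + (T w x - T w y) \<in> target a"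
      by (rule fv.subspace_add[OF subspace_target])
    then show "T w u - T w y \<in> target a" by simp
  qed
  moreover have "(u, gen w) \<in> (lcm_relation deg E G w)\<^sup>*"
    using comb(3)[OF Z_proper] up_closed_J finite_G count_J less.prems(3,4) gen[OF w(1)]
    unfolding exponents_s_def G_def by blast
  ultimately have "T w u - T w (gen w) \<in> target a" by blast
  moreover have "T w (gen w) \<in> target a"
    using w by (intro in_target UnI1) (auto simp: basis_def)
  ultimately have "(T w u - T w (gen w)) + T w (gen w) \<in> target a"
    by (rule fv.subspace_add[OF subspace_target])
  then show ?case by simp
qed

lemma family_subset: "family a \<subseteq> sat P (lspan (basis a))"
  by (rule nakayama[OF P finite_family]) (use T_target in \<open>auto simp: family_def\<close>)

text \<open>An element of \<open>M d\<close> is divided in its own degree \<open>d \<in> D\<close>;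
  after multiplication by a monomial the quotient terms become elements of the family, though not
  necessarily of the basis.\<close>

lemma I_subset: "I a \<subseteq> sat P (lspan (basis a))"
proof -
  let ?S = "sat P (lspan (basis a))"
  have sub: "lsub ?S" by (rule subspace_sat[OF P]) simp
  have Zp: "Zpart a \<subseteq> ?S"
    using sat_superset[OF P] fv.span_superset unfolding basis_def by blast
  have "shifts D M a \<subseteq> ?S"
  proof
    fix q assume "q \<in> shifts D M a"
    then obtain u d p where q: "q = shift u p" "d \<in> D" "p \<in> M d" "deg u + d = a"
      unfolding shifts_def by blast
    have dE: "d \<in> E" using q(2) DE by blast
    have pI: "p \<in> I d" using q(2,3) I_D by blast
    obtain s \<alpha> n where d: "s \<notin> P" "n \<in> Zpart d"
      "scl s p = (\<Sum>m\<in>J \<inter> X d. scl (\<alpha> m) (T m (gen m))) + n"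
      using divide[OF dE pI] by blast
    have "shift u (scl s p) \<in> ?S"
      unfolding d(3) shift_add shift_sum
    proof (intro fv.subspace_add[OF sub] fv.subspace_sum[OF sub])
      show "shift u n \<in> ?S" using shift_Zpart[OF d(2) q(4)] Zp by blast
      fix m assume "m \<in> J \<inter> X d"
      then have mJ: "m \<in> J" "deg m = d" by auto
      have umJ: "u + m \<in> J" using up_closed_J mJ(1) unfolding up_closed_def by (metis exponent_le_iff add.commute)
      have dum: "deg (u + m) = a" using q(4) mJ(2) by (simp add: deg_add)
      have gm: "gen m \<le> u + m" using gen(2)[OF mJ(1)] by (auto simp: le_fun_def intro: trans_le_add2)
      have "T (u + m) (gen m) \<in> ?S"
        using family_subset T_family[OF umJ dum gen(1)[OF mJ(1)] gm] by blast
      then show "shift u (scl (\<alpha> m) (T m (gen m))) \<in> ?S"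
        unfolding shift_scl shift_T[OF gen(2)[OF mJ(1)]] by (rule fv.subspace_scale[OF sub])
    qed
    then have "scl s q \<in> ?S" unfolding q(1) shift_scl .
    then show "q \<in> ?S" by (rule sat_cancel[OF P d(1)])
  qed
  then show ?thesis
    unfolding gpiece_def using Zp by (intro fv.span_minimal[OF _ sub]) blast
qed

text \<open>Apart from vectors with coefficients in \<open>Z\<close>, the basis has at most
  \<open>card (X a) - h a\<close> elements, one fewer than the number of rows of the minors.\<close>

lemma minors_basis: "minors_in (card (X a) - h a + 1) (X a) (lspan (basis a)) Z"
proof -
  let ?B = "(\<lambda>w. T w (gen w)) ` (J \<inter> X a)"
  have "card (X a - J) = h a" using count_J by (auto simp: standard_count_def fun_eq_iff)
  moreover have "card (X a - J) = card (X a) - card (J \<inter> X a)" "card (J \<inter> X a) \<le> card (X a)"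
    using card_Diff_subset_Int[of "X a" J] finX[of a] by (simp_all add: Int_commute card_mono)
  ultimately have "card (J \<inter> X a) < card (X a) - h a + 1" by simp
  moreover have "card ?B \<le> card (J \<inter> X a)" by (rule card_image_le) (simp add: finX)
  ultimately have "minors_in (card (X a) - h a + 1) (X a) ?B Z"
    by (intro minors_in_few_rows[OF Z]) (simp_all add: finX)
  from minors_in_add_ideal[OF Z this] show ?thesis
    by (rule minors_in_mono) (auto simp: basis_def Zpart_def intro!: fv.span_mono)
qed

end

text \<open>Generation uses the standard monomials of \<open>J\<close>, which by
  \<open>count_J\<close> number exactly \<open>h a\<close>. The minors are treated locally, where
  \<open>I a\<close> is spanned by few vectors.\<close>

theorem (in graded_data) loc_free_I: "loc_free Z (X a) (I a) (h a)"
  unfolding loc_free_def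
proof (intro conjI allI impI)
  fix P assume "max_ideal P \<and> Z \<subseteq> P"
  then obtain rk where "graded_data_at deg Z h D E M P rk" using local_data by blast
  then interpret graded_data_at deg Z h D E M P rk .
  obtain f where f: "f \<notin> P" "spans_by f (X a) (I a) (X a - J)" using spans_I by blast
  have "card (X a - J) = h a" using count_J by (auto simp: standard_count_def fun_eq_iff)
  then show "\<exists>N f. N \<subseteq> X a \<and> card N = h a \<and> f \<notin> P \<and> spans_by f (X a) (I a) N"
    using f by blast
next
  show "minors_in (card (X a) - h a + 1) (X a) (I a) Z"
  proof (rule minors_in_locally[OF Z])
    fix P assume "max_ideal P" "Z \<subseteq> P"
    then obtain rk where "graded_data_at deg Z h D E M P rk" using local_data by blast
    then interpret graded_data_at deg Z h D E M P rk .
    show "\<exists>S. minors_in (card (X a) - h a + 1) (X a) S Z \<and> I a \<subseteq> sat P S"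
      using minors_basis I_subset by blast
  qed
qed

section \<open>Rings as quotients of a type-class ring\<close>

text \<open>The product of all commutative rings with elements in \<open>'r\<close>, and of the integers to ensure
  \<open>0 \<noteq> 1\<close>, is an instance of \<^class>\<open>comm_ring_1\<close>. It maps onto each of these rings, which transfers
  statements about an arbitrary \<^locale>\<open>cring\<close> to a type-class ring with an ideal.\<close>

type_synonym 'r ring_ops = "'r set \<times> ('r \<Rightarrow> 'r \<Rightarrow> 'r) \<times> ('r \<Rightarrow> 'r \<Rightarrow> 'r) \<times> 'r \<times> 'r"

text \<open>The axioms of a commutative ring for a bare tuple of carrier, addition, multiplication,
  zero and one. Negatives are only asserted to exist, so the negation of the product ring is defined
  by choice in each component.\<close>

definition cring_ops :: "'r ring_ops \<Rightarrow> bool" where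
  "cring_ops = (\<lambda>(C, pl, tm, z, e). z \<in> C \<and> e \<in> C \<and>
    (\<forall>x\<in>C. \<forall>y\<in>C. pl x y \<in> C \<and> tm x y \<in> C \<and> pl x y = pl y x \<and> tm x y = tm y x) \<and>
    (\<forall>x\<in>C. pl z x = x \<and> tm e x = x \<and> (\<exists>y\<in>C. pl y x = z)) \<and>
    (\<forall>x\<in>C. \<forall>y\<in>C. \<forall>w\<in>C. pl (pl x y) w = pl x (pl y w) \<and> tm (tm x y) w = tm x (tm y w) \<and>
       tm (pl x y) w = pl (tm x w) (tm y w)))"

text \<open>At tuples that are not rings the value is pinned to \<open>undefined\<close>, so that
  families agreeing at all rings are equal.\<close>

definition cring_family :: "int \<times> ('r ring_ops \<Rightarrow> 'r) \<Rightarrow> bool" where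
  "cring_family x \<longleftrightarrow> (\<forall>q. if cring_ops q then snd x q \<in> fst q else snd x q = undefined)"

lemma cring_familyD:
  "cring_family x \<Longrightarrow> cring_ops q \<Longrightarrow> snd x q \<in> fst q"
  "cring_family x \<Longrightarrow> \<not> cring_ops q \<Longrightarrow> snd x q = undefined"
  unfolding cring_family_def by meson+

lemma cring_familyI:
  assumes "\<And>q. cring_ops q \<Longrightarrow> \<phi> q \<in> fst q"
  shows "cring_family (n, \<lambda>q. if cring_ops q then \<phi> q else undefined)"
  unfolding cring_family_def
proof
  fix q
  show "if cring_ops q then snd (n, \<lambda>q. if cring_ops q then \<phi> q else undefined) q \<in> fst q
    else snd (n, \<lambda>q. if cring_ops q then \<phi> q else undefined) q = undefined"
    using assms[of q] by (cases "cring_ops q") (simp_all only: if_True if_False simp_thms snd_conv)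
qed

typedef 'r ring_product = "Collect (cring_family :: int \<times> ('r ring_ops \<Rightarrow> 'r) \<Rightarrow> bool)"
proof -
  have *: "cring_ops q \<Longrightarrow> fst (snd (snd (snd q))) \<in> fst q" for q :: "'r ring_ops"
    by (cases q) (simp add: cring_ops_def)
  show ?thesis by (rule exI, rule CollectI, rule cring_familyI, rule *)
qed

definition component :: "'r ring_ops \<Rightarrow> 'r ring_product \<Rightarrow> 'r" where
  "component q x = snd (Rep_ring_product x) q"

definition int_component :: "'r ring_product \<Rightarrow> int" where
  "int_component x = fst (Rep_ring_product x)"

definition make_product :: "int \<Rightarrow> ('r ring_ops \<Rightarrow> 'r) \<Rightarrow> 'r ring_product" where
  "make_product n \<phi> = Abs_ring_product (n, \<lambda>q. if cring_ops q then \<phi> q else undefined)"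

lemma component_in: "cring_ops (C, ops) \<Longrightarrow> component (C, ops) x \<in> C"
  using cring_familyD(1)[of "Rep_ring_product x" "(C, ops)"] Rep_ring_product[of x]
  unfolding component_def by simp

lemma ring_product_eqI:
  assumes "int_component x = int_component y" "\<And>q. cring_ops q \<Longrightarrow> component q x = component q y"
  shows "x = y"
proof -
  have "snd (Rep_ring_product x) q = snd (Rep_ring_product y) q" for q
  proof (cases "cring_ops q")
    case False
    then show ?thesis
      using cring_familyD(2)[of _ q] Rep_ring_product[of x] Rep_ring_product[of y] by simp
  qed (use assms(2) in \<open>simp add: component_def\<close>)
  then have "snd (Rep_ring_product x) = snd (Rep_ring_product y)" by (rule ext)
  then have "Rep_ring_product x = Rep_ring_product y"
    using assms(1) unfolding int_component_def by (rule prod_eqI[rotated])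
  then show ?thesis by (simp add: Rep_ring_product_inject)
qed

lemma make_product:
  assumes "\<And>q. cring_ops q \<Longrightarrow> \<phi> q \<in> fst q"
  shows "int_component (make_product n \<phi>) = n"
    and "cring_ops q \<Longrightarrow> component q (make_product n \<phi>) = \<phi> q"
proof -
  have "Rep_ring_product (make_product n \<phi>) = (n, \<lambda>q. if cring_ops q then \<phi> q else undefined)"
    unfolding make_product_def using cring_familyI[OF assms] by (simp only: Abs_ring_product_inverse mem_Collect_eq)
  then show "int_component (make_product n \<phi>) = n"
    "cring_ops q \<Longrightarrow> component q (make_product n \<phi>) = \<phi> q"
    by (simp_all add: int_component_def component_def)
qed

instantiation ring_product :: (type) comm_ring_1
begin

definition "0 = make_product 0 (\<lambda>(C, pl, tm, z, e). z)"
definition "1 = make_product 1 (\<lambda>(C, pl, tm, z, e). e)"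
definition "x + y = make_product (int_component x + int_component y)
  (\<lambda>q. case q of (C, pl, tm, z, e) \<Rightarrow> pl (component q x) (component q y))"
definition "x * y = make_product (int_component x * int_component y)
  (\<lambda>q. case q of (C, pl, tm, z, e) \<Rightarrow> tm (component q x) (component q y))"
definition "- x = make_product (- int_component x)
  (\<lambda>q. case q of (C, pl, tm, z, e) \<Rightarrow> SOME y. y \<in> C \<and> pl y (component q x) = z)"
definition "(x :: 'a ring_product) - y = x + - y"

lemma ring_product_ops:
  "int_component (0 :: 'a ring_product) = 0"
  "int_component (1 :: 'a ring_product) = 1"
  "int_component (x + y) = int_component x + int_component y"
  "int_component (x * y) = int_component x * int_component y"
  "int_component (- x) = - int_component x"
  "cring_ops (C, pl, tm, z, e) \<Longrightarrow> component (C, pl, tm, z, e) 0 = z"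
  "cring_ops (C, pl, tm, z, e) \<Longrightarrow> component (C, pl, tm, z, e) 1 = e"
  "cring_ops (C, pl, tm, z, e) \<Longrightarrow> component (C, pl, tm, z, e) (x + y) =
     pl (component (C, pl, tm, z, e) x) (component (C, pl, tm, z, e) y)"
  "cring_ops (C, pl, tm, z, e) \<Longrightarrow> component (C, pl, tm, z, e) (x * y) =
     tm (component (C, pl, tm, z, e) x) (component (C, pl, tm, z, e) y)"
  "cring_ops (C, pl, tm, z, e) \<Longrightarrow>
     pl (component (C, pl, tm, z, e) (- x)) (component (C, pl, tm, z, e) x) = z"
proof -
  have in0: "(case q of (C, pl, tm, z, e) \<Rightarrow> z) \<in> fst q" "(case q of (C, pl, tm, z, e) \<Rightarrow> e) \<in> fst q"
    if "cring_ops q" for q :: "'a ring_ops"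
    using that by (cases q; simp add: cring_ops_def)+
  have in1: "(case q of (C, pl, tm, z, e) \<Rightarrow> pl (component q x) (component q y)) \<in> fst q"
    "(case q of (C, pl, tm, z, e) \<Rightarrow> tm (component q x) (component q y)) \<in> fst q"
    if q: "cring_ops q" for q
  proof -
    obtain C pl tm z e where [simp]: "q = (C, pl, tm, z, e)" by (cases q) auto
    have "component q x \<in> C" "component q y \<in> C" using component_in[of C "(pl, tm, z, e)"] q by simp_all
    then show "(case q of (C, pl, tm, z, e) \<Rightarrow> pl (component q x) (component q y)) \<in> fst q"
      "(case q of (C, pl, tm, z, e) \<Rightarrow> tm (component q x) (component q y)) \<in> fst q"
      using q by (auto simp: cring_ops_def)
  qed
  have neg: "(SOME y. y \<in> C \<and> pl y (component (C, pl, tm, z, e) x) = z) \<in> C \<and>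
      pl (SOME y. y \<in> C \<and> pl y (component (C, pl, tm, z, e) x) = z) (component (C, pl, tm, z, e) x) = z"
    if q: "cring_ops (C, pl, tm, z, e)" for C pl tm z e
  proof (rule someI_ex)
    have "component (C, pl, tm, z, e) x \<in> C" using component_in q by blast
    then show "\<exists>y. y \<in> C \<and> pl y (component (C, pl, tm, z, e) x) = z"
      using q by (auto simp: cring_ops_def)
  qed
  have in2: "(case q of (C, pl, tm, z, e) \<Rightarrow> SOME y. y \<in> C \<and> pl y (component q x) = z) \<in> fst q"
    if q: "cring_ops q" for q
    using neg q by (cases q) auto
  show "int_component (0 :: 'a ring_product) = 0" "int_component (1 :: 'a ring_product) = 1"
    unfolding zero_ring_product_def one_ring_product_def by (rule make_product(1)[OF in0(1)] make_product(1)[OF in0(2)], assumption)+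
  show "int_component (x + y) = int_component x + int_component y"
    "int_component (x * y) = int_component x * int_component y"
    unfolding plus_ring_product_def times_ring_product_def
    by (rule make_product(1)[OF in1(1)] make_product(1)[OF in1(2)], assumption)+
  show "int_component (- x) = - int_component x"
    unfolding uminus_ring_product_def by (rule make_product(1)[OF in2])
  show "component (C, pl, tm, z, e) 0 = z" if "cring_ops (C, pl, tm, z, e)"
    unfolding zero_ring_product_def using make_product(2)[OF in0(1) that] by simp
  show "component (C, pl, tm, z, e) 1 = e" if "cring_ops (C, pl, tm, z, e)"
    unfolding one_ring_product_def using make_product(2)[OF in0(2) that] by simp
  show "component (C, pl, tm, z, e) (x + y) =
      pl (component (C, pl, tm, z, e) x) (component (C, pl, tm, z, e) y)" if "cring_ops (C, pl, tm, z, e)"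
    unfolding plus_ring_product_def by (simp only: make_product(2)[OF in1(1) that] prod.case)
  show "component (C, pl, tm, z, e) (x * y) =
      tm (component (C, pl, tm, z, e) x) (component (C, pl, tm, z, e) y)" if "cring_ops (C, pl, tm, z, e)"
    unfolding times_ring_product_def by (simp only: make_product(2)[OF in1(2) that] prod.case)
  show "pl (component (C, pl, tm, z, e) (- x)) (component (C, pl, tm, z, e) x) = z"
    if "cring_ops (C, pl, tm, z, e)"
    unfolding uminus_ring_product_def by (simp only: make_product(2)[OF in2 that] prod.case neg[OF that])
qed

lemma cring_opsD:
  assumes "cring_ops (C, pl, tm, z, e)"
  shows "x \<in> C \<Longrightarrow> y \<in> C \<Longrightarrow> pl x y = pl y x" "x \<in> C \<Longrightarrow> y \<in> C \<Longrightarrow> tm x y = tm y x"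
    "x \<in> C \<Longrightarrow> pl z x = x" "x \<in> C \<Longrightarrow> tm e x = x"
    "x \<in> C \<Longrightarrow> y \<in> C \<Longrightarrow> w \<in> C \<Longrightarrow> pl (pl x y) w = pl x (pl y w)"
    "x \<in> C \<Longrightarrow> y \<in> C \<Longrightarrow> w \<in> C \<Longrightarrow> tm (tm x y) w = tm x (tm y w)"
    "x \<in> C \<Longrightarrow> y \<in> C \<Longrightarrow> w \<in> C \<Longrightarrow> tm (pl x y) w = pl (tm x w) (tm y w)"
  using assms unfolding cring_ops_def prod.case by blast+

instance
proof
  fix a b c :: "'a ring_product"
  show "a * b * c = a * (b * c)"
  proof (rule ring_product_eqI)
    fix q :: "'a ring_ops" assume "cring_ops q"
    then show "component q (a * b * c) = component q (a * (b * c))"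
      by (cases q) (simp add: ring_product_ops cring_opsD(3-7) component_in)
  qed (simp add: ring_product_ops)
  show "a * b = b * a"
  proof (rule ring_product_eqI)
    fix q :: "'a ring_ops" assume "cring_ops q"
    then show "component q (a * b) = component q (b * a)"
      by (cases q) (metis ring_product_ops(9) cring_opsD(2) component_in)
  qed (simp add: ring_product_ops mult.commute)
  show "1 * a = a"
  proof (rule ring_product_eqI)
    fix q :: "'a ring_ops" assume "cring_ops q"
    then show "component q (1 * a) = component q a"
      by (cases q) (simp add: ring_product_ops cring_opsD(3-7) component_in)
  qed (simp add: ring_product_ops)
  show "a + b + c = a + (b + c)"
  proof (rule ring_product_eqI)
    fix q :: "'a ring_ops" assume "cring_ops q"
    then show "component q (a + b + c) = component q (a + (b + c))"
      by (cases q) (simp add: ring_product_ops cring_opsD(3-7) component_in)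
  qed (simp add: ring_product_ops)
  show "a + b = b + a"
  proof (rule ring_product_eqI)
    fix q :: "'a ring_ops" assume "cring_ops q"
    then show "component q (a + b) = component q (b + a)"
      by (cases q) (metis ring_product_ops(8) cring_opsD(1) component_in)
  qed (simp add: ring_product_ops)
  show "0 + a = a"
  proof (rule ring_product_eqI)
    fix q :: "'a ring_ops" assume "cring_ops q"
    then show "component q (0 + a) = component q a"
      by (cases q) (simp add: ring_product_ops cring_opsD(3-7) component_in)
  qed (simp add: ring_product_ops)
  show "- a + a = 0"
  proof (rule ring_product_eqI)
    fix q :: "'a ring_ops" assume "cring_ops q"
    then show "component q (- a + a) = component q 0"
      by (cases q) (simp add: ring_product_ops)
  qed (simp add: ring_product_ops)
  show "a - b = a + - b" by (simp add: minus_ring_product_def)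
  show "(a + b) * c = a * c + b * c"
  proof (rule ring_product_eqI)
    fix q :: "'a ring_ops" assume "cring_ops q"
    then show "component q ((a + b) * c) = component q (a * c + b * c)"
      by (cases q) (simp add: ring_product_ops cring_opsD(3-7) component_in)
  qed (simp add: ring_product_ops algebra_simps)
  show "(0 :: 'a ring_product) \<noteq> 1"
  proof
    assume "(0 :: 'a ring_product) = 1"
    then have "int_component (0 :: 'a ring_product) = int_component (1 :: 'a ring_product)" by (rule arg_cong)
    then show False by (simp add: ring_product_ops)
  qed
qed

end

section \<open>Surjections from a type-class ring onto a given ring, and their kernels\<close>

locale ring_cover = cring R for R :: "('r, 'm) ring_scheme" (structure) +
  fixes \<pi> :: "'t::comm_ring_1 \<Rightarrow> 'r"
  assumes \<pi>_closed [simp, intro]: "\<pi> t \<in> carrier R"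
    and \<pi>_surj: "x \<in> carrier R \<Longrightarrow> \<exists>t. \<pi> t = x"
    and \<pi>_add: "\<pi> (s + t) = \<pi> s \<oplus> \<pi> t"
    and \<pi>_mult: "\<pi> (s * t) = \<pi> s \<otimes> \<pi> t"
    and \<pi>_0: "\<pi> 0 = \<zero>"
    and \<pi>_1: "\<pi> 1 = \<one>"

definition ring_projection :: "('r, 'm) ring_scheme \<Rightarrow> 'r ring_product \<Rightarrow> 'r" where
  "ring_projection R = component (carrier R, add R, monoid.mult R, zero R, one R)"

lemma ring_cover_projection:
  assumes "cring R" shows "ring_cover R (ring_projection R)"
proof -
  interpret cring R by fact
  have q: "cring_ops (carrier R, add R, monoid.mult R, zero R, one R)"
    unfolding cring_ops_def
    by (auto intro!: a_comm m_comm a_assoc m_assoc l_distr bexI[of _ "\<ominus>\<^bsub>R\<^esub> x" for x] simp: l_neg)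
  show ?thesis
  proof (unfold_locales, unfold ring_projection_def)
    fix x assume x: "x \<in> carrier R"
    \<comment> \<open>The preimage of \<open>x\<close> has component \<open>x\<close> at the ring
      \<open>R\<close> and zero at every other ring.\<close>
    let ?\<phi> = "\<lambda>q'. if fst q' = carrier R \<and> q' = (carrier R, add R, monoid.mult R, zero R, one R) then x
      else fst (snd (snd (snd q')))"
    have "?\<phi> q' \<in> fst q'" if "cring_ops q'" for q'
      using that x by (cases q') (simp add: cring_ops_def)
    from make_product(2)[OF this q] show "\<exists>t. component (carrier R, add R, monoid.mult R, zero R, one R) t = x"
      by (auto simp: fun_eq_iff)
  qed (use q in \<open>simp_all add: ring_product_ops component_in\<close>)
qed

context ring_cover
begin

lemma \<pi>_minus: "\<pi> (- t) = \<ominus> \<pi> t"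
  by (rule minus_equality[symmetric]) (simp_all add: \<pi>_0 flip: \<pi>_add)

lemma \<pi>_diff: "\<pi> (s - t) = \<pi> s \<ominus> \<pi> t"
  using \<pi>_add[of s "- t"] by (simp add: \<pi>_minus a_minus_def)

lemma \<pi>_eq_iff: "\<pi> s = \<pi> t \<longleftrightarrow> \<pi> (s - t) = \<zero>"
  using add.inv_solve_right'[of \<zero> "\<pi> s" "\<pi> t"] by (auto simp: \<pi>_diff a_minus_def r_neg)

lemma \<pi>_power: "\<pi> (t ^ n) = \<pi> t [^] n"
  by (induction n) (simp_all add: \<pi>_1 \<pi>_mult m_comm)

lemma \<pi>_sum: "finite A \<Longrightarrow> \<pi> (\<Sum>a\<in>A. f a) = (\<Oplus>a\<in>A. \<pi> (f a))"
  by (induction A rule: finite_induct) (simp_all add: \<pi>_0 \<pi>_add)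

definition Z :: "'t set" where "Z = {t. \<pi> t = \<zero>}"

lemma ideal_Z: "ideal_set Z"
  by (auto simp: ideal_set_def Z_def \<pi>_0 \<pi>_add \<pi>_mult)

lemma \<pi>_eq_Z: "\<pi> s = \<pi> t \<longleftrightarrow> s - t \<in> Z"
  by (simp add: Z_def \<pi>_eq_iff)

lemma one_in_Z: "1 \<in> Z \<longleftrightarrow> \<one> = \<zero>"
  by (simp add: Z_def \<pi>_1)

end

section \<open>Free modules and their quotients\<close>

lemma free_module_sel [simp]:
  "zero (free_module R X) = (\<lambda>x. \<zero>\<^bsub>R\<^esub>)"
  "add (free_module R X) p q = (\<lambda>x. p x \<oplus>\<^bsub>R\<^esub> q x)"
  "Module.smult (free_module R X) c p = (\<lambda>x. c \<otimes>\<^bsub>R\<^esub> p x)"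
  by (simp_all add: free_module_def)

lemma free_module_carrier:
  "p \<in> carrier (free_module R X) \<longleftrightarrow>
    (\<forall>x. p x \<in> carrier R) \<and> finite {x. p x \<noteq> \<zero>\<^bsub>R\<^esub>} \<and> {x. p x \<noteq> \<zero>\<^bsub>R\<^esub>} \<subseteq> X"
  by (auto simp: free_module_def)

definition Fs :: "'x set \<Rightarrow> ('x \<Rightarrow> 't::comm_ring_1) set" where
  "Fs X = {p \<in> Fn X. finite {x. p x \<noteq> 0}}"

lemma Fs_finite: "finite X \<Longrightarrow> Fs X = Fn X"
  unfolding Fs_def Fn_def by (auto intro: finite_subset[of _ X])

lemma subspace_Fs: "lsub (Fs X :: ('x \<Rightarrow> 't::comm_ring_1) set)"
proof (rule fv.subspaceI)
  show "0 \<in> Fs X" by (simp add: Fs_def Fn_def)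
next
  fix p q :: "'x \<Rightarrow> 't" assume pq: "p \<in> Fs X" "q \<in> Fs X"
  have "{x. (p + q) x \<noteq> 0} \<subseteq> {x. p x \<noteq> 0} \<union> {x. q x \<noteq> 0}" by auto
  moreover have "p + q \<in> Fn X" using pq fv.subspace_add[OF subspace_Fn] by (auto simp: Fs_def)
  ultimately show "p + q \<in> Fs X" using pq by (auto simp: Fs_def intro: finite_subset)
next
  fix c and p :: "'x \<Rightarrow> 't" assume p: "p \<in> Fs X"
  have "{x. scl c p x \<noteq> 0} \<subseteq> {x. p x \<noteq> 0}" by auto
  moreover have "scl c p \<in> Fn X" using p fv.subspace_scale[OF subspace_Fn] by (auto simp: Fs_def)
  ultimately show "scl c p \<in> Fs X" using p by (auto simp: Fs_def intro: finite_subset)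
qed

context ring_cover
begin

abbreviation FM :: "'x set \<Rightarrow> ('r, 'x \<Rightarrow> 'r) module" where "FM X \<equiv> free_module R X"

lemma comp_in_free_module: "p \<in> Fs X \<Longrightarrow> \<pi> \<circ> p \<in> carrier (FM X)"
proof -
  assume p: "p \<in> Fs X"
  have "{x. (\<pi> \<circ> p) x \<noteq> \<zero>} \<subseteq> {x. p x \<noteq> 0}" using \<pi>_0 by auto
  moreover have "{x. p x \<noteq> 0} \<subseteq> X" using p by (auto simp: Fs_def Fn_def)
  ultimately show ?thesis using p by (auto simp: Fs_def free_module_carrier intro: finite_subset)
qed

lemma free_module_lift:
  assumes "q \<in> carrier (FM X)" obtains p where "p \<in> Fs X" "\<pi> \<circ> p = q"
proof -
  obtain l where l: "\<And>x. x \<in> carrier R \<Longrightarrow> \<pi> (l x) = x" using \<pi>_surj by metis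
  \<comment> \<open>Zero coordinates are lifted to 0 rather than to some element of the kernel, so
    that the lift keeps finite support inside \<open>X\<close>.\<close>
  define p where "p x = (if q x = \<zero> then 0 else l (q x))" for x
  have q: "\<And>x. q x \<in> carrier R" "finite {x. q x \<noteq> \<zero>}" "{x. q x \<noteq> \<zero>} \<subseteq> X"
    using assms by (auto simp: free_module_carrier)
  have "\<pi> \<circ> p = q" using l q(1) by (auto simp: p_def fun_eq_iff \<pi>_0)
  moreover
  have "{x. p x \<noteq> 0} \<subseteq> {x. q x \<noteq> \<zero>}" by (auto simp: p_def)
  then have "finite {x. p x \<noteq> 0}" using q(2) by (rule finite_subset)
  moreover have "p \<in> Fn X" using q(3) by (auto simp: Fn_def p_def)
  ultimately show thesis using that unfolding Fs_def by blast
qed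

lemma free_module_image: "carrier (FM X) = (\<circ>) \<pi> ` Fs X"
proof
  show "carrier (FM X) \<subseteq> (\<circ>) \<pi> ` Fs X"
  proof
    fix q assume "q \<in> carrier (FM X)"
    then obtain p where "p \<in> Fs X" "\<pi> \<circ> p = q" by (rule free_module_lift)
    then show "q \<in> (\<circ>) \<pi> ` Fs X" by blast
  qed
qed (use comp_in_free_module in blast)

lemma comp_add: "\<pi> \<circ> (p + q) = (\<lambda>x. (\<pi> \<circ> p) x \<oplus> (\<pi> \<circ> q) x)"
  and comp_scl: "\<pi> \<circ> scl c p = (\<lambda>x. \<pi> c \<otimes> (\<pi> \<circ> p) x)"
  and comp_zero: "\<pi> \<circ> 0 = (\<lambda>x. \<zero>)"
  by (simp_all add: fun_eq_iff \<pi>_add \<pi>_mult \<pi>_0)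

lemma comp_eq_iff: "\<pi> \<circ> p = \<pi> \<circ> q \<longleftrightarrow> (\<forall>x. p x - q x \<in> Z)"
  by (simp add: fun_eq_iff \<pi>_eq_Z)

lemma module_free_module: "Module.module R (FM X)"
proof (rule moduleI)
  show "cring R" by (rule is_cring)
  have lift: "\<exists>p. p \<in> Fs X \<and> q = \<pi> \<circ> p" if "q \<in> carrier (FM X)" for q
    using free_module_lift[OF that] by metis
  show "abelian_group (FM X)"
  proof (rule abelian_groupI)
    fix x y assume xy: "x \<in> carrier (FM X)" "y \<in> carrier (FM X)"
    then obtain p q where pq: "p \<in> Fs X" "q \<in> Fs X" "x = \<pi> \<circ> p" "y = \<pi> \<circ> q" using lift by metis
    then show "x \<oplus>\<^bsub>FM X\<^esub> y \<in> carrier (FM X)"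
      using comp_in_free_module[OF fv.subspace_add[OF subspace_Fs pq(1,2)]] by (simp add: comp_add)
    show "x \<oplus>\<^bsub>FM X\<^esub> y = y \<oplus>\<^bsub>FM X\<^esub> x"
      using xy by (simp add: fun_eq_iff free_module_carrier a_comm)
    fix z assume z: "z \<in> carrier (FM X)"
    show "x \<oplus>\<^bsub>FM X\<^esub> y \<oplus>\<^bsub>FM X\<^esub> z = x \<oplus>\<^bsub>FM X\<^esub> (y \<oplus>\<^bsub>FM X\<^esub> z)"
      using xy z by (simp add: fun_eq_iff free_module_carrier a_assoc)
  next
    show "\<zero>\<^bsub>FM X\<^esub> \<in> carrier (FM X)" by (simp add: free_module_carrier)
    fix x assume x: "x \<in> carrier (FM X)"
    then show "\<zero>\<^bsub>FM X\<^esub> \<oplus>\<^bsub>FM X\<^esub> x = x" by (simp add: fun_eq_iff free_module_carrier)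
    obtain p where p: "p \<in> Fs X" "x = \<pi> \<circ> p" using lift[OF x] by metis
    have "(\<pi> \<circ> scl (- 1) p) \<oplus>\<^bsub>FM X\<^esub> x = \<zero>\<^bsub>FM X\<^esub>"
      by (simp add: p(2) fun_eq_iff \<pi>_minus l_neg)
    then show "\<exists>y\<in>carrier (FM X). y \<oplus>\<^bsub>FM X\<^esub> x = \<zero>\<^bsub>FM X\<^esub>"
      using comp_in_free_module[OF fv.subspace_scale[OF subspace_Fs p(1)]] by blast
  qed
  show "\<one> \<odot>\<^bsub>FM X\<^esub> x = x" if "x \<in> carrier (FM X)" for x
    using that by (simp add: fun_eq_iff free_module_carrier)
  fix a x assume a: "a \<in> carrier R" and x: "x \<in> carrier (FM X)"
  obtain c where c: "a = \<pi> c" using \<pi>_surj[OF a] by metis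
  obtain p where p: "p \<in> Fs X" "x = \<pi> \<circ> p" using lift[OF x] by metis
  show "a \<odot>\<^bsub>FM X\<^esub> x \<in> carrier (FM X)"
    using comp_in_free_module[OF fv.subspace_scale[OF subspace_Fs p(1), of c]]
    by (simp add: comp_scl c p(2))
  fix b assume b: "b \<in> carrier R"
  show "(a \<oplus> b) \<odot>\<^bsub>FM X\<^esub> x = a \<odot>\<^bsub>FM X\<^esub> x \<oplus>\<^bsub>FM X\<^esub> b \<odot>\<^bsub>FM X\<^esub> x"
    using a b x by (simp add: fun_eq_iff free_module_carrier l_distr)
  show "a \<otimes> b \<odot>\<^bsub>FM X\<^esub> x = a \<odot>\<^bsub>FM X\<^esub> (b \<odot>\<^bsub>FM X\<^esub> x)"
    using a b x by (simp add: fun_eq_iff free_module_carrier m_assoc)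
next
  fix a x y assume "a \<in> carrier R" "x \<in> carrier (FM X)" "y \<in> carrier (FM X)"
  then show "a \<odot>\<^bsub>FM X\<^esub> (x \<oplus>\<^bsub>FM X\<^esub> y) = a \<odot>\<^bsub>FM X\<^esub> x \<oplus>\<^bsub>FM X\<^esub> a \<odot>\<^bsub>FM X\<^esub> y"
    by (simp add: fun_eq_iff free_module_carrier r_distr)
qed

text \<open>Together with the image under composition with \<open>\<pi>\<close> this is, for finite
  \<open>X\<close>, the correspondence between submodules over \<open>R\<close> and submodules over
  \<open>T\<close> containing all vectors with coefficients in \<open>Z\<close>.\<close>

definition pull :: "'x set \<Rightarrow> ('x \<Rightarrow> 'r) set \<Rightarrow> ('x \<Rightarrow> 't) set" where
  "pull X L = {p \<in> Fs X. \<pi> \<circ> p \<in> L}"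

lemma submodule_pull:
  assumes L: "submodule L R (FM X)"
  shows "lsub (pull X L)" "\<And>p. p \<in> Fs X \<Longrightarrow> (\<And>x. p x \<in> Z) \<Longrightarrow> p \<in> pull X L"
    "(\<circ>) \<pi> ` pull X L = L"
proof -
  note E = Module.module.submoduleE[OF module_free_module L]
  obtain q where "q \<in> L" using E(2) by blast
  then have "\<zero> \<odot>\<^bsub>FM X\<^esub> q \<in> L" by (rule E(4)[OF zero_closed])
  moreover have "\<zero> \<odot>\<^bsub>FM X\<^esub> q = (\<lambda>x. \<zero>)"
    using \<open>q \<in> L\<close> E(1) by (auto simp: fun_eq_iff free_module_carrier)
  ultimately have z: "(\<lambda>x. \<zero>) \<in> L" by simp
  show *: "p \<in> pull X L" if "p \<in> Fs X" "\<And>x. p x \<in> Z" for p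
  proof -
    have "\<pi> \<circ> p = (\<lambda>x. \<zero>)" using that(2) by (simp add: Z_def fun_eq_iff)
    then show ?thesis using that(1) z by (simp add: pull_def)
  qed
  show "lsub (pull X L)"
  proof (rule fv.subspaceI)
    show "0 \<in> pull X L" by (rule *) (simp_all add: fv.subspace_0[OF subspace_Fs] idealD0[OF ideal_Z])
  next
    fix p q assume "p \<in> pull X L" "q \<in> pull X L"
    then show "p + q \<in> pull X L"
      using E(5)[of "\<pi> \<circ> p" "\<pi> \<circ> q"] fv.subspace_add[OF subspace_Fs, of p X q]
      by (simp add: pull_def comp_add)
  next
    fix c p assume "p \<in> pull X L"
    then show "scl c p \<in> pull X L"
      using E(4)[of "\<pi> c" "\<pi> \<circ> p"] fv.subspace_scale[OF subspace_Fs, of p X c]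
      by (simp add: pull_def comp_scl)
  qed
  show "(\<circ>) \<pi> ` pull X L = L"
  proof
    show "L \<subseteq> (\<circ>) \<pi> ` pull X L"
    proof
      fix q assume q: "q \<in> L"
      then obtain p where "p \<in> Fs X" "\<pi> \<circ> p = q" using free_module_lift E(1) by blast
      then show "q \<in> (\<circ>) \<pi> ` pull X L" using q by (auto simp: pull_def)
    qed
  qed (auto simp: pull_def)
qed

lemma piece_module_pull: "finite X \<Longrightarrow> submodule L R (FM X) \<Longrightarrow> piece_module Z X (pull X L)"
  using submodule_pull[of L X] by (auto simp: piece_module_def Fs_finite pull_def)

lemma submodule_push:
  assumes M: "lsub M" "M \<subseteq> Fs X"
  shows "submodule ((\<circ>) \<pi> ` M) R (FM X)"
proof (rule Module.module.submoduleI[OF module_free_module])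
  show sub: "(\<circ>) \<pi> ` M \<subseteq> carrier (FM X)" using comp_in_free_module M(2) by blast
  show "\<zero>\<^bsub>FM X\<^esub> \<in> (\<circ>) \<pi> ` M" unfolding free_module_sel comp_zero[symmetric]
    by (rule imageI) (rule fv.subspace_0[OF M(1)])
  show sm: "a \<odot>\<^bsub>FM X\<^esub> x \<in> (\<circ>) \<pi> ` M" if a: "a \<in> carrier R" and x: "x \<in> (\<circ>) \<pi> ` M" for a x
  proof -
    obtain c where c: "a = \<pi> c" using \<pi>_surj[OF a] by metis
    obtain p where p: "p \<in> M" "x = \<pi> \<circ> p" using x by blast
    have "a \<odot>\<^bsub>FM X\<^esub> x = \<pi> \<circ> scl c p" by (simp only: c p(2) comp_scl free_module_sel)
    then show ?thesis using imageI[OF fv.subspace_scale[OF M(1) p(1), of c], of "(\<circ>) \<pi>"] by (simp only:)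
  qed
  show "\<ominus>\<^bsub>FM X\<^esub> x \<in> (\<circ>) \<pi> ` M" if "x \<in> (\<circ>) \<pi> ` M" for x
  proof -
    interpret fm: Module.module R "FM X" by (rule module_free_module)
    have x: "x \<in> carrier (FM X)" using that sub by blast
    have "(\<ominus> \<one>) \<odot>\<^bsub>FM X\<^esub> x = \<ominus>\<^bsub>FM X\<^esub> x"
      using fm.smult_l_minus[OF one_closed x] by (simp only: fm.smult_one[OF x])
    then show ?thesis using sm[OF a_inv_closed[OF one_closed] that] by (simp only:)
  qed
  show "x \<oplus>\<^bsub>FM X\<^esub> y \<in> (\<circ>) \<pi> ` M" if xy: "x \<in> (\<circ>) \<pi> ` M" "y \<in> (\<circ>) \<pi> ` M" for x y
  proof -
    obtain p q where pq: "p \<in> M" "q \<in> M" "x = \<pi> \<circ> p" "y = \<pi> \<circ> q" using xy by blast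
    have "x \<oplus>\<^bsub>FM X\<^esub> y = \<pi> \<circ> (p + q)" by (simp only: pq(3,4) comp_add free_module_sel)
    then show ?thesis using imageI[OF fv.subspace_add[OF M(1) pq(1,2)], of "(\<circ>) \<pi>"] by (simp only:)
  qed
qed

lemma pull_push:
  assumes "piece_module Z X M" "finite X" shows "pull X ((\<circ>) \<pi> ` M) = M"
proof
  note M = piece_moduleD[OF assms(1)]
  show "pull X ((\<circ>) \<pi> ` M) \<subseteq> M"
  proof
    fix p assume "p \<in> pull X ((\<circ>) \<pi> ` M)"
    then obtain q where pq: "p \<in> Fn X" "q \<in> M" "\<pi> \<circ> p = \<pi> \<circ> q"
      by (auto simp: pull_def Fs_finite[OF assms(2)])
    have "p - q \<in> M"
    proof (rule M(3))
      show "p - q \<in> Fn X" using pq M(2) fv.subspace_diff[OF subspace_Fn] by blast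
      show "(p - q) x \<in> Z" for x using pq(3) by (simp add: comp_eq_iff)
    qed
    then have "(p - q) + q \<in> M" using pq(2) by (rule fv.subspace_add[OF M(1)])
    then show "p \<in> M" by simp
  qed
  show "M \<subseteq> pull X ((\<circ>) \<pi> ` M)" using M(2) by (auto simp: pull_def Fs_finite[OF assms(2)])
qed

end

subsection \<open>Fractions\<close>

text \<open>Ring fractions and module fractions are treated together: \<open>\<rho>\<close> presents
  the fractionated object as \<open>V\<close> modulo \<open>M\<close>. For the ring itself
  \<open>V\<close> is all of \<open>T\<close> and \<open>M\<close> is \<open>Z\<close>; for the
  quotient of a free module \<open>V\<close> is \<open>Fn X\<close> and \<open>M\<close> is the
  preimage of the submodule.\<close>

locale fraction_cover = ring_cover R \<pi> + fr: Modules.module scale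
  for R :: "('r, 'm) ring_scheme" (structure) and \<pi> :: "'t::comm_ring_1 \<Rightarrow> 'r"
    and scale :: "'t \<Rightarrow> 'b::ab_group_add \<Rightarrow> 'b" (infixr \<open>*s\<close> 75) +
  fixes F :: 't and V M :: "'b set" and \<rho> :: "'b \<Rightarrow> 'w" and act :: "'r \<Rightarrow> 'w \<Rightarrow> 'w"
  assumes V: "fr.subspace V" and M: "fr.subspace M" and MV: "M \<subseteq> V"
    and ZV: "c \<in> Z \<Longrightarrow> v \<in> V \<Longrightarrow> c *s v \<in> M"
    and \<rho>_eq: "v \<in> V \<Longrightarrow> w \<in> V \<Longrightarrow> \<rho> v = \<rho> w \<longleftrightarrow> v - w \<in> M"
    and act_\<rho>: "v \<in> V \<Longrightarrow> act (\<pi> c) (\<rho> v) = \<rho> (c *s v)"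
begin

definition frac :: "'b \<Rightarrow> nat \<Rightarrow> ('w \<times> nat) set" where
  "frac v i = fraction R (\<pi> F) act (\<rho> ` V) (\<rho> v) i"

definition equivalent :: "'b \<Rightarrow> nat \<Rightarrow> 'b \<Rightarrow> nat \<Rightarrow> bool" where
  "equivalent v i w j \<longleftrightarrow> (\<exists>l. F ^ (l + j) *s v - F ^ (l + i) *s w \<in> M)"

lemma frac_alt:
  assumes v: "v \<in> V" shows "frac v i = {(\<rho> w, j) | w j. w \<in> V \<and> equivalent v i w j}"
proof -
  have "act (\<pi> F [^] n) (\<rho> w) = \<rho> (F ^ n *s w)" if "w \<in> V" for w n
    using act_\<rho>[OF that, of "F ^ n"] by (simp add: \<pi>_power)
  then have "(act (\<pi> F [^] (l + j)) (\<rho> v) = act (\<pi> F [^] (l + i)) (\<rho> w)) \<longleftrightarrow>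
      F ^ (l + j) *s v - F ^ (l + i) *s w \<in> M" if "w \<in> V" for w l j
    using that v fr.subspace_scale[OF V] by (simp add: \<rho>_eq)
  then show ?thesis unfolding frac_def fraction_def equivalent_def by blast
qed

lemma equivalent_sym: "equivalent v i w j \<Longrightarrow> equivalent w j v i"
  unfolding equivalent_def using fr.subspace_neg[OF M] by (metis (no_types) minus_diff_eq)

lemma equivalent_trans:
  assumes "equivalent u i v j" "equivalent v j w k" shows "equivalent u i w k"
proof -
  obtain l where l: "F ^ (l + j) *s u - F ^ (l + i) *s v \<in> M" using assms(1) by (auto simp: equivalent_def)
  obtain m where m: "F ^ (m + k) *s v - F ^ (m + j) *s w \<in> M" using assms(2) by (auto simp: equivalent_def)
  have "F ^ (m + k) *s (F ^ (l + j) *s u - F ^ (l + i) *s v) +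
      F ^ (l + i) *s (F ^ (m + k) *s v - F ^ (m + j) *s w) \<in> M"
    by (intro fr.subspace_add[OF M] fr.subspace_scale[OF M] l m)
  also have "F ^ (m + k) *s (F ^ (l + j) *s u - F ^ (l + i) *s v) +
      F ^ (l + i) *s (F ^ (m + k) *s v - F ^ (m + j) *s w) =
      F ^ ((m + l + j) + k) *s u - F ^ ((m + l + j) + i) *s w"
    by (simp add: fr.scale_right_diff_distrib power_add ac_simps)
  finally show ?thesis unfolding equivalent_def by blast
qed

lemma equivalent_refl: "equivalent v i v i"
  unfolding equivalent_def using fr.subspace_0[OF M] by auto

lemma frac_eq_iff:
  assumes "v \<in> V" "w \<in> V" shows "frac v i = frac w j \<longleftrightarrow> equivalent v i w j"
proof
  assume "frac v i = frac w j"
  moreover have "(\<rho> w, j) \<in> frac w j" using assms equivalent_refl by (auto simp: frac_alt)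
  ultimately have "(\<rho> w, j) \<in> frac v i" by simp
  then obtain w' where w': "w' \<in> V" "\<rho> w' = \<rho> w" "equivalent v i w' j"
    unfolding frac_alt[OF assms(1)] by auto
  have "w' - w \<in> M" using \<rho>_eq[OF w'(1) assms(2)] w'(2) by simp
  then have "F ^ (0 + j) *s w' - F ^ (0 + j) *s w \<in> M"
    using fr.subspace_scale[OF M, of "w' - w" "F ^ (0 + j)"] by (simp add: fr.scale_right_diff_distrib)
  then have "equivalent w' j w j" unfolding equivalent_def by blast
  then show "equivalent v i w j" using equivalent_trans w'(3) by blast
next
  assume "equivalent v i w j"
  then have "equivalent v i u k \<longleftrightarrow> equivalent w j u k" for u k
    using equivalent_trans[of v i w j u k] equivalent_trans[of w j v i u k] equivalent_sym[of v i w j]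
    by argo
  then show "frac v i = frac w j" using assms by (simp add: frac_alt)
qed

lemma frac_eqI:
  assumes "v \<in> V" "w \<in> V" "F ^ j *s v = F ^ i *s w" shows "frac v i = frac w j"
proof -
  have "equivalent v i w j"
    unfolding equivalent_def by (rule exI[of _ 0]) (simp add: assms(3) fr.subspace_0[OF M])
  then show ?thesis using frac_eq_iff[OF assms(1,2)] by blast
qed

text \<open>The operations on fractions are defined as unions over all representatives. If the value
  does not depend on the representative, the union collapses to that value.\<close>

lemma Union_frac:
  assumes v: "v \<in> V" and "\<And>w j. w \<in> V \<Longrightarrow> equivalent v i w j \<Longrightarrow> G (\<rho> w) j = S"
  shows "(\<Union>(a, j)\<in>frac v i. G a j) = S"
proof -
  have "G a j = S" if "(a, j) \<in> frac v i" for a j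
    using that assms by (auto simp: frac_alt)
  moreover have "(\<rho> v, i) \<in> frac v i" using v equivalent_refl by (auto simp: frac_alt)
  ultimately show ?thesis by blast
qed

lemma equivalent_add:
  assumes "equivalent v i v' i'" "equivalent w j w' j'"
  shows "equivalent (F ^ j *s v + F ^ i *s w) (i + j) (F ^ j' *s v' + F ^ i' *s w') (i' + j')"
proof -
  obtain l where l: "F ^ (l + i') *s v - F ^ (l + i) *s v' \<in> M" using assms(1) by (auto simp: equivalent_def)
  obtain m where m: "F ^ (m + j') *s w - F ^ (m + j) *s w' \<in> M" using assms(2) by (auto simp: equivalent_def)
  have "F ^ (m + j + j') *s (F ^ (l + i') *s v - F ^ (l + i) *s v') +
      F ^ (l + i + i') *s (F ^ (m + j') *s w - F ^ (m + j) *s w') \<in> M"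
    by (intro fr.subspace_add[OF M] fr.subspace_scale[OF M] l m)
  also have "F ^ (m + j + j') *s (F ^ (l + i') *s v - F ^ (l + i) *s v') +
      F ^ (l + i + i') *s (F ^ (m + j') *s w - F ^ (m + j) *s w') =
     F ^ ((l + m) + (i' + j')) *s (F ^ j *s v + F ^ i *s w) -
     F ^ ((l + m) + (i + j)) *s (F ^ j' *s v' + F ^ i' *s w')"
    by (simp add: fr.scale_right_diff_distrib fr.scale_right_distrib power_add ac_simps)
  finally show ?thesis unfolding equivalent_def by blast
qed

lemma equivalent_mult:
  assumes "F ^ (l + i') * a - F ^ (l + i) * a' \<in> Z" "equivalent w j w' j'" "w \<in> V" "w' \<in> V"
  shows "equivalent (a *s w) (i + j) (a' *s w') (i' + j')"
proof -
  obtain m where m: "F ^ (m + j') *s w - F ^ (m + j) *s w' \<in> M" using assms(2) by (auto simp: equivalent_def)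
  have "(F ^ (l + i') * a - F ^ (l + i) * a') *s (F ^ (m + j') *s w) +
      (F ^ (l + i) * a') *s (F ^ (m + j') *s w - F ^ (m + j) *s w') \<in> M"
    by (intro fr.subspace_add[OF M] ZV[OF assms(1)] fr.subspace_scale[OF V] assms(3) fr.subspace_scale[OF M] m)
  also have "(F ^ (l + i') * a - F ^ (l + i) * a') *s (F ^ (m + j') *s w) +
      (F ^ (l + i) * a') *s (F ^ (m + j') *s w - F ^ (m + j) *s w') =
     F ^ ((l + m) + (i' + j')) *s (a *s w) - F ^ ((l + m) + (i + j)) *s (a' *s w')"
    by (simp add: algebra_simps power_add)
  finally show ?thesis unfolding equivalent_def by blast
qed

end

subsection \<open>Localization at an element\<close>

lemma module_mult: "Modules.module ((*) :: 't::comm_ring_1 \<Rightarrow> 't \<Rightarrow> 't)"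
  by standard (auto simp: algebra_simps)

lemma subspace_mult_iff: "Modules.module.subspace (*) Q \<longleftrightarrow> ideal_set (Q :: 't::comm_ring_1 set)"
  by (simp add: Modules.module.subspace_def[OF module_mult] ideal_set_def)

locale localized_ring = ring_cover R \<pi>
  for R :: "('r, 'm) ring_scheme" (structure) and \<pi> :: "'t::comm_ring_1 \<Rightarrow> 'r" +
  fixes F :: 't
begin

sublocale rfr: fraction_cover R \<pi> "(*)" F UNIV Z \<pi> "monoid.mult R"
proof (intro fraction_cover.intro fraction_cover_axioms.intro ring_cover_axioms module_mult)
  show "Modules.module.subspace (*) (UNIV :: 't set)"
    by (simp add: subspace_mult_iff ideal_set_def)
  show "Modules.module.subspace (*) Z" using ideal_Z by (simp add: subspace_mult_iff)
  show "c * v \<in> Z" if "c \<in> Z" for c v using idealD_mult2[OF ideal_Z that] .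
qed (simp_all add: \<pi>_eq_Z \<pi>_mult)

declare rfr.fr.scale_scale [simp del]

abbreviation K :: "('r \<times> nat) set ring" where "K \<equiv> loc_ring R (\<pi> F)"

abbreviation fr :: "'t \<Rightarrow> nat \<Rightarrow> ('r \<times> nat) set" where "fr \<equiv> rfr.frac"

text \<open>The kernel of the map from \<open>T\<close> to the localization of \<open>R\<close> at
  the powers of \<open>\<pi> F\<close>.\<close>

definition Zf :: "'t set" where "Zf = {c. \<exists>l. F ^ l * c \<in> Z}"

lemma range_\<pi>: "range \<pi> = carrier R"
  using \<pi>_surj by force

lemma ring_fraction_fr: "ring_fraction R (\<pi> F) (\<pi> x) i = fr x i"
  by (simp add: rfr.frac_def range_\<pi>)

lemma fr_eq_iff: "fr x i = fr y j \<longleftrightarrow> (\<exists>l. F ^ l * (F ^ j * x - F ^ i * y) \<in> Z)"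
proof -
  have "F ^ l * (F ^ j * x - F ^ i * y) = F ^ (l + j) * x - F ^ (l + i) * y" for l
    by (simp only: power_add right_diff_distrib mult.assoc)
  then show ?thesis by (simp only: rfr.frac_eq_iff[OF UNIV_I UNIV_I] rfr.equivalent_def)
qed

lemma fr_eqI: "F ^ j * x = F ^ i * y \<Longrightarrow> fr x i = fr y j"
  by (rule rfr.frac_eqI) simp_all

lemma Zf_shift: "F ^ l * c \<in> Zf \<Longrightarrow> c \<in> Zf"
  unfolding Zf_def mem_Collect_eq mult.assoc[symmetric] power_add[symmetric] by blast

lemma ideal_Zf: "ideal_set Zf"
  unfolding ideal_set_def
proof (intro conjI ballI allI)
  show "0 \<in> Zf" using idealD0[OF ideal_Z] by (simp add: Zf_def)
  fix a b assume "a \<in> Zf" "b \<in> Zf"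
  then obtain l m where l: "F ^ l * a \<in> Z" and m: "F ^ m * b \<in> Z" unfolding Zf_def by blast
  have "F ^ m * (F ^ l * a) + F ^ l * (F ^ m * b) \<in> Z"
    using idealD_add[OF ideal_Z idealD_mult[OF ideal_Z l, of "F ^ m"] idealD_mult[OF ideal_Z m, of "F ^ l"]] .
  moreover have "F ^ m * (F ^ l * a) + F ^ l * (F ^ m * b) = F ^ (l + m) * (a + b)"
    by (simp add: power_add algebra_simps)
  ultimately have "F ^ (l + m) * (a + b) \<in> Z" by (simp only:)
  then show "a + b \<in> Zf" unfolding Zf_def by blast
next
  fix c a assume "a \<in> Zf"
  then obtain l where l: "F ^ l * a \<in> Z" unfolding Zf_def by blast
  have "F ^ l * (c * a) \<in> Z" using idealD_mult[OF ideal_Z l, of c] by (simp add: ac_simps)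
  then show "c * a \<in> Zf" unfolding Zf_def by blast
qed

lemma Z_Zf: "Z \<subseteq> Zf"
proof
  fix c assume "c \<in> Z"
  then have "F ^ 0 * c \<in> Z" by simp
  then show "c \<in> Zf" unfolding Zf_def by blast
qed

lemma fr_zero_iff: "fr x i = fr 0 j \<longleftrightarrow> x \<in> Zf"
proof
  assume "fr x i = fr 0 j"
  then obtain l where "F ^ l * (F ^ j * x - F ^ i * 0) \<in> Z" unfolding fr_eq_iff by blast
  then have "F ^ (l + j) * x \<in> Z" by (simp add: power_add mult.assoc)
  then show "x \<in> Zf" unfolding Zf_def by blast
next
  assume "x \<in> Zf"
  then obtain l where "F ^ l * x \<in> Z" unfolding Zf_def by blast
  then have "F ^ l * (F ^ j * x - F ^ i * 0) \<in> Z"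
    using idealD_mult[OF ideal_Z, of "F ^ l * x" "F ^ j"] by (simp add: ac_simps)
  then show "fr x i = fr 0 j" unfolding fr_eq_iff by blast
qed

lemma K_carrier: "carrier K = {fr x i | x i. True}"
proof -
  have "carrier K = {ring_fraction R (\<pi> F) a i | a i. a \<in> carrier R}" by (simp add: loc_ring_def)
  also have "\<dots> = {fr x i | x i. True}"
  proof (intro equalityI subsetI)
    fix y assume "y \<in> {ring_fraction R (\<pi> F) a i | a i. a \<in> carrier R}"
    then obtain a i where y: "y = ring_fraction R (\<pi> F) a i" "a \<in> carrier R" by blast
    obtain t where "\<pi> t = a" using \<pi>_surj[OF y(2)] by blast
    then have "y = fr t i" using y(1) ring_fraction_fr[of t i] by simp
    then show "y \<in> {fr x i | x i. True}" by blast
  next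
    fix y assume "y \<in> {fr x i | x i. True}"
    then obtain t i where "y = ring_fraction R (\<pi> F) (\<pi> t) i" using ring_fraction_fr by blast
    then show "y \<in> {ring_fraction R (\<pi> F) a i | a i. a \<in> carrier R}" using \<pi>_closed by blast
  qed
  finally show ?thesis .
qed

lemma fr_closed [simp, intro]: "fr x i \<in> carrier K"
  by (auto simp: K_carrier)

lemma K_one: "\<one>\<^bsub>K\<^esub> = fr 1 0" and K_zero: "\<zero>\<^bsub>K\<^esub> = fr 0 0"
  using ring_fraction_fr[of 1 0] ring_fraction_fr[of 0 0] by (simp_all add: loc_ring_def \<pi>_1 \<pi>_0)

lemma K_zero_iff: "fr x i = \<zero>\<^bsub>K\<^esub> \<longleftrightarrow> x \<in> Zf"
  by (simp add: K_zero fr_zero_iff)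

lemma K_add: "fr x i \<oplus>\<^bsub>K\<^esub> fr y j = fr (F ^ j * x + F ^ i * y) (i + j)"
proof -
  have "fr x i \<oplus>\<^bsub>K\<^esub> fr y j = (\<Union>(a, i')\<in>fr x i. \<Union>(b, j')\<in>fr y j.
       ring_fraction R (\<pi> F) ((\<pi> F [^] j' \<otimes> a) \<oplus> (\<pi> F [^] i' \<otimes> b)) (i' + j'))"
    by (simp add: loc_ring_def)
  also have "\<dots> = fr (F ^ j * x + F ^ i * y) (i + j)"
  proof (rule rfr.Union_frac[OF UNIV_I], rule rfr.Union_frac[OF UNIV_I])
    fix v i' w j' assume "rfr.equivalent x i v i'" "rfr.equivalent y j w j'"
    from rfr.equivalent_add[OF this]
    have "fr (F ^ j * x + F ^ i * y) (i + j) = fr (F ^ j' * v + F ^ i' * w) (i' + j')"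
      by (simp add: rfr.frac_eq_iff)
    then show "ring_fraction R (\<pi> F) ((\<pi> F [^] j' \<otimes> \<pi> v) \<oplus> (\<pi> F [^] i' \<otimes> \<pi> w)) (i' + j') =
        fr (F ^ j * x + F ^ i * y) (i + j)"
      by (simp only: \<pi>_power[symmetric] \<pi>_mult[symmetric] \<pi>_add[symmetric] ring_fraction_fr)
  qed
  finally show ?thesis .
qed

lemma K_mult: "fr x i \<otimes>\<^bsub>K\<^esub> fr y j = fr (x * y) (i + j)"
proof -
  have "fr x i \<otimes>\<^bsub>K\<^esub> fr y j = (\<Union>(a, i')\<in>fr x i. \<Union>(b, j')\<in>fr y j.
       ring_fraction R (\<pi> F) (a \<otimes> b) (i' + j'))"
    by (simp add: loc_ring_def)
  also have "\<dots> = fr (x * y) (i + j)"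
  proof (rule rfr.Union_frac[OF UNIV_I], rule rfr.Union_frac[OF UNIV_I])
    fix v i' w j' assume 1: "rfr.equivalent x i v i'" and 2: "rfr.equivalent y j w j'"
    obtain l where "F ^ (l + i') * x - F ^ (l + i) * v \<in> Z" using 1 unfolding rfr.equivalent_def by blast
    from rfr.equivalent_mult[OF this 2]
    have "fr (x * y) (i + j) = fr (v * w) (i' + j')" by (simp add: rfr.frac_eq_iff)
    then show "ring_fraction R (\<pi> F) (\<pi> v \<otimes> \<pi> w) (i' + j') = fr (x * y) (i + j)"
      by (simp only: \<pi>_mult[symmetric] ring_fraction_fr)
  qed
  finally show ?thesis .
qed

lemma fr_add_same: "fr x n \<oplus>\<^bsub>K\<^esub> fr y n = fr (x + y) n"
  unfolding K_add by (rule fr_eqI) (simp add: power_add algebra_simps)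

lemma cring_K: "cring K"
proof (rule cringI)
  have ex: "\<exists>a i. x = fr a i" if "x \<in> carrier K" for x using that by (auto simp: K_carrier)
  show "abelian_group K"
  proof (rule abelian_groupI)
    fix x y assume "x \<in> carrier K" "y \<in> carrier K"
    then obtain a i b j where [simp]: "x = fr a i" "y = fr b j" using ex by metis
    show "x \<oplus>\<^bsub>K\<^esub> y \<in> carrier K" by (simp add: K_add)
    show "x \<oplus>\<^bsub>K\<^esub> y = y \<oplus>\<^bsub>K\<^esub> x" by (simp add: K_add ac_simps)
    fix z assume "z \<in> carrier K"
    then obtain c k where [simp]: "z = fr c k" using ex by metis
    show "x \<oplus>\<^bsub>K\<^esub> y \<oplus>\<^bsub>K\<^esub> z = x \<oplus>\<^bsub>K\<^esub> (y \<oplus>\<^bsub>K\<^esub> z)"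
      by (simp add: K_add algebra_simps power_add)
  next
    show "\<zero>\<^bsub>K\<^esub> \<in> carrier K" by (simp add: K_zero)
    fix x assume "x \<in> carrier K"
    then obtain a i where [simp]: "x = fr a i" using ex by metis
    show "\<zero>\<^bsub>K\<^esub> \<oplus>\<^bsub>K\<^esub> x = x" by (simp add: K_zero K_add)
    have "fr (- a) i \<oplus>\<^bsub>K\<^esub> x = \<zero>\<^bsub>K\<^esub>" by (simp add: fr_add_same K_zero fr_eq_iff idealD0[OF ideal_Z])
    then show "\<exists>y\<in>carrier K. y \<oplus>\<^bsub>K\<^esub> x = \<zero>\<^bsub>K\<^esub>" by (rule bexI) simp
  qed
  show "comm_monoid K"
  proof (rule comm_monoidI)
    fix x y assume "x \<in> carrier K" "y \<in> carrier K"
    then obtain a i b j where [simp]: "x = fr a i" "y = fr b j" using ex by metis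
    show "x \<otimes>\<^bsub>K\<^esub> y \<in> carrier K" by (simp add: K_mult)
    show "x \<otimes>\<^bsub>K\<^esub> y = y \<otimes>\<^bsub>K\<^esub> x" by (simp add: K_mult ac_simps)
    fix z assume "z \<in> carrier K"
    then obtain c k where [simp]: "z = fr c k" using ex by metis
    show "x \<otimes>\<^bsub>K\<^esub> y \<otimes>\<^bsub>K\<^esub> z = x \<otimes>\<^bsub>K\<^esub> (y \<otimes>\<^bsub>K\<^esub> z)"
      by (simp add: K_mult ac_simps)
  next
    show "\<one>\<^bsub>K\<^esub> \<in> carrier K" by (simp add: K_one)
    fix x assume "x \<in> carrier K"
    then obtain a i where [simp]: "x = fr a i" using ex by metis
    show "\<one>\<^bsub>K\<^esub> \<otimes>\<^bsub>K\<^esub> x = x" by (simp add: K_one K_mult)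
  qed
  fix x y z assume "x \<in> carrier K" "y \<in> carrier K" "z \<in> carrier K"
  then obtain a i b j c k where [simp]: "x = fr a i" "y = fr b j" "z = fr c k" using ex by metis
  show "(x \<oplus>\<^bsub>K\<^esub> y) \<otimes>\<^bsub>K\<^esub> z = x \<otimes>\<^bsub>K\<^esub> z \<oplus>\<^bsub>K\<^esub> y \<otimes>\<^bsub>K\<^esub> z"
    unfolding \<open>x = fr a i\<close> \<open>y = fr b j\<close> \<open>z = fr c k\<close> K_add K_mult
    by (rule fr_eqI) (simp add: power_add algebra_simps)
qed

sublocale K: cring K by (rule cring_K)

lemma fr_minus_one: "\<ominus>\<^bsub>K\<^esub> \<one>\<^bsub>K\<^esub> = fr (- 1) 0"
proof (rule K.minus_equality)
  show "fr (- 1) 0 \<oplus>\<^bsub>K\<^esub> \<one>\<^bsub>K\<^esub> = \<zero>\<^bsub>K\<^esub>" by (simp add: K_one K_zero fr_add_same)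
qed (simp_all add: K_one)

lemma fr_minus_one_power: "(\<ominus>\<^bsub>K\<^esub> \<one>\<^bsub>K\<^esub>) [^]\<^bsub>K\<^esub> (i::nat) = fr ((- 1) ^ i) 0"
  unfolding fr_minus_one by (induction i) (simp_all add: K_one K_mult)

lemma fr_sum: "finite A \<Longrightarrow> (\<Oplus>\<^bsub>K\<^esub>a\<in>A. fr (x a) n) = fr (\<Sum>a\<in>A. x a) n"
  by (induction A rule: finite_induct) (simp_all add: fr_add_same K_zero_iff[symmetric] K_zero fr_zero_iff idealD0[OF ideal_Zf])

lemma fr_prod: "finite A \<Longrightarrow> (\<Otimes>\<^bsub>K\<^esub>a\<in>A. fr (x a) (n a)) = fr (\<Prod>a\<in>A. x a) (\<Sum>a\<in>A. n a)"
  by (induction A rule: finite_induct) (simp_all add: K_mult K_one)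

text \<open>The denominators depend on the row only, so all Leibniz terms have the same denominator
  and the determinant can be formed from the numerators.\<close>

lemma ring_det_fr:
  assumes "\<And>i j. i < m \<Longrightarrow> j < m \<Longrightarrow> A i j = fr (M i j) (n i)"
  shows "ring_det K m A = fr (dt m M) (\<Sum>i<m. n i)"
proof -
  have fin: "finite {\<pi>. \<pi> permutes {..<m}}" by (simp add: finite_permutations)
  have "(if evenperm p then \<one>\<^bsub>K\<^esub> else \<ominus>\<^bsub>K\<^esub> \<one>\<^bsub>K\<^esub>) \<otimes>\<^bsub>K\<^esub> (\<Otimes>\<^bsub>K\<^esub>i\<in>{..<m}. A i (p i)) =
      fr (signof p * (\<Prod>i<m. M i (p i))) (\<Sum>i<m. n i)" if p: "p permutes {..<m}" for p
  proof -
    have "p i < m" if "i < m" for i using permutes_in_image[OF p, of i] that by simp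
    then have "(\<Otimes>\<^bsub>K\<^esub>i\<in>{..<m}. A i (p i)) = (\<Otimes>\<^bsub>K\<^esub>i\<in>{..<m}. fr (M i (p i)) (n i))"
      using assms by (intro K.finprod_cong') auto
    also have "\<dots> = fr (\<Prod>i<m. M i (p i)) (\<Sum>i<m. n i)" by (rule fr_prod) simp
    finally have "(\<Otimes>\<^bsub>K\<^esub>i\<in>{..<m}. A i (p i)) = fr (\<Prod>i<m. M i (p i)) (\<Sum>i<m. n i)" .
    moreover have "(if evenperm p then \<one>\<^bsub>K\<^esub> else \<ominus>\<^bsub>K\<^esub> \<one>\<^bsub>K\<^esub>) = fr (signof p) 0"
      unfolding fr_minus_one by (simp add: K_one sign_def)
    ultimately show ?thesis by (simp only: K_mult add_0_left)
  qed
  then have "ring_det K m A = (\<Oplus>\<^bsub>K\<^esub>p\<in>{p. p permutes {..<m}}.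
      fr (signof p * (\<Prod>i<m. M i (p i))) (\<Sum>i<m. n i))"
    unfolding ring_det_def by (intro K.finsum_cong') auto
  also have "\<dots> = fr (dt m M) (\<Sum>i<m. n i)" unfolding fr_sum[OF fin] dt_leibniz ..
  finally show ?thesis .
qed

text \<open>A trivialization over \<open>D(F)\<close> in terms of the coordinates \<open>a x\<close> of the images of the basis
  elements, after clearing denominators.\<close>

definition trivial_data :: "('x \<Rightarrow> 't) set \<Rightarrow> 'x set \<Rightarrow> nat \<Rightarrow> ('x \<Rightarrow> nat \<Rightarrow> 't) \<Rightarrow> bool" where
  "trivial_data M X r a \<longleftrightarrow>
    (\<forall>p\<in>Fn X. (\<exists>l. scl (F ^ l) p \<in> M) \<longleftrightarrow> (\<forall>j<r. (\<Sum>x\<in>X. p x * a x j) \<in> Zf)) \<and>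
    (\<forall>j<r. \<exists>p\<in>Fn X. \<exists>i. \<forall>j'<r. (\<Sum>x\<in>X. p x * a x j') - (if j' = j then F ^ i else 0) \<in> Zf)"

lemma common_denominator:
  assumes "finite A" "\<And>a. a \<in> A \<Longrightarrow> y a \<in> carrier K"
  shows "\<exists>N x. \<forall>a\<in>A. y a = fr (x a) N"
proof -
  have "\<forall>a\<in>A. \<exists>b i. y a = fr b i" using assms(2) by (auto simp: K_carrier)
  then obtain b i where b: "\<And>a. a \<in> A \<Longrightarrow> y a = fr (b a) (i a)" by metis
  have "y a = fr (F ^ (sum i A - i a) * b a) (sum i A)" if "a \<in> A" for a
  proof -
    have "i a \<le> sum i A" using member_le_sum[OF that, of i] assms(1) by simp
    then have "F ^ sum i A = F ^ i a * F ^ (sum i A - i a)" by (simp flip: power_add)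
    then show ?thesis unfolding b[OF that] by (intro fr_eqI) (simp add: ac_simps)
  qed
  then show ?thesis by (intro exI ballI)
qed

end

subsection \<open>Localization of a quotient of a free module\<close>

locale localized_quotient = localized_ring R \<pi> F
  for R :: "('r, 'm) ring_scheme" (structure) and \<pi> :: "'t::comm_ring_1 \<Rightarrow> 'r" and F +
  fixes X :: "'x set" and L :: "('x \<Rightarrow> 'r) set"
  assumes finX: "finite X" and L: "submodule L R (FM X)"
begin

abbreviation M :: "('x \<Rightarrow> 't) set" where "M \<equiv> pull X L"
abbreviation W :: "('r, ('x \<Rightarrow> 'r) set) module" where "W \<equiv> quotient_module (FM X) L"

lemma M_piece: "piece_module Z X M" by (rule piece_module_pull[OF finX L])

lemmas M_sub = piece_moduleD[OF M_piece]

definition cos :: "('x \<Rightarrow> 't) \<Rightarrow> ('x \<Rightarrow> 'r) set" where "cos p = L +>\<^bsub>FM X\<^esub> (\<pi> \<circ> p)"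

lemma cos_alt: "cos p = {\<pi> \<circ> (m + p) | m. m \<in> M}"
proof -
  have "cos p = (\<Union>l\<in>(\<circ>) \<pi> ` M. {l \<oplus>\<^bsub>FM X\<^esub> (\<pi> \<circ> p)})"
    unfolding cos_def a_r_coset_def' submodule_pull(3)[OF L] ..
  also have "\<dots> = {\<pi> \<circ> (m + p) | m. m \<in> M}"
    by (auto simp: comp_add)
  finally show ?thesis .
qed

lemma cos_eq_iff:
  assumes "p \<in> Fn X" "q \<in> Fn X" shows "cos p = cos q \<longleftrightarrow> p - q \<in> M"
proof
  assume "cos p = cos q"
  moreover have "\<pi> \<circ> (0 + p) \<in> cos p" unfolding cos_alt using fv.subspace_0[OF M_sub(1)] by blast
  ultimately obtain m where m: "m \<in> M" "\<pi> \<circ> (0 + p) = \<pi> \<circ> (m + q)" unfolding cos_alt by blast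
  have "p - (m + q) \<in> M"
  proof (rule M_sub(3))
    show "p - (m + q) \<in> Fn X"
      using assms m(1) M_sub(2) fv.subspace_diff[OF subspace_Fn] fv.subspace_add[OF subspace_Fn] by blast
    show "(p - (m + q)) x \<in> Z" for x using m(2) unfolding comp_eq_iff by simp
  qed
  then have "(p - (m + q)) + m \<in> M" using m(1) by (rule fv.subspace_add[OF M_sub(1)])
  then show "p - q \<in> M" by simp
next
  assume d: "p - q \<in> M"
  have sub: "cos p \<subseteq> cos q" if "p - q \<in> M" for p q
  proof
    fix y assume "y \<in> cos p"
    then obtain m where m: "m \<in> M" "y = \<pi> \<circ> (m + p)" unfolding cos_alt by blast
    have "m + p = (m + (p - q)) + q" by simp
    then have "y = \<pi> \<circ> ((m + (p - q)) + q)" using m(2) by (simp only:)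
    then show "y \<in> cos q" using fv.subspace_add[OF M_sub(1) m(1) that] unfolding cos_alt by blast
  qed
  have "q - p \<in> M" using fv.subspace_neg[OF M_sub(1) d] by simp
  then show "cos p = cos q" using sub d by blast
qed

lemma W_carrier: "carrier W = cos ` Fn X"
  unfolding quotient_module_def A_RCOSETS_def' cos_def
  by (auto simp: free_module_image Fs_finite[OF finX])

lemma W_add: "cos p \<oplus>\<^bsub>W\<^esub> cos q = cos (p + q)"
proof -
  have "cos p \<oplus>\<^bsub>W\<^esub> cos q = (\<Union>h\<in>cos p. \<Union>k\<in>cos q. {h \<oplus>\<^bsub>FM X\<^esub> k})"
    by (simp add: quotient_module_def set_add_def')
  also have "\<dots> = {\<pi> \<circ> ((m + p) + (m' + q)) | m m'. m \<in> M \<and> m' \<in> M}"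
    unfolding cos_alt free_module_sel comp_add[of "_ + p" "_ + q"] by blast
  also have "\<dots> = cos (p + q)"
  proof
    show "{\<pi> \<circ> ((m + p) + (m' + q)) | m m'. m \<in> M \<and> m' \<in> M} \<subseteq> cos (p + q)"
    proof safe
      fix m m' assume m: "m \<in> M" "m' \<in> M"
      have "(m + p) + (m' + q) = (m + m') + (p + q)" by (simp add: add.assoc add.left_commute)
      then have "\<pi> \<circ> ((m + p) + (m' + q)) = \<pi> \<circ> ((m + m') + (p + q))" by (simp only:)
      then show "\<pi> \<circ> ((m + p) + (m' + q)) \<in> cos (p + q)"
        using fv.subspace_add[OF M_sub(1) m] unfolding cos_alt by blast
    qed
    show "cos (p + q) \<subseteq> {\<pi> \<circ> ((m + p) + (m' + q)) | m m'. m \<in> M \<and> m' \<in> M}"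
    proof
      fix y assume "y \<in> cos (p + q)"
      then obtain m where m: "m \<in> M" "y = \<pi> \<circ> (m + (p + q))" unfolding cos_alt by blast
      have "m + (p + q) = (m + p) + (0 + q)" by (simp only: add.assoc add_0_left)
      then have "y = \<pi> \<circ> ((m + p) + (0 + q))" using m(2) by (simp only:)
      then show "y \<in> {\<pi> \<circ> ((m + p) + (m' + q)) | m m'. m \<in> M \<and> m' \<in> M}"
        using m(1) fv.subspace_0[OF M_sub(1)] by blast
    qed
  qed
  finally show ?thesis .
qed

lemma W_smult:
  assumes p: "p \<in> Fn X" shows "\<pi> c \<odot>\<^bsub>W\<^esub> cos p = cos (scl c p)"
proof -
  have "L +>\<^bsub>FM X\<^esub> (\<pi> c \<odot>\<^bsub>FM X\<^esub> y) = cos (scl c p)" if y: "y \<in> cos p" for y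
  proof -
    obtain m where m: "m \<in> M" "y = \<pi> \<circ> (m + p)" using y unfolding cos_alt by blast
    have mp: "m + p \<in> Fn X" using fv.subspace_add[OF subspace_Fn] m(1) p M_sub(2) by blast
    have "L +>\<^bsub>FM X\<^esub> (\<pi> c \<odot>\<^bsub>FM X\<^esub> y) = cos (scl c (m + p))"
      unfolding m(2) cos_def free_module_sel comp_scl ..
    also have "\<dots> = cos (scl c p)"
    proof -
      have "scl c (m + p) - scl c p = scl c m" by (simp add: fun_eq_iff algebra_simps)
      then have "scl c (m + p) - scl c p \<in> M" using fv.subspace_scale[OF M_sub(1) m(1), of c] by simp
      then show ?thesis
        using cos_eq_iff fv.subspace_scale[OF subspace_Fn mp] fv.subspace_scale[OF subspace_Fn p] by blast
    qed
    finally show ?thesis .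
  qed
  moreover have "cos p \<noteq> {}" unfolding cos_alt using fv.subspace_0[OF M_sub(1)] by blast
  ultimately show ?thesis by (simp add: quotient_module_def)
qed

sublocale mfr: fraction_cover R \<pi> scl F "Fn X" M cos "Module.smult W"
proof (intro fraction_cover.intro fraction_cover_axioms.intro ring_cover_axioms fv.module_axioms)
  show "Modules.module.subspace scl (Fn X)" using subspace_Fn by (simp add: lsub_def)
  show "Modules.module.subspace scl M" using M_sub(1) by (simp add: lsub_def)
  show "M \<subseteq> Fn X" by (rule M_sub(2))
  show "scl c v \<in> M" if "c \<in> Z" "v \<in> Fn X" for c v
    using that fv.subspace_scale[OF subspace_Fn that(2)] by (intro M_sub(3)) (auto intro: idealD_mult2[OF ideal_Z])
qed (simp_all add: cos_eq_iff W_smult)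

abbreviation mf :: "('x \<Rightarrow> 't) \<Rightarrow> nat \<Rightarrow> (('x \<Rightarrow> 'r) set \<times> nat) set" where "mf \<equiv> mfr.frac"
abbreviation LM :: "(('r \<times> nat) set, (('x \<Rightarrow> 'r) set \<times> nat) set) module" where
  "LM \<equiv> loc_module R (\<pi> F) W"

lemma module_fraction_mf: "module_fraction R (\<pi> F) W (cos p) i = mf p i"
  by (simp add: mfr.frac_def W_carrier)

lemma mf_eq_iff:
  "p \<in> Fn X \<Longrightarrow> q \<in> Fn X \<Longrightarrow> mf p i = mf q j \<longleftrightarrow> (\<exists>l. scl (F ^ (l + j)) p - scl (F ^ (l + i)) q \<in> M)"
  by (simp add: mfr.frac_eq_iff mfr.equivalent_def)

lemma LM_carrier: "carrier LM = {mf p i | p i. p \<in> Fn X}"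
proof -
  have C: "carrier LM = {module_fraction R (\<pi> F) W w i | w i. w \<in> carrier W}" by (simp add: loc_module_def)
  show ?thesis
  proof (intro equalityI subsetI)
    fix y assume "y \<in> carrier LM"
    then obtain w i where y: "y = module_fraction R (\<pi> F) W w i" "w \<in> carrier W" unfolding C by blast
    have "w \<in> cos ` Fn X" using y(2) W_carrier by simp
    then obtain p where p: "p \<in> Fn X" "w = cos p" by blast
    have "y = mf p i" using y(1) p(2) module_fraction_mf[of p i] by simp
    then show "y \<in> {mf p i | p i. p \<in> Fn X}" using p(1) by blast
  next
    fix y assume "y \<in> {mf p i | p i. p \<in> Fn X}"
    then obtain p i where p: "y = mf p i" "p \<in> Fn X" by blast
    have "y = module_fraction R (\<pi> F) W (cos p) i" using p(1) module_fraction_mf[of p i] by simp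
    moreover have "cos p \<in> carrier W" using W_carrier p(2) by simp
    ultimately show "y \<in> carrier LM" unfolding C by blast
  qed
qed

lemma LM_add:
  assumes "p \<in> Fn X" "q \<in> Fn X"
  shows "mf p i \<oplus>\<^bsub>LM\<^esub> mf q j = mf (scl (F ^ j) p + scl (F ^ i) q) (i + j)"
proof -
  have Fn: "scl c u + scl d v \<in> Fn X" if "u \<in> Fn X" "v \<in> Fn X" for u v and c d :: 't
    using that by (intro fv.subspace_add[OF subspace_Fn] fv.subspace_scale[OF subspace_Fn])
  have "mf p i \<oplus>\<^bsub>LM\<^esub> mf q j = (\<Union>(m, i')\<in>mf p i. \<Union>(m', j')\<in>mf q j. module_fraction R (\<pi> F) W
         ((\<pi> F [^] j' \<odot>\<^bsub>W\<^esub> m) \<oplus>\<^bsub>W\<^esub> (\<pi> F [^] i' \<odot>\<^bsub>W\<^esub> m')) (i' + j'))"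
    by (simp add: loc_module_def)
  also have "\<dots> = mf (scl (F ^ j) p + scl (F ^ i) q) (i + j)"
  proof (rule mfr.Union_frac[OF assms(1)], rule mfr.Union_frac[OF assms(2)])
    fix v i' w j' assume vw: "v \<in> Fn X" "w \<in> Fn X" and "mfr.equivalent p i v i'" "mfr.equivalent q j w j'"
    from mfr.equivalent_add[OF this(3,4)]
    have "mf (scl (F ^ j) p + scl (F ^ i) q) (i + j) = mf (scl (F ^ j') v + scl (F ^ i') w) (i' + j')"
      using Fn assms vw by (simp add: mfr.frac_eq_iff)
    then show "module_fraction R (\<pi> F) W ((\<pi> F [^] j' \<odot>\<^bsub>W\<^esub> cos v) \<oplus>\<^bsub>W\<^esub> (\<pi> F [^] i' \<odot>\<^bsub>W\<^esub> cos w)) (i' + j') =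
        mf (scl (F ^ j) p + scl (F ^ i) q) (i + j)"
      by (simp only: \<pi>_power[symmetric] W_smult[OF vw(1)] W_smult[OF vw(2)] W_add module_fraction_mf)
  qed
  finally show ?thesis .
qed

lemma LM_smult:
  assumes p: "p \<in> Fn X" shows "fr x i \<odot>\<^bsub>LM\<^esub> mf p j = mf (scl x p) (i + j)"
proof -
  have "fr x i \<odot>\<^bsub>LM\<^esub> mf p j = (\<Union>(a, i')\<in>fr x i. \<Union>(m, j')\<in>mf p j.
      module_fraction R (\<pi> F) W (a \<odot>\<^bsub>W\<^esub> m) (i' + j'))"
    by (simp add: loc_module_def)
  also have "\<dots> = mf (scl x p) (i + j)"
  proof (rule rfr.Union_frac[OF UNIV_I], rule mfr.Union_frac[OF p])
    fix v i' w j' assume 1: "rfr.equivalent x i v i'" and w: "w \<in> Fn X" and 2: "mfr.equivalent p j w j'"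
    obtain l where "F ^ (l + i') * x - F ^ (l + i) * v \<in> Z" using 1 unfolding rfr.equivalent_def by blast
    from mfr.equivalent_mult[OF this 2 p w]
    have "mf (scl x p) (i + j) = mf (scl v w) (i' + j')"
      by (rule mfr.frac_eq_iff[THEN iffD2, OF fv.subspace_scale[OF subspace_Fn p] fv.subspace_scale[OF subspace_Fn w]])
    then show "module_fraction R (\<pi> F) W (\<pi> v \<odot>\<^bsub>W\<^esub> cos w) (i' + j') = mf (scl x p) (i + j)"
      by (simp only: W_smult[OF w] module_fraction_mf)
  qed
  finally show ?thesis .
qed


end

context localized_quotient begin

definition coords :: "('x \<Rightarrow> nat \<Rightarrow> 't) \<Rightarrow> ('x \<Rightarrow> 't) \<Rightarrow> nat \<Rightarrow> 't" where
  "coords a p j = (\<Sum>x\<in>X. p x * a x j)"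

lemma coords_add: "coords a (p + q) j = coords a p j + coords a q j"
  by (simp add: coords_def sum.distrib distrib_right)

lemma coords_scl: "coords a (scl c p) j = c * coords a p j"
  by (simp add: coords_def sum_distrib_left mult.assoc)

lemma coords_diff: "coords a (p - q) j = coords a p j - coords a q j"
  by (simp add: coords_def sum_subtractf left_diff_distrib)

lemma coords_sum: "coords a (\<Sum>i\<in>A. p i) j = (\<Sum>i\<in>A. coords a (p i) j)"
  unfolding coords_def sum_apply sum_distrib_right by (rule sum.swap)

lemma trivial_data_coords:
  "trivial_data M X r a \<longleftrightarrow>
    (\<forall>p\<in>Fn X. (\<exists>l. scl (F ^ l) p \<in> M) \<longleftrightarrow> (\<forall>j<r. coords a p j \<in> Zf)) \<and>
    (\<forall>j<r. \<exists>p\<in>Fn X. \<exists>i. \<forall>j'<r. coords a p j' - (if j' = j then F ^ i else 0) \<in> Zf)"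
  unfolding trivial_data_def coords_def ..

lemma FK_carrier:
  fixes r :: nat
  shows "y \<in> carrier (free_module K {..<r}) \<longleftrightarrow>
    (\<forall>j. y j \<in> carrier K) \<and> (\<forall>j\<ge>r. y j = \<zero>\<^bsub>K\<^esub>)"
proof -
  have "finite {j. y j \<noteq> \<zero>\<^bsub>K\<^esub>}" if "{j. y j \<noteq> \<zero>\<^bsub>K\<^esub>} \<subseteq> {..<r}"
    using finite_subset[OF that] by simp
  moreover have "{j. y j \<noteq> \<zero>\<^bsub>K\<^esub>} \<subseteq> {..<r} \<longleftrightarrow> (\<forall>j\<ge>r. y j = \<zero>\<^bsub>K\<^esub>)"
    by (metis (mono_tags, lifting) lessThan_iff mem_Collect_eq not_le subset_iff)
  ultimately show ?thesis unfolding free_module_carrier by argo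
qed

text \<open>By linearity a trivialization is determined by the images of the basis vectors, which
  are brought to one denominator \<open>F ^ N\<close>. Its injectivity becomes the description of
  the kernel in \<open>trivial_data\<close>, and preimages of unit vectors give the second
  clause.\<close>

lemma trivialization_data:
  assumes \<Phi>: "\<Phi> \<in> trivializations R (\<pi> F) W r"
  shows "\<exists>a N. trivial_data M X r a \<and> (\<forall>x\<in>X. \<forall>j<r. \<Phi> (mf (ev x) 0) j = fr (a x j) N)"
proof -
  let ?FK = "free_module K {..<r}"
  have bij: "bij_betw \<Phi> (carrier LM) (carrier ?FK)"
    and add: "\<And>x y. x \<in> carrier LM \<Longrightarrow> y \<in> carrier LM \<Longrightarrow> \<Phi> (x \<oplus>\<^bsub>LM\<^esub> y) = \<Phi> x \<oplus>\<^bsub>?FK\<^esub> \<Phi> y"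
    and sm: "\<And>c x. c \<in> carrier K \<Longrightarrow> x \<in> carrier LM \<Longrightarrow> \<Phi> (c \<odot>\<^bsub>LM\<^esub> x) = c \<odot>\<^bsub>?FK\<^esub> \<Phi> x"
    using \<Phi> unfolding trivializations_def module_isos_def by blast+
  have mfc: "mf p i \<in> carrier LM" if "p \<in> Fn X" for p i using that unfolding LM_carrier by blast
  have \<Phi>c: "\<Phi> (mf p i) \<in> carrier ?FK" if "p \<in> Fn X" for p i
    using bij_betwE[OF bij] mfc[OF that] by blast
  have \<Phi>K: "\<Phi> (mf p i) j \<in> carrier K" if "p \<in> Fn X" for p i j
    using \<Phi>c[OF that] unfolding FK_carrier by blast
  have evX: "ev x \<in> Fn X" if "x \<in> X" for x using that by (rule ev_in_Fn)
  have "finite (X \<times> {..<r})" using finX by simp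
  moreover have "\<Phi> (mf (ev (fst z)) 0) (snd z) \<in> carrier K" if "z \<in> X \<times> {..<r}" for z
    using that by (intro \<Phi>K evX) auto
  ultimately obtain N a0 where a0: "\<forall>z\<in>X \<times> {..<r}. \<Phi> (mf (ev (fst z)) 0) (snd z) = fr (a0 z) N"
    using common_denominator[of "X \<times> {..<r}" "\<lambda>z. \<Phi> (mf (ev (fst z)) 0) (snd z)"] by blast
  define a where "a x j = a0 (x, j)" for x j
  have a: "\<Phi> (mf (ev x) 0) j = fr (a x j) N" if "x \<in> X" "j < r" for x j
    using bspec[OF a0, of "(x, j)"] that by (simp add: a_def)
  have sub: "\<Phi> (mf (\<Sum>x\<in>Y. scl (p x) (ev x)) 0) j = fr (\<Sum>x\<in>Y. p x * a x j) N"
    if "Y \<subseteq> X" and j: "j < r" for Y p j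
    using finite_subset[OF that(1) finX] that(1)
  proof (induction Y rule: finite_induct)
    case empty
    have z: "(0 :: 'x \<Rightarrow> 't) \<in> Fn X" by (rule fv.subspace_0[OF subspace_Fn])
    obtain y i where y: "\<Phi> (mf 0 0) j = fr y i" using \<Phi>K[OF z, of 0 j] unfolding K_carrier by blast
    have "mf 0 0 = fr 0 0 \<odot>\<^bsub>LM\<^esub> mf 0 0" by (simp add: LM_smult[OF z])
    then have "\<Phi> (mf 0 0) j = (fr 0 0 \<odot>\<^bsub>?FK\<^esub> \<Phi> (mf 0 0)) j" using sm[OF fr_closed mfc[OF z], of 0 0 0] by simp
    also have "\<dots> = fr 0 i" by (simp add: y K_mult)
    also have "\<dots> = fr 0 N" by (simp add: fr_zero_iff idealD0[OF ideal_Zf])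
    finally show ?case by (simp only: sum.empty)
  next
    case (insert x Y)
    let ?q = "\<Sum>x\<in>Y. scl (p x) (ev x) :: 'x \<Rightarrow> 't"
    have x: "x \<in> X" and q: "?q \<in> Fn X"
      using insert.prems by (auto intro!: fv.subspace_sum[OF subspace_Fn] fv.subspace_scale[OF subspace_Fn] ev_in_Fn)
    have sx: "scl (p x) (ev x) \<in> Fn X" by (rule fv.subspace_scale[OF subspace_Fn evX[OF x]])
    have "mf (\<Sum>x\<in>insert x Y. scl (p x) (ev x)) 0 = (fr (p x) 0 \<odot>\<^bsub>LM\<^esub> mf (ev x) 0) \<oplus>\<^bsub>LM\<^esub> mf ?q 0"
      using insert.hyps by (simp add: LM_smult[OF evX[OF x]] LM_add[OF sx q])
    then have "\<Phi> (mf (\<Sum>x\<in>insert x Y. scl (p x) (ev x)) 0) =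
        (fr (p x) 0 \<odot>\<^bsub>?FK\<^esub> \<Phi> (mf (ev x) 0)) \<oplus>\<^bsub>?FK\<^esub> \<Phi> (mf ?q 0)"
      using add[of "fr (p x) 0 \<odot>\<^bsub>LM\<^esub> mf (ev x) 0" "mf ?q 0"] sm[of "fr (p x) 0" "mf (ev x) 0"] mfc[OF q, of 0]
        mfc[OF evX[OF x], of 0] mfc[OF sx, of 0] LM_smult[OF evX[OF x], of "p x" 0 0] by simp
    then have "\<Phi> (mf (\<Sum>x\<in>insert x Y. scl (p x) (ev x)) 0) j =
        (fr (p x) 0 \<otimes>\<^bsub>K\<^esub> \<Phi> (mf (ev x) 0) j) \<oplus>\<^bsub>K\<^esub> \<Phi> (mf ?q 0) j"
      by (simp only: free_module_sel)
    moreover have "\<Phi> (mf ?q 0) j = fr (\<Sum>x\<in>Y. p x * a x j) N"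
      using insert.prems by (intro insert.IH) blast
    ultimately have "\<Phi> (mf (\<Sum>x\<in>insert x Y. scl (p x) (ev x)) 0) j =
        (fr (p x) 0 \<otimes>\<^bsub>K\<^esub> fr (a x j) N) \<oplus>\<^bsub>K\<^esub> fr (\<Sum>x\<in>Y. p x * a x j) N"
      by (simp only: a[OF x j])
    also have "\<dots> = fr (\<Sum>x\<in>insert x Y. p x * a x j) N"
      using insert.hyps by (simp add: K_mult fr_add_same)
    finally show ?case .
  qed
  have \<Phi>0: "\<Phi> (mf p 0) j = fr (coords a p j) N" if "p \<in> Fn X" "j < r" for p j
    using sub[OF order_refl that(2), of p] Fn_expand[OF finX that(1)] unfolding coords_def by simp
  have zero: "(\<forall>j. \<Phi> (mf p 0) j = \<Phi> (mf 0 0) j) \<longleftrightarrow> (\<forall>j<r. coords a p j \<in> Zf)" if p: "p \<in> Fn X" for p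
  proof -
    have z: "(0 :: 'x \<Rightarrow> 't) \<in> Fn X" by (rule fv.subspace_0[OF subspace_Fn])
    have "\<Phi> (mf p 0) j = \<Phi> (mf 0 0) j" if "r \<le> j" for j
      using \<Phi>c[OF p, of 0] \<Phi>c[OF z, of 0] that unfolding FK_carrier by simp
    moreover have "\<Phi> (mf p 0) j = \<Phi> (mf 0 0) j \<longleftrightarrow> coords a p j \<in> Zf" if "j < r" for j
    proof -
      have "coords a 0 j = 0" by (simp add: coords_def)
      then show ?thesis using \<Phi>0[OF p that] \<Phi>0[OF z that] fr_zero_iff by simp
    qed
    ultimately show ?thesis by (meson not_le)
  qed
  have D1: "(\<exists>l. scl (F ^ l) p \<in> M) \<longleftrightarrow> (\<forall>j<r. coords a p j \<in> Zf)" if p: "p \<in> Fn X" for p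
  proof -
    have z: "(0 :: 'x \<Rightarrow> 't) \<in> Fn X" by (rule fv.subspace_0[OF subspace_Fn])
    have "(\<exists>l. scl (F ^ l) p \<in> M) \<longleftrightarrow> mf p 0 = mf 0 0"
      unfolding mf_eq_iff[OF p z] by simp
    also have "\<dots> \<longleftrightarrow> \<Phi> (mf p 0) = \<Phi> (mf 0 0)"
      using bij_betw_imp_inj_on[OF bij] mfc[OF p] mfc[OF z] by (metis inj_onD)
    also have "\<dots> \<longleftrightarrow> (\<forall>j. \<Phi> (mf p 0) j = \<Phi> (mf 0 0) j)" by (rule fun_eq_iff)
    finally show ?thesis using zero[OF p] by simp
  qed
  have D2: "\<exists>p\<in>Fn X. \<exists>i. \<forall>j'<r. coords a p j' - (if j' = j then F ^ i else 0) \<in> Zf" if j: "j < r" for j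
  proof -
    define \<delta> where "\<delta> = (\<lambda>j'. if j' = j then fr 1 0 else fr 0 0)"
    have "\<delta> \<in> carrier ?FK" using j by (auto simp: FK_carrier \<delta>_def K_zero)
    then have "\<delta> \<in> \<Phi> ` carrier LM" using bij_betw_imp_surj_on[OF bij] by simp
    then obtain y where y: "y \<in> carrier LM" "\<Phi> y = \<delta>" by blast
    obtain p i where p: "y = mf p i" "p \<in> Fn X" using y(1) unfolding LM_carrier by blast
    have "mf (scl (F ^ i) p) i = mf p 0"
      unfolding mf_eq_iff[OF fv.subspace_scale[OF subspace_Fn p(2)] p(2)]
      by (rule exI[of _ 0]) (simp add: fv.subspace_0[OF M_sub(1)])
    then have "mf p 0 = fr (F ^ i) 0 \<odot>\<^bsub>LM\<^esub> mf p i" by (simp add: LM_smult[OF p(2)])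
    then have eq: "\<Phi> (mf p 0) j' = fr (F ^ i) 0 \<otimes>\<^bsub>K\<^esub> \<delta> j'" for j'
      using sm[OF fr_closed mfc[OF p(2)], of "F ^ i" 0 i] y(2) p(1) by simp
    \<comment> \<open>The image of \<open>mf p 0\<close> is \<open>F ^ i\<close> times a unit
      vector, while the numerators \<open>coords a p\<close> belong to the denominator
      \<open>F ^ N\<close>; hence the exponent \<open>i + N\<close>.\<close>
    have "coords a p j' - (if j' = j then F ^ (i + N) else 0) \<in> Zf" if j': "j' < r" for j'
    proof -
      have "fr (coords a p j') N = fr (if j' = j then F ^ i else 0) 0"
        using eq[of j'] \<Phi>0[OF p(2) j'] by (auto simp: \<delta>_def K_mult)
      then obtain l where "F ^ l * (F ^ 0 * coords a p j' - F ^ N * (if j' = j then F ^ i else 0)) \<in> Z"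
        unfolding fr_eq_iff by blast
      moreover have "F ^ 0 * coords a p j' - F ^ N * (if j' = j then F ^ i else 0) =
          coords a p j' - (if j' = j then F ^ (i + N) else 0)"
        by (simp add: power_add mult.commute)
      ultimately show ?thesis unfolding Zf_def by (metis mem_Collect_eq)
    qed
    then show ?thesis using p(2) by blast
  qed
  have "trivial_data M X r a" unfolding trivial_data_coords using D1 D2 by blast
  then show ?thesis using a by blast
qed

text \<open>Conversely the numerators define a map on fractions; a denominator common to the images
  of the basis vectors is a unit after inverting \<open>F\<close> and can be left out.\<close>

lemma data_trivialization:
  assumes data: "trivial_data M X r a"
  shows "trivializations R (\<pi> F) W r \<noteq> {}"
proof -
  let ?FK = "free_module K {..<r}"
  have D1: "(\<exists>l. scl (F ^ l) p \<in> M) \<longleftrightarrow> (\<forall>j<r. coords a p j \<in> Zf)" if "p \<in> Fn X" for p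
    using data that unfolding trivial_data_coords by blast
  have D2: "\<exists>p i. p \<in> Fn X \<and> (\<forall>j'<r. coords a p j' - (if j' = j then F ^ i else 0) \<in> Zf)" if "j < r" for j
    using data that unfolding trivial_data_coords by blast
  \<comment> \<open>One equivalence serves twice: from left to right it makes the map independent of
    the chosen representative, from right to left it gives injectivity.\<close>
  have key: "mf p i = mf q k \<longleftrightarrow> (\<forall>j<r. fr (coords a p j) i = fr (coords a q j) k)"
    if pq: "p \<in> Fn X" "q \<in> Fn X" for p q i k
  proof -
    let ?d = "scl (F ^ k) p - scl (F ^ i) q"
    have dX: "?d \<in> Fn X"
      by (intro fv.subspace_diff[OF subspace_Fn] fv.subspace_scale[OF subspace_Fn] pq)
    have "scl (F ^ (l + k)) p - scl (F ^ (l + i)) q = scl (F ^ l) ?d" for l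
      by (simp add: fun_eq_iff power_add right_diff_distrib mult.assoc)
    then have "mf p i = mf q k \<longleftrightarrow> (\<exists>l. scl (F ^ l) ?d \<in> M)" by (simp only: mf_eq_iff[OF pq])
    also have "\<dots> \<longleftrightarrow> (\<forall>j<r. coords a ?d j \<in> Zf)" by (rule D1[OF dX])
    also have "\<dots> \<longleftrightarrow> (\<forall>j<r. fr (coords a p j) i = fr (coords a q j) k)"
      by (simp only: fr_eq_iff coords_diff coords_scl Zf_def mem_Collect_eq)
    finally show ?thesis .
  qed
  define \<Phi> where "\<Phi> y = (\<lambda>j. if j < r then
      (let z = SOME z. fst z \<in> Fn X \<and> y = mf (fst z) (snd z) in fr (coords a (fst z) j) (snd z)) else fr 0 0)" for y
  have \<Phi>: "\<Phi> (mf p i) = (\<lambda>j. if j < r then fr (coords a p j) i else fr 0 0)" if p: "p \<in> Fn X" for p i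
  proof -
    define z where "z = (SOME z. fst z \<in> Fn X \<and> mf p i = mf (fst z) (snd z))"
    have "fst z \<in> Fn X \<and> mf p i = mf (fst z) (snd z)"
      unfolding z_def by (rule someI[of _ "(p, i)"]) (simp add: p)
    then have "fr (coords a p j) i = fr (coords a (fst z) j) (snd z)" if "j < r" for j
      using key[OF p, of "fst z" i "snd z"] that by blast
    then show ?thesis unfolding \<Phi>_def z_def[symmetric] Let_def by (simp add: fun_eq_iff)
  qed
  have "bij_betw \<Phi> (carrier LM) (carrier ?FK)"
    unfolding bij_betw_def
  proof
    show "inj_on \<Phi> (carrier LM)"
    proof (rule inj_onI)
      fix x y assume xy: "x \<in> carrier LM" "y \<in> carrier LM" "\<Phi> x = \<Phi> y"
      then obtain p i q k where pq: "x = mf p i" "p \<in> Fn X" "y = mf q k" "q \<in> Fn X"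
        unfolding LM_carrier by blast
      have "fr (coords a p j) i = fr (coords a q j) k" if "j < r" for j
        using fun_cong[OF xy(3), of j] that unfolding pq(1,3) \<Phi>[OF pq(2)] \<Phi>[OF pq(4)] by simp
      then show "x = y" unfolding pq(1,3) using key[OF pq(2,4)] by blast
    qed
    show "\<Phi> ` carrier LM = carrier ?FK"
    proof
      show "\<Phi> ` carrier LM \<subseteq> carrier ?FK"
      proof
        fix y assume "y \<in> \<Phi> ` carrier LM"
        then obtain p i where "p \<in> Fn X" "y = \<Phi> (mf p i)" unfolding LM_carrier by blast
        then show "y \<in> carrier ?FK" by (simp add: \<Phi> FK_carrier K_zero)
      qed
      show "carrier ?FK \<subseteq> \<Phi> ` carrier LM"
      proof
        fix y assume y: "y \<in> carrier ?FK"
        obtain N b where b: "\<And>j. j < r \<Longrightarrow> y j = fr (b j) N"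
          using common_denominator[of "{..<r}" y] y unfolding FK_carrier by auto
        obtain p i where p: "\<And>j. j < r \<Longrightarrow> p j \<in> Fn X"
            "\<And>j j'. j < r \<Longrightarrow> j' < r \<Longrightarrow> coords a (p j) j' - (if j' = j then F ^ i j else 0) \<in> Zf"
          using D2 by metis
        \<comment> \<open>The vector \<open>p j\<close> reaches a unit vector only up to the factor
          \<open>F ^ i j\<close>, with an exponent depending on \<open>j\<close>. Since
          \<open>I\<close> bounds all these exponents, the factors \<open>F ^ (I - i j)\<close>
          equalize them.\<close>
        define I where "I = (\<Sum>j<r. i j)"
        have iI: "i j \<le> I" if "j < r" for j unfolding I_def using that by (intro member_le_sum) auto
        define q where "q = (\<Sum>j<r. scl (b j * F ^ (I - i j)) (p j))"
        have qX: "q \<in> Fn X" unfolding q_def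
          by (intro fv.subspace_sum[OF subspace_Fn] fv.subspace_scale[OF subspace_Fn] p(1)) simp
        have "coords a q j' - F ^ I * b j' \<in> Zf" if j': "j' < r" for j'
        proof -
          have "F ^ I * b j' = (\<Sum>j<r. (b j * F ^ (I - i j)) * (if j' = j then F ^ i j else 0))"
          proof -
            have "(\<Sum>j<r. (b j * F ^ (I - i j)) * (if j' = j then F ^ i j else 0)) =
                (\<Sum>j<r. if j' = j then b j * F ^ (I - i j) * F ^ i j else 0)"
              by (rule sum.cong) auto
            also have "\<dots> = b j' * F ^ (I - i j') * F ^ i j'" using j' by simp
            also have "\<dots> = F ^ I * b j'"
            proof -
              have "F ^ I = F ^ (I - i j') * F ^ i j'" using iI[OF j'] by (simp flip: power_add)
              then show ?thesis by (simp only: ac_simps)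
            qed
            finally show ?thesis ..
          qed
          then have "coords a q j' - F ^ I * b j' =
              (\<Sum>j<r. (b j * F ^ (I - i j)) * (coords a (p j) j' - (if j' = j then F ^ i j else 0)))"
            unfolding q_def coords_sum coords_scl by (simp only: right_diff_distrib sum_subtractf)
          also have "\<dots> \<in> Zf" by (intro idealD_sum[OF ideal_Zf] idealD_mult[OF ideal_Zf] p(2) j') simp
          finally show ?thesis .
        qed
        then have eq: "fr (coords a q j) (I + N) = y j" if jr: "j < r" for j
        proof -
          obtain l where "F ^ l * (coords a q j - F ^ I * b j) \<in> Z"
            using \<open>\<And>j'. j' < r \<Longrightarrow> coords a q j' - F ^ I * b j' \<in> Zf\<close>[OF jr] unfolding Zf_def by blast
          from idealD_mult[OF ideal_Z this, of "F ^ N"]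
          have "F ^ l * (F ^ N * coords a q j - F ^ (I + N) * b j) \<in> Z"
            by (simp add: power_add algebra_simps)
          then show ?thesis unfolding b[OF jr] fr_eq_iff by blast
        qed
        have "\<Phi> (mf q (I + N)) = y"
          unfolding \<Phi>[OF qX] using eq y by (auto simp: fun_eq_iff FK_carrier K_zero)
        then show "y \<in> \<Phi> ` carrier LM" using qX unfolding LM_carrier by blast
      qed
    qed
  qed
  moreover have "\<Phi> (x \<oplus>\<^bsub>LM\<^esub> y) = \<Phi> x \<oplus>\<^bsub>?FK\<^esub> \<Phi> y" if xy: "x \<in> carrier LM" "y \<in> carrier LM" for x y
  proof -
    obtain p i q k where pq: "x = mf p i" "p \<in> Fn X" "y = mf q k" "q \<in> Fn X"
      using xy unfolding LM_carrier by blast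
    have "scl (F ^ k) p + scl (F ^ i) q \<in> Fn X"
      by (intro fv.subspace_add[OF subspace_Fn] fv.subspace_scale[OF subspace_Fn] pq)
    then show ?thesis
      unfolding pq(1,3) LM_add[OF pq(2,4)]
      by (simp add: \<Phi> pq(2,4) fun_eq_iff coords_add coords_scl K_add[symmetric] fr_add_same)
  qed
  moreover have "\<Phi> (c \<odot>\<^bsub>LM\<^esub> x) = c \<odot>\<^bsub>?FK\<^esub> \<Phi> x" if cx: "c \<in> carrier K" "x \<in> carrier LM" for c x
  proof -
    obtain s i where s: "c = fr s i" using cx(1) unfolding K_carrier by blast
    obtain p k where p: "x = mf p k" "p \<in> Fn X" using cx(2) unfolding LM_carrier by blast
    have "fr s i \<otimes>\<^bsub>K\<^esub> fr 0 0 = fr 0 0" by (simp add: K_mult fr_zero_iff idealD0[OF ideal_Zf])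
    then show ?thesis
      unfolding s p(1) LM_smult[OF p(2)]
      by (simp add: \<Phi> p(2) fv.subspace_scale[OF subspace_Fn] fun_eq_iff coords_scl K_mult)
  qed
  ultimately have "\<Phi> \<in> trivializations R (\<pi> F) W r"
    unfolding trivializations_def module_isos_def by blast
  then show ?thesis by blast
qed

end

section \<open>Pluecker coordinates\<close>

text \<open>With \<open>a x\<close> the coordinates of the image of \<open>x\<close> in the quotient, \<open>gam a B\<close> is \<open>\<gamma>\<^sub>B\<close> and
  \<open>rho a B\<close> is \<open>\<Sum>\<^sub>i (-1)\<^sup>i \<gamma>\<^bsub>B - b\<^sub>i\<^esub> b\<^sub>i\<close>.\<close>

definition gam :: "('x \<Rightarrow> nat \<Rightarrow> 't::comm_ring_1) \<Rightarrow> 'x list \<Rightarrow> 't" where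
  "gam a bs = dt (length bs) (\<lambda>i j. a (bs ! i) j)"

definition alpha :: "'x set \<Rightarrow> ('x \<Rightarrow> nat \<Rightarrow> 't::comm_ring_1) \<Rightarrow> ('x \<Rightarrow> 't) \<Rightarrow> nat \<Rightarrow> 't" where
  "alpha X a p = (\<lambda>j. \<Sum>x\<in>X. p x * a x j)"

definition rho :: "('x \<Rightarrow> nat \<Rightarrow> 't::comm_ring_1) \<Rightarrow> 'x list \<Rightarrow> 'x \<Rightarrow> 't" where
  "rho a bs = (\<Sum>i<length bs. scl ((- 1) ^ i * gam a (omit i bs)) (ev (bs ! i)))"

lemma length_omit: "i < length bs \<Longrightarrow> length (omit i bs) = length bs - 1"
  by (simp add: omit_def)

lemma nth_omit: "i < length bs \<Longrightarrow> k < length bs - 1 \<Longrightarrow> omit i bs ! k = bs ! (if k < i then k else Suc k)"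
  by (auto simp: omit_def nth_append)

lemma set_omit: "set (omit i bs) \<subseteq> set bs"
  by (auto simp: omit_def dest: in_set_takeD in_set_dropD)

lemma omit_0_Cons [simp]: "omit 0 (x # bs) = bs"
  by (simp add: omit_def)

lemma omit_Suc_Cons [simp]: "omit (Suc i) (x # bs) = x # omit i bs"
  by (simp add: omit_def)

text \<open>Expand the determinant with a repeated column.\<close>

lemma cofactor_relation:
  fixes v :: "nat \<Rightarrow> nat \<Rightarrow> 't::comm_ring_1"
  assumes j: "j < h"
  shows "(\<Sum>i<Suc h. (- 1) ^ i * dt h (\<lambda>k j. v (if k < i then k else Suc k) j) * v i j) = 0"
proof -
  define A where "A = mat (Suc h) (Suc h) (\<lambda>(i, c). case c of 0 \<Rightarrow> v i j | Suc c' \<Rightarrow> v i c')"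
  have A: "A \<in> carrier_mat (Suc h) (Suc h)" by (simp add: A_def)
  have "det A = 0"
    by (rule det_identical_columns[OF A, of 0 "Suc j"]) (use j in \<open>auto simp: A_def intro!: eq_vecI\<close>)
  moreover have "det A = (\<Sum>i<Suc h. A $$ (i, 0) * cofactor A i 0)"
    by (rule laplace_expansion_column[OF A]) simp
  moreover have "A $$ (i, 0) * cofactor A i 0 =
      (- 1) ^ i * dt h (\<lambda>k j. v (if k < i then k else Suc k) j) * v i j" if i: "i < Suc h" for i
  proof -
    have "mat_delete A i 0 = mat h h (\<lambda>(k, j). v (if k < i then k else Suc k) j)"
      unfolding mat_delete_def using i by (intro eq_matI) (auto simp: A_def)
    moreover have "A $$ (i, 0) = v i j" using i by (simp add: A_def)
    ultimately show ?thesis by (simp add: cofactor_def dt_def ac_simps)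
  qed
  ultimately show ?thesis by simp
qed

lemma gam_relation:
  assumes "length bs = Suc h" "j < h"
  shows "(\<Sum>i<Suc h. (- 1) ^ i * gam a (omit i bs) * a (bs ! i) j) = 0"
proof -
  have "gam a (omit i bs) = dt h (\<lambda>k j. a (bs ! (if k < i then k else Suc k)) j)" if "i < Suc h" for i
  proof -
    have l: "length (omit i bs) = h" using that assms(1) by (simp add: length_omit)
    show ?thesis unfolding gam_def l by (rule dt_cong) (use that assms(1) in \<open>simp add: nth_omit\<close>)
  qed
  then have "(\<Sum>i<Suc h. (- 1) ^ i * gam a (omit i bs) * a (bs ! i) j) = (\<Sum>i<Suc h. (- 1) ^ i *
      dt h (\<lambda>k j. a (bs ! (if k < i then k else Suc k)) j) * a (bs ! i) j)"
    by (intro sum.cong) simp_all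
  then show ?thesis using cofactor_relation[OF assms(2), of "\<lambda>i. a (bs ! i)"] by (simp only:)
qed

lemma cramer_matrix:
  fixes A :: "nat \<Rightarrow> nat \<Rightarrow> 't::comm_ring_1"
  shows "\<exists>b. \<forall>i<r. \<forall>k<r. (\<Sum>j<r. A i j * b j k) = (if i = k then dt r A else 0)"
proof -
  let ?A = "mat r r (\<lambda>(i, j). A i j)"
  have A: "?A \<in> carrier_mat r r" by simp
  note adj = adj_mat[OF A]
  have "(\<Sum>j<r. A i j * adj_mat ?A $$ (j, k)) = (if i = k then dt r A else 0)" if "i < r" "k < r" for i k
  proof -
    have "(?A * adj_mat ?A) $$ (i, k) = (\<Sum>j<r. A i j * adj_mat ?A $$ (j, k))"
      using that adj(1) by (simp add: scalar_prod_def lessThan_atLeast0)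
    moreover have "(?A * adj_mat ?A) $$ (i, k) = (if i = k then dt r A else 0)"
      using that unfolding adj(2) by (simp add: dt_def)
    ultimately show ?thesis by (simp only:)
  qed
  then show ?thesis by (intro exI[of _ "\<lambda>j k. adj_mat ?A $$ (j, k)"] allI impI)
qed

lemma alpha_scl: "alpha X a (scl c p) = scl c (alpha X a p)"
  by (simp add: alpha_def fun_eq_iff sum_distrib_left mult.assoc)

lemma alpha_diff: "alpha X a (p - q) = alpha X a p - alpha X a q"
  by (simp add: alpha_def fun_eq_iff sum_subtractf left_diff_distrib)

lemma alpha_sum: "alpha X a (\<Sum>i\<in>A. p i) j = (\<Sum>i\<in>A. alpha X a (p i) j)"
  unfolding alpha_def sum_apply sum_distrib_right by (rule sum.swap)

lemma alpha_ev: "finite X \<Longrightarrow> x \<in> X \<Longrightarrow> alpha X a (ev x) j = a x j"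
  unfolding alpha_def ev_def by (simp add: if_distrib[of "\<lambda>c. c * _"] cong: if_cong)

lemma rho_Fn: "set bs \<subseteq> X \<Longrightarrow> rho a bs \<in> Fn X"
  unfolding rho_def
  by (intro fv.subspace_sum[OF subspace_Fn] fv.subspace_scale[OF subspace_Fn] ev_in_Fn) auto

lemma alpha_rho:
  assumes "finite X" "set bs \<subseteq> X" "length bs = Suc h" "j < h"
  shows "alpha X a (rho a bs) j = 0"
proof -
  have "alpha X a (rho a bs) j = (\<Sum>i<Suc h. (- 1) ^ i * gam a (omit i bs) * a (bs ! i) j)"
    unfolding rho_def alpha_sum alpha_scl assms(3)
    by (rule sum.cong) (use assms in \<open>auto simp: alpha_ev nth_mem subsetD\<close>)
  then show ?thesis using gam_relation[OF assms(3,4)] by (simp only:)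
qed

text \<open>The Pluecker coordinate \<open>gam a B\<close> is used twice. Subtracting multiples of
  \<open>rho a (x # B)\<close> from \<open>gam a B\<close> times \<open>p\<close> removes all
  coefficients outside \<open>B\<close>; the remaining coefficients solve a linear system of
  determinant \<open>gam a B\<close> with right-hand side in \<open>Q\<close>, and the adjugate
  matrix places their multiples by \<open>gam a B\<close> in \<open>Q\<close>.\<close>

lemma relation_in_span_rho:
  assumes Q: "ideal_set Q" and X: "finite X" and B: "set B \<subseteq> X" "distinct B" "length B = r"
    and p: "p \<in> Fn X" "\<And>j. j < r \<Longrightarrow> alpha X a p j \<in> Q"
  shows "(scl (gam a B * gam a B) p - (\<Sum>x\<in>X - set B. scl (gam a B * p x) (rho a (x # B)))) y \<in> Q"
proof -
  let ?g = "gam a B"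
  define q where "q = scl ?g p - (\<Sum>x\<in>X - set B. scl (p x) (rho a (x # B)))"
  have eq: "scl (?g * ?g) p - (\<Sum>x\<in>X - set B. scl (?g * p x) (rho a (x # B))) = scl ?g q"
    unfolding q_def by (simp add: fun_eq_iff sum_apply right_diff_distrib sum_distrib_left mult.assoc)
  have rho_out: "rho a (x # B) y = (if y = x then ?g else 0)" if "y \<notin> set B" for x y
  proof -
    have "rho a (x # B) y = (\<Sum>i<Suc (length B). (- 1) ^ i * gam a (omit i (x # B)) * ev ((x # B) ! i) y)"
      by (simp only: rho_def sum_apply scl_apply length_Cons)
    also have "\<dots> = ?g * ev x y + (\<Sum>i<length B. (- 1) ^ Suc i * gam a (x # omit i B) * ev (B ! i) y)"
      by (subst sum.lessThan_Suc_shift) (simp only: power_0 omit_0_Cons omit_Suc_Cons nth_Cons_0 nth_Cons_Suc mult_1_left)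
    also have "(\<Sum>i<length B. (- 1) ^ Suc i * gam a (x # omit i B) * ev (B ! i) y) = 0"
      by (rule sum.neutral) (use that in \<open>auto simp: ev_def\<close>)
    finally show ?thesis by (simp add: ev_def)
  qed
  have q_out: "q y = 0" if "y \<notin> set B" for y
  proof -
    have "(\<Sum>x\<in>X - set B. scl (p x) (rho a (x # B))) y = (\<Sum>x\<in>X - set B. if x = y then p y * ?g else 0)"
      unfolding sum_apply by (rule sum.cong) (auto simp: rho_out[OF that])
    also have "\<dots> = ?g * p y" using X that p(1) by (auto simp: Fn_def)
    finally show ?thesis by (simp add: q_def)
  qed
  have "alpha X a q j \<in> Q" if j: "j < r" for j
  proof -
    have "alpha X a (rho a (x # B)) j = 0" if "x \<in> X - set B" for x
      by (rule alpha_rho[OF X _ _ j]) (use that B in auto)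
    then have "alpha X a (\<Sum>x\<in>X - set B. scl (p x) (rho a (x # B))) j = 0"
      unfolding alpha_sum alpha_scl scl_apply by (intro sum.neutral) simp
    moreover have "alpha X a q j = alpha X a (scl ?g p) j - alpha X a (\<Sum>x\<in>X - set B. scl (p x) (rho a (x # B))) j"
      unfolding q_def alpha_diff by simp
    ultimately have "alpha X a q j = ?g * alpha X a p j" by (simp add: alpha_scl)
    then show ?thesis using idealD_mult[OF Q p(2)[OF j]] by simp
  qed
  moreover have "alpha X a q j = (\<Sum>i<r. q (B ! i) * a (B ! i) j)" for j
  proof -
    have "alpha X a q j = (\<Sum>x\<in>set B. q x * a x j)"
      unfolding alpha_def by (rule sum.mono_neutral_right[OF X B(1)]) (auto simp: q_out)
    also have "\<dots> = (\<Sum>i<r. q (B ! i) * a (B ! i) j)"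
      by (rule sum.reindex_bij_betw[symmetric]) (use bij_betw_nth[OF B(2)] B(3) in auto)
    finally show ?thesis .
  qed
  ultimately have z: "(\<Sum>i<r. q (B ! i) * a (B ! i) j) \<in> Q" if "j < r" for j using that by simp
  have "?g * q y \<in> Q"
  proof (cases "y \<in> set B")
    case True
    then obtain k where k: "k < r" "y = B ! k" using B(3) by (auto simp: in_set_conv_nth)
    obtain b where b: "\<And>i k. i < r \<Longrightarrow> k < r \<Longrightarrow> (\<Sum>j<r. a (B ! i) j * b j k) = (if i = k then ?g else 0)"
      using cramer_matrix[of r "\<lambda>i j. a (B ! i) j"] B(3) unfolding gam_def by auto
    have "(\<Sum>j<r. (\<Sum>i<r. q (B ! i) * a (B ! i) j) * b j k) = (\<Sum>i<r. q (B ! i) * (\<Sum>j<r. a (B ! i) j * b j k))"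
      unfolding sum_distrib_right sum_distrib_left mult.assoc by (rule sum.swap)
    also have "\<dots> = (\<Sum>i<r. if i = k then q (B ! i) * ?g else 0)"
      by (rule sum.cong) (auto simp: b k(1))
    also have "\<dots> = ?g * q y" using k by simp
    finally have "?g * q y = (\<Sum>j<r. (\<Sum>i<r. q (B ! i) * a (B ! i) j) * b j k)" ..
    also have "\<dots> \<in> Q" by (intro idealD_sum[OF Q] idealD_mult2[OF Q] z) simp
    finally show ?thesis .
  next
    case False
    then show ?thesis using q_out idealD0[OF Q] by simp
  qed
  then show ?thesis unfolding eq by simp
qed

text \<open>Selecting columns, possibly with repetition, is multiplication by a 0-1 matrix.\<close>

lemma dt_columns: 
  assumes "length xs = m" "set xs \<subseteq> {..<m}"
  shows "dt m (\<lambda>i j. y i (xs ! j)) = dt m y * dt m (\<lambda>j' j. if j' = xs ! j then 1 else 0)"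
proof -
  let ?Y = "mat m m (\<lambda>(i, j). y i j)" and ?P = "mat m m (\<lambda>(j', j). if j' = xs ! j then 1 else 0)"
  have "mat m m (\<lambda>(i, j). y i (xs ! j)) = ?Y * ?P"
  proof (rule eq_matI)
    fix i j assume "i < dim_row (?Y * ?P)" "j < dim_col (?Y * ?P)"
    then have ij: "i < m" "j < m" by auto
    have "xs ! j \<in> set xs" using assms(1) ij(2) by (intro nth_mem) simp
    then have xj: "xs ! j < m" using assms(2) by blast
    have "(?Y * ?P) $$ (i, j) = (\<Sum>k<m. y i k * (if k = xs ! j then 1 else 0))"
      using ij by (simp add: scalar_prod_def lessThan_atLeast0)
    also have "\<dots> = (\<Sum>k<m. if k = xs ! j then y i k else 0)" by (rule sum.cong) auto
    also have "\<dots> = y i (xs ! j)" using xj by simp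
    finally show "mat m m (\<lambda>(i, j). y i (xs ! j)) $$ (i, j) = (?Y * ?P) $$ (i, j)" using ij by simp
  qed auto
  then show ?thesis unfolding dt_def by (simp add: det_mult[of ?Y m ?P])
qed

text \<open>If all Pluecker coordinates were in \<open>P\<close>, then so would be all
  \<open>r\<close>-minors of vectors in the span of the rows \<open>a x\<close> modulo
  \<open>P\<close>. By surjectivity this span contains a diagonal system whose entries are powers of
  \<open>F\<close>, and its determinant is outside \<open>P\<close>.\<close>

lemma exists_gam_notin:
  fixes a :: "'x \<Rightarrow> nat \<Rightarrow> 't::comm_ring_1"
  assumes P: "max_ideal P" and F: "F \<notin> P"
    and sur: "\<And>j. j < r \<Longrightarrow> \<exists>p i. \<forall>j'<r. alpha X a p j' - (if j' = j then F ^ i else 0) \<in> P"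
  shows "\<exists>B. set B \<subseteq> X \<and> distinct B \<and> length B = r \<and> gam a B \<notin> P"
proof (rule ccontr)
  assume none: "\<not> ?thesis"
  have iP: "ideal_set P" using P by (rule max_idealD)
  \<comment> \<open>Coordinates from \<open>r\<close> on are unconstrained; they are cut off because
    the span is compared with vectors all of whose coordinates lie in \<open>P\<close>.\<close>
  define a' where "a' x = (\<lambda>j. if j < r then a x j else 0)" for x
  have gamP: "gam a B \<in> P" if B: "set B \<subseteq> X" "length B = r" for B
  proof (cases "distinct B")
    case False
    then obtain i j where "i < r" "j < r" "i \<noteq> j" "B ! i = B ! j"
      using B(2) unfolding distinct_conv_nth by blast
    then have "gam a B = 0" unfolding gam_def B(2) by (intro dt_identical_rows[of i r j]) auto
    then show ?thesis using idealD0[OF iP] by simp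
  qed (use none B in blast)
  have "minors_in r {..<r} (a' ` X) P"
    unfolding minors_in_def
  proof (intro allI impI)
    fix y xs assume A: "(\<forall>i<r. y i \<in> a' ` X) \<and> set xs \<subseteq> {..<r} \<and> length xs = r"
    then have "\<forall>i. \<exists>x. i < r \<longrightarrow> x \<in> X \<and> y i = a' x" by blast
    then obtain b where b: "\<And>i. i < r \<Longrightarrow> b i \<in> X \<and> y i = a' (b i)" by metis
    have "dt r y = gam a (map b [0..<r])"
      unfolding gam_def by (simp, rule dt_cong) (simp add: b a'_def)
    also have "\<dots> \<in> P" by (rule gamP) (use b in auto)
    finally have "dt r y \<in> P" .
    moreover have "dt r (\<lambda>i j. y i (xs ! j)) = dt r y * dt r (\<lambda>j' j. if j' = xs ! j then 1 else 0)"
      using A by (intro dt_columns) auto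
    ultimately show "dt r (\<lambda>i j. y i (xs ! j)) \<in> P" using idealD_mult2[OF iP] by simp
  qed
  note mi = minors_in_add_ideal[OF iP this]
  let ?S = "lspan (a' ` X \<union> {q. \<forall>x. q x \<in> P})"
  obtain p i where pi: "\<And>j j'. j < r \<Longrightarrow> j' < r \<Longrightarrow> alpha X a (p j) j' - (if j' = j then F ^ i j else 0) \<in> P"
    using sur by metis
  define D where "D j = (\<lambda>j'. if j' = j then F ^ i j else 0)" for j
  have D: "D j \<in> ?S" if j: "j < r" for j
  proof -
    define y where "y = (\<Sum>x\<in>X. scl (p j x) (a' x))"
    have "y \<in> ?S" unfolding y_def by (intro fv.span_sum fv.span_scale fv.span_base) auto
    moreover have "\<forall>j'. (y - D j) j' \<in> P"
    proof
      fix j'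
      show "(y - D j) j' \<in> P"
      proof (cases "j' < r")
        case True
        then have "y j' = alpha X a (p j) j'" by (simp add: y_def sum_apply alpha_def a'_def)
        then show ?thesis using pi[OF j True] by (simp add: D_def)
      next
        case False
        then have "y j' = 0" "D j j' = 0" using j by (auto simp: y_def sum_apply a'_def D_def)
        then show ?thesis using idealD0[OF iP] by simp
      qed
    qed
    then have "y - D j \<in> ?S" by (intro fv.span_base) simp
    ultimately have "y - (y - D j) \<in> ?S" by (rule fv.span_diff)
    then show ?thesis by simp
  qed
  have "dt r (\<lambda>j j'. D j ([0..<r] ! j')) \<in> P"
    by (rule minors_inD[OF mi]) (use D in auto)
  moreover have "dt r (\<lambda>j j'. D j ([0..<r] ! j')) = dt r D"
    by (rule dt_cong) simp
  moreover have "dt r D = (\<Prod>j<r. D j j)"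
    by (rule dt_upper_triangular) (simp add: D_def)
  ultimately have "(\<Prod>j<r. F ^ i j) \<in> P" by (simp add: D_def)
  moreover have "(\<Prod>j<r. F ^ i j) \<notin> P" by (intro max_ideal_prod[OF P] max_ideal_power[OF P F])
  ultimately show False by blast
qed

lemma dt_first_row_sum:
  fixes c :: "'i \<Rightarrow> 't::comm_ring_1" and w :: "'i \<Rightarrow> nat \<Rightarrow> 't" and v :: "nat \<Rightarrow> nat \<Rightarrow> 't"
  assumes m: "0 < m"
  shows "(\<Sum>i\<in>I. c i * dt m (\<lambda>k j. case k of 0 \<Rightarrow> w i j | Suc k' \<Rightarrow> v k' j)) =
    dt m (\<lambda>k j. case k of 0 \<Rightarrow> (\<Sum>i\<in>I. c i * w i j) | Suc k' \<Rightarrow> v k' j)"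
proof -
  define M where "M = (\<lambda>k j. case k of 0 \<Rightarrow> 0 | Suc k' \<Rightarrow> v k' j)"
  have row: "(\<lambda>k j. case k of 0 \<Rightarrow> z j | Suc k' \<Rightarrow> v k' j) = M(0 := z)" for z
    by (auto simp: fun_eq_iff M_def split: nat.splits)
  define g where "g i = dt m (M(0 := w i))" for i
  define L where "L I = dt m (M(0 := \<lambda>j. \<Sum>i\<in>I. c i * w i j))" for I
  have zero: "dt m (M(0 := \<lambda>j. 0)) = 0" by (rule dt_row_zero[OF m])
  have "L {} = 0" "infinite I \<Longrightarrow> L I = 0" for I unfolding L_def using zero by (simp_all del: fun_upd_apply)
  moreover have "L (insert x I) = c x * g x + L I" if "finite I" "x \<notin> I" for x I
    unfolding L_def g_def dt_row_linear[OF m, symmetric] sum.insert[OF that] ..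
  ultimately have "(\<Sum>i\<in>I. c i * g i) = L I"
    by (induction I rule: infinite_finite_induct) simp_all
  then show ?thesis unfolding g_def L_def by (simp only: row)
qed

lemma gam_Cons: "gam a (x # cs) = dt (Suc (length cs)) (\<lambda>k j. case k of 0 \<Rightarrow> a x j | Suc k' \<Rightarrow> a (cs ! k') j)"
  unfolding gam_def by (rule dt_cong[THEN trans]) (auto split: nat.splits)

text \<open>The quadratic equations as determinants whose first row is the image of \<^const>\<open>rho\<close>.\<close>

lemma quadric_eq:
  assumes "length bs = Suc ha" "Suc (length cs) = hb"
  shows "(\<Sum>i\<le>ha. (- 1) ^ i * (gam aa (omit i bs) * gam ab ((y i) # cs))) =
    dt hb (\<lambda>k j. case k of 0 \<Rightarrow> (\<Sum>i\<le>ha. ((- 1) ^ i * gam aa (omit i bs)) * ab (y i) j) | Suc k' \<Rightarrow> ab (cs ! k') j)"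
  using dt_first_row_sum[of hb "\<lambda>i. (- 1) ^ i * gam aa (omit i bs)" "\<lambda>i. ab (y i)" "\<lambda>k'. ab (cs ! k')" "{..ha}"]
    assms by (simp add: gam_Cons mult.assoc)

lemma alpha_shift_rho:
  assumes X: "finite Xb" and "length bs = Suc ha" "\<And>i. i \<le> ha \<Longrightarrow> u + bs ! i \<in> Xb"
  shows "alpha Xb ab (shift u (rho aa bs)) j = (\<Sum>i\<le>ha. ((- 1) ^ i * gam aa (omit i bs)) * ab (u + bs ! i) j)"
proof -
  have "shift u (rho aa bs) = (\<Sum>i\<le>ha. scl ((- 1) ^ i * gam aa (omit i bs)) (ev (u + bs ! i)))"
    unfolding rho_def shift_sum shift_scl shift_ev assms(2) lessThan_Suc_atMost ..
  then have "alpha Xb ab (shift u (rho aa bs)) j =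
      (\<Sum>i\<le>ha. alpha Xb ab (scl ((- 1) ^ i * gam aa (omit i bs)) (ev (u + bs ! i))) j)"
    by (simp only: alpha_sum)
  also have "\<dots> = (\<Sum>i\<le>ha. ((- 1) ^ i * gam aa (omit i bs)) * ab (u + bs ! i) j)"
    by (rule sum.cong) (simp_all add: alpha_scl alpha_ev[OF X] assms(3))
  finally show ?thesis .
qed

lemma dt_first_row_in_ideal:
  assumes Q: "ideal_set Q" and "\<And>j. j < m \<Longrightarrow> w j \<in> Q" "0 < m"
  shows "dt m (\<lambda>k j. case k of 0 \<Rightarrow> w j | Suc k' \<Rightarrow> v k' j) \<in> Q"
proof -
  have "dt m (\<lambda>k j. case k of 0 \<Rightarrow> w j | Suc k' \<Rightarrow> v k' j) =
      dt m (\<lambda>k j. case k of 0 \<Rightarrow> (if j < m then w j else 0) | Suc k' \<Rightarrow> v k' j)"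
    by (rule dt_cong) (auto split: nat.splits)
  also have "\<dots> \<in> Q" by (rule dt_row_in_ideal[OF Q assms(3)]) (use assms(2) idealD0[OF Q] in auto)
  finally show ?thesis .
qed

text \<open>Apply the cofactor relation to the \<open>h + 1\<close> rows formed by \<open>w\<close>
  and the rows of \<open>B\<close>: up to signs, it expresses \<open>gam a B * w j\<close> through
  the determinants of \<open>w\<close> with \<open>h - 1\<close> rows of \<open>B\<close>. So
  equations with only \<open>h - 1\<close> auxiliary monomials control the whole vector
  \<open>w\<close>.\<close>

lemma vector_from_minors:
  assumes Q: "ideal_set Q" and B: "length B = h" and j: "j < h"
    and E: "\<And>k. k < h \<Longrightarrow> dt h (\<lambda>i j. case i of 0 \<Rightarrow> w j | Suc i' \<Rightarrow> a (omit k B ! i') j) \<in> Q"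
  shows "gam a B * w j \<in> Q"
proof -
  define v where "v = (\<lambda>i. case i of 0 \<Rightarrow> w | Suc i' \<Rightarrow> a (B ! i'))"
  have "dt h (\<lambda>k j. v (if k < Suc i then k else Suc k) j) =
      dt h (\<lambda>k j. case k of 0 \<Rightarrow> w j | Suc k' \<Rightarrow> a (omit i B ! k') j)" if "i < h" for i
    by (rule dt_cong) (use that B in \<open>auto simp: v_def nth_omit split: nat.splits\<close>)
  then have tail: "(- 1) ^ Suc i * dt h (\<lambda>k j. v (if k < Suc i then k else Suc k) j) * v (Suc i) j \<in> Q"
    if "i < h" for i
    using E that by (intro idealD_mult2[OF Q] idealD_mult[OF Q]) simp
  have "dt h (\<lambda>k j. v (if k < 0 then k else Suc k) j) = gam a B"
    unfolding gam_def B by (rule dt_cong) (simp add: v_def)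
  then have "gam a B * w j + (\<Sum>i<h. (- 1) ^ Suc i * dt h (\<lambda>k j. v (if k < Suc i then k else Suc k) j) * v (Suc i) j) = 0"
    using cofactor_relation[OF j, of v] unfolding sum.lessThan_Suc_shift by (simp add: v_def)
  then have "gam a B * w j = - (\<Sum>i<h. (- 1) ^ Suc i * dt h (\<lambda>k j. v (if k < Suc i then k else Suc k) j) * v (Suc i) j)"
    by (simp only: add_eq_0_iff2)
  moreover have "\<dots> \<in> Q" by (intro idealD_minus[OF Q] idealD_sum[OF Q] tail) simp
  ultimately show ?thesis by (simp only:)
qed

section \<open>Local freeness and trivializations\<close>

context localized_ring
begin

lemma Zf_subset:
  assumes P: "max_ideal P" "Z \<subseteq> P" "F \<notin> P" shows "Zf \<subseteq> P"
proof
  fix c assume "c \<in> Zf"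
  then obtain l where "F ^ l * c \<in> Z" unfolding Zf_def by blast
  then show "c \<in> P" using max_ideal_prime[OF P(1) max_ideal_power[OF P(1,3)]] P(2) by blast
qed

lemma trivial_data_alpha:
  "trivial_data M X r a \<longleftrightarrow>
    (\<forall>p\<in>Fn X. (\<exists>l. scl (F ^ l) p \<in> M) \<longleftrightarrow> (\<forall>j<r. alpha X a p j \<in> Zf)) \<and>
    (\<forall>j<r. \<exists>p\<in>Fn X. \<exists>i. \<forall>j'<r. alpha X a p j' - (if j' = j then F ^ i else 0) \<in> Zf)"
  unfolding trivial_data_def alpha_def ..

lemma trivial_dataD:
  assumes "trivial_data M X r a"
  shows "p \<in> Fn X \<Longrightarrow> (\<exists>l. scl (F ^ l) p \<in> M) \<longleftrightarrow> (\<forall>j<r. alpha X a p j \<in> Zf)"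
    and "j < r \<Longrightarrow> \<exists>p\<in>Fn X. \<exists>i. \<forall>j'<r. alpha X a p j' - (if j' = j then F ^ i else 0) \<in> Zf"
proof -
  note A = assms[unfolded trivial_data_alpha]
  show "p \<in> Fn X \<Longrightarrow> (\<exists>l. scl (F ^ l) p \<in> M) \<longleftrightarrow> (\<forall>j<r. alpha X a p j \<in> Zf)"
    by (rule bspec[OF conjunct1[OF A]])
  show "j < r \<Longrightarrow> \<exists>p\<in>Fn X. \<exists>i. \<forall>j'<r. alpha X a p j' - (if j' = j then F ^ i else 0) \<in> Zf"
    using conjunct2[OF A] by simp
qed

lemma frame_selection:
  assumes P: "max_ideal P" "Z \<subseteq> P" "F \<notin> P" and data: "trivial_data M X r a"
  shows "\<exists>B. set B \<subseteq> X \<and> distinct B \<and> length B = r \<and> gam a B \<notin> P"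
proof (rule exists_gam_notin[OF P(1,3)])
  fix j assume j: "j < r"
  obtain p i where "\<forall>j'<r. alpha X a p j' - (if j' = j then F ^ i else 0) \<in> Zf"
    using trivial_dataD(2)[OF data j] by blast
  then have "\<forall>j'<r. alpha X a p j' - (if j' = j then F ^ i else 0) \<in> P" using Zf_subset[OF P] by blast
  then show "\<exists>p i. \<forall>j'<r. alpha X a p j' - (if j' = j then F ^ i else 0) \<in> P" by blast
qed

text \<open>All coordinates of the relation vanish by the cofactor identity, and the vectors with
  zero coordinates are those in \<open>M\<close> up to a power of \<open>F\<close>.\<close>

lemma rho_in:
  assumes X: "finite X" and data: "trivial_data M X r a" and bs: "set bs \<subseteq> X" "length bs = Suc r"
  shows "\<exists>l. scl (F ^ l) (rho a bs) \<in> M"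
proof -
  have "alpha X a (rho a bs) j \<in> Zf" if "j < r" for j
    using alpha_rho[OF X bs that, of a] idealD0[OF ideal_Zf] by simp
  then show ?thesis unfolding trivial_dataD(1)[OF data rho_Fn[OF bs(1)]] by blast
qed

lemma common_power:
  assumes M: "lsub M" and A: "finite A" and ex: "\<And>x. x \<in> A \<Longrightarrow> \<exists>l. scl (F ^ l) (q x) \<in> M"
  shows "\<exists>L. \<forall>x\<in>A. scl (F ^ L) (q x) \<in> M"
proof -
  obtain l where l: "\<And>x. x \<in> A \<Longrightarrow> scl (F ^ l x) (q x) \<in> M" using ex by metis
  have "scl (F ^ sum l A) (q x) \<in> M" if x: "x \<in> A" for x
  proof -
    have "l x \<le> sum l A" by (rule member_le_sum[OF x _ A]) simp
    then have "F ^ sum l A = F ^ (sum l A - l x) * F ^ l x" by (simp flip: power_add)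
    then have "scl (F ^ sum l A) (q x) = scl (F ^ (sum l A - l x)) (scl (F ^ l x) (q x))"
      by (simp add: fun_eq_iff mult.assoc)
    then show ?thesis using fv.subspace_scale[OF M l[OF x]] by (simp only:)
  qed
  then show ?thesis by blast
qed

text \<open>The relation \<open>rho a (x # B)\<close> has coefficient \<open>gam a B\<close> at the
  entry \<open>x\<close>, and its other terms are supported on \<open>B\<close>; so it expresses
  that multiple of \<open>x\<close> through \<open>B\<close>.\<close>

lemma data_spans_by:
  assumes X: "finite X" and M: "lsub M" and data: "trivial_data M X r a"
    and B: "set B \<subseteq> X" "length B = r"
  shows "\<exists>l. spans_by (F ^ l * gam a B) X M (set B)"
proof -
  have "\<exists>l. scl (F ^ l) (rho a (x # B)) \<in> M" if "x \<in> X" for x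
    by (rule rho_in[OF X data]) (use that B in simp_all)
  then obtain L where L: "\<forall>x\<in>X. scl (F ^ L) (rho a (x # B)) \<in> M"
    using common_power[OF M X, of "\<lambda>x. rho a (x # B)"] by blast
  have "spans_by (F ^ L * gam a B) X M (set B)"
    unfolding spans_by_def
  proof
    fix x assume x: "x \<in> X"
    define n where "n = (\<Sum>i<r. scl ((- 1) ^ i * gam a (x # omit i B)) (ev (B ! i)))"
    have nB: "n \<in> Fn (set B)"
      unfolding n_def
      by (intro fv.subspace_sum[OF subspace_Fn] fv.subspace_scale[OF subspace_Fn] ev_in_Fn) (use B(2) in simp)
    have "rho a (x # B) = scl (gam a B) (ev x) + (\<Sum>i<r. scl ((- 1) ^ Suc i * gam a (x # omit i B)) (ev (B ! i)))"
      unfolding rho_def by (simp add: B(2) sum.lessThan_Suc_shift del: power_Suc sum.lessThan_Suc)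
    also have "(\<Sum>i<r. scl ((- 1) ^ Suc i * gam a (x # omit i B)) (ev (B ! i))) = - n"
      unfolding n_def sum_negf[symmetric] by (rule sum.cong) (simp_all add: fun_eq_iff)
    finally have eq: "rho a (x # B) = scl (gam a B) (ev x) + - n" .
    have "scl (F ^ L * gam a B) (ev x) - scl (F ^ L) n = scl (F ^ L) (rho a (x # B))"
      unfolding eq by (simp add: fun_eq_iff algebra_simps)
    moreover have "scl (F ^ L) (rho a (x # B)) \<in> M" using L x by blast
    ultimately have "scl (F ^ L * gam a B) (ev x) - scl (F ^ L) n \<in> M" by (simp only:)
    then show "\<exists>n\<in>Fn (set B). scl (F ^ L * gam a B) (ev x) - n \<in> M"
      using fv.subspace_scale[OF subspace_Fn nB] by blast
  qed
  then show ?thesis by blast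
qed

lemma reduce_to_rho:
  assumes X: "finite X" and data: "trivial_data M X r a"
    and B: "set B \<subseteq> X" "distinct B" "length B = r" and p: "p \<in> Fn X" "scl (F ^ l) p \<in> M"
  shows "scl (gam a B * gam a B) p \<in> lspan ((\<lambda>x. rho a (x # B)) ` (X - set B) \<union> {q. \<forall>x. q x \<in> Zf})"
    (is "scl ?g p \<in> lspan (?T \<union> ?Q)")
proof -
  have al: "alpha X a p j \<in> Zf" if "j < r" for j using trivial_dataD(1)[OF data p(1)] p(2) that by blast
  define s where "s = (\<Sum>x\<in>X - set B. scl (gam a B * p x) (rho a (x # B)))"
  have "s \<in> lspan (?T \<union> ?Q)"
    unfolding s_def by (intro fv.span_sum fv.span_scale fv.span_base) blast
  moreover have "scl ?g p - s \<in> lspan (?T \<union> ?Q)"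
    unfolding s_def using relation_in_span_rho[OF ideal_Zf X B p(1) al]
    by (intro fv.span_base) blast
  ultimately have "s + (scl ?g p - s) \<in> lspan (?T \<union> ?Q)" by (rule fv.span_add)
  then show ?thesis by simp
qed

text \<open>After multiplication by the square of a Pluecker coordinate outside \<open>P\<close>,
  each row lies, modulo \<open>Zf\<close>, in the span of at most \<open>card X - r\<close>
  relations; hence larger minors vanish near \<open>P\<close>.\<close>

lemma minors_from_data:
  assumes P: "max_ideal P" "Z \<subseteq> P" "F \<notin> P" and X: "finite X" and M: "M \<subseteq> Fn X"
    and data: "trivial_data M X r a" and y: "\<And>i. i < m \<Longrightarrow> y i \<in> M"
    and xs: "set xs \<subseteq> X" "length xs = m" and m: "card X - r < m"
  shows "\<exists>s. s \<notin> P \<and> s * dt m (\<lambda>i j. y i (xs ! j)) \<in> Z"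
proof -
  obtain B where B: "set B \<subseteq> X" "distinct B" "length B = r" "gam a B \<notin> P"
    using frame_selection[OF P data] by blast
  let ?g = "gam a B * gam a B" and ?T = "(\<lambda>x. rho a (x # B)) ` (X - set B)"
  have "card ?T \<le> card (X - set B)" using X by (intro card_image_le) simp
  also have "\<dots> = card X - r" using B(1-3) by (simp add: card_Diff_subset distinct_card)
  also have "\<dots> < m" by (rule m)
  finally have card: "card ?T < m" .
  have mi: "minors_in m X (lspan (?T \<union> {q. \<forall>x. q x \<in> Zf})) Zf"
    by (rule minors_in_add_ideal[OF ideal_Zf minors_in_few_rows[OF ideal_Zf _ card]]) (use X in simp)
  have "scl ?g (y i) \<in> lspan (?T \<union> {q. \<forall>x. q x \<in> Zf})" if i: "i < m" for i
    by (rule reduce_to_rho[OF X data B(1-3), of _ 0]) (use y[OF i] M in auto)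
  then have "dt m (\<lambda>i j. scl ?g (y i) (xs ! j)) \<in> Zf" by (rule minors_inD[OF mi _ xs])
  moreover have "dt m (\<lambda>i j. scl ?g (y i) (xs ! j)) = ?g ^ m * dt m (\<lambda>i j. y i (xs ! j))"
    using dt_scale_rows[of m "\<lambda>i. ?g"] by simp
  ultimately obtain l where "F ^ l * (?g ^ m * dt m (\<lambda>i j. y i (xs ! j))) \<in> Z"
    unfolding Zf_def by auto
  then have "(F ^ l * ?g ^ m) * dt m (\<lambda>i j. y i (xs ! j)) \<in> Z" by (simp only: mult.assoc)
  moreover have "F ^ l * ?g ^ m \<notin> P"
    by (intro max_ideal_prime[OF P(1)] max_ideal_power[OF P(1)] P(3) B(4))
  ultimately show ?thesis by blast
qed

lemma Zf_coefficients:
  assumes X: "finite X" and M: "piece_module Z X M" and q: "q \<in> Fn X" "\<And>x. q x \<in> Zf"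
  shows "\<exists>l. scl (F ^ l) q \<in> M"
proof -
  have "\<exists>l. scl (F ^ l) (scl (q x) (ev x)) \<in> M" if x: "x \<in> X" for x
  proof -
    obtain l where l: "F ^ l * q x \<in> Z" using q(2)[of x] unfolding Zf_def by blast
    have "scl (F ^ l) (scl (q x) (ev x)) \<in> M"
    proof (rule piece_moduleD(3)[OF M])
      show "scl (F ^ l) (scl (q x) (ev x)) \<in> Fn X"
        by (intro fv.subspace_scale[OF subspace_Fn] ev_in_Fn x)
      show "scl (F ^ l) (scl (q x) (ev x)) y \<in> Z" for y
        using idealD_mult2[OF ideal_Z l, of "ev x y"] by (simp add: mult.assoc)
    qed
    then show ?thesis by blast
  qed
  then obtain L where L: "\<forall>x\<in>X. scl (F ^ L) (scl (q x) (ev x)) \<in> M"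
    using common_power[OF piece_moduleD(1)[OF M] X, of "\<lambda>x. scl (q x) (ev x)"] by blast
  have "scl (F ^ L) q = scl (F ^ L) (\<Sum>x\<in>X. scl (q x) (ev x))"
    by (rule arg_cong[OF Fn_expand[OF X q(1)]])
  also have "\<dots> = (\<Sum>x\<in>X. scl (F ^ L) (scl (q x) (ev x)))" by (rule fv.scale_sum_right)
  also have "\<dots> \<in> M" by (rule fv.subspace_sum[OF piece_moduleD(1)[OF M]]) (use L in blast)
  finally show ?thesis by blast
qed

text \<open>With \<open>F\<close> inverted, \<open>N\<close> generates the quotient, and by the
  minors every relation supported on \<open>N\<close> is trivial; so the quotient is free on
  \<open>N\<close>. The coordinates of \<open>x\<close> are the coefficients of \<open>n x\<close>,
  that is, of \<open>F\<close> times \<open>x\<close>; the unit \<open>F\<close> only rescales the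
  coordinates.\<close>

lemma data_from_spans:
  assumes X: "finite X" and M: "piece_module Z X M" and N: "N \<subseteq> X" "card N = r"
    and sp: "spans_by F X M N" and mi: "minors_in (card X - r + 1) X M Z"
  shows "\<exists>a. trivial_data M X r a"
proof -
  note lM = piece_moduleD(1)[OF M]
  obtain ns where ns: "set ns = N" "distinct ns"
    using finite_distinct_list[OF finite_subset[OF N(1) X]] by blast
  have len: "length ns = r" using distinct_card[OF ns(2)] ns(1) N(2) by simp
  have nsN: "ns ! j \<in> N" if "j < r" for j using that len ns(1) nth_mem[of j ns] by simp
  have "\<forall>x. \<exists>n. x \<in> X \<longrightarrow> n \<in> Fn N \<and> scl F (ev x) - n \<in> M" using sp unfolding spans_by_def by blast
  then obtain n where n: "\<And>x. x \<in> X \<Longrightarrow> n x \<in> Fn N" "\<And>x. x \<in> X \<Longrightarrow> scl F (ev x) - n x \<in> M" by metis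
  define a where "a x j = n x (ns ! j)" for x j
  have rel: "c v \<in> Zf" if "c \<in> M" "c \<in> Fn N" "v \<in> N" for c v
  proof -
    have "F ^ (card X - r) * c v \<in> Z"
      by (rule minors_relation[OF X N _ mi that]) (use n in blast)
    then show ?thesis unfolding Zf_def by blast
  qed
  \<comment> \<open>The vector supported on \<open>N\<close> that represents \<open>F\<close> times
    the class of \<open>p\<close>.\<close>
  define Q where "Q p = (\<Sum>x\<in>X. scl (p x) (n x))" for p
  have QN: "Q p \<in> Fn N" for p
    unfolding Q_def by (intro fv.subspace_sum[OF subspace_Fn] fv.subspace_scale[OF subspace_Fn] n(1))
  have Qj: "alpha X a p j = Q p (ns ! j)" for p j
    unfolding Q_def a_def alpha_def sum_apply by simp
  have FQ: "scl F p - Q p \<in> M" if p: "p \<in> Fn X" for p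
  proof -
    have "scl F p = scl F (\<Sum>x\<in>X. scl (p x) (ev x))"
      by (rule arg_cong[OF Fn_expand[OF X p]])
    also have "\<dots> = (\<Sum>x\<in>X. scl (p x) (scl F (ev x)))"
      unfolding fv.scale_sum_right by (rule sum.cong) (simp_all add: fun_eq_iff mult.left_commute)
    finally have "scl F p - Q p = (\<Sum>x\<in>X. scl (p x) (scl F (ev x) - n x))"
      unfolding Q_def by (simp only: sum_subtractf[symmetric] fv.scale_right_diff_distrib)
    then show ?thesis
      using fv.subspace_sum[OF lM, of X "\<lambda>x. scl (p x) (scl F (ev x) - n x)"] fv.subspace_scale[OF lM n(2)]
      by (simp only:)
  qed
  have "(\<exists>l. scl (F ^ l) p \<in> M) \<longleftrightarrow> (\<forall>j<r. alpha X a p j \<in> Zf)" if p: "p \<in> Fn X" for p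
  proof
    assume "\<exists>l. scl (F ^ l) p \<in> M"
    then obtain l where l: "scl (F ^ l) p \<in> M" by blast
    have "scl F (scl (F ^ l) p) - scl (F ^ l) (scl F p - Q p) \<in> M"
      by (intro fv.subspace_diff[OF lM] fv.subspace_scale[OF lM] l FQ[OF p])
    moreover have "scl F (scl (F ^ l) p) - scl (F ^ l) (scl F p - Q p) = scl (F ^ l) (Q p)"
      by (simp add: fun_eq_iff algebra_simps)
    ultimately have c: "scl (F ^ l) (Q p) \<in> M" by (simp only:)
    have "F ^ l * Q p v \<in> Zf" if "v \<in> N" for v
      using rel[OF c fv.subspace_scale[OF subspace_Fn QN] that] by simp
    then have "Q p v \<in> Zf" if "v \<in> N" for v using Zf_shift that by blast
    then show "\<forall>j<r. alpha X a p j \<in> Zf" unfolding Qj using nsN by blast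
  next
    assume al: "\<forall>j<r. alpha X a p j \<in> Zf"
    have "Q p v \<in> Zf" for v
    proof (cases "v \<in> N")
      case True
      then obtain j where "j < r" "v = ns ! j" using ns(1) len unfolding in_set_conv_nth by (metis in_set_conv_nth)
      then show ?thesis using al Qj by metis
    next
      case False then show ?thesis using FnD[OF QN] idealD0[OF ideal_Zf] by metis
    qed
    moreover have "Q p \<in> Fn X" using QN Fn_mono[OF N(1)] by blast
    ultimately obtain l where l: "scl (F ^ l) (Q p) \<in> M" using Zf_coefficients[OF X M] by blast
    have "scl (F ^ l) (scl F p - Q p) + scl (F ^ l) (Q p) \<in> M"
      by (intro fv.subspace_add[OF lM] fv.subspace_scale[OF lM] l FQ[OF p])
    moreover have "scl (F ^ l) (scl F p - Q p) + scl (F ^ l) (Q p) = scl (F ^ Suc l) p"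
      by (simp add: fun_eq_iff algebra_simps)
    ultimately have "scl (F ^ Suc l) p \<in> M" by (simp only:)
    then show "\<exists>l. scl (F ^ l) p \<in> M" by blast
  qed
  moreover have "\<exists>p\<in>Fn X. \<exists>i. \<forall>j'<r. alpha X a p j' - (if j' = j then F ^ i else 0) \<in> Zf" if j: "j < r" for j
  proof -
    have x: "ns ! j \<in> X" using nsN[OF j] N(1) by blast
    let ?c = "scl F (ev (ns ! j)) - n (ns ! j)"
    have cN: "?c \<in> Fn N"
      by (intro fv.subspace_diff[OF subspace_Fn] fv.subspace_scale[OF subspace_Fn] ev_in_Fn nsN j n(1) x)
    \<comment> \<open>For a position of \<open>N\<close> itself, \<open>F\<close> times it minus its
      expression \<open>n\<close> is a relation supported on \<open>N\<close>, so its coefficients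
      lie in \<open>Zf\<close>. This gives the unit vectors with exponent 1.\<close>
    have "alpha X a (ev (ns ! j)) j' - (if j' = j then F ^ 1 else 0) \<in> Zf" if j': "j' < r" for j'
    proof -
      have "- ?c (ns ! j') \<in> Zf" by (intro idealD_minus[OF ideal_Zf] rel n(2) x cN nsN j')
      moreover have "ev (ns ! j) (ns ! j') = (if j' = j then 1 else 0 :: 't)"
        using ns(2) len j j' by (simp add: ev_def nth_eq_iff_index_eq)
      ultimately show ?thesis unfolding alpha_ev[OF X x] a_def by (simp split: if_splits)
    qed
    then show ?thesis using ev_in_Fn[OF x] by blast
  qed
  ultimately show ?thesis unfolding trivial_data_alpha by blast
qed

end

context ring_cover
begin

lemma localized: "localized_ring R \<pi>"
  by (rule localized_ring.intro) (rule ring_cover_axioms)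

lemma loc_free_from_data:
  assumes X: "finite X" and M: "piece_module Z X M"
    and data: "\<And>P. max_ideal P \<Longrightarrow> Z \<subseteq> P \<Longrightarrow> \<exists>F a. F \<notin> P \<and> localized_ring.trivial_data R \<pi> F M X r a"
  shows "loc_free Z X M r"
  unfolding loc_free_def
proof (intro conjI allI impI)
  fix P assume "max_ideal P \<and> Z \<subseteq> P"
  then have P: "max_ideal P" "Z \<subseteq> P" by blast+
  obtain F a where F: "F \<notin> P" "localized_ring.trivial_data R \<pi> F M X r a" using data[OF P] by blast
  interpret F: localized_ring R \<pi> F by (rule localized)
  obtain B where B: "set B \<subseteq> X" "distinct B" "length B = r" "gam a B \<notin> P"
    using F.frame_selection[OF P F] by blast
  obtain l where l: "spans_by (F ^ l * gam a B) X M (set B)"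
    using F.data_spans_by[OF X piece_moduleD(1)[OF M] F(2) B(1,3)] by blast
  have "F ^ l * gam a B \<notin> P" by (intro max_ideal_prime[OF P(1)] max_ideal_power[OF P(1)] F(1) B(4))
  moreover have "card (set B) = r" using distinct_card[OF B(2)] B(3) by simp
  ultimately show "\<exists>N f. N \<subseteq> X \<and> card N = r \<and> f \<notin> P \<and> spans_by f X M N" using B(1) l by blast
next
  show "minors_in (card X - r + 1) X M Z"
    unfolding minors_in_def
  proof (intro allI impI)
    fix y xs assume y: "(\<forall>i<card X - r + 1. y i \<in> M) \<and> set xs \<subseteq> X \<and> length xs = card X - r + 1"
    show "dt (card X - r + 1) (\<lambda>i j. y i (xs ! j)) \<in> Z"
    proof (rule in_ideal_locally[OF ideal_Z])
      fix P assume P: "max_ideal P" "Z \<subseteq> P"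
      obtain F a where F: "F \<notin> P" "localized_ring.trivial_data R \<pi> F M X r a" using data[OF P] by blast
      interpret F: localized_ring R \<pi> F by (rule localized)
      show "\<exists>s. s \<notin> P \<and> s * dt (card X - r + 1) (\<lambda>i j. y i (xs ! j)) \<in> Z"
        by (rule F.minors_from_data[OF P F(1) X piece_moduleD(2)[OF M] F(2)]) (use y in auto)
    qed
  qed
qed

text \<open>Since \<open>D\<close> is finite, the product of the elements that serve the single
  degrees serves all degrees simultaneously.\<close>

lemma exists_common_data:
  assumes D: "finite D" and X: "\<And>d. d \<in> D \<Longrightarrow> finite (X d)"
    and M: "\<And>d. d \<in> D \<Longrightarrow> piece_module Z (X d) (M d)"
    and lf: "\<And>d. d \<in> D \<Longrightarrow> loc_free Z (X d) (M d) (r d)" and P: "max_ideal P" "Z \<subseteq> P"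
  shows "\<exists>F. F \<notin> P \<and> (\<forall>d\<in>D. \<exists>a. localized_ring.trivial_data R \<pi> F (M d) (X d) (r d) a)"
proof -
  let ?Q = "\<lambda>d z. fst z \<subseteq> X d \<and> card (fst z) = r d \<and> snd z \<notin> P \<and> spans_by (snd z) (X d) (M d) (fst z)"
  have "\<forall>d\<in>D. \<exists>z. ?Q d z"
  proof
    fix d assume d: "d \<in> D"
    obtain N f where "N \<subseteq> X d" "card N = r d" "f \<notin> P" "spans_by f (X d) (M d) N"
      using conjunct1[OF lf[OF d, unfolded loc_free_def]] P by blast
    then show "\<exists>z. ?Q d z" by (intro exI[of _ "(N, f)"]) simp
  qed
  from bchoice[OF this] obtain z where z: "\<forall>d\<in>D. ?Q d (z d)" ..
  define f where "f d = snd (z d)" for d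
  have "prod f D \<notin> P" using z by (intro max_ideal_prod[OF P(1)]) (simp add: f_def)
  moreover have "\<exists>a. localized_ring.trivial_data R \<pi> (prod f D) (M d) (X d) (r d) a" if d: "d \<in> D" for d
  proof -
    have Q: "?Q d (z d)" using z d by blast
    have eq: "prod f D = prod f (D - {d}) * f d" using prod.remove[OF D d, of f] by (simp add: mult.commute)
    have sp: "spans_by (prod f D) (X d) (M d) (fst (z d))"
      unfolding eq f_def by (rule spans_by_mult[OF piece_moduleD(1)[OF M[OF d]]]) (use Q in blast)
    show ?thesis
      by (rule localized_ring.data_from_spans[OF localized X[OF d] M[OF d] _ _ sp conjunct2[OF lf[OF d, unfolded loc_free_def]]])
        (use Q in simp_all)
  qed
  ultimately show ?thesis by blast
qed

lemma ideal_image: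
  assumes Q: "ideal_set Q" shows "ideal (\<pi> ` Q) R"
proof (rule idealI)
  show "subgroup (\<pi> ` Q) (add_monoid R)"
  proof (rule add.subgroupI)
    show "\<pi> ` Q \<noteq> {}" using idealD0[OF Q] by blast
    show "\<ominus> a \<in> \<pi> ` Q" if a: "a \<in> \<pi> ` Q" for a
    proof -
      obtain q where "a = \<pi> q" "q \<in> Q" using a by blast
      then have "\<ominus> a = \<pi> (- q)" "- q \<in> Q" using idealD_minus[OF Q] \<pi>_minus by simp_all
      then show ?thesis by blast
    qed
    show "a \<oplus> b \<in> \<pi> ` Q" if ab: "a \<in> \<pi> ` Q" "b \<in> \<pi> ` Q" for a b
    proof -
      obtain q q' where "a = \<pi> q" "q \<in> Q" "b = \<pi> q'" "q' \<in> Q" using ab by blast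
      then have "a \<oplus> b = \<pi> (q + q')" "q + q' \<in> Q" using idealD_add[OF Q] \<pi>_add by simp_all
      then show ?thesis by blast
    qed
  qed blast
  have *: "x \<otimes> a \<in> \<pi> ` Q" if ax: "a \<in> \<pi> ` Q" "x \<in> carrier R" for a x
  proof -
    obtain t where t: "\<pi> t = x" using \<pi>_surj[OF ax(2)] by blast
    obtain q where "a = \<pi> q" "q \<in> Q" using ax(1) by blast
    then have "x \<otimes> a = \<pi> (t * q)" "t * q \<in> Q" using t idealD_mult[OF Q] \<pi>_mult by simp_all
    then show ?thesis by blast
  qed
  show "x \<otimes> a \<in> \<pi> ` Q" if "a \<in> \<pi> ` Q" "x \<in> carrier R" for a x by (rule *[OF that])
  show "a \<otimes> x \<in> \<pi> ` Q" if "a \<in> \<pi> ` Q" "x \<in> carrier R" for a x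
  proof -
    have "a \<in> carrier R" using that(1) by blast
    then show ?thesis using *[OF that] m_comm[OF _ that(2)] by simp
  qed
qed (rule cring.axioms(1)[OF is_cring])

lemma ideal_preimage:
  assumes "ideal I R" shows "ideal_set {t. \<pi> t \<in> I}"
proof -
  interpret I: ideal I R by fact
  show ?thesis unfolding ideal_set_def by (auto simp: \<pi>_0 \<pi>_add \<pi>_mult I.zero_closed I.a_closed I.I_l_closed)
qed

text \<open>A family generating the unit ideal has a member outside each given maximal ideal, which
  yields one direction. For the other, the elements over which the quotient trivializes are shown to
  generate the unit ideal, and finitely many of them suffice.\<close>

lemma locally_free_iff:
  assumes X: "finite X" and L: "submodule L R (FM X)"
  shows "locally_free R (quotient_module (FM X) L) r \<longleftrightarrow> loc_free Z X (pull X L) r"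
proof
  note M = piece_module_pull[OF X L]
  assume "locally_free R (quotient_module (FM X) L) r"
  then obtain F0 where F0: "F0 \<subseteq> carrier R" "genideal R F0 = carrier R"
      "\<forall>f\<in>F0. trivializations R f (quotient_module (FM X) L) r \<noteq> {}"
    unfolding locally_free_def by blast
  show "loc_free Z X (pull X L) r"
  proof (rule loc_free_from_data[OF X M])
    fix P assume P: "max_ideal P" "Z \<subseteq> P"
    have "\<exists>F. F \<notin> P \<and> \<pi> F \<in> F0"
    proof (rule ccontr)
      assume no: "\<not> (\<exists>F. F \<notin> P \<and> \<pi> F \<in> F0)"
      have "F0 \<subseteq> \<pi> ` P"
      proof
        fix f assume f: "f \<in> F0"
        then obtain t where "\<pi> t = f" using \<pi>_surj F0(1) by blast
        then show "f \<in> \<pi> ` P" using no f by blast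
      qed
      then have "genideal R F0 \<subseteq> \<pi> ` P" by (rule genideal_minimal[OF ideal_image[OF max_idealD(1)[OF P(1)]]])
      then have "\<pi> 1 \<in> \<pi> ` P" unfolding F0(2) by blast
      then obtain p where p: "p \<in> P" "\<pi> 1 = \<pi> p" by blast
      then have "1 - p \<in> P" using P(2) unfolding \<pi>_eq_Z by blast
      from idealD_add[OF max_idealD(1)[OF P(1)] this p(1)] show False using max_idealD(2)[OF P(1)] by simp
    qed
    then obtain F where F: "F \<notin> P" "\<pi> F \<in> F0" by blast
    interpret Q: localized_quotient R \<pi> F X L by (intro localized_quotient.intro localized_quotient_axioms.intro localized X L)
    obtain \<Phi> where "\<Phi> \<in> trivializations R (\<pi> F) (quotient_module (FM X) L) r" using F0(3) F(2) by blast
    from Q.trivialization_data[OF this]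
    show "\<exists>F a. F \<notin> P \<and> localized_ring.trivial_data R \<pi> F (pull X L) X r a" using F(1) by blast
  qed
next
  note M = piece_module_pull[OF X L]
  assume lf: "loc_free Z X (pull X L) r"
  define S where "S = {t. trivializations R (\<pi> t) (quotient_module (FM X) L) r \<noteq> {}}"
  define Q where "Q = {t. \<exists>A. finite A \<and> A \<subseteq> S \<and> \<pi> t \<in> genideal R (\<pi> ` A)}"
  have sub: "\<pi> ` A \<subseteq> carrier R" for A by blast
  have id: "ideal (genideal R (\<pi> ` A)) R" for A by (rule genideal_ideal[OF sub])
  note idz = additive_subgroup.zero_closed[OF ideal.axioms(1)[OF id]]
  have QI: "t \<in> Q" if "finite A" "A \<subseteq> S" "\<pi> t \<in> genideal R (\<pi> ` A)" for t A
    unfolding Q_def mem_Collect_eq using that by (intro exI[of _ A] conjI)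
  have QE: "\<exists>A. finite A \<and> A \<subseteq> S \<and> \<pi> t \<in> genideal R (\<pi> ` A)" if "t \<in> Q" for t
    using that unfolding Q_def mem_Collect_eq .
  have ZQ: "c \<in> Q" if "\<pi> c = \<zero>" for c
  proof -
    show ?thesis by (rule QI[of "{}"]) (use idz[of "{}"] that in simp_all)
  qed
  have "1 \<in> Q"
  proof (rule one_in_ideal_locally[where Z = Z])
    show "ideal_set Q"
      unfolding ideal_set_def
    proof (intro conjI ballI allI)
      show "0 \<in> Q" by (rule ZQ) (rule \<pi>_0)
      fix a assume "a \<in> Q"
      then obtain A where A: "finite A" "A \<subseteq> S" "\<pi> a \<in> genideal R (\<pi> ` A)" using QE by blast
      have "\<pi> (c * a) \<in> genideal R (\<pi> ` A)" for c
        unfolding \<pi>_mult by (rule ideal.I_l_closed[OF id A(3) \<pi>_closed])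
      then show "c * a \<in> Q" for c by (rule QI[OF A(1,2)])
      fix b assume "b \<in> Q"
      then obtain B where B: "finite B" "B \<subseteq> S" "\<pi> b \<in> genideal R (\<pi> ` B)" using QE by blast
      have "genideal R (\<pi> ` A) \<subseteq> genideal R (\<pi> ` (A \<union> B))" "genideal R (\<pi> ` B) \<subseteq> genideal R (\<pi> ` (A \<union> B))"
        by (rule subset_Idl_subset[OF sub], simp add: image_Un)+
      then have "\<pi> a \<in> genideal R (\<pi> ` (A \<union> B))" "\<pi> b \<in> genideal R (\<pi> ` (A \<union> B))"
        using A(3) B(3) by (simp_all only: subset_iff)
      then have "\<pi> (a + b) \<in> genideal R (\<pi> ` (A \<union> B))"
        unfolding \<pi>_add by (rule additive_subgroup.a_closed[OF ideal.axioms(1)[OF id]])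
      then show "a + b \<in> Q" by (rule QI[rotated 2]) (use A(1,2) B(1,2) in simp_all)
    qed
    show "Z \<subseteq> Q" using ZQ unfolding Z_def by blast
    fix P assume P: "max_ideal P" "Z \<subseteq> P"
    obtain N f where Nf: "N \<subseteq> X" "card N = r" "f \<notin> P" "spans_by f X (pull X L) N"
      using lf P unfolding loc_free_def by blast
    interpret Q: localized_quotient R \<pi> f X L by (intro localized_quotient.intro localized_quotient_axioms.intro localized X L)
    have mi: "minors_in (card X - r + 1) X (pull X L) Z"
      by (rule conjunct2[OF lf[unfolded loc_free_def]])
    obtain a where a: "Q.trivial_data (pull X L) X r a"
      using Q.data_from_spans[OF X M Nf(1,2,4) mi] by blast
    have fS: "f \<in> S" unfolding S_def mem_Collect_eq by (rule Q.data_trivialization[OF a])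
    have "f \<in> Q"
      by (rule QI[of "{f}"]) (use fS genideal_self[OF sub, of "{f}"] in simp_all)
    then show "\<exists>s\<in>Q. s \<notin> P" using Nf(3) by blast
  qed
  then obtain A where A: "finite A" "A \<subseteq> S" "\<pi> 1 \<in> genideal R (\<pi> ` A)" using QE by blast
  have gen: "genideal R (\<pi> ` A) = carrier R"
    by (rule ideal.one_imp_carrier[OF id A(3)[unfolded \<pi>_1]])
  have "\<forall>f\<in>\<pi> ` A. trivializations R f (quotient_module (FM X) L) r \<noteq> {}"
  proof
    fix f assume "f \<in> \<pi> ` A"
    then obtain t where t: "f = \<pi> t" "t \<in> S" using A(2) by blast
    show "trivializations R f (quotient_module (FM X) L) r \<noteq> {}" using t(2) unfolding S_def t(1) mem_Collect_eq .
  qed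
  then show "locally_free R (quotient_module (FM X) L) r"
    unfolding locally_free_def using gen A(1) sub[of A] by (intro exI[of _ "\<pi> ` A"]) simp
qed

end

section \<open>The natural equations in local coordinates\<close>

locale grassmann_family = ring_cover R \<pi>
  for R :: "('r, 'm) ring_scheme" (structure) and \<pi> :: "'t::comm_ring_1 \<Rightarrow> 'r" +
  fixes deg :: "('n::finite \<Rightarrow> nat) \<Rightarrow> 'a::ab_group_add" and h :: "'a \<Rightarrow> nat"
    and D :: "'a set" and L :: "'a \<Rightarrow> (('n \<Rightarrow> nat) \<Rightarrow> 'r) set"
  assumes pos: "positive_grading deg"
    and L: "\<And>d. d \<in> D \<Longrightarrow> submodule (L d) R (FM (monomials deg d))"
begin

sublocale graded deg Z h
  by unfold_locales (rule pos, rule ideal_Z)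

abbreviation M :: "'a \<Rightarrow> (('n \<Rightarrow> nat) \<Rightarrow> 't) set" where "M d \<equiv> pull (X d) (L d)"

lemma M_piece: "d \<in> D \<Longrightarrow> piece_module Z (X d) (M d)"
  by (rule piece_module_pull[OF finX L])

lemma deg_of_subset: "set bs \<subseteq> X c \<Longrightarrow> deg u + c = d \<Longrightarrow> x \<in> set bs \<Longrightarrow> u + x \<in> X d"
  by (auto simp: monomials_def deg_add)

end

text \<open>A trivialization in each degree of \<open>D\<close> together with its numerators
  \<open>a d\<close>, over the common denominator \<open>F ^ N d\<close>.\<close>

locale frame = grassmann_family R \<pi> deg h D L + localized_ring R \<pi> F
  for R :: "('r, 'm) ring_scheme" (structure) and \<pi> :: "'t::comm_ring_1 \<Rightarrow> 'r"
    and deg :: "('n::finite \<Rightarrow> nat) \<Rightarrow> 'a::ab_group_add" and h D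
    and L :: "'a \<Rightarrow> (('n \<Rightarrow> nat) \<Rightarrow> 'r) set" and F +
  fixes \<Phi> :: "'a \<Rightarrow> ((('n \<Rightarrow> nat) \<Rightarrow> 'r) set \<times> nat) set \<Rightarrow> nat \<Rightarrow> ('r \<times> nat) set"
    and a :: "'a \<Rightarrow> ('n \<Rightarrow> nat) \<Rightarrow> nat \<Rightarrow> 't" and N :: "'a \<Rightarrow> nat"
  assumes data: "\<And>d. d \<in> D \<Longrightarrow> trivial_data (M d) (X d) (h d) (a d)"
    and \<Phi>_eq: "\<And>d x j. d \<in> D \<Longrightarrow> x \<in> X d \<Longrightarrow> j < h d \<Longrightarrow>
      \<Phi> d (module_fraction R (\<pi> F) (quotient_module (graded_piece R deg d) (L d))
        (L d +>\<^bsub>graded_piece R deg d\<^esub> xpow R x) 0) j = fr (a d x j) (N d)"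
begin

lemma pluecker_fr:
  assumes d: "d \<in> D" and bs: "set bs \<subseteq> X d" "length bs \<le> h d"
  shows "pluecker R deg L (\<pi> F) \<Phi> d bs = fr (gam (a d) bs) (length bs * N d)"
proof -
  have "ring_det K (length bs) (\<lambda>i j. \<Phi> d (module_fraction R (\<pi> F) (quotient_module (graded_piece R deg d) (L d))
        (L d +>\<^bsub>graded_piece R deg d\<^esub> xpow R (bs ! i)) 0) j) =
      fr (dt (length bs) (\<lambda>i j. a d (bs ! i) j)) (\<Sum>i<length bs. N d)"
  proof (rule ring_det_fr)
    fix i j assume ij: "i < length bs" "j < length bs"
    have x: "bs ! i \<in> X d" using bs(1) ij(1) by (meson nth_mem subsetD)
    show "\<Phi> d (module_fraction R (\<pi> F) (quotient_module (graded_piece R deg d) (L d))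
        (L d +>\<^bsub>graded_piece R deg d\<^esub> xpow R (bs ! i)) 0) j = fr (a d (bs ! i) j) (N d)"
      by (rule \<Phi>_eq[OF d x]) (use ij(2) bs(2) in simp)
  qed
  then show ?thesis unfolding pluecker_def Let_def gam_def by simp
qed

text \<open>All summands have the denominator with exponent \<open>h c * N c + h d * N d\<close>, so
  the equation concerns numerators only. The sum of numerators is a determinant whose first row is
  the image of the multiplied relation in degree \<open>d\<close>.\<close>

lemma quadric_iff:
  assumes c: "c \<in> D" and d: "d \<in> D" and bs: "set bs \<subseteq> X c" "length bs = Suc (h c)"
    and cs: "set cs \<subseteq> X d" "Suc (length cs) = h d" and u: "deg u + c = d"
  shows "(\<Oplus>\<^bsub>K\<^esub>i\<in>{..h c}. (\<ominus>\<^bsub>K\<^esub> \<one>\<^bsub>K\<^esub>) [^]\<^bsub>K\<^esub> i \<otimes>\<^bsub>K\<^esub> (pluecker R deg L (\<pi> F) \<Phi> c (omit i bs) \<otimes>\<^bsub>K\<^esub>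
      pluecker R deg L (\<pi> F) \<Phi> d ((u + bs ! i) # cs))) = \<zero>\<^bsub>K\<^esub> \<longleftrightarrow>
    dt (h d) (\<lambda>k j. case k of 0 \<Rightarrow> alpha (X d) (a d) (shift u (rho (a c) bs)) j | Suc k' \<Rightarrow> a d (cs ! k') j) \<in> Zf"
proof -
  have ubs: "u + bs ! i \<in> X d" if "i \<le> h c" for i
    by (rule deg_of_subset[OF bs(1) u]) (use that bs(2) in simp)
  let ?t = "\<lambda>i. (- 1) ^ i * (gam (a c) (omit i bs) * gam (a d) ((u + bs ! i) # cs))"
  have "(\<ominus>\<^bsub>K\<^esub> \<one>\<^bsub>K\<^esub>) [^]\<^bsub>K\<^esub> i \<otimes>\<^bsub>K\<^esub> (pluecker R deg L (\<pi> F) \<Phi> c (omit i bs) \<otimes>\<^bsub>K\<^esub>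
      pluecker R deg L (\<pi> F) \<Phi> d ((u + bs ! i) # cs)) = fr (?t i) (h c * N c + h d * N d)" if i: "i \<le> h c" for i
  proof -
    have l: "length (omit i bs) = h c" using length_omit[of i bs] i bs(2) by simp
    have 1: "pluecker R deg L (\<pi> F) \<Phi> c (omit i bs) = fr (gam (a c) (omit i bs)) (h c * N c)"
      using pluecker_fr[OF c, of "omit i bs"] set_omit[of i bs] bs(1) l by auto
    have 2: "pluecker R deg L (\<pi> F) \<Phi> d ((u + bs ! i) # cs) = fr (gam (a d) ((u + bs ! i) # cs)) (h d * N d)"
      using pluecker_fr[OF d, of "(u + bs ! i) # cs"] ubs[OF i] cs by simp
    show ?thesis unfolding 1 2 fr_minus_one_power K_mult by simp
  qed
  then have "(\<Oplus>\<^bsub>K\<^esub>i\<in>{..h c}. (\<ominus>\<^bsub>K\<^esub> \<one>\<^bsub>K\<^esub>) [^]\<^bsub>K\<^esub> i \<otimes>\<^bsub>K\<^esub> (pluecker R deg L (\<pi> F) \<Phi> c (omit i bs) \<otimes>\<^bsub>K\<^esub>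
      pluecker R deg L (\<pi> F) \<Phi> d ((u + bs ! i) # cs))) = (\<Oplus>\<^bsub>K\<^esub>i\<in>{..h c}. fr (?t i) (h c * N c + h d * N d))"
    by (intro K.finsum_cong') auto
  also have "\<dots> = fr (\<Sum>i\<le>h c. ?t i) (h c * N c + h d * N d)" by (rule fr_sum) simp
  finally have "(\<Oplus>\<^bsub>K\<^esub>i\<in>{..h c}. (\<ominus>\<^bsub>K\<^esub> \<one>\<^bsub>K\<^esub>) [^]\<^bsub>K\<^esub> i \<otimes>\<^bsub>K\<^esub> (pluecker R deg L (\<pi> F) \<Phi> c (omit i bs) \<otimes>\<^bsub>K\<^esub>
      pluecker R deg L (\<pi> F) \<Phi> d ((u + bs ! i) # cs))) = \<zero>\<^bsub>K\<^esub> \<longleftrightarrow> (\<Sum>i\<le>h c. ?t i) \<in> Zf"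
    by (simp only: K_zero_iff)
  also have "(\<Sum>i\<le>h c. ?t i) = dt (h d) (\<lambda>k j. case k of 0 \<Rightarrow>
      (\<Sum>i\<le>h c. ((- 1) ^ i * gam (a c) (omit i bs)) * a d (u + bs ! i) j) | Suc k' \<Rightarrow> a d (cs ! k') j)"
    by (rule quadric_eq[OF bs(2) cs(2)])
  also have "\<dots> = dt (h d) (\<lambda>k j. case k of 0 \<Rightarrow> alpha (X d) (a d) (shift u (rho (a c) bs)) j | Suc k' \<Rightarrow> a d (cs ! k') j)"
    by (simp only: alpha_shift_rho[OF finX bs(2) ubs])
  finally show ?thesis .
qed

lemma rho_in_M: "d \<in> D \<Longrightarrow> set bs \<subseteq> X d \<Longrightarrow> length bs = Suc (h d) \<Longrightarrow> \<exists>l. scl (F ^ l) (rho (a d) bs) \<in> M d"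
  by (rule rho_in[OF finX data])

lemma quadric_from_closed:
  assumes c: "c \<in> D" and d: "d \<in> D" and bs: "set bs \<subseteq> X c" "length bs = Suc (h c)"
    and cl: "\<And>p. p \<in> M c \<Longrightarrow> shift u p \<in> M d" and hd: "0 < h d"
  shows "dt (h d) (\<lambda>k j. case k of 0 \<Rightarrow> alpha (X d) (a d) (shift u (rho (a c) bs)) j | Suc k' \<Rightarrow> a d (cs ! k') j) \<in> Zf"
proof (rule dt_first_row_in_ideal[OF ideal_Zf _ hd])
  fix j assume j: "j < h d"
  obtain l where "scl (F ^ l) (rho (a c) bs) \<in> M c" using rho_in_M[OF c bs] by blast
  from cl[OF this] have sM: "scl (F ^ l) (shift u (rho (a c) bs)) \<in> M d" unfolding shift_scl .
  then have "scl (F ^ l) (shift u (rho (a c) bs)) \<in> Fn (X d)" using piece_moduleD(2)[OF M_piece[OF d]] by blast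
  moreover have "scl (F ^ 0) (scl (F ^ l) (shift u (rho (a c) bs))) \<in> M d" using sM by simp
  ultimately have "alpha (X d) (a d) (scl (F ^ l) (shift u (rho (a c) bs))) j \<in> Zf"
    using trivial_dataD(1)[OF data[OF d]] j by blast
  then have "F ^ l * alpha (X d) (a d) (shift u (rho (a c) bs)) j \<in> Zf" unfolding alpha_scl by simp
  then show "alpha (X d) (a d) (shift u (rho (a c) bs)) j \<in> Zf" by (rule Zf_shift)
qed

lemma alpha_in: "(\<And>x. p x \<in> Zf) \<Longrightarrow> alpha Y b p j \<in> Zf"
  unfolding alpha_def by (intro idealD_sum[OF ideal_Zf] idealD_mult2[OF ideal_Zf])

text \<open>With Pluecker coordinates \<open>g\<close> and \<open>g'\<close> outside
  \<open>P\<close> in the degrees \<open>c\<close> and \<open>d\<close>, the factor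
  \<open>g * g\<close> expresses \<open>p\<close> through relations \<open>rho\<close>, and
  \<open>g'\<close> recovers the image of each relation from its determinants. A power of
  \<open>F\<close> converts membership in \<open>Zf\<close> into membership in the module.\<close>

lemma closed_locally:
  assumes P: "max_ideal P" "Z \<subseteq> P" "F \<notin> P"
    and c: "c \<in> D" and d: "d \<in> D" and u: "deg u + c = d" and p: "p \<in> M c"
    and eq: "\<And>bs cs. distinct bs \<Longrightarrow> set bs \<subseteq> X c \<Longrightarrow> length bs = Suc (h c) \<Longrightarrow> set cs \<subseteq> X d \<Longrightarrow> Suc (length cs) = h d \<Longrightarrow>
      dt (h d) (\<lambda>k j. case k of 0 \<Rightarrow> alpha (X d) (a d) (shift u (rho (a c) bs)) j | Suc k' \<Rightarrow> a d (cs ! k') j) \<in> Zf"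
  shows "\<exists>s. s \<notin> P \<and> scl s (shift u p) \<in> M d"
proof -
  obtain B where B: "set B \<subseteq> X c" "distinct B" "length B = h c" "gam (a c) B \<notin> P"
    using frame_selection[OF P data[OF c]] by blast
  obtain B' where B': "set B' \<subseteq> X d" "distinct B'" "length B' = h d" "gam (a d) B' \<notin> P"
    using frame_selection[OF P data[OF d]] by blast
  let ?g = "gam (a c) B" and ?g' = "gam (a d) B'" and ?\<phi> = "\<lambda>q j. alpha (X d) (a d) (shift u q) j"
  have pX: "p \<in> Fn (X c)" using p piece_moduleD(2)[OF M_piece[OF c]] by blast
  have "scl (F ^ 0) p \<in> M c" using p by simp
  then have al: "alpha (X c) (a c) p j \<in> Zf" if "j < h c" for j
    using trivial_dataD(1)[OF data[OF c] pX] that by blast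
  have rho: "?g' * ?\<phi> (rho (a c) (x # B)) j \<in> Zf" if x: "x \<in> X c - set B" and j: "j < h d" for x j
  proof (rule vector_from_minors[OF ideal_Zf B'(3) j])
    fix k assume k: "k < h d"
    show "dt (h d) (\<lambda>i j. case i of 0 \<Rightarrow> ?\<phi> (rho (a c) (x # B)) j | Suc i' \<Rightarrow> a d (omit k B' ! i') j) \<in> Zf"
      by (rule eq) (use x B(1-3) B' k set_omit[of k B'] length_omit[of k B'] in auto)
  qed
  define q where "q = scl (?g * ?g) p - (\<Sum>x\<in>X c - set B. scl (?g * p x) (rho (a c) (x # B)))"
  have q: "q y \<in> Zf" for y unfolding q_def by (rule relation_in_span_rho[OF ideal_Zf finX B(1-3) pX al])
  have main: "?g' * (?g * ?g) * ?\<phi> p j \<in> Zf" if j: "j < h d" for j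
  proof -
    have lin: "?\<phi> (scl s v) j = s * ?\<phi> v j" for s v by (simp add: shift_scl alpha_scl)
    have "?\<phi> q j = (?g * ?g) * ?\<phi> p j - (\<Sum>x\<in>X c - set B. (?g * p x) * ?\<phi> (rho (a c) (x # B)) j)"
      unfolding q_def shift_diff alpha_diff shift_sum minus_apply alpha_sum lin ..
    then have E: "?g' * ?\<phi> q j = ?g' * ((?g * ?g) * ?\<phi> p j) -
        ?g' * (\<Sum>x\<in>X c - set B. (?g * p x) * ?\<phi> (rho (a c) (x # B)) j)"
      by (simp only: right_diff_distrib)
    have S: "(\<Sum>x\<in>X c - set B. (?g * p x) * (?g' * ?\<phi> (rho (a c) (x # B)) j)) =
        ?g' * (\<Sum>x\<in>X c - set B. (?g * p x) * ?\<phi> (rho (a c) (x # B)) j)"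
      unfolding sum_distrib_left by (rule sum.cong) (simp_all only: ac_simps)
    have "?g' * (?g * ?g) * ?\<phi> p j = ?g' * ?\<phi> q j +
        (\<Sum>x\<in>X c - set B. (?g * p x) * (?g' * ?\<phi> (rho (a c) (x # B)) j))"
      unfolding E S by (simp only: mult.assoc diff_add_cancel)
    also have "\<dots> \<in> Zf"
      by (intro idealD_add[OF ideal_Zf] idealD_mult[OF ideal_Zf] idealD_sum[OF ideal_Zf] rho j alpha_in
        shift_coeff_in[OF ideal_Zf] q)
    finally show ?thesis .
  qed
  let ?s = "?g' * (?g * ?g)"
  have sX: "scl ?s (shift u p) \<in> Fn (X d)"
    using shift_Fn[OF pX, of u] u by (intro fv.subspace_scale[OF subspace_Fn]) simp
  have "alpha (X d) (a d) (scl ?s (shift u p)) j \<in> Zf" if "j < h d" for j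
    using main[OF that] by (simp add: alpha_scl)
  then obtain l where "scl (F ^ l) (scl ?s (shift u p)) \<in> M d"
    using trivial_dataD(1)[OF data[OF d] sX] by blast
  then have "scl (F ^ l * ?s) (shift u p) \<in> M d" by (simp only: fv.scale_scale)
  moreover have "F ^ l * ?s \<notin> P"
    by (intro max_ideal_prime[OF P(1)] max_ideal_power[OF P(1)] P(3) B(4) B'(4))
  ultimately show ?thesis by blast
qed

definition gamma_vector :: "'a \<times> ('n \<Rightarrow> nat) list \<times> ('n \<Rightarrow> nat) \<Rightarrow> ('n \<Rightarrow> nat) \<Rightarrow> 't" where
  "gamma_vector = (\<lambda>(d, bs, u). shift u (rho (a d) bs))"

lemma gamma_entry_fr:
  assumes "z \<in> gamma_rows deg h D e"
  shows "gamma_entry R deg h L (\<pi> F) \<Phi> z w = fr (gamma_vector z w) (h (fst z) * N (fst z))"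
proof -
  obtain d bs u where row: "z = (d, bs, u)" by (cases z) auto
  have d: "d \<in> D" and bs: "set bs \<subseteq> X d" "length bs = Suc (h d)"
    using assms unfolding row gamma_rows_def by auto
  let ?t = "\<lambda>i. if u + bs ! i = w then (- 1) ^ i * gam (a d) (omit i bs) else 0"
  have "(if u + bs ! i = w then (\<ominus>\<^bsub>K\<^esub> \<one>\<^bsub>K\<^esub>) [^]\<^bsub>K\<^esub> i \<otimes>\<^bsub>K\<^esub> pluecker R deg L (\<pi> F) \<Phi> d (omit i bs) else \<zero>\<^bsub>K\<^esub>) =
      fr (?t i) (h d * N d)" if i: "i \<le> h d" for i
  proof -
    have l: "length (omit i bs) = h d" using length_omit[of i bs] i bs(2) by simp
    have 1: "pluecker R deg L (\<pi> F) \<Phi> d (omit i bs) = fr (gam (a d) (omit i bs)) (h d * N d)"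
      using pluecker_fr[OF d, of "omit i bs"] set_omit[of i bs] bs(1) l by auto
    have 0: "\<zero>\<^bsub>K\<^esub> = fr 0 (h d * N d)" using K_zero_iff[of 0 "h d * N d"] idealD0[OF ideal_Zf] by simp
    show ?thesis unfolding 0 1 fr_minus_one_power K_mult by simp
  qed
  then have "gamma_entry R deg h L (\<pi> F) \<Phi> z w = (\<Oplus>\<^bsub>K\<^esub>i\<in>{..h d}. fr (?t i) (h d * N d))"
    unfolding row gamma_entry_def Let_def prod.case by (intro K.finsum_cong') auto
  also have "\<dots> = fr (\<Sum>i\<le>h d. ?t i) (h d * N d)" by (rule fr_sum) simp
  also have "(\<Sum>i\<le>h d. ?t i) = gamma_vector z w"
  proof -
    have "shift u (rho (a d) bs) w = (\<Sum>i\<le>h d. scl ((- 1) ^ i * gam (a d) (omit i bs)) (ev (u + bs ! i)) w)"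
      unfolding rho_def shift_sum shift_scl shift_ev bs(2) lessThan_Suc_atMost sum_apply ..
    also have "\<dots> = (\<Sum>i\<le>h d. ?t i)" by (rule sum.cong) (auto simp: ev_def)
    finally show ?thesis unfolding gamma_vector_def row prod.case ..
  qed
  finally show ?thesis by (simp add: row)
qed

text \<open>An ideal is zero iff its generators are. When r_e < h(e) the ideal is all of
  \<open>K\<close>, which is zero iff \<open>1 \<in> Zf\<close>.\<close>

lemma minors_ideal_iff:
  "minors_ideal K (int (card (X e)) - int (h e) + 1) (gamma_rows deg h D e) (X e) (gamma_entry R deg h L (\<pi> F) \<Phi>) =
      {\<zero>\<^bsub>K\<^esub>} \<longleftrightarrow>
    (if card (X e) < h e then 1 \<in> Zf
     else (\<forall>xs ys. distinct xs \<and> set xs \<subseteq> gamma_rows deg h D e \<and> length xs = card (X e) - h e + 1 \<and>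
       distinct ys \<and> set ys \<subseteq> X e \<and> length ys = card (X e) - h e + 1 \<longrightarrow>
       dt (card (X e) - h e + 1) (\<lambda>i j. gamma_vector (xs ! i) (ys ! j)) \<in> Zf))"
proof (cases "card (X e) < h e")
  case True
  have "carrier K = {\<zero>\<^bsub>K\<^esub>} \<longleftrightarrow> \<one>\<^bsub>K\<^esub> = \<zero>\<^bsub>K\<^esub>" using K.carrier_one_zero by blast
  also have "\<dots> \<longleftrightarrow> 1 \<in> Zf" unfolding K_one K_zero_iff ..
  finally show ?thesis using True unfolding minors_ideal_def by simp
next
  case False
  let ?m = "card (X e) - h e + 1"
  have m: "nat (int (card (X e)) - int (h e) + 1) = ?m" "\<not> int (card (X e)) - int (h e) + 1 \<le> 0" using False by auto
  let ?S = "{ring_det K ?m (\<lambda>i j. gamma_entry R deg h L (\<pi> F) \<Phi> (xs ! i) (ys ! j)) | xs ys.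
          distinct xs \<and> set xs \<subseteq> gamma_rows deg h D e \<and> length xs = ?m \<and>
          distinct ys \<and> set ys \<subseteq> X e \<and> length ys = ?m}"
  have det: "ring_det K ?m (\<lambda>i j. gamma_entry R deg h L (\<pi> F) \<Phi> (xs ! i) (ys ! j)) =
      fr (dt ?m (\<lambda>i j. gamma_vector (xs ! i) (ys ! j))) (\<Sum>i<?m. h (fst (xs ! i)) * N (fst (xs ! i)))"
    if "set xs \<subseteq> gamma_rows deg h D e" "length xs = ?m" for xs ys
  proof (rule ring_det_fr)
    fix i j assume "i < ?m" "j < ?m"
    then have "xs ! i \<in> gamma_rows deg h D e" using that nth_mem[of i xs] by auto
    then show "gamma_entry R deg h L (\<pi> F) \<Phi> (xs ! i) (ys ! j) =
        fr (gamma_vector (xs ! i) (ys ! j)) (h (fst (xs ! i)) * N (fst (xs ! i)))"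
      by (rule gamma_entry_fr)
  qed
  have sub: "?S \<subseteq> carrier K" using det by auto
  have "genideal K ?S = {\<zero>\<^bsub>K\<^esub>} \<longleftrightarrow> ?S \<subseteq> {\<zero>\<^bsub>K\<^esub>}"
  proof
    assume "genideal K ?S = {\<zero>\<^bsub>K\<^esub>}"
    then show "?S \<subseteq> {\<zero>\<^bsub>K\<^esub>}" using K.genideal_self[OF sub] by simp
  next
    assume "?S \<subseteq> {\<zero>\<^bsub>K\<^esub>}"
    then have "genideal K ?S \<subseteq> {\<zero>\<^bsub>K\<^esub>}" by (rule K.genideal_minimal[OF K.zeroideal])
    moreover have "\<zero>\<^bsub>K\<^esub> \<in> genideal K ?S"
      using additive_subgroup.zero_closed[OF ideal.axioms(1)[OF K.genideal_ideal[OF sub]]] .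
    ultimately show "genideal K ?S = {\<zero>\<^bsub>K\<^esub>}" by blast
  qed
  also have "\<dots> \<longleftrightarrow> (\<forall>xs ys. distinct xs \<and> set xs \<subseteq> gamma_rows deg h D e \<and> length xs = ?m \<and>
       distinct ys \<and> set ys \<subseteq> X e \<and> length ys = ?m \<longrightarrow>
       ring_det K ?m (\<lambda>i j. gamma_entry R deg h L (\<pi> F) \<Phi> (xs ! i) (ys ! j)) = \<zero>\<^bsub>K\<^esub>)" by blast
  also have "\<dots> \<longleftrightarrow> (\<forall>xs ys. distinct xs \<and> set xs \<subseteq> gamma_rows deg h D e \<and> length xs = ?m \<and>
       distinct ys \<and> set ys \<subseteq> X e \<and> length ys = ?m \<longrightarrow>
       dt ?m (\<lambda>i j. gamma_vector (xs ! i) (ys ! j)) \<in> Zf)"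
    using det K_zero_iff by (metis (no_types, lifting))
  finally show ?thesis using False m unfolding minors_ideal_def by simp
qed

text \<open>Up to a power of \<open>F\<close>, each row of \<open>\<Gamma>\<close> is a monomial
  multiple of an element of \<open>M\<close>.\<close>

lemma minors_from_shifts:
  assumes mi: "minors_in m (X e) (shifts D M e) Z"
    and xs: "set xs \<subseteq> gamma_rows deg h D e" "length xs = m" and ys: "set ys \<subseteq> X e" "length ys = m"
  shows "dt m (\<lambda>i j. gamma_vector (xs ! i) (ys ! j)) \<in> Zf"
proof -
  have "\<exists>l. scl (F ^ l) (gamma_vector row) \<in> shifts D M e" if "row \<in> gamma_rows deg h D e" for row
  proof -
    obtain d bs u where row: "row = (d, bs, u)" by (cases row) auto
    have d: "d \<in> D" and bs: "set bs \<subseteq> X d" "length bs = Suc (h d)" and u: "deg u + d = e"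
      using that unfolding row gamma_rows_def monomials_def by auto
    obtain l where "scl (F ^ l) (rho (a d) bs) \<in> M d" using rho_in_M[OF d bs] by blast
    then have "shift u (scl (F ^ l) (rho (a d) bs)) \<in> shifts D M e" using d u unfolding shifts_def by blast
    then show ?thesis unfolding row gamma_vector_def prod.case shift_scl by blast
  qed
  moreover have "xs ! i \<in> gamma_rows deg h D e" if "i < m" for i using xs that nth_mem[of i xs] by auto
  ultimately have "\<forall>i. \<exists>l. i < m \<longrightarrow> scl (F ^ l) (gamma_vector (xs ! i)) \<in> shifts D M e" by blast
  then obtain l where l: "\<And>i. i < m \<Longrightarrow> scl (F ^ l i) (gamma_vector (xs ! i)) \<in> shifts D M e" by metis
  have "dt m (\<lambda>i j. scl (F ^ l i) (gamma_vector (xs ! i)) (ys ! j)) \<in> Z"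
    by (rule minors_inD[OF mi l ys])
  moreover have "dt m (\<lambda>i j. scl (F ^ l i) (gamma_vector (xs ! i)) (ys ! j)) =
      F ^ (\<Sum>i<m. l i) * dt m (\<lambda>i j. gamma_vector (xs ! i) (ys ! j))"
    unfolding scl_apply power_sum by (rule dt_scale_rows)
  ultimately show ?thesis unfolding Zf_def by auto
qed

text \<open>Conversely, near \<open>P\<close> the rows of \<open>\<Gamma>\<close> span all monomial
  multiples of \<open>M\<close> in degree \<open>e\<close> modulo \<open>Zf\<close>, because the
  square of a Pluecker coordinate outside \<open>P\<close> expresses each element of
  \<open>M\<close> through relations \<open>rho\<close>.\<close>

lemma minors_locally:
  assumes P: "max_ideal P" "Z \<subseteq> P" "F \<notin> P" and e: "e \<notin> D"
    and eq: "\<And>xs ys. distinct xs \<Longrightarrow> set xs \<subseteq> gamma_rows deg h D e \<Longrightarrow> length xs = m \<Longrightarrow>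
       distinct ys \<Longrightarrow> set ys \<subseteq> X e \<Longrightarrow> length ys = m \<Longrightarrow> dt m (\<lambda>i j. gamma_vector (xs ! i) (ys ! j)) \<in> Zf"
    and y: "\<And>i. i < m \<Longrightarrow> y i \<in> shifts D M e" and ys: "set ys \<subseteq> X e" "length ys = m"
  shows "\<exists>s. s \<notin> P \<and> s * dt m (\<lambda>i j. y i (ys ! j)) \<in> Z"
proof -
  let ?R = "gamma_vector ` gamma_rows deg h D e"
  have "minors_in m (X e) ?R Zf"
    unfolding minors_in_def
  proof (intro allI impI)
    fix z zs assume z: "(\<forall>i<m. z i \<in> ?R) \<and> set zs \<subseteq> X e \<and> length zs = m"
    then have "\<forall>i. \<exists>row. i < m \<longrightarrow> row \<in> gamma_rows deg h D e \<and> z i = gamma_vector row" by blast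
    then obtain row where row: "\<And>i. i < m \<Longrightarrow> row i \<in> gamma_rows deg h D e" "\<And>i. i < m \<Longrightarrow> z i = gamma_vector (row i)"
      by metis
    let ?xs = "map row [0..<m]"
    have eqd: "dt m (\<lambda>i j. z i (zs ! j)) = dt m (\<lambda>i j. gamma_vector (?xs ! i) (zs ! j))"
      by (rule dt_cong) (simp add: row(2))
    show "dt m (\<lambda>i j. z i (zs ! j)) \<in> Zf"
    proof (cases "distinct ?xs \<and> distinct zs")
      case True
      then show ?thesis unfolding eqd by (intro eq) (use z row(1) in auto)
    next
      case False
      then consider "\<not> distinct ?xs" | "\<not> distinct zs" by blast
      then have "dt m (\<lambda>i j. gamma_vector (?xs ! i) (zs ! j)) = 0"
      proof cases
        case 1
        then obtain i j where ij: "i < length ?xs" "j < length ?xs" "i \<noteq> j" "?xs ! i = ?xs ! j"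
          unfolding distinct_conv_nth by blast
        show ?thesis by (rule dt_identical_rows[of i _ j]) (use ij in simp_all)
      next
        case 2
        then obtain i j where ij: "i < length zs" "j < length zs" "i \<noteq> j" "zs ! i = zs ! j"
          unfolding distinct_conv_nth by blast
        show ?thesis by (rule dt_identical_cols[of i _ j]) (use ij z in simp_all)
      qed
      then show ?thesis unfolding eqd using idealD0[OF ideal_Zf] by simp
    qed
  qed
  from minors_in_add_ideal[OF ideal_Zf this]
  have mi: "minors_in m (X e) (lspan (?R \<union> {q. \<forall>x. q x \<in> Zf})) Zf" .
  have "\<exists>s. s \<notin> P \<and> scl s (y i) \<in> lspan (?R \<union> {q. \<forall>x. q x \<in> Zf})" if i: "i < m" for i
  proof -
    obtain u d p where p: "y i = shift u p" "d \<in> D" "p \<in> M d" "deg u + d = e"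
      using y[OF i] unfolding shifts_def by blast
    obtain B where B: "set B \<subseteq> X d" "distinct B" "length B = h d" "gam (a d) B \<notin> P"
      using frame_selection[OF P data[OF p(2)]] by blast
    let ?g = "gam (a d) B"
    have pX: "p \<in> Fn (X d)" using p(3) piece_moduleD(2)[OF M_piece[OF p(2)]] by blast
    have "scl (F ^ 0) p \<in> M d" using p(3) by simp
    then have al: "alpha (X d) (a d) p j \<in> Zf" if "j < h d" for j
      using trivial_dataD(1)[OF data[OF p(2)] pX] that by blast
    define s where "s = (\<Sum>x\<in>X d - set B. scl (?g * p x) (rho (a d) (x # B)))"
    \<comment> \<open>Rows exist only for degrees strictly below \<open>e\<close>; equality is
      excluded because \<open>d\<close> is in \<open>D\<close> and \<open>e\<close> is not.\<close>
    have "deg_less deg d e" using p(2,4) e unfolding deg_less_def by (metis add_diff_cancel_right' rangeI)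
    then have row: "(d, x # B, u) \<in> gamma_rows deg h D e" if "x \<in> X d - set B" for x
      using that B p(2,4) unfolding gamma_rows_def monomials_def by auto
    have "shift u (rho (a d) (x # B)) \<in> ?R" if "x \<in> X d - set B" for x
      using imageI[OF row[OF that], of gamma_vector] unfolding gamma_vector_def prod.case .
    then have "shift u s \<in> lspan (?R \<union> {q. \<forall>x. q x \<in> Zf})"
      unfolding s_def shift_sum shift_scl by (intro fv.span_sum fv.span_scale fv.span_base) blast
    moreover have "shift u (scl (?g * ?g) p - s) x \<in> Zf" for x
      unfolding s_def by (intro shift_coeff_in[OF ideal_Zf] relation_in_span_rho[OF ideal_Zf finX B(1-3) pX al])
    then have "shift u (scl (?g * ?g) p - s) \<in> lspan (?R \<union> {q. \<forall>x. q x \<in> Zf})"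
      by (intro fv.span_base) blast
    ultimately have "shift u s + shift u (scl (?g * ?g) p - s) \<in> lspan (?R \<union> {q. \<forall>x. q x \<in> Zf})"
      by (rule fv.span_add)
    moreover have "shift u s + shift u (scl (?g * ?g) p - s) = scl (?g * ?g) (y i)"
      unfolding shift_add[symmetric] p(1) shift_scl[symmetric] by simp
    ultimately have "scl (?g * ?g) (y i) \<in> lspan (?R \<union> {q. \<forall>x. q x \<in> Zf})" by (simp only:)
    moreover have "?g * ?g \<notin> P" by (rule max_ideal_prime[OF P(1) B(4) B(4)])
    ultimately show ?thesis by blast
  qed
  then have "\<forall>i. \<exists>s. i < m \<longrightarrow> s \<notin> P \<and> scl s (y i) \<in> lspan (?R \<union> {q. \<forall>x. q x \<in> Zf})" by blast
  then obtain s where s: "\<And>i. i < m \<Longrightarrow> s i \<notin> P" "\<And>i. i < m \<Longrightarrow> scl (s i) (y i) \<in> lspan (?R \<union> {q. \<forall>x. q x \<in> Zf})"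
    by metis
  have "dt m (\<lambda>i j. scl (s i) (y i) (ys ! j)) \<in> Zf" by (rule minors_inD[OF mi s(2) ys])
  then have "(\<Prod>i<m. s i) * dt m (\<lambda>i j. y i (ys ! j)) \<in> Zf" unfolding scl_apply dt_scale_rows .
  then obtain l where "F ^ l * ((\<Prod>i<m. s i) * dt m (\<lambda>i j. y i (ys ! j))) \<in> Z" unfolding Zf_def by blast
  then have "(F ^ l * (\<Prod>i<m. s i)) * dt m (\<lambda>i j. y i (ys ! j)) \<in> Z" by (simp only: mult.assoc)
  moreover have "F ^ l * (\<Prod>i<m. s i) \<notin> P"
    by (intro max_ideal_prime[OF P(1)] max_ideal_power[OF P(1)] P(3) max_ideal_prod[OF P(1)]) (simp add: s(1))
  ultimately show ?thesis by blast
qed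

end

context grassmann_family
begin

lemma exists_frame:
  assumes "\<Phi> \<in> local_trivializations R deg h D L (\<pi> F)"
  shows "\<exists>a N. frame R \<pi> deg h D L F \<Phi> a N"
proof -
  interpret Q: localized_ring R \<pi> F by (rule localized)
  have "\<exists>a N. Q.trivial_data (M d) (X d) (h d) a \<and> (\<forall>x\<in>X d. \<forall>j<h d.
      \<Phi> d (module_fraction R (\<pi> F) (quotient_module (graded_piece R deg d) (L d))
        (L d +>\<^bsub>graded_piece R deg d\<^esub> xpow R x) 0) j = Q.fr (a x j) N)"
    if d: "d \<in> D" for d
  proof -
    interpret W: localized_quotient R \<pi> F "X d" "L d" by (intro localized_quotient.intro localized_quotient_axioms.intro localized finX L d)
    have "\<Phi> d \<in> trivializations R (\<pi> F) (quotient_module (FM (X d)) (L d)) (h d)"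
      using assms d unfolding local_trivializations_def graded_piece_def by blast
    from W.trivialization_data[OF this] obtain a N where
      aN: "Q.trivial_data (M d) (X d) (h d) a" "\<forall>x\<in>X d. \<forall>j<h d. \<Phi> d (W.mf (ev x) 0) j = Q.fr (a x j) N"
      by blast
    have x: "\<pi> \<circ> ev x = xpow R x" for x :: "'n \<Rightarrow> nat" by (simp add: xpow_def ev_def fun_eq_iff \<pi>_0 \<pi>_1)
    have "module_fraction R (\<pi> F) (quotient_module (graded_piece R deg d) (L d))
        (L d +>\<^bsub>graded_piece R deg d\<^esub> xpow R x) 0 = W.mf (ev x) 0" for x
      unfolding graded_piece_def using W.module_fraction_mf[of "ev x" 0] unfolding W.cos_def x .
    then show ?thesis using aN by auto
  qed
  then have "\<forall>d. \<exists>a N. d \<in> D \<longrightarrow> Q.trivial_data (M d) (X d) (h d) a \<and> (\<forall>x\<in>X d. \<forall>j<h d.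
      \<Phi> d (module_fraction R (\<pi> F) (quotient_module (graded_piece R deg d) (L d))
        (L d +>\<^bsub>graded_piece R deg d\<^esub> xpow R x) 0) j = Q.fr (a x j) N)"
    by blast
  then obtain a N where aN: "\<forall>d. d \<in> D \<longrightarrow> Q.trivial_data (M d) (X d) (h d) (a d) \<and> (\<forall>x\<in>X d. \<forall>j<h d.
      \<Phi> d (module_fraction R (\<pi> F) (quotient_module (graded_piece R deg d) (L d))
        (L d +>\<^bsub>graded_piece R deg d\<^esub> xpow R x) 0) j = Q.fr (a d x j) (N d))"
    by metis
  have "frame R \<pi> deg h D L F \<Phi> a N"
    by (intro frame.intro frame_axioms.intro grassmann_family_axioms localized) (use aN in auto)
  then show ?thesis by blast
qed

text \<open>The equations quantify over simultaneous trivializations in all degrees of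
  \<open>D\<close>. Near each maximal ideal such trivializations exist, so there the equations carry
  information.\<close>

lemma exists_local_frame:
  assumes D: "finite D" and lf: "\<And>d. d \<in> D \<Longrightarrow> loc_free Z (X d) (M d) (h d)" and P: "max_ideal P" "Z \<subseteq> P"
  shows "\<exists>F \<Phi> a N. F \<notin> P \<and> \<Phi> \<in> local_trivializations R deg h D L (\<pi> F) \<and> frame R \<pi> deg h D L F \<Phi> a N"
proof -
  obtain F where F: "F \<notin> P" "\<forall>d\<in>D. \<exists>a. localized_ring.trivial_data R \<pi> F (M d) (X d) (h d) a"
    using exists_common_data[where X = X and M = "\<lambda>d. pull (X d) (L d)" and r = h and D = D, OF D finX M_piece lf P] by blast
  have "trivializations R (\<pi> F) (quotient_module (graded_piece R deg d) (L d)) (h d) \<noteq> {}" if d: "d \<in> D" for d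
  proof -
    interpret Q: localized_quotient R \<pi> F "X d" "L d" by (intro localized_quotient.intro localized_quotient_axioms.intro localized finX L d)
    show ?thesis unfolding graded_piece_def using F(2) d Q.data_trivialization by blast
  qed
  then have "\<forall>d. \<exists>\<phi>. d \<in> D \<longrightarrow> \<phi> \<in> trivializations R (\<pi> F) (quotient_module (graded_piece R deg d) (L d)) (h d)"
    by blast
  then obtain \<Phi> where "\<forall>d. d \<in> D \<longrightarrow> \<Phi> d \<in> trivializations R (\<pi> F) (quotient_module (graded_piece R deg d) (L d)) (h d)"
    by metis
  then have \<Phi>: "\<Phi> \<in> local_trivializations R deg h D L (\<pi> F)" unfolding local_trivializations_def by blast
  obtain a N where "frame R \<pi> deg h D L F \<Phi> a N" using exists_frame[OF \<Phi>] by blast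
  then show ?thesis using F(1) \<Phi> by blast
qed

section \<open>Equivalence of the natural equations with closure under multiplication and vanishing
  minors\<close>

lemma quadratic_if_closed:
  assumes cl: "\<And>c d u p. c \<in> D \<Longrightarrow> d \<in> D \<Longrightarrow> p \<in> M c \<Longrightarrow> deg u + c = d \<Longrightarrow> shift u p \<in> M d"
  shows "quadratic_equations R deg h D L"
  unfolding quadratic_equations_def Let_def
proof (intro ballI allI impI, elim conjE)
  fix f \<Phi> c d u bs cs
  assume f: "f \<in> carrier R" and \<Phi>: "\<Phi> \<in> local_trivializations R deg h D L f" and cd: "c \<in> D" "d \<in> D"
    and u: "u \<in> monomials deg (d - c)" and bs: "set bs \<subseteq> X c" "length bs = h c + 1"
    and cs: "set cs \<subseteq> X d" "length cs + 1 = h d"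
  obtain F where F: "\<pi> F = f" using \<pi>_surj[OF f] by blast
  obtain a N where "frame R \<pi> deg h D L F \<Phi> a N" using exists_frame \<Phi> unfolding F[symmetric] by blast
  then interpret frame R \<pi> deg h D L F \<Phi> a N .
  have u': "deg u + c = d" using u by (simp add: monomials_def)
  have cs': "Suc (length cs) = h d" using cs(2) by simp
  have bs': "length bs = Suc (h c)" using bs(2) by simp
  show "(\<Oplus>\<^bsub>loc_ring R f\<^esub>i\<in>{..h c}. (\<ominus>\<^bsub>loc_ring R f\<^esub> \<one>\<^bsub>loc_ring R f\<^esub>) [^]\<^bsub>loc_ring R f\<^esub> i \<otimes>\<^bsub>loc_ring R f\<^esub>
      (pluecker R deg L f \<Phi> c (omit i bs) \<otimes>\<^bsub>loc_ring R f\<^esub> pluecker R deg L f \<Phi> d ((u + bs ! i) # cs))) =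
      \<zero>\<^bsub>loc_ring R f\<^esub>"
    unfolding F[symmetric] quadric_iff[OF cd bs(1) bs' cs(1) cs' u']
    by (rule quadric_from_closed[OF cd bs(1) bs']) (use cl cd u' cs' in auto)
qed

lemma closed_if_quadratic:
  assumes D: "finite D" and lf: "\<And>d. d \<in> D \<Longrightarrow> loc_free Z (X d) (M d) (h d)"
    and eq: "quadratic_equations R deg h D L"
    and c: "c \<in> D" and d: "d \<in> D" and p: "p \<in> M c" and u: "deg u + c = d"
  shows "shift u p \<in> M d"
proof (cases "u = 0")
  case True
  then show ?thesis using p u deg_zero by simp
next
  \<comment> \<open>The quadratic equations concern distinct degrees only; for
    \<open>u \<noteq> 0\<close> positivity makes the two degrees distinct.\<close>
  case False
  then have "deg u \<noteq> 0" using pos unfolding positive_grading_def by blast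
  then have less: "deg_less deg c d" using u unfolding deg_less_def by (metis add_cancel_left_left add_diff_cancel_right' rangeI)
  have u': "u \<in> monomials deg (d - c)" using u by (auto simp: monomials_def)
  note Md = piece_moduleD[OF M_piece[OF d]]
  have pX: "p \<in> Fn (X c)" using p piece_moduleD(2)[OF M_piece[OF c]] by blast
  then have sX: "shift u p \<in> Fn (X d)" using shift_Fn[of p c u] u by simp
  show ?thesis
  proof (rule in_subspace_locally[OF ideal_Z Md(1)])
    show "scl s (shift u p) \<in> M d" if "s \<in> Z" for s
      by (rule Md(3)) (use that fv.subspace_scale[OF subspace_Fn sX] idealD_mult2[OF ideal_Z] in auto)
    fix P assume P: "max_ideal P" "Z \<subseteq> P"
    obtain F \<Phi> a N where F: "F \<notin> P" and \<Phi>: "\<Phi> \<in> local_trivializations R deg h D L (\<pi> F)"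
      and fr: "frame R \<pi> deg h D L F \<Phi> a N" using exists_local_frame[OF D lf P] by blast
    interpret frame R \<pi> deg h D L F \<Phi> a N by (rule fr)
    show "\<exists>s. s \<notin> P \<and> scl s (shift u p) \<in> M d"
    proof (rule closed_locally[OF P F c d u p])
      fix bs cs assume b: "distinct bs" "set bs \<subseteq> X c" "length bs = Suc (h c)" and cs: "set cs \<subseteq> X d" "Suc (length cs) = h d"
      have "distinct bs \<and> set bs \<subseteq> X c \<and> length bs = h c + 1 \<and> set cs \<subseteq> X d \<and> length cs + 1 = h d"
        using b cs by simp
      note E = eq[unfolded quadratic_equations_def Let_def, rule_format, OF _ \<Phi> c d less u' this]
      have "\<pi> F \<in> carrier R" by blast
      from E[OF this] show "dt (h d) (\<lambda>k j. case k of 0 \<Rightarrow> alpha (X d) (a d) (shift u (rho (a c) bs)) j |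
          Suc k' \<Rightarrow> a d (cs ! k') j) \<in> Zf"
        unfolding quadric_iff[OF c d b(2,3) cs u] .
    qed
  qed
qed

lemma determinantal_if_minors:
  assumes mi: "minors_in (card (X e) - h e + 1) (X e) (shifts D M e) Z"
    and rank: "card (X e) < h e \<Longrightarrow> Z = UNIV"
  shows "determinantal_equations R deg h D e L"
  unfolding determinantal_equations_def
proof (intro ballI)
  fix f \<Phi> assume f: "f \<in> carrier R" and \<Phi>: "\<Phi> \<in> local_trivializations R deg h D L f"
  obtain F where F: "\<pi> F = f" using \<pi>_surj[OF f] by blast
  obtain a N where "frame R \<pi> deg h D L F \<Phi> a N" using exists_frame \<Phi> unfolding F[symmetric] by blast
  then interpret frame R \<pi> deg h D L F \<Phi> a N .
  show "minors_ideal (loc_ring R f) (int (card (X e)) - int (h e) + 1) (gamma_rows deg h D e) (X e)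
      (gamma_entry R deg h L f \<Phi>) = {\<zero>\<^bsub>loc_ring R f\<^esub>}"
    unfolding F[symmetric] minors_ideal_iff
    using Z_Zf rank minors_from_shifts[OF mi] by (simp split: if_split) blast
qed

lemma minors_if_determinantal:
  assumes D: "finite D" and lf: "\<And>d. d \<in> D \<Longrightarrow> loc_free Z (X d) (M d) (h d)"
    and e: "e \<notin> D" and eq: "determinantal_equations R deg h D e L"
  shows "minors_in (card (X e) - h e + 1) (X e) (shifts D M e) Z"
    and "card (X e) < h e \<Longrightarrow> Z = UNIV"
proof -
  have E: "if card (X e) < h e then 1 \<in> localized_ring.Zf R \<pi> F
     else (\<forall>xs ys. distinct xs \<and> set xs \<subseteq> gamma_rows deg h D e \<and> length xs = card (X e) - h e + 1 \<and>
       distinct ys \<and> set ys \<subseteq> X e \<and> length ys = card (X e) - h e + 1 \<longrightarrow>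
       dt (card (X e) - h e + 1) (\<lambda>i j. frame.gamma_vector a (xs ! i) (ys ! j)) \<in> localized_ring.Zf R \<pi> F)"
    if "\<Phi> \<in> local_trivializations R deg h D L (\<pi> F)" "frame R \<pi> deg h D L F \<Phi> a N" for F \<Phi> a N
  proof -
    interpret frame R \<pi> deg h D L F \<Phi> a N by (rule that(2))
    have "\<pi> F \<in> carrier R" by blast
    from eq[unfolded determinantal_equations_def, rule_format, OF this that(1)]
    show ?thesis unfolding minors_ideal_iff .
  qed
  \<comment> \<open>The equations require 1 to vanish in the localization at some \<open>F\<close>
    outside \<open>P\<close>, and then 1 would lie in \<open>P\<close>; so no maximal ideal over
    \<open>Z\<close> exists.\<close>
  show univ: "Z = UNIV" if c: "card (X e) < h e"
  proof (rule ccontr)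
    assume "Z \<noteq> UNIV"
    then have "1 \<notin> Z" using idealD_mult[OF ideal_Z, of 1] by auto
    then obtain P where P: "max_ideal P" "Z \<subseteq> P" using max_ideal_exists[OF ideal_Z] by blast
    obtain F \<Phi> a N where F: "F \<notin> P" and \<Phi>: "\<Phi> \<in> local_trivializations R deg h D L (\<pi> F)"
      and fr: "frame R \<pi> deg h D L F \<Phi> a N" using exists_local_frame[OF D lf P] by blast
    interpret frame R \<pi> deg h D L F \<Phi> a N by (rule fr)
    have "1 \<in> Zf" using E[OF \<Phi> fr] c by simp
    then show False using Zf_subset[OF P F] max_idealD(2)[OF P(1)] by blast
  qed
  show "minors_in (card (X e) - h e + 1) (X e) (shifts D M e) Z"
    unfolding minors_in_def
  proof (intro allI impI)
    fix y ys assume y: "(\<forall>i<card (X e) - h e + 1. y i \<in> shifts D M e) \<and> set ys \<subseteq> X e \<and> length ys = card (X e) - h e + 1"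
    show "dt (card (X e) - h e + 1) (\<lambda>i j. y i (ys ! j)) \<in> Z"
    proof (cases "card (X e) < h e")
      case True then show ?thesis using univ by blast
    next
      case False
      show ?thesis
      proof (rule in_ideal_locally[OF ideal_Z])
        fix P assume P: "max_ideal P" "Z \<subseteq> P"
        obtain F \<Phi> a N where F: "F \<notin> P" and \<Phi>: "\<Phi> \<in> local_trivializations R deg h D L (\<pi> F)"
          and fr: "frame R \<pi> deg h D L F \<Phi> a N" using exists_local_frame[OF D lf P] by blast
        interpret frame R \<pi> deg h D L F \<Phi> a N by (rule fr)
        show "\<exists>s. s \<notin> P \<and> s * dt (card (X e) - h e + 1) (\<lambda>i j. y i (ys ! j)) \<in> Z"
        proof (rule minors_locally[OF P F e])
          show "dt (card (X e) - h e + 1) (\<lambda>i j. gamma_vector (xs ! i) (zs ! j)) \<in> Zf"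
            if "distinct xs" "set xs \<subseteq> gamma_rows deg h D e" "length xs = card (X e) - h e + 1"
              "distinct zs" "set zs \<subseteq> X e" "length zs = card (X e) - h e + 1" for xs zs
            using E[OF \<Phi> fr] False that by simp
        qed (use y in auto)
      qed
    qed
  qed
qed

end

section \<open>Homogeneous ideals and their graded pieces\<close>

text \<open>The ring laws are inherited along a surjection. For \<open>poly_ring\<close> this
  replaces a direct verification of the laws of convolution.\<close>

lemma cring_image:
  fixes f :: "'t::comm_ring_1 \<Rightarrow> 's" and S :: "('s, 'm) ring_scheme" (structure)
  assumes im: "range f = carrier S" and add: "\<And>x y. f (x + y) = f x \<oplus> f y" and mult: "\<And>x y. f (x * y) = f x \<otimes> f y"
    and z: "f 0 = \<zero>" and o: "f 1 = \<one>"
  shows "cring S"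
proof -
  have c [simp]: "f x \<in> carrier S" for x using im by blast
  have ex: "\<exists>x. y = f x" if "y \<in> carrier S" for y using im that by blast
  show ?thesis
  proof (rule cringI)
    show "abelian_group S"
    proof (rule abelian_groupI)
      fix x y assume "x \<in> carrier S" "y \<in> carrier S"
      then obtain a b where [simp]: "x = f a" "y = f b" using ex by metis
      show "x \<oplus> y \<in> carrier S" "x \<oplus> y = y \<oplus> x" by (simp_all add: add[symmetric] ac_simps)
      fix w assume "w \<in> carrier S"
      then obtain d where [simp]: "w = f d" using ex by metis
      show "x \<oplus> y \<oplus> w = x \<oplus> (y \<oplus> w)" by (simp add: add[symmetric] ac_simps)
    next
      show "\<zero> \<in> carrier S" by (simp add: z[symmetric])
      fix x assume "x \<in> carrier S"
      then obtain a where [simp]: "x = f a" using ex by metis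
      show "\<zero> \<oplus> x = x" by (simp add: z[symmetric] add[symmetric])
      have "f (- a) \<oplus> x = \<zero>" by (simp add: z[symmetric] add[symmetric])
      then show "\<exists>y\<in>carrier S. y \<oplus> x = \<zero>" by (rule bexI) simp
    qed
    show "comm_monoid S"
    proof (rule comm_monoidI)
      fix x y assume "x \<in> carrier S" "y \<in> carrier S"
      then obtain a b where [simp]: "x = f a" "y = f b" using ex by metis
      show "x \<otimes> y \<in> carrier S" "x \<otimes> y = y \<otimes> x" by (simp_all add: mult[symmetric] ac_simps)
      fix w assume "w \<in> carrier S"
      then obtain d where [simp]: "w = f d" using ex by metis
      show "x \<otimes> y \<otimes> w = x \<otimes> (y \<otimes> w)" by (simp add: mult[symmetric] ac_simps)
    next
      show "\<one> \<in> carrier S" by (simp add: o[symmetric])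
      fix x assume "x \<in> carrier S"
      then obtain a where [simp]: "x = f a" using ex by metis
      show "\<one> \<otimes> x = x" by (simp add: o[symmetric] mult[symmetric])
    qed
    fix x y w assume "x \<in> carrier S" "y \<in> carrier S" "w \<in> carrier S"
    then obtain a b d where [simp]: "x = f a" "y = f b" "w = f d" using ex by metis
    show "(x \<oplus> y) \<otimes> w = x \<otimes> w \<oplus> y \<otimes> w"
      by (simp add: mult[symmetric] add[symmetric] distrib_right)
  qed
qed

section \<open>Polynomials over the covering ring and their homogeneous parts\<close>

type_synonym ('n, 't) mpoly = "('n \<Rightarrow> nat) \<Rightarrow>\<^sub>0 't"

abbreviation coef :: "('n, 't::comm_ring_1) mpoly \<Rightarrow> ('n \<Rightarrow> nat) \<Rightarrow> 't" where
  "coef \<equiv> Poly_Mapping.lookup"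

lemma lookup_times:
  fixes p q :: "('n::finite, 't::comm_ring_1) mpoly"
  shows "coef (p * q) w = (\<Sum>u | u \<le> w. coef p u * coef q (w - u))"
proof -
  have inner: "Sum_any (\<lambda>v. (coef q v when w = u + v)) = (if u \<le> w then coef q (w - u) else 0)" for u
  proof (cases "u \<le> w")
    case True
    have "w = u + v \<longleftrightarrow> v = w - u" for v
      using le_add_diff_exponent[OF True] by (metis add_diff_cancel_left')
    then show ?thesis using True by simp
  next
    case False
    then have "w \<noteq> u + v" for v using exponent_le_iff by blast
    then show ?thesis using False by simp
  qed
  have "coef (p * q) w = Sum_any (\<lambda>u. coef p u * (if u \<le> w then coef q (w - u) else 0))"
    unfolding lookup_mult inner ..
  also have "\<dots> = (\<Sum>u | u \<le> w. coef p u * (if u \<le> w then coef q (w - u) else 0))"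
    by (rule Sum_any.expand_superset) (auto simp: finite_exponents_le)
  finally show ?thesis by simp
qed

lemma lookup_single_times:
  fixes q :: "('n::finite, 't::comm_ring_1) mpoly"
  shows "coef (Poly_Mapping.single u c * q) = scl c (shift u (coef q))"
proof
  fix w
  have "coef (Poly_Mapping.single u c * q) w = (\<Sum>v | v \<le> w. if v = u then c * coef q (w - u) else 0)"
    unfolding lookup_times by (rule sum.cong) (auto simp: lookup_single when_def)
  also have "\<dots> = scl c (shift u (coef q)) w"
    by (simp add: finite_exponents_le shift_def)
  finally show "coef (Poly_Mapping.single u c * q) w = scl c (shift u (coef q)) w" .
qed

lemma sum_monomials:
  "(\<Sum>u\<in>Poly_Mapping.keys p. Poly_Mapping.single u (coef p u)) = (p :: ('n, 't::comm_ring_1) mpoly)"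
  by (rule poly_mapping_eqI) (simp add: lookup_sum lookup_single when_def in_keys_iff)

definition mpoly :: "(('n \<Rightarrow> nat) \<Rightarrow> 't) \<Rightarrow> ('n, 't::comm_ring_1) mpoly" where
  "mpoly p = Abs_poly_mapping p"

lemma lookup_mpoly: "p \<in> Fs X \<Longrightarrow> coef (mpoly p) = p"
  unfolding mpoly_def Fs_def by (simp add: Abs_poly_mapping_inverse)

lemma lookup_Fs: "coef q \<in> Fs UNIV"
  unfolding Fs_def Fn_def by simp

definition part :: "(('n \<Rightarrow> nat) \<Rightarrow> 'a) \<Rightarrow> 'a \<Rightarrow> (('n \<Rightarrow> nat) \<Rightarrow> 't::comm_ring_1) \<Rightarrow> ('n \<Rightarrow> nat) \<Rightarrow> 't" where
  "part deg a p = (\<lambda>u. if deg u = a then p u else 0)"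

lemma part_add: "part deg a (p + q) = part deg a p + part deg a q"
  and part_scl: "part deg a (scl c p) = scl c (part deg a p)"
  and part_zero: "part deg a 0 = 0"
  and part_part: "part deg b (part deg a p) = (if a = b then part deg a p else 0)"
  and part_Fn: "part deg a p \<in> Fn (monomials deg a)"
  by (auto simp: part_def fun_eq_iff Fn_def monomials_def)

lemma part_of_Fn: "p \<in> Fn (monomials deg a) \<Longrightarrow> part deg b p = (if a = b then p else 0)"
  unfolding part_def Fn_def monomials_def by (auto simp: fun_eq_iff)

locale poly_cover = ring_cover R \<pi>
  for R :: "('r, 'm) ring_scheme" (structure) and \<pi> :: "'t::comm_ring_1 \<Rightarrow> 'r" +
  fixes deg :: "('n::finite \<Rightarrow> nat) \<Rightarrow> 'a::ab_group_add"
  assumes pos: "positive_grading deg"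
begin

abbreviation S :: "(('n \<Rightarrow> nat) \<Rightarrow> 'r) ring" where "S \<equiv> poly_ring R"

definition \<Psi> :: "('n, 't) mpoly \<Rightarrow> ('n \<Rightarrow> nat) \<Rightarrow> 'r" where "\<Psi> q = \<pi> \<circ> coef q"

lemma S_carrier: "carrier S = carrier (FM UNIV)"
  by (simp add: poly_ring_def)

lemma range_\<Psi>: "range \<Psi> = carrier S"
proof
  show "range \<Psi> \<subseteq> carrier S"
    unfolding S_carrier \<Psi>_def using comp_in_free_module[OF lookup_Fs] by blast
  show "carrier S \<subseteq> range \<Psi>"
  proof
    fix q assume "q \<in> carrier S"
    then obtain p where "p \<in> Fs UNIV" "\<pi> \<circ> p = q" unfolding S_carrier by (rule free_module_lift)
    then have "\<Psi> (mpoly p) = q" unfolding \<Psi>_def by (simp add: lookup_mpoly)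
    then show "q \<in> range \<Psi>" by blast
  qed
qed

lemma \<Psi>_ops: "\<Psi> (p + q) = \<Psi> p \<oplus>\<^bsub>S\<^esub> \<Psi> q" "\<Psi> (p * q) = \<Psi> p \<otimes>\<^bsub>S\<^esub> \<Psi> q"
  "\<Psi> 0 = \<zero>\<^bsub>S\<^esub>" "\<Psi> 1 = \<one>\<^bsub>S\<^esub>"
proof -
  show "\<Psi> (p + q) = \<Psi> p \<oplus>\<^bsub>S\<^esub> \<Psi> q"
    by (simp add: \<Psi>_def poly_ring_def lookup_add \<pi>_add fun_eq_iff)
  have "\<pi> (\<Sum>u | u \<le> w. coef p u * coef q (w - u)) =
      (\<Oplus>u\<in>{u. u \<le> w}. \<pi> (coef p u) \<otimes> \<pi> (coef q (w - u)))" for w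
    unfolding \<pi>_sum[OF finite_exponents_le] by (simp add: \<pi>_mult)
  then show "\<Psi> (p * q) = \<Psi> p \<otimes>\<^bsub>S\<^esub> \<Psi> q"
    by (simp add: \<Psi>_def poly_ring_def lookup_times fun_eq_iff)
  show "\<Psi> 0 = \<zero>\<^bsub>S\<^esub>" by (simp add: \<Psi>_def poly_ring_def \<pi>_0 fun_eq_iff)
  show "\<Psi> 1 = \<one>\<^bsub>S\<^esub>" by (simp add: \<Psi>_def poly_ring_def \<pi>_0 \<pi>_1 fun_eq_iff lookup_one when_def)
qed

lemma cring_S: "cring S"
  by (rule cring_image[of \<Psi>]) (simp_all only: range_\<Psi> \<Psi>_ops)

text \<open>Polynomials over \<open>T\<close> cover \<open>poly_ring R\<close> just as
  \<open>T\<close> covers \<open>R\<close>. Hence the facts about covers, notably those on images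
  and preimages of ideals and on free modules, hold for the polynomial ring as well.\<close>

sublocale S: ring_cover S \<Psi>
proof (intro ring_cover.intro ring_cover_axioms.intro cring_S)
  show "\<Psi> t \<in> carrier S" for t using range_\<Psi> by blast
  show "\<exists>t. \<Psi> t = x" if "x \<in> carrier S" for x using that unfolding range_\<Psi>[symmetric] by blast
qed (rule \<Psi>_ops)+

lemma \<Psi>_single: "\<Psi> (Poly_Mapping.single u 1) = xpow R u"
  by (auto simp: \<Psi>_def xpow_def lookup_single when_def fun_eq_iff \<pi>_0 \<pi>_1)

abbreviation X :: "'a \<Rightarrow> ('n \<Rightarrow> nat) set" where "X \<equiv> monomials deg"

lemma finX: "finite (X a)" by (rule finite_monomials[OF pos])

lemma deg_add: "deg (u + v) = deg u + deg v" by (rule positive_grading_add[OF pos])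

lemma lookup_mpoly_Fn: "p \<in> Fn (X a) \<Longrightarrow> coef (mpoly p) = p"
  using lookup_mpoly[of p "X a"] Fs_finite[OF finX] by blast

lemma \<Psi>_mpoly: "p \<in> Fn (X a) \<Longrightarrow> \<Psi> (mpoly p) = \<pi> \<circ> p"
  by (simp add: \<Psi>_def lookup_mpoly_Fn)

lemma part_shift: "part deg b (shift u p) = shift u (part deg (b - deg u) p)"
proof
  fix w show "part deg b (shift u p) w = shift u (part deg (b - deg u) p) w"
  proof (cases "u \<le> w")
    case True
    then obtain v where w: "w = u + v" using exponent_le_iff by blast
    have "deg w = b \<longleftrightarrow> deg v = b - deg u" unfolding w deg_add by (auto simp: algebra_simps)
    then show ?thesis by (simp add: part_def w)
  qed (simp add: part_def shift_def)
qed

lemma lookup_parts: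
  "(\<Sum>a\<in>deg ` Poly_Mapping.keys q. mpoly (part deg a (coef q))) = q"
proof (rule poly_mapping_eqI)
  fix u
  have "(\<Sum>a\<in>deg ` Poly_Mapping.keys q. part deg a (coef q) u) = coef q u"
    by (cases "u \<in> Poly_Mapping.keys q") (auto simp: part_def in_keys_iff)
  then show "coef (\<Sum>a\<in>deg ` Poly_Mapping.keys q. mpoly (part deg a (coef q))) u = coef q u"
    by (simp add: lookup_sum lookup_mpoly_Fn[OF part_Fn])
qed

lemma component_\<Psi>: "(\<lambda>u. if deg u = a then \<Psi> q u else \<zero>) = \<Psi> (mpoly (part deg a (coef q)))"
  unfolding \<Psi>_mpoly[OF part_Fn] by (auto simp: \<Psi>_def part_def \<pi>_0)

section \<open>Homogeneous ideals assembled from graded pieces and cut into them\<close>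

definition family_ideal :: "('a \<Rightarrow> (('n \<Rightarrow> nat) \<Rightarrow> 't) set) \<Rightarrow> ('n, 't) mpoly set" where
  "family_ideal M = {q. \<forall>a. part deg a (coef q) \<in> M a}"

lemma ideal_family:
  assumes M: "\<And>a. piece_module Z (X a) (M a)" and sh: "\<And>a u p. p \<in> M a \<Longrightarrow> shift u p \<in> M (deg u + a)"
  shows "ideal_set (family_ideal M)"
  unfolding ideal_set_def
proof (intro conjI ballI allI)
  note lM = piece_moduleD(1)[OF M]
  have l0: "coef (0 :: ('n, 't) mpoly) = 0" and la: "coef (p + q) = coef p + coef q" for p q :: "('n, 't) mpoly"
    by (simp_all add: fun_eq_iff lookup_add)
  show 0: "0 \<in> family_ideal M" using fv.subspace_0[OF lM] by (simp add: family_ideal_def l0 part_zero)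
  show add: "p + q \<in> family_ideal M" if "p \<in> family_ideal M" "q \<in> family_ideal M" for p q
    unfolding family_ideal_def mem_Collect_eq la part_add
    using that[unfolded family_ideal_def mem_Collect_eq] by (intro allI fv.subspace_add[OF lM]) simp_all
  fix c q assume q: "q \<in> family_ideal M"
  have single: "Poly_Mapping.single u s * q \<in> family_ideal M" for u s
  proof -
    have "part deg b (coef (Poly_Mapping.single u s * q)) \<in> M b" for b
    proof -
      have "part deg (b - deg u) (coef q) \<in> M (b - deg u)" using q unfolding family_ideal_def by blast
      from sh[OF this, of u] have "shift u (part deg (b - deg u) (coef q)) \<in> M b" by simp
      then show ?thesis unfolding lookup_single_times part_scl part_shift by (rule fv.subspace_scale[OF lM])
    qed
    then show ?thesis unfolding family_ideal_def by blast
  qed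
  have "(\<Sum>u\<in>A. Poly_Mapping.single u (coef c u) * q) \<in> family_ideal M" for A
    by (induction A rule: infinite_finite_induct) (simp_all add: 0 add single)
  from this[of "Poly_Mapping.keys c"] show "c * q \<in> family_ideal M"
    unfolding sum_distrib_right[symmetric] sum_monomials .
qed

lemma piece_family:
  assumes M: "\<And>a. piece_module Z (X a) (M a)"
  shows "ideal_piece R deg (\<Psi> ` family_ideal M) a = (\<circ>) \<pi> ` M a"
proof
  show "ideal_piece R deg (\<Psi> ` family_ideal M) a \<subseteq> (\<circ>) \<pi> ` M a"
  proof
    fix x assume "x \<in> ideal_piece R deg (\<Psi> ` family_ideal M) a"
    then obtain q where q: "x = \<Psi> q" "q \<in> family_ideal M" and x: "x \<in> carrier (FM (X a))"
      unfolding ideal_piece_def graded_piece_def by blast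
    have "x u = \<zero>" if "deg u \<noteq> a" for u
      using x that unfolding free_module_carrier monomials_def by blast
    then have "x = (\<lambda>u. if deg u = a then \<Psi> q u else \<zero>)" using q(1) by auto
    also have "\<dots> = \<pi> \<circ> part deg a (coef q)" unfolding component_\<Psi> by (rule \<Psi>_mpoly[OF part_Fn])
    finally show "x \<in> (\<circ>) \<pi> ` M a" using q(2) unfolding family_ideal_def by blast
  qed
  show "(\<circ>) \<pi> ` M a \<subseteq> ideal_piece R deg (\<Psi> ` family_ideal M) a"
  proof
    fix x assume "x \<in> (\<circ>) \<pi> ` M a"
    then obtain p where p: "x = \<pi> \<circ> p" "p \<in> M a" by blast
    have pX: "p \<in> Fn (X a)" using piece_moduleD(2)[OF M] p(2) by blast
    have "part deg b (coef (mpoly p)) \<in> M b" for b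
      unfolding lookup_mpoly_Fn[OF pX] part_of_Fn[OF pX] using p(2) fv.subspace_0[OF piece_moduleD(1)[OF M]] by auto
    then have "mpoly p \<in> family_ideal M" unfolding family_ideal_def by blast
    then have "x \<in> \<Psi> ` family_ideal M" unfolding p(1) \<Psi>_mpoly[OF pX, symmetric] by (rule imageI)
    moreover have "p \<in> Fs (X a)" using pX Fs_finite[OF finX] by blast
    then have "x \<in> carrier (FM (X a))" unfolding p(1) by (rule comp_in_free_module)
    ultimately show "x \<in> ideal_piece R deg (\<Psi> ` family_ideal M) a"
      unfolding ideal_piece_def graded_piece_def by blast
  qed
qed

lemma homogeneous_family:
  assumes M: "\<And>a. piece_module Z (X a) (M a)" and sh: "\<And>a u p. p \<in> M a \<Longrightarrow> shift u p \<in> M (deg u + a)"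
  shows "homogeneous_ideal R deg (\<Psi> ` family_ideal M)"
  unfolding homogeneous_ideal_def
proof (intro conjI ballI allI)
  show "ideal (\<Psi> ` family_ideal M) S" by (rule S.ideal_image[OF ideal_family[OF M sh]])
  fix p a assume "p \<in> \<Psi> ` family_ideal M"
  then obtain q where q: "p = \<Psi> q" "q \<in> family_ideal M" by blast
  have "part deg b (coef (mpoly (part deg a (coef q)))) \<in> M b" for b
    unfolding lookup_mpoly_Fn[OF part_Fn] part_part
    using q(2) fv.subspace_0[OF piece_moduleD(1)[OF M]] unfolding family_ideal_def by auto
  then show "(\<lambda>u. if deg u = a then p u else \<zero>) \<in> \<Psi> ` family_ideal M"
    unfolding q(1) component_\<Psi> by (intro imageI) (simp add: family_ideal_def)
qed

definition pieces :: "(('n \<Rightarrow> nat) \<Rightarrow> 'r) set \<Rightarrow> 'a \<Rightarrow> (('n \<Rightarrow> nat) \<Rightarrow> 't) set" where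
  "pieces I a = {p \<in> Fn (X a). \<Psi> (mpoly p) \<in> I}"

lemma pieces_piece_module:
  assumes I: "ideal I S" shows "piece_module Z (X a) (pieces I a)"
proof -
  note Q = S.ideal_preimage[OF I]
  have "mpoly (p + q) = mpoly p + mpoly q" if "p \<in> Fn (X a)" "q \<in> Fn (X a)" for p q :: "('n \<Rightarrow> nat) \<Rightarrow> 't"
    by (rule poly_mapping_eqI) (simp add: lookup_add lookup_mpoly_Fn[OF that(1)] lookup_mpoly_Fn[OF that(2)]
      lookup_mpoly_Fn[OF fv.subspace_add[OF subspace_Fn that]])
  moreover have "mpoly (scl c p) = Poly_Mapping.single 0 c * mpoly p" if "p \<in> Fn (X a)" for c and p :: "('n \<Rightarrow> nat) \<Rightarrow> 't"
    by (rule poly_mapping_eqI) (simp add: lookup_single_times lookup_mpoly_Fn[OF that]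
      lookup_mpoly_Fn[OF fv.subspace_scale[OF subspace_Fn that]])
  moreover have "mpoly 0 = (0 :: ('n, 't) mpoly)" by (simp add: mpoly_def zero_fun_def)
  ultimately have m: "\<And>p q :: ('n \<Rightarrow> nat) \<Rightarrow> 't. p \<in> Fn (X a) \<Longrightarrow> q \<in> Fn (X a) \<Longrightarrow> mpoly (p + q) = mpoly p + mpoly q"
      "\<And>c (p :: ('n \<Rightarrow> nat) \<Rightarrow> 't). p \<in> Fn (X a) \<Longrightarrow> mpoly (scl c p) = Poly_Mapping.single 0 c * mpoly p"
      "mpoly 0 = (0 :: ('n, 't) mpoly)" by blast+
  have "lsub (pieces I a)"
  proof (rule fv.subspaceI)
    show "0 \<in> pieces I a"
      using idealD0[OF Q] fv.subspace_0[OF subspace_Fn, of "X a"] by (simp add: pieces_def m(3))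
    fix p assume p: "p \<in> pieces I a"
    then have pX: "p \<in> Fn (X a)" and pI: "mpoly p \<in> {t. \<Psi> t \<in> I}" by (simp_all add: pieces_def)
    show "p + q \<in> pieces I a" if q: "q \<in> pieces I a" for q
    proof -
      have qX: "q \<in> Fn (X a)" and qI: "mpoly q \<in> {t. \<Psi> t \<in> I}" using q by (simp_all add: pieces_def)
      show ?thesis
        using idealD_add[OF Q pI qI] fv.subspace_add[OF subspace_Fn pX qX] by (simp add: pieces_def m(1)[OF pX qX])
    qed
    show "scl c p \<in> pieces I a" for c
      using idealD_mult[OF Q pI, of "Poly_Mapping.single 0 c"] fv.subspace_scale[OF subspace_Fn pX, of c]
      by (simp add: pieces_def m(2)[OF pX])
  qed
  moreover have "p \<in> pieces I a" if p: "p \<in> Fn (X a)" "\<And>x. p x \<in> Z" for p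
  proof -
    have "\<Psi> (mpoly p) = \<Psi> 0" unfolding \<Psi>_mpoly[OF p(1)] using p(2) by (auto simp: \<Psi>_def Z_def \<pi>_0)
    then show ?thesis using p(1) idealD0[OF Q] by (simp add: pieces_def)
  qed
  ultimately show ?thesis unfolding piece_module_def by (auto simp: pieces_def)
qed

lemma image_pieces:
  assumes I: "ideal I S" shows "(\<circ>) \<pi> ` pieces I a = ideal_piece R deg I a"
proof
  show "(\<circ>) \<pi> ` pieces I a \<subseteq> ideal_piece R deg I a"
  proof
    fix x assume "x \<in> (\<circ>) \<pi> ` pieces I a"
    then obtain p where p: "x = \<pi> \<circ> p" "p \<in> Fn (X a)" "\<Psi> (mpoly p) \<in> I" unfolding pieces_def by blast
    have "p \<in> Fs (X a)" using p(2) Fs_finite[OF finX] by blast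
    then show "x \<in> ideal_piece R deg I a"
      using comp_in_free_module p unfolding ideal_piece_def graded_piece_def \<Psi>_mpoly[OF p(2)] by blast
  qed
  show "ideal_piece R deg I a \<subseteq> (\<circ>) \<pi> ` pieces I a"
  proof
    fix x assume x: "x \<in> ideal_piece R deg I a"
    then have "x \<in> carrier (FM (X a))" unfolding ideal_piece_def graded_piece_def by blast
    then obtain p where p: "p \<in> Fs (X a)" "\<pi> \<circ> p = x" by (rule free_module_lift)
    have pX: "p \<in> Fn (X a)" using p(1) Fs_finite[OF finX] by blast
    then have "p \<in> pieces I a" using x p(2) unfolding pieces_def ideal_piece_def by (simp add: \<Psi>_mpoly)
    then show "x \<in> (\<circ>) \<pi> ` pieces I a" using p(2) by blast
  qed
qed

lemma submodule_ideal_piece: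
  assumes I: "ideal I S" shows "submodule (ideal_piece R deg I a) R (FM (X a))"
  unfolding image_pieces[OF I, symmetric]
  using submodule_push[of "pieces I a" "X a"] piece_moduleD(1,2)[OF pieces_piece_module[OF I]] Fs_finite[OF finX]
  by blast

lemma pull_ideal_piece:
  assumes I: "ideal I S" shows "pull (X a) (ideal_piece R deg I a) = pieces I a"
  unfolding image_pieces[OF I, symmetric] by (rule pull_push[OF pieces_piece_module[OF I] finX])

lemma shift_pieces:
  assumes I: "ideal I S" and p: "p \<in> pieces I a" shows "shift u p \<in> pieces I (deg u + a)"
proof -
  have pX: "p \<in> Fn (X a)" and pI: "\<Psi> (mpoly p) \<in> I" using p unfolding pieces_def by blast+
  have sX: "shift u p \<in> Fn (X (deg u + a))" by (rule shift_in_Fn[OF deg_add pX])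
  have "mpoly (shift u p) = Poly_Mapping.single u 1 * mpoly p"
    by (rule poly_mapping_eqI) (simp add: lookup_single_times lookup_mpoly_Fn[OF sX] lookup_mpoly_Fn[OF pX])
  moreover have "Poly_Mapping.single u 1 * mpoly p \<in> {t. \<Psi> t \<in> I}"
    by (rule idealD_mult[OF S.ideal_preimage[OF I]]) (use pI in blast)
  ultimately show ?thesis using sX unfolding pieces_def by simp
qed

text \<open>An element is the finite sum of its homogeneous parts, and a homogeneous ideal contains
  these parts.\<close>

lemma subset_by_pieces:
  assumes I: "homogeneous_ideal R deg I" and J: "ideal J S"
    and le: "\<And>a. ideal_piece R deg I a \<subseteq> J"
  shows "I \<subseteq> J"
proof
  fix x assume x: "x \<in> I"
  have iI: "ideal I S" using I unfolding homogeneous_ideal_def by blast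
  have "x \<in> carrier S" using x ideal.Icarr[OF iI] by blast
  then obtain q where q: "x = \<Psi> q" using range_\<Psi> by blast
  have "\<Psi> (mpoly (part deg a (coef q))) \<in> J" for a
  proof -
    have "\<Psi> (mpoly (part deg a (coef q))) \<in> I"
      using I x unfolding homogeneous_ideal_def q component_\<Psi>[symmetric] by blast
    then have "part deg a (coef q) \<in> pieces I a" unfolding pieces_def mem_Collect_eq by (rule conjI[OF part_Fn])
    then have "\<pi> \<circ> part deg a (coef q) \<in> ideal_piece R deg I a" unfolding image_pieces[OF iI, symmetric] by blast
    then show ?thesis unfolding \<Psi>_mpoly[OF part_Fn] using le by blast
  qed
  then have "(\<Sum>a\<in>deg ` Poly_Mapping.keys q. mpoly (part deg a (coef q))) \<in> {t. \<Psi> t \<in> J}"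
    by (intro idealD_sum[OF S.ideal_preimage[OF J]]) blast
  then show "x \<in> J" unfolding lookup_parts q by blast
qed

end

section \<open>Monomial ideals\<close>

context poly_cover
begin

definition Mon :: "('n \<Rightarrow> nat) set \<Rightarrow> (('n \<Rightarrow> nat) \<Rightarrow> 'r) set" where
  "Mon J = {q \<in> carrier S. \<forall>w. w \<notin> J \<longrightarrow> q w = \<zero>}"

lemma \<Psi>_in_Mon: "\<Psi> t \<in> Mon J \<longleftrightarrow> (\<forall>w. w \<notin> J \<longrightarrow> coef t w \<in> Z)"
  using S.\<pi>_closed[of t] by (simp add: Mon_def \<Psi>_def Z_def)

text \<open>The coefficient of a product at \<open>w\<close> involves only coefficients of the
  factor \<open>p\<close> at exponents below \<open>w\<close>, and these are outside
  \<open>J\<close> whenever \<open>w\<close> is.\<close>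

lemma ideal_Mon_preimage:
  fixes J :: "('n \<Rightarrow> nat) set"
  assumes J: "up_closed J" shows "ideal_set {t. \<forall>w. w \<notin> J \<longrightarrow> coef t w \<in> Z}"
  unfolding ideal_set_def
proof (intro conjI ballI allI)
  show "0 \<in> {t. \<forall>w. w \<notin> J \<longrightarrow> coef t w \<in> Z}" using idealD0[OF ideal_Z] by simp
  fix p assume p: "p \<in> {t. \<forall>w. w \<notin> J \<longrightarrow> coef t w \<in> Z}"
  show "p + q \<in> {t. \<forall>w. w \<notin> J \<longrightarrow> coef t w \<in> Z}" if "q \<in> {t. \<forall>w. w \<notin> J \<longrightarrow> coef t w \<in> Z}" for q
    using p that idealD_add[OF ideal_Z] by (simp add: lookup_add)
  have "coef (c * p) w \<in> Z" if w: "w \<notin> J" for c w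
  proof -
    have "w - u \<notin> J" for u
    proof
      assume "w - u \<in> J"
      moreover have "w - u \<le> w" by (simp add: le_fun_def)
      ultimately show False using J w unfolding up_closed_def by blast
    qed
    then have "coef p (w - u) \<in> Z" for u using p by simp
    then show ?thesis unfolding lookup_times by (intro idealD_sum[OF ideal_Z] idealD_mult[OF ideal_Z])
  qed
  then show "c * p \<in> {t. \<forall>w. w \<notin> J \<longrightarrow> coef t w \<in> Z}" for c by blast
qed

lemma ideal_Mon:
  assumes J: "up_closed J" shows "ideal (Mon J) S"
proof -
  have "Mon J = \<Psi> ` {t. \<forall>w. w \<notin> J \<longrightarrow> coef t w \<in> Z}"
  proof (intro equalityI subsetI)
    fix q assume q: "q \<in> Mon J"
    then have "q \<in> range \<Psi>" unfolding range_\<Psi> Mon_def by blast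
    then obtain t where "q = \<Psi> t" by blast
    then show "q \<in> \<Psi> ` {t. \<forall>w. w \<notin> J \<longrightarrow> coef t w \<in> Z}" using q \<Psi>_in_Mon by blast
  next
    fix q assume "q \<in> \<Psi> ` {t. \<forall>w. w \<notin> J \<longrightarrow> coef t w \<in> Z}"
    then show "q \<in> Mon J" using \<Psi>_in_Mon by blast
  qed
  then show ?thesis using S.ideal_image[OF ideal_Mon_preimage[OF J]] by simp
qed

lemma up_closed_generated: "up_closed {w. \<exists>u\<in>U. u \<le> w}"
  unfolding up_closed_def using order_trans by blast

lemma genideal_xpow: "genideal S (xpow R ` U) = Mon {w. \<exists>u\<in>U. u \<le> w}" (is "_ = Mon ?J")
proof
  have c: "xpow R ` U \<subseteq> carrier S" using S.\<pi>_closed unfolding \<Psi>_single[symmetric] by blast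
  have "xpow R u \<in> Mon ?J" if "u \<in> U" for u
    unfolding \<Psi>_single[symmetric] \<Psi>_in_Mon using that idealD0[OF ideal_Z] by (auto simp: lookup_single when_def)
  then show "genideal S (xpow R ` U) \<subseteq> Mon ?J"
    by (intro S.genideal_minimal[OF ideal_Mon[OF up_closed_generated]]) blast
  show "Mon ?J \<subseteq> genideal S (xpow R ` U)"
  proof
    fix q assume q: "q \<in> Mon ?J"
    then have "q \<in> range \<Psi>" unfolding range_\<Psi> Mon_def by blast
    then obtain t where t: "q = \<Psi> t" by blast
    note I = S.ideal_preimage[OF S.genideal_ideal[OF c]]
    define t' where "t' = (\<Sum>w\<in>Poly_Mapping.keys t \<inter> ?J. Poly_Mapping.single w (coef t w))"
    have "Poly_Mapping.single w s \<in> {t. \<Psi> t \<in> genideal S (xpow R ` U)}" if w: "w \<in> ?J" for w s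
    proof -
      obtain u where u: "u \<in> U" "u \<le> w" using w by blast
      have "xpow R u \<in> genideal S (xpow R ` U)" using S.genideal_self[OF c] u(1) by blast
      then have "Poly_Mapping.single u 1 \<in> {t. \<Psi> t \<in> genideal S (xpow R ` U)}" by (simp add: \<Psi>_single)
      from idealD_mult[OF I this, of "Poly_Mapping.single (w - u) s"]
      have "Poly_Mapping.single (w - u + u) s \<in> {t. \<Psi> t \<in> genideal S (xpow R ` U)}" by (simp add: mult_single)
      then show ?thesis using le_add_diff_exponent[OF u(2)] by (simp add: add.commute)
    qed
    then have "t' \<in> {t. \<Psi> t \<in> genideal S (xpow R ` U)}" unfolding t'_def by (intro idealD_sum[OF I]) blast
    moreover have "\<Psi> t' = q"
    proof
      fix w
      have "coef t' w = (if w \<in> Poly_Mapping.keys t \<inter> ?J then coef t w else 0)"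
        unfolding t'_def lookup_sum by (simp add: lookup_single when_def)
      then show "\<Psi> t' w = q w"
        using q unfolding Mon_def t by (auto simp: \<Psi>_def \<pi>_0 in_keys_iff)
    qed
    ultimately show "q \<in> genideal S (xpow R ` U)" by blast
  qed
qed

lemma xpow_in_Mon:
  assumes "\<one> \<noteq> \<zero>" shows "xpow R u \<in> Mon J \<longleftrightarrow> u \<in> J"
proof -
  have "xpow R u \<in> carrier S" using S.\<pi>_closed unfolding \<Psi>_single[symmetric] by blast
  then show ?thesis using assms by (auto simp: Mon_def xpow_def)
qed

lemma mono_hilbert_Mon: "\<one> \<noteq> \<zero> \<Longrightarrow> mono_hilbert R deg (Mon J) = standard_count deg J"
  by (simp add: fun_eq_iff mono_hilbert_def standard_count_def xpow_in_Mon set_diff_eq)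

lemma monomial_Mon: "up_closed J \<Longrightarrow> monomial_ideal R (Mon J)"
proof -
  assume "up_closed J"
  then have "{w. \<exists>u\<in>J. u \<le> w} = J" unfolding up_closed_def by blast
  then have "Mon J = genideal S (xpow R ` J)" by (simp add: genideal_xpow)
  then show ?thesis unfolding monomial_ideal_def by blast
qed

lemma generated_Mon:
  assumes o: "\<one> \<noteq> \<zero>" and J: "up_closed J"
  shows "generated_in_degrees R deg D (Mon J) \<longleftrightarrow> exponents_generated deg D J"
proof -
  let ?J' = "{w. \<exists>u\<in>{u \<in> J. deg u \<in> D}. u \<le> w}"
  have gen: "{xpow R u | u. xpow R u \<in> Mon J \<and> deg u \<in> D} = xpow R ` {u \<in> J. deg u \<in> D}"
    unfolding xpow_in_Mon[OF o] by (rule image_Collect[symmetric])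
  have "generated_in_degrees R deg D (Mon J) \<longleftrightarrow> Mon J = Mon ?J'"
    unfolding generated_in_degrees_def gen genideal_xpow ..
  also have "\<dots> \<longleftrightarrow> J \<subseteq> ?J'"
  proof
    assume eq: "Mon J = Mon ?J'"
    show "J \<subseteq> ?J'"
    proof
      fix u assume "u \<in> J"
      then have "xpow R u \<in> Mon ?J'" using xpow_in_Mon[OF o, of u J, unfolded eq] by blast
      then show "u \<in> ?J'" using xpow_in_Mon[OF o] by blast
    qed
  next
    assume le: "J \<subseteq> ?J'"
    have "?J' \<subseteq> J" using J unfolding up_closed_def by blast
    then show "Mon J = Mon ?J'" by (rule arg_cong[OF equalityI[OF le]])
  qed
  also have "J \<subseteq> ?J' \<longleftrightarrow> exponents_generated deg D J"
    unfolding exponents_generated_def by blast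
  finally show ?thesis .
qed

section \<open>Transfer of the conditions on monomial ideals to exponent sets\<close>

lemma exponents_g_if:
  assumes o: "\<one> \<noteq> \<zero>" and c: "cond_g R deg h D"
  shows "exponents_g deg h D"
  unfolding exponents_g_def
proof (intro allI impI, elim conjE)
  fix J :: "('n \<Rightarrow> nat) set" assume J: "up_closed J" and count: "standard_count deg J = h"
  have "monomial_ideal R (Mon J) \<and> mono_hilbert R deg (Mon J) = h"
    using monomial_Mon[OF J] mono_hilbert_Mon[OF o, of J] count by simp
  then have "generated_in_degrees R deg D (Mon J)" by (rule c[unfolded cond_g_def, rule_format])
  then show "exponents_generated deg D J" unfolding generated_Mon[OF o J] .
qed

lemma exponents_h_if:
  assumes o: "\<one> \<noteq> \<zero>" and c: "cond_h R deg h D"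
  shows "exponents_h deg h D"
  unfolding exponents_h_def
proof (intro allI impI, elim conjE)
  fix J :: "('n \<Rightarrow> nat) set" and a
  assume J: "up_closed J" and gen: "exponents_generated deg D J" and count: "\<forall>a\<in>D. standard_count deg J a = h a"
  have "monomial_ideal R (Mon J) \<and> generated_in_degrees R deg D (Mon J) \<and> (\<forall>a\<in>D. mono_hilbert R deg (Mon J) a = h a)"
    unfolding generated_Mon[OF o J] mono_hilbert_Mon[OF o] using monomial_Mon[OF J] gen count by simp
  then have "mono_hilbert R deg (Mon J) a = h a" by (rule c[unfolded cond_h_def, rule_format])
  then show "standard_count deg J a = h a" unfolding mono_hilbert_Mon[OF o] .
qed

lemma exponents_h'_if:
  assumes o: "\<one> \<noteq> \<zero>" and c: "cond_h' R deg h D"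
  shows "exponents_h' deg h D"
  unfolding exponents_h'_def
proof (intro allI impI, elim conjE)
  fix J :: "('n \<Rightarrow> nat) set" and a
  assume J: "up_closed J" and gen: "exponents_generated deg D J" and count: "\<forall>a\<in>D. standard_count deg J a = h a"
  have "monomial_ideal R (Mon J) \<and> generated_in_degrees R deg D (Mon J) \<and> (\<forall>a\<in>D. mono_hilbert R deg (Mon J) a = h a)"
    unfolding generated_Mon[OF o J] mono_hilbert_Mon[OF o] using monomial_Mon[OF J] gen count by simp
  then have "mono_hilbert R deg (Mon J) a \<le> h a" by (rule c[unfolded cond_h'_def, rule_format])
  then show "standard_count deg J a \<le> h a" unfolding mono_hilbert_Mon[OF o] .
qed

definition lifted_pair :: "('n \<Rightarrow> nat) \<Rightarrow> ('n \<Rightarrow> nat) \<Rightarrow> ('n \<Rightarrow> nat) \<Rightarrow> ('n, 't) mpoly" where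
  "lifted_pair x y g = (if g = x then Poly_Mapping.single (sup x y - x) 1 else 0) -
     (if g = y then Poly_Mapping.single (sup x y - y) 1 else 0)"

lemma pair_syzygy_lift: "pair_syzygy R x y = \<Psi> \<circ> lifted_pair x y"
  by (simp add: fun_eq_iff pair_syzygy_def Let_def lifted_pair_def S.\<pi>_diff \<Psi>_single S.\<pi>_0)

lemma lifted_pair_sum:
  assumes C: "finite C"
  shows "(\<Sum>g\<in>C. lifted_pair x y g * Poly_Mapping.single g 1) =
    (if x \<in> C then Poly_Mapping.single (sup x y) 1 else 0) - (if y \<in> C then Poly_Mapping.single (sup x y) 1 else 0)"
proof -
  have "sup x y - x + x = sup x y" "sup x y - y + y = sup x y"
    using le_add_diff_exponent[of x "sup x y"] le_add_diff_exponent[of y "sup x y"] by (simp_all add: add.commute)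
  then have "lifted_pair x y g * Poly_Mapping.single g 1 = (if g = x then Poly_Mapping.single (sup x y) 1 else 0) -
      (if g = y then Poly_Mapping.single (sup x y) 1 else 0)" for g
    by (auto simp: lifted_pair_def left_diff_distrib mult_single)
  then show ?thesis using C by (simp add: sum_subtractf)
qed

text \<open>Suppose \<open>u\<close> and \<open>v\<close> lie in different components of the graph
  at \<open>w\<close>, and let \<open>C\<close> be the component of \<open>u\<close>. Summing a
  syzygy over the generators in \<open>C\<close> only is a module homomorphism. It kills, as far as
  terms dividing the monomial \<open>w\<close> are concerned, every pair syzygy with lcm-degree in
  \<open>D\<close>, but not the pair syzygy of \<open>u\<close> and \<open>v\<close>. So the latter
  is not generated by the former, against (s).\<close>

lemma exponents_s_if:
  assumes o: "\<one> \<noteq> \<zero>" and s: "cond_s R deg h D"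
  shows "exponents_s deg h D"
  unfolding exponents_s_def
proof (intro allI impI ballI, elim conjE)
  fix J w u v
  assume J: "up_closed J" and fin: "finite (minimal_exponents J)" and count: "standard_count deg J = h"
    and u: "u \<in> minimal_exponents J" and v: "v \<in> minimal_exponents J" and uv: "u \<le> w" "v \<le> w"
  define G where "G = minimal_exponents J"
  have G: "minimal_generators R (Mon J) = G"
    unfolding minimal_generators_def G_def minimal_exponents_def xpow_in_Mon[OF o] by (rule refl)
  have finG: "finite G" using fin unfolding G_def .
  define \<rho> where "\<rho> = lcm_relation deg D G w"
  show "(u, v) \<in> (lcm_relation deg D (minimal_exponents J) w)\<^sup>*"
  proof (rule ccontr)
    assume "(u, v) \<notin> (lcm_relation deg D (minimal_exponents J) w)\<^sup>*"
    then have no: "(u, v) \<notin> \<rho>\<^sup>*" unfolding \<rho>_def G_def .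
    define C where "C = {g \<in> G. (u, g) \<in> \<rho>\<^sup>*}"
    have finC: "finite C" unfolding C_def using finG by simp
    have uC: "u \<in> C" and vC: "v \<notin> C" using u no unfolding C_def G_def by blast+
    \<comment> \<open>Polynomials without terms dividing the monomial \<open>w\<close>, with
      coefficients read modulo \<open>Z\<close>, form an ideal; this makes \<open>M\<close> a
      submodule.\<close>
    have "up_closed {z. \<not> z \<le> w}" unfolding up_closed_def using order_trans by blast
    from ideal_Mon_preimage[OF this] have A: "ideal_set {t. \<forall>z. z \<le> w \<longrightarrow> coef t z \<in> Z}" by simp
    define \<phi> where "\<phi> s = (\<Sum>g\<in>C. s g * Poly_Mapping.single g 1)" for s :: "('n \<Rightarrow> nat) \<Rightarrow> ('n, 't) mpoly"
    define M where "M = {s \<in> Fs G. \<phi> s \<in> {t. \<forall>z. z \<le> w \<longrightarrow> coef t z \<in> Z}}"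
    have \<phi>: "\<phi> 0 = 0" "\<phi> (s + s') = \<phi> s + \<phi> s'" "\<phi> (scl c s) = c * \<phi> s" for s s' c
      by (simp_all add: \<phi>_def sum.distrib distrib_right sum_distrib_left mult.assoc)
    have "lsub M"
      unfolding M_def
    proof (rule fv.subspaceI, goal_cases)
      case 1 show ?case unfolding mem_Collect_eq[of _ "\<lambda>s. s \<in> Fs G \<and> _ s"] \<phi>(1)
        by (rule conjI[OF fv.subspace_0[OF subspace_Fs] idealD0[OF A]])
    next
      case (2 s s') then show ?case unfolding mem_Collect_eq[of _ "\<lambda>s. s \<in> Fs G \<and> _ s"] \<phi>(2)
        by (elim conjE) (intro conjI fv.subspace_add[OF subspace_Fs] idealD_add[OF A])
    next
      case (3 s c) then show ?case unfolding mem_Collect_eq[of _ "\<lambda>s. s \<in> Fs G \<and> _ s"] \<phi>(3)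
        by (elim conjE) (intro conjI fv.subspace_scale[OF subspace_Fs] idealD_mult[OF A])
    qed
    then have sub: "submodule ((\<circ>) \<Psi> ` M) S (free_module S G)"
      by (rule S.submodule_push) (auto simp: M_def)
    have tFs: "lifted_pair x y \<in> Fs G" if "x \<in> G" "y \<in> G" for x y
    proof -
      have "{g. lifted_pair x y g \<noteq> 0} \<subseteq> {x, y}" by (auto simp: lifted_pair_def)
      then have "finite {g. lifted_pair x y g \<noteq> 0}" by (rule finite_subset) simp
      then show ?thesis using that by (auto simp: Fs_def Fn_def lifted_pair_def)
    qed
    have gen: "pair_syzygy R x y \<in> (\<circ>) \<Psi> ` M" if xy: "x \<in> G" "y \<in> G" "deg (sup x y) \<in> D" for x y
    proof -
      \<comment> \<open>The only monomial that can occur is the lcm of \<open>x\<close> and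
        \<open>y\<close>. If it divides the monomial \<open>w\<close>, then \<open>x\<close> and
        \<open>y\<close> are joined by an edge, so both or neither belong to \<open>C\<close>, and
        the contributions cancel.\<close>
      have "coef (\<phi> (lifted_pair x y)) z \<in> Z" if z: "z \<le> w" for z
      proof (cases "z = sup x y")
        case True
        then have le: "x \<le> w" "y \<le> w" using z by auto
        then have "(x, y) \<in> \<rho>" "(y, x) \<in> \<rho>" using xy unfolding \<rho>_def lcm_relation_def by (simp_all add: sup_commute)
        then have "(u, x) \<in> \<rho>\<^sup>* \<longleftrightarrow> (u, y) \<in> \<rho>\<^sup>*" 
          using rtrancl.rtrancl_into_rtrancl[of u x \<rho> y] rtrancl.rtrancl_into_rtrancl[of u y \<rho> x] by blast
        then have "x \<in> C \<longleftrightarrow> y \<in> C" using xy unfolding C_def by simp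
        then show ?thesis unfolding \<phi>_def lifted_pair_sum[OF finC] using idealD0[OF ideal_Z] by simp
      next
        case False
        then have "coef (\<phi> (lifted_pair x y)) z = 0"
          unfolding \<phi>_def lifted_pair_sum[OF finC] by (auto simp: lookup_minus lookup_single when_def)
        then show ?thesis using idealD0[OF ideal_Z] by simp
      qed
      then have "lifted_pair x y \<in> M" unfolding M_def using tFs[OF xy(1,2)] by blast
      then show ?thesis unfolding pair_syzygy_lift by blast
    qed
    have "monomial_ideal R (Mon J) \<and> mono_hilbert R deg (Mon J) = h"
      using monomial_Mon[OF J] mono_hilbert_Mon[OF o, of J] count by simp
    from s[unfolded cond_s_def Let_def, rule_format, OF this]
    have "syzygy_module R (Mon J) = module_span S (free_module S G)
        {pair_syzygy R u v | u v. u \<in> G \<and> v \<in> G \<and> deg (sup u v) \<in> D}" unfolding G .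
    also have "\<dots> \<subseteq> (\<circ>) \<Psi> ` M" unfolding module_span_def
    proof (rule Inter_lower, rule CollectI, rule conjI[OF sub], rule subsetI)
      fix z assume "z \<in> {pair_syzygy R u v | u v. u \<in> G \<and> v \<in> G \<and> deg (sup u v) \<in> D}"
      then obtain x y where "z = pair_syzygy R x y" "x \<in> G" "y \<in> G" "deg (sup x y) \<in> D" by blast
      then show "z \<in> (\<circ>) \<Psi> ` M" using gen[of x y] by simp
    qed
    finally have syz: "syzygy_module R (Mon J) \<subseteq> (\<circ>) \<Psi> ` M" .
    have uG: "u \<in> G" "v \<in> G" using u v unfolding G_def by blast+
    have "(\<Oplus>\<^bsub>S\<^esub>g\<in>G. (\<Psi> \<circ> lifted_pair u v) g \<otimes>\<^bsub>S\<^esub> xpow R g) =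
        \<Psi> (\<Sum>g\<in>G. lifted_pair u v g * Poly_Mapping.single g 1)"
      unfolding S.\<pi>_sum[OF finG] by (simp add: S.\<pi>_mult \<Psi>_single)
    also have "\<dots> = \<zero>\<^bsub>S\<^esub>" unfolding lifted_pair_sum[OF finG] using uG by (simp add: S.\<pi>_0)
    finally have "pair_syzygy R u v \<in> syzygy_module R (Mon J)"
      unfolding syzygy_module_def Let_def G pair_syzygy_lift using S.comp_in_free_module[OF tFs[OF uG]] by blast
    then obtain s' where s': "s' \<in> M" "\<Psi> \<circ> lifted_pair u v = \<Psi> \<circ> s'" using syz unfolding pair_syzygy_lift by blast
    have \<Psi>\<phi>: "\<Psi> (\<phi> s) = (\<Oplus>\<^bsub>S\<^esub>g\<in>C. (\<Psi> \<circ> s) g \<otimes>\<^bsub>S\<^esub> xpow R g)" for s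
      unfolding \<phi>_def S.\<pi>_sum[OF finC] by (simp add: S.\<pi>_mult \<Psi>_single)
    have "\<Psi> (\<phi> (lifted_pair u v)) = \<Psi> (\<phi> s')" unfolding \<Psi>\<phi> s'(2) ..
    then have "\<pi> \<circ> coef (\<phi> (lifted_pair u v)) = \<pi> \<circ> coef (\<phi> s')" unfolding \<Psi>_def .
    from fun_cong[OF this, of "sup u v"]
    have "\<pi> (coef (\<phi> (lifted_pair u v)) (sup u v)) = \<pi> (coef (\<phi> s') (sup u v))" by (simp only: comp_apply)
    moreover have "sup u v \<le> w" using uv by simp
    then have "coef (\<phi> s') (sup u v) \<in> Z" using s'(1) unfolding M_def by blast
    \<comment> \<open>Of the two generators only \<open>u\<close> lies in \<open>C\<close>, so
      nothing cancels.\<close>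
    moreover have "coef (\<phi> (lifted_pair u v)) (sup u v) = 1"
      unfolding \<phi>_def lifted_pair_sum[OF finC] using uC vC by simp
    ultimately show False using o unfolding Z_def by (simp add: \<pi>_1)
  qed
qed

end

section \<open>The Hilbert functor\<close>

context poly_cover
begin

text \<open>If the homogeneous generators of each degree are already stable under multiplication by
  monomials, the ideal they generate has as its pieces just the spans over \<open>R\<close> of the
  generators of that degree. The extension of a homogeneous ideal along a ring homomorphism is of
  this kind.\<close>

lemma piece_genideal:
  assumes G: "\<And>a. G a \<subseteq> carrier (FM (X a))" "\<And>a. (\<lambda>x. \<zero>) \<in> G a"
    and sh: "\<And>a u p. p \<in> Fn (X a) \<Longrightarrow> \<pi> \<circ> p \<in> G a \<Longrightarrow> \<pi> \<circ> shift u p \<in> G (deg u + a)"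
    and Y: "Y \<subseteq> carrier S" "\<And>a. G a \<subseteq> Y" "\<And>q a. q \<in> Y \<Longrightarrow> (\<lambda>u. if deg u = a then q u else \<zero>) \<in> G a"
  shows "ideal_piece R deg (genideal S Y) a = module_span R (FM (X a)) (G a)"
proof -
  define B where "B a = {p \<in> Fn (X a). \<pi> \<circ> p \<in> G a}" for a
  define M where "M a = lspan (B a)" for a
  have BM: "B a \<subseteq> M a" for a unfolding M_def by (rule fv.span_superset)
  have MF: "M a \<subseteq> Fn (X a)" for a unfolding M_def by (rule fv.span_minimal[OF _ subspace_Fn]) (auto simp: B_def)
  have lM: "lsub (M a)" for a unfolding M_def by simp
  have "p \<in> M a" if p: "p \<in> Fn (X a)" "\<forall>x. p x \<in> Z" for p a
  proof -
    have "\<pi> \<circ> p = (\<lambda>x. \<zero>)" using p(2) by (auto simp: Z_def)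
    then have "p \<in> B a" unfolding B_def using p(1) G(2) by simp
    then show ?thesis using BM by blast
  qed
  then have M: "piece_module Z (X a) (M a)" for a unfolding piece_module_def using lM MF by blast
  have shM: "shift u p \<in> M (deg u + a)" if "p \<in> M a" for u p a
  proof -
    have "lsub {p. shift u p \<in> M (deg u + a)}"
      by (rule fv.subspaceI) (simp_all add: shift_0 shift_add shift_scl fv.subspace_0[OF lM] fv.subspace_add[OF lM]
        fv.subspace_scale[OF lM])
    moreover have "B a \<subseteq> {p. shift u p \<in> M (deg u + a)}"
    proof
      fix p assume "p \<in> B a"
      then have "shift u p \<in> B (deg u + a)" unfolding B_def using sh shift_in_Fn[OF deg_add] by blast
      then show "p \<in> {p. shift u p \<in> M (deg u + a)}" using BM by blast
    qed
    ultimately have "M a \<subseteq> {p. shift u p \<in> M (deg u + a)}" unfolding M_def by (intro fv.span_minimal)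
    then show ?thesis using that by blast
  qed
  note hom = homogeneous_family[OF M shM]
  have idY: "ideal (genideal S Y) S" by (rule S.genideal_ideal[OF Y(1)])
  have span: "(\<circ>) \<pi> ` M a \<subseteq> N" if N: "submodule N R (FM (X a))" "G a \<subseteq> N" for N a
  proof -
    have "B a \<subseteq> pull (X a) N" unfolding B_def pull_def Fs_finite[OF finX] using N(2) by blast
    then have "M a \<subseteq> pull (X a) N" unfolding M_def by (rule fv.span_minimal[OF _ submodule_pull(1)[OF N(1)]])
    then show ?thesis using submodule_pull(3)[OF N(1)] by blast
  qed
  have "genideal S Y = \<Psi> ` family_ideal M"
  proof
    show "genideal S Y \<subseteq> \<Psi> ` family_ideal M"
    proof (rule S.genideal_minimal)
      show "ideal (\<Psi> ` family_ideal M) S" using hom unfolding homogeneous_ideal_def by blast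
      show "Y \<subseteq> \<Psi> ` family_ideal M"
      proof
        fix q assume q: "q \<in> Y"
        then have "q \<in> range \<Psi>" using Y(1) unfolding range_\<Psi> by blast
        then obtain t where t: "q = \<Psi> t" by blast
        have "part deg a (coef t) \<in> M a" for a
        proof -
          have "\<pi> \<circ> part deg a (coef t) \<in> G a"
            using Y(3)[OF q, of a] unfolding t component_\<Psi> \<Psi>_mpoly[OF part_Fn] .
          then have "part deg a (coef t) \<in> B a" unfolding B_def mem_Collect_eq by (rule conjI[OF part_Fn])
          then show ?thesis using BM by blast
        qed
        then show "q \<in> \<Psi> ` family_ideal M" unfolding t family_ideal_def by blast
      qed
    qed
    show "\<Psi> ` family_ideal M \<subseteq> genideal S Y"
    proof (rule subset_by_pieces[OF hom idY])
      fix a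
      have "G a \<subseteq> ideal_piece R deg (genideal S Y) a"
        using G(1)[of a] Y(2)[of a] S.genideal_self[OF Y(1)] unfolding ideal_piece_def graded_piece_def by blast
      then show "ideal_piece R deg (\<Psi> ` family_ideal M) a \<subseteq> genideal S Y"
        unfolding piece_family[OF M] using span[OF submodule_ideal_piece[OF idY]] unfolding ideal_piece_def by blast
    qed
  qed
  then have "ideal_piece R deg (genideal S Y) a = (\<circ>) \<pi> ` M a" by (simp only: piece_family[OF M])
  also have "\<dots> = module_span R (FM (X a)) (G a)"
  proof
    show "(\<circ>) \<pi> ` M a \<subseteq> module_span R (FM (X a)) (G a)" unfolding module_span_def using span by blast
    have "submodule ((\<circ>) \<pi> ` M a) R (FM (X a))"
      by (rule submodule_push[OF lM]) (simp add: Fs_finite[OF finX] MF)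
    moreover have "G a \<subseteq> (\<circ>) \<pi> ` M a"
    proof
      fix x assume x: "x \<in> G a"
      then have "x \<in> carrier (FM (X a))" using G(1) by blast
      then obtain p where p: "p \<in> Fs (X a)" "\<pi> \<circ> p = x" by (rule free_module_lift)
      then have "p \<in> B a" unfolding B_def using x Fs_finite[OF finX] by blast
      then show "x \<in> (\<circ>) \<pi> ` M a" using BM p(2) by blast
    qed
    ultimately show "module_span R (FM (X a)) (G a) \<subseteq> (\<circ>) \<pi> ` M a"
      unfolding module_span_def by (intro Inter_lower) blast
  qed
  finally show ?thesis .
qed

lemma hilbert_points_iff:
  "I \<in> hilbert_points R deg h \<longleftrightarrow>
    homogeneous_ideal R deg I \<and> (\<forall>a. loc_free Z (X a) (pieces I a) (h a))"
proof -
  have "locally_free R (quotient_module (graded_piece R deg a) (ideal_piece R deg I a)) (h a) \<longleftrightarrow>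
      loc_free Z (X a) (pieces I a) (h a)" if "ideal I S" for a
    using locally_free_iff[OF finX submodule_ideal_piece[OF that]] unfolding graded_piece_def pull_ideal_piece[OF that] .
  then show ?thesis unfolding hilbert_points_def homogeneous_ideal_def by blast
qed

lemma hilbert_points_eqI:
  assumes I: "homogeneous_ideal R deg I" and I': "homogeneous_ideal R deg I'" and eq: "\<And>a. pieces I a = pieces I' a"
  shows "I = I'"
proof -
  have id: "ideal I S" "ideal I' S" using I I' unfolding homogeneous_ideal_def by blast+
  have "ideal_piece R deg I a = ideal_piece R deg I' a" for a
    unfolding image_pieces[OF id(1), symmetric] image_pieces[OF id(2), symmetric] eq ..
  then have "ideal_piece R deg I a \<subseteq> I'" "ideal_piece R deg I' a \<subseteq> I" for a unfolding ideal_piece_def by blast+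
  then show ?thesis using subset_by_pieces[OF I id(2)] subset_by_pieces[OF I' id(1)] by blast
qed

text \<open>By (g) every piece of a Hilbert point equals \<open>gpiece D (pieces I) a\<close>, an
  expression in the pieces of degrees in \<open>D\<close> alone.\<close>

lemma inj_restrict:
  assumes g: "Z \<noteq> UNIV \<Longrightarrow> exponents_g deg h D"
  shows "inj_on (restrict_degrees R deg D) (hilbert_points R deg h)"
proof (rule inj_onI)
  interpret G: graded deg Z h by unfold_locales (rule pos, rule ideal_Z)
  fix I I' assume I: "I \<in> hilbert_points R deg h" and I': "I' \<in> hilbert_points R deg h"
    and eq: "restrict_degrees R deg D I = restrict_degrees R deg D I'"
  have gp: "pieces I a = G.gpiece D (pieces I) a" if I: "I \<in> hilbert_points R deg h" for I a
  proof
    have id: "ideal I S" and lf: "\<And>a. loc_free Z (X a) (pieces I a) (h a)"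
      using I unfolding hilbert_points_iff homogeneous_ideal_def by blast+
    note P = pieces_piece_module[OF id]
    show "pieces I a \<subseteq> G.gpiece D (pieces I) a"
      by (rule G.generated_by_pieces[OF P lf shift_pieces[OF id] g])
    have "G.shifts D (pieces I) a \<union> G.Zpart a \<subseteq> pieces I a"
      using shift_pieces[OF id] piece_moduleD(3)[OF P] unfolding G.shifts_def G.Zpart_def by auto
    then show "G.gpiece D (pieces I) a \<subseteq> pieces I a"
      unfolding G.gpiece_def by (rule fv.span_minimal[OF _ piece_moduleD(1)[OF P]])
  qed
  have hI: "homogeneous_ideal R deg I" "homogeneous_ideal R deg I'" using I I' unfolding hilbert_points_iff by blast+
  have id: "ideal I S" "ideal I' S" using hI unfolding homogeneous_ideal_def by blast+
  have eqD: "pieces I d = pieces I' d" if "d \<in> D" for d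
  proof -
    have "ideal_piece R deg I d = ideal_piece R deg I' d"
      using fun_cong[OF eq, of d] that by (simp add: restrict_degrees_def)
    then show ?thesis unfolding pull_ideal_piece[OF id(1), symmetric] pull_ideal_piece[OF id(2), symmetric] by simp
  qed
  have sub: "G.shifts D N a \<subseteq> G.shifts D N' a" if e: "\<And>d. d \<in> D \<Longrightarrow> N d = N' d" for N N' a
  proof
    fix y assume "y \<in> G.shifts D N a"
    then obtain u d p where y: "y = shift u p" "d \<in> D" "p \<in> N d" "deg u + d = a" unfolding G.shifts_def by blast
    have "p \<in> N' d" using y(3) e[OF y(2)] by simp
    then show "y \<in> G.shifts D N' a" unfolding G.shifts_def using y(1,2,4) by blast
  qed
  have sh: "G.shifts D (pieces I) a = G.shifts D (pieces I') a" for a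
    using sub[of "pieces I" "pieces I'" a] sub[of "pieces I'" "pieces I" a] eqD by (simp add: equalityI)
  have "pieces I a = pieces I' a" for a
  proof -
    have "pieces I a = G.gpiece D (pieces I) a" by (rule gp[OF I])
    also have "\<dots> = G.gpiece D (pieces I') a" unfolding G.gpiece_def sh ..
    also have "\<dots> = pieces I' a" by (rule gp[OF I', symmetric])
    finally show ?thesis .
  qed
  then show "I = I'" by (rule hilbert_points_eqI[OF hI])
qed

lemma restrict_satisfies_equations:
  assumes I: "I \<in> hilbert_points R deg h"
  shows "restrict_degrees R deg D I \<in> grassmann_points R deg h D"
    and "quadratic_equations R deg h D (restrict_degrees R deg D I)"
    and "determinantal_equations R deg h D e (restrict_degrees R deg D I)"
proof -
  have id: "ideal I S" and lf: "\<And>a. loc_free Z (X a) (pieces I a) (h a)"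
    using I unfolding hilbert_points_iff homogeneous_ideal_def by blast+
  define L where "L = restrict_degrees R deg D I"
  have L: "L d = ideal_piece R deg I d" if "d \<in> D" for d unfolding L_def restrict_degrees_def using that by simp
  interpret F: grassmann_family R \<pi> deg h D L
    by (intro grassmann_family.intro grassmann_family_axioms.intro ring_cover_axioms pos)
      (simp add: L submodule_ideal_piece[OF id])
  have M: "pull (X d) (L d) = pieces I d" if "d \<in> D" for d unfolding L[OF that] by (rule pull_ideal_piece[OF id])
  show "restrict_degrees R deg D I \<in> grassmann_points R deg h D"
    using I submodule_ideal_piece[OF id] unfolding grassmann_points_def hilbert_points_def restrict_degrees_def
    by (auto simp: graded_piece_def)
  show "quadratic_equations R deg h D (restrict_degrees R deg D I)"
    unfolding L_def[symmetric]
    by (rule F.quadratic_if_closed) (use M shift_pieces[OF id] in auto)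
  have "F.shifts D F.M e \<subseteq> pieces I e"
    unfolding F.shifts_def using M shift_pieces[OF id] by auto
  then have mi: "minors_in (card (X e) - h e + 1) (X e) (F.shifts D F.M e) Z"
    by (rule minors_in_mono[OF conjunct2[OF lf[of e, unfolded loc_free_def]]])
  show "determinantal_equations R deg h D e (restrict_degrees R deg D I)"
    unfolding L_def[symmetric]
  proof (rule F.determinantal_if_minors[OF mi])
    \<comment> \<open>Over a nonzero ring local freeness provides \<open>h e\<close> distinct
      monomials of degree \<open>e\<close> near some maximal ideal, so this case occurs only for the
      zero ring.\<close>
    assume less: "card (X e) < h e"
    show "Z = UNIV"
    proof (rule ccontr)
      assume "Z \<noteq> UNIV"
      then have "1 \<notin> Z" using idealD_mult[OF ideal_Z, of 1] by auto
      then obtain P where "max_ideal P" "Z \<subseteq> P" using max_ideal_exists[OF ideal_Z] by blast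
      then obtain N where "N \<subseteq> X e" "card N = h e"
        using conjunct1[OF lf[of e, unfolded loc_free_def]] by blast
      then show False using card_mono[OF finX, of N e] less by simp
    qed
  qed
qed

text \<open>The ideal generated by the given pieces is a Hilbert point by \<open>loc_free_I\<close>,
  and by closure under multiplication it restricts to the given family.\<close>

lemma surj_restrict:
  assumes D: "finite D" and DE: "D \<subseteq> E"
    and comb: "Z \<noteq> UNIV \<Longrightarrow> exponents_h' deg h D" "Z \<noteq> UNIV \<Longrightarrow> exponents_h deg h E"
      "Z \<noteq> UNIV \<Longrightarrow> exponents_s deg h E"
    and L: "L \<in> grassmann_points R deg h D" and q: "quadratic_equations R deg h D L"
    and det: "\<And>e. e \<in> E - D \<Longrightarrow> determinantal_equations R deg h D e L"
  shows "\<exists>I\<in>hilbert_points R deg h. restrict_degrees R deg D I = L"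
proof -
  have Ls: "submodule (L d) R (FM (X d))" "locally_free R (quotient_module (FM (X d)) (L d)) (h d)" if "d \<in> D" for d
    using L that unfolding grassmann_points_def graded_piece_def by blast+
  interpret F: grassmann_family R \<pi> deg h D L
    by (intro grassmann_family.intro grassmann_family_axioms.intro ring_cover_axioms pos Ls(1))
  have lf: "loc_free Z (X d) (F.M d) (h d)" if "d \<in> D" for d
    using Ls(2)[OF that] unfolding locally_free_iff[OF finX Ls(1)[OF that]] .
  interpret H: graded_data deg Z h D E F.M
  proof (intro graded_data.intro graded_data_axioms.intro F.graded_axioms D DE comb)
    show "piece_module Z (X d) (F.M d)" if "d \<in> D" for d by (rule F.M_piece[OF that])
    show "loc_free Z (X d) (F.M d) (h d)" if "d \<in> D" for d by (rule lf[OF that])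
    show "shift u p \<in> F.M b" if "a \<in> D" "b \<in> D" "p \<in> F.M a" "deg u + a = b" for a b u p
      by (rule F.closed_if_quadratic[OF D lf q that])
    show "minors_in (card (X e) - h e + 1) (X e) (F.shifts D F.M e) Z" if "e \<in> E - D" for e
      by (rule F.minors_if_determinantal(1)[OF D lf _ det[OF that]]) (use that in auto)
    show "Z = UNIV" if "e \<in> E - D" "card (X e) < h e" for e
      by (rule F.minors_if_determinantal(2)[OF D lf _ det[OF that(1)] that(2)]) (use that in auto)
  qed
  have P: "piece_module Z (X a) (H.I a)" for a
    by (rule F.piece_module_gpiece) (use piece_moduleD(2)[OF F.M_piece] in blast)
  have sh: "shift u p \<in> H.I (deg u + a)" if "p \<in> H.I a" for a u p
    by (rule F.gpiece_shift[OF that refl])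
  define I where "I = \<Psi> ` family_ideal H.I"
  have pI: "ideal_piece R deg I a = (\<circ>) \<pi> ` H.I a" for a unfolding I_def by (rule piece_family[OF P])
  have hom: "homogeneous_ideal R deg I" unfolding I_def by (rule homogeneous_family[OF P sh])
  then have id: "ideal I S" unfolding homogeneous_ideal_def by blast
  have "pieces I a = H.I a" for a
    unfolding pull_ideal_piece[OF id, symmetric] pI by (rule pull_push[OF P finX])
  then have "I \<in> hilbert_points R deg h" unfolding hilbert_points_iff using hom H.loc_free_I by simp
  moreover have "restrict_degrees R deg D I = L"
  proof
    fix d show "restrict_degrees R deg D I d = L d"
    proof (cases "d \<in> D")
      case True
      then show ?thesis unfolding restrict_degrees_def
        by (simp add: pI H.I_D submodule_pull(3)[OF Ls(1)])
    next
      case False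
      then show ?thesis using L unfolding restrict_degrees_def grassmann_points_def extensional_def by simp
    qed
  qed
  ultimately show ?thesis by blast
qed

end

text \<open>Pieces of an extended ideal are the extended pieces, which is the naturality of
  restriction in \<open>R\<close>. The extension is generated by images of homogeneous elements, and
  the images of the pieces are stable under multiplication by monomials.\<close>

lemma hilbert_map_pieces:
  fixes deg :: "('n::finite \<Rightarrow> nat) \<Rightarrow> 'a::ab_group_add"
  assumes R: "poly_cover R \<pi> deg" and R': "poly_cover R' \<pi>' deg" and \<psi>: "\<psi> \<in> Ring.ring_hom R R'"
    and I: "homogeneous_ideal R deg I"
  shows "ideal_piece R' deg (hilbert_map R' \<psi> I) a =
    module_span R' (graded_piece R' deg a) ((\<lambda>p. \<psi> \<circ> p) ` ideal_piece R deg I a)"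
proof -
  interpret A: poly_cover R \<pi> deg by (rule R)
  interpret B: poly_cover R' \<pi>' deg by (rule R')
  have id: "ideal I (poly_ring R)" using I unfolding homogeneous_ideal_def by blast
  have \<psi>c: "\<psi> x \<in> carrier R'" if "x \<in> carrier R" for x using ring_hom_closed[OF \<psi> that] .
  have \<psi>0: "\<psi> \<zero>\<^bsub>R\<^esub> = \<zero>\<^bsub>R'\<^esub>" by (rule ring_hom_zero[OF \<psi> A.ring_axioms B.ring_axioms])
  have \<psi>F: "\<psi> \<circ> p \<in> carrier (free_module R' Y)" if "p \<in> carrier (free_module R Y)" for p and Y :: "('n \<Rightarrow> nat) set"
  proof -
    have "{x. (\<psi> \<circ> p) x \<noteq> \<zero>\<^bsub>R'\<^esub>} \<subseteq> {x. p x \<noteq> \<zero>\<^bsub>R\<^esub>}" using \<psi>0 by auto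
    moreover have fin: "finite {x. p x \<noteq> \<zero>\<^bsub>R\<^esub>}" and sub: "{x. p x \<noteq> \<zero>\<^bsub>R\<^esub>} \<subseteq> Y"
      and c: "\<forall>x. (\<psi> \<circ> p) x \<in> carrier R'"
      using that \<psi>c unfolding free_module_carrier by simp_all
    ultimately show ?thesis
      unfolding free_module_carrier using finite_subset[OF _ fin] subset_trans[OF _ sub] by blast
  qed
  show ?thesis
    unfolding hilbert_map_def graded_piece_def
  proof (rule B.piece_genideal[where G = "\<lambda>a. (\<lambda>p. \<psi> \<circ> p) ` ideal_piece R deg I a"])
    show "(\<lambda>p. \<psi> \<circ> p) ` ideal_piece R deg I a \<subseteq> carrier (free_module R' (monomials deg a))" for a
      using \<psi>F unfolding ideal_piece_def graded_piece_def by blast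
    show "(\<lambda>x. \<zero>\<^bsub>R'\<^esub>) \<in> (\<lambda>p. \<psi> \<circ> p) ` ideal_piece R deg I a" for a
    proof -
      have "\<pi> \<circ> 0 \<in> (\<circ>) \<pi> ` A.pieces I a"
        by (rule imageI) (rule fv.subspace_0[OF piece_moduleD(1)[OF A.pieces_piece_module[OF id]]])
      then have "(\<lambda>x. \<zero>\<^bsub>R\<^esub>) \<in> ideal_piece R deg I a" unfolding A.comp_zero A.image_pieces[OF id] .
      then have "\<psi> \<circ> (\<lambda>x. \<zero>\<^bsub>R\<^esub>) \<in> (\<lambda>p. \<psi> \<circ> p) ` ideal_piece R deg I a" by (rule imageI)
      then show ?thesis by (simp add: comp_def \<psi>0)
    qed
    show "\<pi>' \<circ> shift u p \<in> (\<lambda>p. \<psi> \<circ> p) ` ideal_piece R deg I (deg u + a)"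
      if p: "p \<in> Fn (monomials deg a)" "\<pi>' \<circ> p \<in> (\<lambda>p. \<psi> \<circ> p) ` ideal_piece R deg I a" for a u p
    proof -
      obtain p0 where p0: "p0 \<in> A.pieces I a" "\<pi>' \<circ> p = \<psi> \<circ> (\<pi> \<circ> p0)"
        using p(2) unfolding A.image_pieces[OF id, symmetric] by blast
      have "\<pi>' \<circ> shift u p = \<psi> \<circ> (\<pi> \<circ> shift u p0)"
      proof
        fix w show "(\<pi>' \<circ> shift u p) w = (\<psi> \<circ> (\<pi> \<circ> shift u p0)) w"
          using fun_cong[OF p0(2), of "w - u"] by (simp add: shift_def A.\<pi>_0 B.\<pi>_0 \<psi>0)
      qed
      moreover have "\<pi> \<circ> shift u p0 \<in> ideal_piece R deg I (deg u + a)"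
        unfolding A.image_pieces[OF id, symmetric] using A.shift_pieces[OF id p0(1)] by blast
      ultimately show ?thesis by simp
    qed
    show "(\<lambda>p. \<psi> \<circ> p) ` I \<subseteq> carrier (poly_ring R')"
      using \<psi>F ideal.Icarr[OF id] unfolding A.S_carrier B.S_carrier by blast
    show "(\<lambda>p. \<psi> \<circ> p) ` ideal_piece R deg I a \<subseteq> (\<lambda>p. \<psi> \<circ> p) ` I" for a unfolding ideal_piece_def by blast
    show "(\<lambda>u. if deg u = a then q u else \<zero>\<^bsub>R'\<^esub>) \<in> (\<lambda>p. \<psi> \<circ> p) ` ideal_piece R deg I a"
      if q: "q \<in> (\<lambda>p. \<psi> \<circ> p) ` I" for q a
    proof -
      obtain p where p: "p \<in> I" "q = \<psi> \<circ> p" using q by blast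
      let ?c = "\<lambda>u. if deg u = a then p u else \<zero>\<^bsub>R\<^esub>"
      have pc: "p \<in> carrier (free_module R UNIV)" using ideal.Icarr[OF id p(1)] unfolding A.S_carrier .
      have "{u. ?c u \<noteq> \<zero>\<^bsub>R\<^esub>} \<subseteq> {u. p u \<noteq> \<zero>\<^bsub>R\<^esub>}" by auto
      then have "finite {u. ?c u \<noteq> \<zero>\<^bsub>R\<^esub>}" by (rule finite_subset) (use pc in \<open>simp add: free_module_carrier\<close>)
      moreover have "{u. ?c u \<noteq> \<zero>\<^bsub>R\<^esub>} \<subseteq> monomials deg a" by (auto simp: monomials_def)
      moreover have "\<forall>u. ?c u \<in> carrier R" using pc by (simp add: free_module_carrier)
      ultimately have "?c \<in> carrier (free_module R (monomials deg a))" unfolding free_module_carrier by blast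
      moreover have "?c \<in> I" using I p(1) unfolding homogeneous_ideal_def by blast
      ultimately have c: "?c \<in> ideal_piece R deg I a" unfolding ideal_piece_def graded_piece_def by blast
      have eq: "(\<lambda>u. if deg u = a then q u else \<zero>\<^bsub>R'\<^esub>) = \<psi> \<circ> ?c" by (auto simp: p(2) \<psi>0)
      show ?thesis unfolding eq by (rule imageI[OF c])
    qed
  qed
qed

theorem theorem3p16:
  fixes k :: "('k, 'm1) ring_scheme"
    and deg :: "('n::finite \<Rightarrow> nat) \<Rightarrow> 'a::ab_group_add"
    and h :: "'a \<Rightarrow> nat"
    and D E :: "'a set"
    and R :: "('r, 'm2) ring_scheme" and \<eta> :: "'k \<Rightarrow> 'r"
    and R' :: "('s, 'm3) ring_scheme" and \<eta>' :: "'k \<Rightarrow> 's"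
    and \<psi> :: "'r \<Rightarrow> 's"
  assumes "cring k"
    and "positive_grading deg"
    and "\<forall>a. a \<notin> range deg \<longrightarrow> h a = 0"
    and "supportive k deg h D"
    and "D \<subseteq> E"
    and "very_supportive k deg h E"
    \<comment> \<open>\<open>\<psi> : R \<rightarrow> R'\<close> is a homomorphism of arbitrary commutative \<open>k\<close>-algebras\<close>
    and "cring R" and "\<eta> \<in> ring_hom k R"
    and "cring R'" and "\<eta>' \<in> ring_hom k R'"
    and "\<psi> \<in> ring_hom R R'" and "\<forall>c\<in>carrier k. \<psi> (\<eta> c) = \<eta>' c"
  shows
    "bij_betw (restrict_degrees R deg D) (hilbert_points R deg h)
       {L \<in> grassmann_points R deg h D.
          quadratic_equations R deg h D L \<and>
          (\<forall>e\<in>E - D. determinantal_equations R deg h D e L)}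
     \<and> (\<forall>I\<in>hilbert_points R deg h.
          restrict_degrees R' deg D (hilbert_map R' \<psi> I)
            = grassmann_map R' \<psi> deg D (restrict_degrees R deg D I))"
proof -
  note cR = cring.axioms(1)[OF assms(7)] and ck = cring.axioms(1)[OF assms(1)]
  have cover: "poly_cover Q (ring_projection Q) deg" if "cring Q" for Q :: "('q, 'm) ring_scheme"
    by (intro poly_cover.intro poly_cover_axioms.intro ring_cover_projection that assms(2))
  interpret A: poly_cover R "ring_projection R" deg by (rule cover[OF assms(7)])
  interpret K: poly_cover k "ring_projection k" deg by (rule cover[OF assms(1)])
  \<comment> \<open>A \<open>k\<close>-algebra over the zero ring is zero. So a nonzero
    \<open>R\<close> makes the exponents of monomials over \<open>k\<close> readable, and the
    conditions on monomial ideals over \<open>k\<close> can be transferred.\<close>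
  have one: "\<one>\<^bsub>k\<^esub> \<noteq> \<zero>\<^bsub>k\<^esub>" if "A.Z \<noteq> UNIV"
  proof
    assume "\<one>\<^bsub>k\<^esub> = \<zero>\<^bsub>k\<^esub>"
    then have "\<one>\<^bsub>R\<^esub> = \<zero>\<^bsub>R\<^esub>" using ring_hom_one[OF assms(8)] ring_hom_zero[OF assms(8) ck cR] by simp
    then have "1 \<in> A.Z" using A.one_in_Z by blast
    then have "c \<in> A.Z" for c using idealD_mult[OF A.ideal_Z, of 1 c] by simp
    then show False using that by blast
  qed
  have D: "finite D" "cond_g k deg h D" "cond_h' k deg h D" using assms(4) unfolding supportive_def by blast+
  have E: "cond_h k deg h E" "cond_s k deg h E" using assms(6) unfolding very_supportive_def by blast+
  have "bij_betw (restrict_degrees R deg D) (hilbert_points R deg h)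
       {L \<in> grassmann_points R deg h D.
          quadratic_equations R deg h D L \<and>
          (\<forall>e\<in>E - D. determinantal_equations R deg h D e L)}" (is "bij_betw ?f ?H ?G")
    unfolding bij_betw_def
  proof
    show "inj_on ?f ?H" by (rule A.inj_restrict) (rule K.exponents_g_if[OF one D(2)])
    show "?f ` ?H = ?G"
    proof
      show "?f ` ?H \<subseteq> ?G" using A.restrict_satisfies_equations by blast
      show "?G \<subseteq> ?f ` ?H"
      proof
        fix L assume "L \<in> ?G"
        then have L: "L \<in> grassmann_points R deg h D" "quadratic_equations R deg h D L"
            "\<And>e. e \<in> E - D \<Longrightarrow> determinantal_equations R deg h D e L" by blast+
        have "\<exists>I\<in>?H. ?f I = L"
          by (rule A.surj_restrict[OF D(1) assms(5) _ _ _ L])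
            (rule K.exponents_h'_if[OF one D(3)] K.exponents_h_if[OF one E(1)] K.exponents_s_if[OF one E(2)]; assumption)+
        then show "L \<in> ?f ` ?H" by blast
      qed
    qed
  qed
  moreover have "restrict_degrees R' deg D (hilbert_map R' \<psi> I) =
      grassmann_map R' \<psi> deg D (restrict_degrees R deg D I)" if I: "I \<in> ?H" for I
  proof -
    have hom: "homogeneous_ideal R deg I" using I unfolding hilbert_points_def by blast
    show ?thesis
      unfolding grassmann_map_def restrict_degrees_def[of R']
      by (rule restrict_ext)
        (simp add: restrict_degrees_def hilbert_map_pieces[OF cover[OF assms(7)] cover[OF assms(9)] assms(11) hom])
  qed
  ultimately show ?thesis by blast
qed

end
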